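(* Suppose there is no largest inaccessible cardinal. Then the following ordinals are all equal: the supremum of the first-order theory categorical cardinals; the supremum of the second-order theory categorical cardinals; the supremum of the $\alpha$-order theory categorical cardinals for any absolutely definable ordinal $\alpha$; the supremum of the first-order fresh cardinals; the supremum of the second-order fresh cardinals; and the supremum of the $\alpha$-order fresh cardinals for any absolutely definable ordinal $\alpha$. Furthermore, if there is a proper class of inaccessible cardinals, then this common supremum is strictly larger than the least lightface $\Sigma_2$-correct cardinal, yet bounded above by the least $\Sigma_2(\mathbb{R})$-correct ordinal.
   Context: $V_\kappa$ is the rank-initial segment of the cumulative hierarchy. An ordinal $\alpha$ is absolutely definable if there is a first-order formula $\psi(x)$ such that for every inaccessible $\kappa$, $\alpha\in V_\kappa$ and $\alpha$ is the unique element of $V_\kappa$ satisfying $\psi$ in $V_\kappa$. $\alpha$-order sentences about $V_\kappa$ are first-order assertions about $V_{\kappa+\alpha}$; second-order quantifiers range over all subsets of $V_\kappa$. A cardinal $\kappa$ is theory categorical of a given order if $\kappa$ is inaccessible and there is a theory $T$ of that order with $V_\kappa\models T$ and $V_\lambda\not\models T$ for all inaccessible $\lambda\neq\kappa$. An inaccessible $\kappa$ is fresh of a given order if the theory of $V_\kappa$ of that order is not the theory of that order of $V_\delta$ for any inaccessible $\delta<\kappa$. An ordinal $\delta$ is lightface $\Sigma_2$-correct if $V_\delta$ and $V$ satisfy the same parameter-free $\Sigma_2$ sentences, and $\Sigma_2(\mathbb{R})$-correct if they satisfy the same $\Sigma_2$ formulas with real parameters. *)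

theory Defs
  imports Main
begin

text \<open>
  The universe \<open>V\<close> is an arbitrary model of first-order ZFC: a type \<open>'a\<close> with a binary relation
  \<open>mem\<close>.  By completeness, a statement holds in all such models iff it is a theorem of ZFC.
  All set-theoretic notions, including the syntax and semantics of the formal languages, are
  interpreted inside the model, and their defining conditions quantify only over elements of \<open>'a\<close>.
  A theory is hence a set of the model whose elements are (codes of) formulas in the sense of the
  model; no assumption is made that the natural numbers of the model are standard.
\<close>

text \<open>Meta-level first-order formulas, needed only for the two axiom schemes.\<close>

datatype fm = Mem nat nat | Eq nat nat | Neg fm | And fm fm | Ex nat fm

primrec holds :: "('a \<Rightarrow> 'a \<Rightarrow> bool) \<Rightarrow> fm \<Rightarrow> (nat \<Rightarrow> 'a) \<Rightarrow> bool" where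
  "holds mem (Mem i j) e \<longleftrightarrow> mem (e i) (e j)"
| "holds mem (Eq i j) e \<longleftrightarrow> e i = e j"
| "holds mem (Neg p) e \<longleftrightarrow> \<not> holds mem p e"
| "holds mem (And p q) e \<longleftrightarrow> holds mem p e \<and> holds mem q e"
| "holds mem (Ex i p) e \<longleftrightarrow> (\<exists>x. holds mem p (e(i := x)))"

locale ZFC =
  fixes mem :: "'a \<Rightarrow> 'a \<Rightarrow> bool" (infix "\<epsilon>" 50)
  assumes extensionality: "(\<And>z. z \<epsilon> x \<longleftrightarrow> z \<epsilon> y) \<Longrightarrow> x = y"
    and foundation: "y \<epsilon> x \<Longrightarrow> \<exists>z. z \<epsilon> x \<and> \<not> (\<exists>w. w \<epsilon> z \<and> w \<epsilon> x)"
    and pairing: "\<exists>z. x \<epsilon> z \<and> y \<epsilon> z"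
    and union: "\<exists>u. \<forall>y z. z \<epsilon> y \<and> y \<epsilon> x \<longrightarrow> z \<epsilon> u"
    and power: "\<exists>p. \<forall>y. (\<forall>z. z \<epsilon> y \<longrightarrow> z \<epsilon> x) \<longrightarrow> y \<epsilon> p"
    and infinity: "\<exists>I. (\<exists>x. x \<epsilon> I \<and> (\<forall>z. \<not> z \<epsilon> x)) \<and>
                       (\<forall>x. x \<epsilon> I \<longrightarrow> (\<exists>y. y \<epsilon> I \<and> (\<forall>z. z \<epsilon> y \<longleftrightarrow> z \<epsilon> x \<or> z = x)))"
    and separation: "\<exists>y. \<forall>z. z \<epsilon> y \<longleftrightarrow> z \<epsilon> x \<and> holds (\<epsilon>) p (e(0 := z))"
    and replacement: "(\<forall>x. x \<epsilon> A \<longrightarrow> (\<exists>!y. holds (\<epsilon>) p (e(0 := x, 1 := y)))) \<Longrightarrow>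
                      \<exists>B. \<forall>x. x \<epsilon> A \<longrightarrow> (\<exists>y. y \<epsilon> B \<and> holds (\<epsilon>) p (e(0 := x, 1 := y)))"
    and choice: "(\<forall>x. x \<epsilon> A \<longrightarrow> (\<exists>z. z \<epsilon> x)) \<Longrightarrow>
                 (\<forall>x y z. x \<epsilon> A \<and> y \<epsilon> A \<and> z \<epsilon> x \<and> z \<epsilon> y \<longrightarrow> x = y) \<Longrightarrow>
                 \<exists>C. \<forall>x. x \<epsilon> A \<longrightarrow> (\<exists>!z. z \<epsilon> x \<and> z \<epsilon> C)"

context
  fixes mem :: "'a \<Rightarrow> 'a \<Rightarrow> bool" (infix "\<epsilon>" 50)
begin

definition subs :: "'a \<Rightarrow> 'a \<Rightarrow> bool" where
  "subs x y \<longleftrightarrow> (\<forall>z. z \<epsilon> x \<longrightarrow> z \<epsilon> y)"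

text \<open>The element of the model whose extension is the class \<open>C\<close>; meaningful only when there is one.\<close>

definition mkset :: "('a \<Rightarrow> bool) \<Rightarrow> 'a" where
  "mkset C = (THE x. \<forall>z. z \<epsilon> x \<longleftrightarrow> C z)"

definition emp :: 'a where
  "emp = mkset (\<lambda>z. False)"

definition suc :: "'a \<Rightarrow> 'a" where
  "suc x = mkset (\<lambda>z. z \<epsilon> x \<or> z = x)"

definition pow :: "'a \<Rightarrow> 'a" where
  "pow x = mkset (\<lambda>z. subs z x)"

definition upair :: "'a \<Rightarrow> 'a \<Rightarrow> 'a" where
  "upair x y = mkset (\<lambda>z. z = x \<or> z = y)"

definition opair :: "'a \<Rightarrow> 'a \<Rightarrow> 'a" where
  "opair x y = upair (upair x x) (upair x y)"

definition app :: "'a \<Rightarrow> 'a \<Rightarrow> 'a" where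
  "app f x = (THE y. opair x y \<epsilon> f)"

definition is_fun :: "'a \<Rightarrow> 'a \<Rightarrow> 'a \<Rightarrow> bool" where
  "is_fun f A B \<longleftrightarrow> (\<forall>z. z \<epsilon> f \<longrightarrow> (\<exists>x y. x \<epsilon> A \<and> y \<epsilon> B \<and> z = opair x y)) \<and>
                    (\<forall>x. x \<epsilon> A \<longrightarrow> (\<exists>!y. opair x y \<epsilon> f))"

definition is_inj :: "'a \<Rightarrow> 'a \<Rightarrow> 'a \<Rightarrow> bool" where
  "is_inj f A B \<longleftrightarrow> is_fun f A B \<and>
                    (\<forall>x y. x \<epsilon> A \<and> y \<epsilon> A \<and> app f x = app f y \<longrightarrow> x = y)"

text \<open>The function \<open>f\<close> with its value at \<open>x\<close> changed to \<open>y\<close>.\<close>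

definition upd :: "'a \<Rightarrow> 'a \<Rightarrow> 'a \<Rightarrow> 'a" where
  "upd f x y = mkset (\<lambda>z. z \<epsilon> f \<and> (\<forall>w. z \<noteq> opair x w) \<or> z = opair x y)"

definition omega :: 'a where
  "omega = mkset (\<lambda>n. \<forall>I. emp \<epsilon> I \<and> (\<forall>x. x \<epsilon> I \<longrightarrow> suc x \<epsilon> I) \<longrightarrow> n \<epsilon> I)"

definition transitive :: "'a \<Rightarrow> bool" where
  "transitive x \<longleftrightarrow> (\<forall>y. y \<epsilon> x \<longrightarrow> subs y x)"

definition Ord :: "'a \<Rightarrow> bool" where
  "Ord x \<longleftrightarrow> transitive x \<and> (\<forall>y. y \<epsilon> x \<longrightarrow> transitive y)"

definition ord_le :: "'a \<Rightarrow> 'a \<Rightarrow> bool" where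
  "ord_le x y \<longleftrightarrow> x \<epsilon> y \<or> x = y"

text \<open>Transfinite recursion: the value at \<open>a\<close> of the function \<open>f\<close> with \<open>f b = H f b\<close> for all
  ordinals \<open>b \<le> a\<close>, where \<open>H f b\<close> depends only on the values of \<open>f\<close> below \<open>b\<close>.\<close>

definition ord_rec :: "('a \<Rightarrow> 'a \<Rightarrow> 'a) \<Rightarrow> 'a \<Rightarrow> 'a" where
  "ord_rec H a = (THE v. \<exists>f B. is_fun f (suc a) B \<and>
                   (\<forall>b. b \<epsilon> suc a \<longrightarrow> app f b = H f b) \<and> v = app f a)"

text \<open>\<open>V\<^sub>a\<close> is the union of the power sets of the \<open>V\<^sub>b\<close> with \<open>b < a\<close>.\<close>

definition V :: "'a \<Rightarrow> 'a" where
  "V a = ord_rec (\<lambda>f b. mkset (\<lambda>x. \<exists>c. c \<epsilon> b \<and> subs x (app f c))) a"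

text \<open>\<open>k + a = k \<union> {k + c | c < a}\<close>.\<close>

definition ord_add :: "'a \<Rightarrow> 'a \<Rightarrow> 'a" where
  "ord_add k a = ord_rec (\<lambda>f b. mkset (\<lambda>x. x \<epsilon> k \<or> (\<exists>c. c \<epsilon> b \<and> x = app f c))) a"

definition cardinal :: "'a \<Rightarrow> bool" where
  "cardinal k \<longleftrightarrow> Ord k \<and> \<not> (\<exists>b f. b \<epsilon> k \<and> is_inj f k b)"

definition regular :: "'a \<Rightarrow> bool" where
  "regular k \<longleftrightarrow> (\<forall>m f. m \<epsilon> k \<and> is_fun f m k \<longrightarrow>
                    (\<exists>b. b \<epsilon> k \<and> (\<forall>x. x \<epsilon> m \<longrightarrow> app f x \<epsilon> b)))"

definition strong_limit :: "'a \<Rightarrow> bool" where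
  "strong_limit k \<longleftrightarrow> (\<forall>m. m \<epsilon> k \<longrightarrow> (\<exists>n f. n \<epsilon> k \<and> is_inj f (pow m) n))"

definition inaccessible :: "'a \<Rightarrow> bool" where
  "inaccessible k \<longleftrightarrow> cardinal k \<and> omega \<epsilon> k \<and> regular k \<and> strong_limit k"

definition is_sup :: "('a \<Rightarrow> bool) \<Rightarrow> 'a \<Rightarrow> bool" where
  "is_sup C s \<longleftrightarrow> Ord s \<and> (\<forall>k. C k \<longrightarrow> ord_le k s) \<and>
                  (\<forall>t. Ord t \<and> (\<forall>k. C k \<longrightarrow> ord_le k t) \<longrightarrow> ord_le s t)"

definition is_least :: "('a \<Rightarrow> bool) \<Rightarrow> 'a \<Rightarrow> bool" where
  "is_least C k \<longleftrightarrow> C k \<and> (\<forall>m. C m \<longrightarrow> ord_le k m)"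

text \<open>
  One syntax serves for first- and second-order formulas in the language of set theory.
  First-order variables \<open>x\<^sub>i\<close> and second-order variables \<open>X\<^sub>i\<close> are indexed by the natural numbers of
  the model.  The other connectives and the universal quantifiers are abbreviations.
\<close>

definition tag :: "nat \<Rightarrow> 'a" where
  "tag n = (suc ^^ n) emp"

\<comment> \<open>\<open>x\<^sub>i \<in> x\<^sub>j\<close>\<close>
definition cMem :: "'a \<Rightarrow> 'a \<Rightarrow> 'a" where
  "cMem i j = opair (tag 0) (opair i j)"

\<comment> \<open>\<open>x\<^sub>i = x\<^sub>j\<close>\<close>
definition cEq :: "'a \<Rightarrow> 'a \<Rightarrow> 'a" where
  "cEq i j = opair (tag 1) (opair i j)"

\<comment> \<open>\<open>x\<^sub>i \<in> X\<^sub>j\<close>\<close>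
definition cMem2 :: "'a \<Rightarrow> 'a \<Rightarrow> 'a" where
  "cMem2 i j = opair (tag 2) (opair i j)"

definition cNeg :: "'a \<Rightarrow> 'a" where
  "cNeg p = opair (tag 3) p"

definition cAnd :: "'a \<Rightarrow> 'a \<Rightarrow> 'a" where
  "cAnd p q = opair (tag 4) (opair p q)"

\<comment> \<open>\<open>\<exists>x\<^sub>i. p\<close>\<close>
definition cEx :: "'a \<Rightarrow> 'a \<Rightarrow> 'a" where
  "cEx i p = opair (tag 5) (opair i p)"

\<comment> \<open>\<open>\<exists>X\<^sub>i. p\<close>\<close>
definition cEx2 :: "'a \<Rightarrow> 'a \<Rightarrow> 'a" where
  "cEx2 i p = opair (tag 6) (opair i p)"

definition cAll :: "'a \<Rightarrow> 'a \<Rightarrow> 'a" where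
  "cAll i p = cNeg (cEx i (cNeg p))"

text \<open>Each class of formulas is the least one closed under its formation rules; as the sets
  closed under the rules are those of the model, this is the class of formulas in the sense of the
  model.\<close>

definition fo_closed :: "'a \<Rightarrow> bool" where
  "fo_closed X \<longleftrightarrow>
     (\<forall>i j. i \<epsilon> omega \<and> j \<epsilon> omega \<longrightarrow> cMem i j \<epsilon> X \<and> cEq i j \<epsilon> X) \<and>
     (\<forall>p. p \<epsilon> X \<longrightarrow> cNeg p \<epsilon> X) \<and>
     (\<forall>p q. p \<epsilon> X \<and> q \<epsilon> X \<longrightarrow> cAnd p q \<epsilon> X) \<and>
     (\<forall>i p. i \<epsilon> omega \<and> p \<epsilon> X \<longrightarrow> cEx i p \<epsilon> X)"

definition so_closed :: "'a \<Rightarrow> bool" where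
  "so_closed X \<longleftrightarrow> fo_closed X \<and>
     (\<forall>i j. i \<epsilon> omega \<and> j \<epsilon> omega \<longrightarrow> cMem2 i j \<epsilon> X) \<and>
     (\<forall>i p. i \<epsilon> omega \<and> p \<epsilon> X \<longrightarrow> cEx2 i p \<epsilon> X)"

text \<open>Unbounded quantifiers are replaced by \<open>\<exists>x\<^sub>i. x\<^sub>i \<in> x\<^sub>j \<and> p\<close> with \<open>i \<noteq> j\<close>.\<close>

definition delta0_closed :: "'a \<Rightarrow> bool" where
  "delta0_closed X \<longleftrightarrow>
     (\<forall>i j. i \<epsilon> omega \<and> j \<epsilon> omega \<longrightarrow> cMem i j \<epsilon> X \<and> cEq i j \<epsilon> X) \<and>
     (\<forall>p. p \<epsilon> X \<longrightarrow> cNeg p \<epsilon> X) \<and>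
     (\<forall>p q. p \<epsilon> X \<and> q \<epsilon> X \<longrightarrow> cAnd p q \<epsilon> X) \<and>
     (\<forall>i j p. i \<epsilon> omega \<and> j \<epsilon> omega \<and> i \<noteq> j \<and> p \<epsilon> X \<longrightarrow> cEx i (cAnd (cMem i j) p) \<epsilon> X)"

definition fo_formula :: "'a \<Rightarrow> bool" where
  "fo_formula p \<longleftrightarrow> (\<forall>X. fo_closed X \<longrightarrow> p \<epsilon> X)"

definition so_formula :: "'a \<Rightarrow> bool" where
  "so_formula p \<longleftrightarrow> (\<forall>X. so_closed X \<longrightarrow> p \<epsilon> X)"

definition delta0_formula :: "'a \<Rightarrow> bool" where
  "delta0_formula p \<longleftrightarrow> (\<forall>X. delta0_closed X \<longrightarrow> p \<epsilon> X)"

definition Sigma2_formula :: "'a \<Rightarrow> bool" where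
  "Sigma2_formula p \<longleftrightarrow>
     (\<exists>i j q. i \<epsilon> omega \<and> j \<epsilon> omega \<and> delta0_formula q \<and> p = cEx i (cAll j q))"

text \<open>The relation that the variable \<open>v\<close> is free in the formula \<open>p\<close>; the variable \<open>x\<^sub>i\<close> is
  represented by \<open>var1 i\<close> and \<open>X\<^sub>i\<close> by \<open>var2 i\<close>.\<close>

definition var1 :: "'a \<Rightarrow> 'a" where
  "var1 i = opair (tag 0) i"

definition var2 :: "'a \<Rightarrow> 'a" where
  "var2 i = opair (tag 1) i"

definition free_closed :: "'a \<Rightarrow> bool" where
  "free_closed F \<longleftrightarrow>
     (\<forall>i j. i \<epsilon> omega \<and> j \<epsilon> omega \<longrightarrow>
        opair (var1 i) (cMem i j) \<epsilon> F \<and> opair (var1 j) (cMem i j) \<epsilon> F \<and>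
        opair (var1 i) (cEq i j) \<epsilon> F \<and> opair (var1 j) (cEq i j) \<epsilon> F \<and>
        opair (var1 i) (cMem2 i j) \<epsilon> F \<and> opair (var2 j) (cMem2 i j) \<epsilon> F) \<and>
     (\<forall>v p. opair v p \<epsilon> F \<longrightarrow> opair v (cNeg p) \<epsilon> F) \<and>
     (\<forall>v p q. opair v p \<epsilon> F \<and> so_formula q \<longrightarrow>
        opair v (cAnd p q) \<epsilon> F \<and> opair v (cAnd q p) \<epsilon> F) \<and>
     (\<forall>v p i. opair v p \<epsilon> F \<and> i \<epsilon> omega \<and> v \<noteq> var1 i \<longrightarrow> opair v (cEx i p) \<epsilon> F) \<and>
     (\<forall>v p i. opair v p \<epsilon> F \<and> i \<epsilon> omega \<and> v \<noteq> var2 i \<longrightarrow> opair v (cEx2 i p) \<epsilon> F)"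

definition free_in :: "'a \<Rightarrow> 'a \<Rightarrow> bool" where
  "free_in v p \<longleftrightarrow> (\<forall>F. free_closed F \<longrightarrow> opair v p \<epsilon> F)"

definition fo_sentence :: "'a \<Rightarrow> bool" where
  "fo_sentence p \<longleftrightarrow> fo_formula p \<and> \<not> (\<exists>v. free_in v p)"

definition so_sentence :: "'a \<Rightarrow> bool" where
  "so_sentence p \<longleftrightarrow> so_formula p \<and> \<not> (\<exists>v. free_in v p)"

text \<open>\<open>S\<close> satisfies Tarski's clauses for the structure \<open>(A, \<in>)\<close>: it consists of the \<open>(p, (s, t))\<close>
  such that \<open>p\<close> is satisfied by the assignment \<open>s\<close> of elements of \<open>A\<close> to the first-order variables
  and the assignment \<open>t\<close> of subsets of \<open>A\<close> to the second-order variables.\<close>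

definition sat_rel :: "'a \<Rightarrow> 'a \<Rightarrow> bool" where
  "sat_rel A S \<longleftrightarrow> (\<forall>s t. is_fun s omega A \<and> is_fun t omega (pow A) \<longrightarrow>
     (let R = (\<lambda>p s t. opair p (opair s t) \<epsilon> S) in
       (\<forall>i j. i \<epsilon> omega \<and> j \<epsilon> omega \<longrightarrow>
          (R (cMem i j) s t \<longleftrightarrow> app s i \<epsilon> app s j) \<and>
          (R (cEq i j) s t \<longleftrightarrow> app s i = app s j) \<and>
          (R (cMem2 i j) s t \<longleftrightarrow> app s i \<epsilon> app t j)) \<and>
       (\<forall>p. so_formula p \<longrightarrow> (R (cNeg p) s t \<longleftrightarrow> \<not> R p s t)) \<and>
       (\<forall>p q. so_formula p \<and> so_formula q \<longrightarrow> (R (cAnd p q) s t \<longleftrightarrow> R p s t \<and> R q s t)) \<and>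
       (\<forall>i p. i \<epsilon> omega \<and> so_formula p \<longrightarrow>
          (R (cEx i p) s t \<longleftrightarrow> (\<exists>x. x \<epsilon> A \<and> R p (upd s i x) t)) \<and>
          (R (cEx2 i p) s t \<longleftrightarrow> (\<exists>X. subs X A \<and> R p s (upd t i X))))))"

definition Sat :: "'a \<Rightarrow> 'a \<Rightarrow> 'a \<Rightarrow> 'a \<Rightarrow> bool" where
  "Sat A p s t \<longleftrightarrow> (\<exists>S. sat_rel A S \<and> opair p (opair s t) \<epsilon> S)"

text \<open>Satisfaction of first-order formulas, for which the choice of \<open>t\<close> is irrelevant.\<close>

definition fo_Sat :: "'a \<Rightarrow> 'a \<Rightarrow> 'a \<Rightarrow> bool" where
  "fo_Sat A p s \<longleftrightarrow> (\<forall>t. is_fun t omega (pow A) \<longrightarrow> Sat A p s t)"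

definition models :: "'a \<Rightarrow> 'a \<Rightarrow> bool" where
  "models A p \<longleftrightarrow> (\<forall>s t. is_fun s omega A \<and> is_fun t omega (pow A) \<longrightarrow> Sat A p s t)"

text \<open>Truth in the universe, for formulas of low complexity: a \<open>\<Delta>\<^sub>0\<close> formula is evaluated in any
  transitive set containing the values of the variables, and the two outer quantifiers of a
  \<open>\<Sigma>\<^sub>2\<close> formula range over the whole universe.  (Satisfaction of arbitrary formulas in the universe
  is not definable.)\<close>

definition V_Sat_delta0 :: "'a \<Rightarrow> 'a \<Rightarrow> bool" where
  "V_Sat_delta0 p s \<longleftrightarrow> (\<exists>A. transitive A \<and> is_fun s omega A \<and> fo_Sat A p s)"

definition V_Sat_Sigma2 :: "'a \<Rightarrow> 'a \<Rightarrow> bool" where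
  "V_Sat_Sigma2 p s \<longleftrightarrow>
     (\<exists>i j q. i \<epsilon> omega \<and> j \<epsilon> omega \<and> delta0_formula q \<and> p = cEx i (cAll j q) \<and>
        (\<exists>x. \<forall>y. V_Sat_delta0 q (upd (upd s i x) j y)))"

definition V_models_Sigma2 :: "'a \<Rightarrow> bool" where
  "V_models_Sigma2 p \<longleftrightarrow> (\<forall>s A. is_fun s omega A \<longrightarrow> V_Sat_Sigma2 p s)"

text \<open>\<open>a\<close>-order sentences about \<open>V\<^sub>k\<close> are first-order sentences about \<open>V\<^bsub>k+a\<^esub>\<close>.  A language \<open>L\<close> is a
  class of sentences, and \<open>Tr k p\<close> says that \<open>p\<close>, read as a sentence about \<open>V\<^sub>k\<close>, is true.\<close>

definition theory_categorical :: "('a \<Rightarrow> bool) \<Rightarrow> ('a \<Rightarrow> 'a \<Rightarrow> bool) \<Rightarrow> 'a \<Rightarrow> bool" where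
  "theory_categorical L Tr k \<longleftrightarrow> inaccessible k \<and>
     (\<exists>T. (\<forall>p. p \<epsilon> T \<longrightarrow> L p) \<and> (\<forall>p. p \<epsilon> T \<longrightarrow> Tr k p) \<and>
          (\<forall>l. inaccessible l \<and> l \<noteq> k \<longrightarrow> \<not> (\<forall>p. p \<epsilon> T \<longrightarrow> Tr l p)))"

definition fresh :: "('a \<Rightarrow> bool) \<Rightarrow> ('a \<Rightarrow> 'a \<Rightarrow> bool) \<Rightarrow> 'a \<Rightarrow> bool" where
  "fresh L Tr k \<longleftrightarrow> inaccessible k \<and>
     \<not> (\<exists>d. inaccessible d \<and> d \<epsilon> k \<and> (\<forall>p. L p \<longrightarrow> (Tr d p \<longleftrightarrow> Tr k p)))"

definition fo_theory_categorical :: "'a \<Rightarrow> bool" where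
  "fo_theory_categorical = theory_categorical fo_sentence (\<lambda>k. models (V k))"

definition so_theory_categorical :: "'a \<Rightarrow> bool" where
  "so_theory_categorical = theory_categorical so_sentence (\<lambda>k. models (V k))"

definition order_theory_categorical :: "'a \<Rightarrow> 'a \<Rightarrow> bool" where
  "order_theory_categorical a = theory_categorical fo_sentence (\<lambda>k. models (V (ord_add k a)))"

definition fo_fresh :: "'a \<Rightarrow> bool" where
  "fo_fresh = fresh fo_sentence (\<lambda>k. models (V k))"

definition so_fresh :: "'a \<Rightarrow> bool" where
  "so_fresh = fresh so_sentence (\<lambda>k. models (V k))"

definition order_fresh :: "'a \<Rightarrow> 'a \<Rightarrow> bool" where
  "order_fresh a = fresh fo_sentence (\<lambda>k. models (V (ord_add k a)))"

text \<open>The free variable of the defining formula is \<open>x\<^sub>0\<close>.\<close>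

definition absolutely_definable :: "'a \<Rightarrow> bool" where
  "absolutely_definable a \<longleftrightarrow> Ord a \<and>
     (\<exists>p. fo_formula p \<and> (\<forall>v. free_in v p \<longrightarrow> v = var1 emp) \<and>
        (\<forall>k. inaccessible k \<longrightarrow> a \<epsilon> V k \<and>
           (\<forall>s. is_fun s omega (V k) \<longrightarrow> (fo_Sat (V k) p s \<longleftrightarrow> app s emp = a))))"

definition lightface_Sigma2_correct :: "'a \<Rightarrow> bool" where
  "lightface_Sigma2_correct d \<longleftrightarrow> Ord d \<and>
     (\<forall>p. Sigma2_formula p \<and> fo_sentence p \<longrightarrow> (models (V d) p \<longleftrightarrow> V_models_Sigma2 p))"

text \<open>Reals are subsets of \<open>\<omega>\<close>; \<open>s\<close> assigns the parameters to the free variables of \<open>p\<close>.\<close>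

definition Sigma2_real_correct :: "'a \<Rightarrow> bool" where
  "Sigma2_real_correct d \<longleftrightarrow> Ord d \<and> subs (pow omega) (V d) \<and>
     (\<forall>p s. Sigma2_formula p \<and> is_fun s omega (pow omega) \<longrightarrow>
        (fo_Sat (V d) p s \<longleftrightarrow> V_Sat_Sigma2 p s))"

end

end

theory Submission
  imports Defs
begin

text \<open>
  Let \<open>\<kappa>\<close> be fresh of any order and \<open>\<lambda>\<close> the next inaccessible cardinal.  Then \<open>\<lambda>\<close> is theory categorical of
  every order: \<open>V\<^sub>\<lambda>\<close> sees \<open>\<kappa>\<close> as its greatest inaccessible, sees that \<open>\<kappa>\<close> is fresh, and decides each
  sentence of the theory of \<open>\<kappa>\<close>, since every hereditarily finite set, in particular every (possibly
  nonstandard) sentence of the model, is defined by a formula of the model.  Two fresh cardinals with the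
  same theory are equal, so these statements determine \<open>\<kappa>\<close> and hence \<open>\<lambda>\<close>.  Conversely theory categorical
  cardinals are fresh.  Hence all the classes are cofinal in each other.

  If the inaccessible cardinals are unbounded, reflection of \<open>\<Pi>\<^sub>1\<close> witnesses together with Levy's theorem
  \<open>V\<^sub>k \<prec>\<^bsub>\<Sigma>1\<^esub> V\<close> yields an inaccessible \<open>\<Sigma>\<^sub>2\<close>-correct cardinal.  The least inaccessible lightface
  \<open>\<Sigma>\<^sub>2\<close>-correct cardinal is fresh, since the existence of a smaller inaccessible with its theory would
  make the latter correct too; and there is no greatest fresh cardinal.  Finally, a real \<open>r\<close>
  coding the theory of a fresh \<open>\<kappa>\<close> makes ``some inaccessible has theory \<open>r\<close>'' a true \<open>\<Sigma>\<^sub>2\<close> statement, and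
  reflecting it below a \<open>\<Sigma>\<^sub>2(\<real>)\<close>-correct \<open>\<delta>\<close> gives \<open>\<kappa> < \<delta>\<close>.
\<close>

subsection \<open>First-order formulas with de Bruijn indices and parameters\<close>

text \<open>Separation and replacement are schemes over \<open>fm\<close>, so every class or
  function to which they are applied needs a certificate of definability; \<open>D\<close> and
  \<open>fn\<close> carry it, and the rules \<open>dintro\<close> derive it from the shape of the
  term. The same certificates produce sentences of the object language, and there the class in which
  a formula is evaluated matters. V_(l+b) may be a successor stage, which is closed under subsets
  but not under pairing, so functions, satisfaction relations and ordinal sums cannot be discussed
  over it directly. They are discussed inside an element of V_(l+b) that is closed under the basic
  operations. Relativization to that element leaves only bounded quantifiers, so the same
  construction also provides the Delta_0 matrix of the Sigma_2 statement about a real. Formulas of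
  the metatheory have standard length, those of the model need not. Hence the sentence whose truth
  is to be decided enters a fixed standard formula as a hereditarily finite parameter, which is then
  eliminated by a definition found by induction inside the model.\<close>

datatype 'a tm = Var nat | Con 'a

text \<open>Parameters are constants rather than assigned variables, so formulas with parameters can
  be combined without any bookkeeping of assignments. A formula without constants
  (\<open>set_db p = {}\<close>) is one that can be turned into a formula of the object
  language.\<close>

datatype 'a db = DMem "'a tm" "'a tm" | DEq "'a tm" "'a tm" | DNeg "'a db"
  | DAnd "'a db" "'a db" | DEx "'a db"

primrec tval :: "(nat \<Rightarrow> 'a) \<Rightarrow> 'a tm \<Rightarrow> 'a" where
  "tval e (Var i) = e i"
| "tval e (Con c) = c"

text \<open>Quantifiers range over \<open>B\<close>, so this one semantics serves for the universe,
  for a stage V_a and for relativization to a set.\<close>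

primrec dsat :: "('a \<Rightarrow> 'a \<Rightarrow> bool) \<Rightarrow> ('a \<Rightarrow> bool) \<Rightarrow> 'a db \<Rightarrow> (nat \<Rightarrow> 'a) \<Rightarrow> bool" where
  "dsat m B (DMem s t) e = m (tval e s) (tval e t)"
| "dsat m B (DEq s t) e = (tval e s = tval e t)"
| "dsat m B (DNeg p) e = (\<not> dsat m B p e)"
| "dsat m B (DAnd p q) e = (dsat m B p e \<and> dsat m B q e)"
| "dsat m B (DEx p) e = (\<exists>x. B x \<and> dsat m B p (case_nat x e))"

primrec tren :: "(nat \<Rightarrow> nat) \<Rightarrow> 'a tm \<Rightarrow> 'a tm" where
  "tren f (Var i) = Var (f i)"
| "tren f (Con c) = Con c"

primrec dren :: "(nat \<Rightarrow> nat) \<Rightarrow> 'a db \<Rightarrow> 'a db" where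
  "dren f (DMem s t) = DMem (tren f s) (tren f t)"
| "dren f (DEq s t) = DEq (tren f s) (tren f t)"
| "dren f (DNeg p) = DNeg (dren f p)"
| "dren f (DAnd p q) = DAnd (dren f p) (dren f q)"
| "dren f (DEx p) = DEx (dren (case_nat 0 (\<lambda>i. Suc (f i))) p)"

lemma tval_tren: "tval e (tren f t) = tval (\<lambda>i. e (f i)) t"
  by (cases t) auto

lemma dsat_dren: "dsat m B (dren f p) e = dsat m B p (\<lambda>i. e (f i))"
proof (induction p arbitrary: f e)
  case (DEx p)
  have "(\<lambda>i. case_nat x e (case i of 0 \<Rightarrow> 0 | Suc i \<Rightarrow> Suc (f i))) = case_nat x (\<lambda>i. e (f i))" for x
    by (rule ext) (simp split: nat.split)
  then show ?case by (simp add: DEx)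
qed (auto simp: tval_tren)

lemma set_tm_tren [simp]: "set_tm (tren f t) = set_tm t"
  by (cases t) auto

lemma set_db_dren [simp]: "set_db (dren f p) = set_db p"
  by (induction p arbitrary: f) auto

primrec tfv :: "'a tm \<Rightarrow> nat set" where
  "tfv (Var i) = {i}"
| "tfv (Con c) = {}"

primrec dfv :: "'a db \<Rightarrow> nat set" where
  "dfv (DMem s t) = tfv s \<union> tfv t"
| "dfv (DEq s t) = tfv s \<union> tfv t"
| "dfv (DNeg p) = dfv p"
| "dfv (DAnd p q) = dfv p \<union> dfv q"
| "dfv (DEx p) = {i. Suc i \<in> dfv p}"

lemma tval_cong: "(\<And>i. i \<in> tfv t \<Longrightarrow> e i = e' i) \<Longrightarrow> tval e t = tval e' t"
  by (cases t) auto

lemma dsat_cong: "(\<And>i. i \<in> dfv p \<Longrightarrow> e i = e' i) \<Longrightarrow> dsat m B p e = dsat m B p e'"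
proof (induction p arbitrary: e e')
  case (DMem s t)
  then have "tval e s = tval e' s" "tval e t = tval e' t" by (auto intro!: tval_cong)
  then show ?case by simp
next
  case (DEq s t)
  then have "tval e s = tval e' s" "tval e t = tval e' t" by (auto intro!: tval_cong)
  then show ?case by simp
next
  case (DNeg p)
  have "dsat m B p e = dsat m B p e'"
    using DNeg.prems by (auto intro!: DNeg.IH)
  then show ?case by (simp only: dsat.simps)
next
  case (DAnd p q)
  have "dsat m B p e = dsat m B p e'" "dsat m B q e = dsat m B q e'"
    using DAnd.prems by (auto intro!: DAnd.IH)
  then show ?case by (simp only: dsat.simps)
next
  case (DEx p)
  have "dsat m B p (case_nat x e) = dsat m B p (case_nat x e')" for x
    by (rule DEx.IH) (use DEx.prems in \<open>auto split: nat.split\<close>)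
  then show ?case by (simp only: dsat.simps)
qed

text \<open>\<open>g\<close> names the constants and \<open>f\<close> the free indices: a constant
  becomes a free variable of the named formula, to be assigned that constant.\<close>

primrec vt :: "('a \<Rightarrow> nat) \<Rightarrow> (nat \<Rightarrow> nat) \<Rightarrow> 'a tm \<Rightarrow> nat" where
  "vt g f (Var i) = f i"
| "vt g f (Con c) = g c"

text \<open>Every binder gets its own name, starting with \<open>N\<close>, which lies above the names of all free
  variables and constants.\<close>

primrec named :: "('a \<Rightarrow> nat) \<Rightarrow> nat \<Rightarrow> (nat \<Rightarrow> nat) \<Rightarrow> 'a db \<Rightarrow> fm" where
  "named g N f (DMem s t) = Mem (vt g f s) (vt g f t)"
| "named g N f (DEq s t) = Eq (vt g f s) (vt g f t)"
| "named g N f (DNeg p) = Neg (named g N f p)"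
| "named g N f (DAnd p q) = And (named g N f p) (named g N f q)"
| "named g N f (DEx p) = Ex N (named g (Suc N) (case_nat N f) p)"

primrec holdsR :: "('a \<Rightarrow> 'a \<Rightarrow> bool) \<Rightarrow> ('a \<Rightarrow> bool) \<Rightarrow> fm \<Rightarrow> (nat \<Rightarrow> 'a) \<Rightarrow> bool" where
  "holdsR m B (Mem i j) e \<longleftrightarrow> m (e i) (e j)"
| "holdsR m B (Eq i j) e \<longleftrightarrow> e i = e j"
| "holdsR m B (Neg p) e \<longleftrightarrow> \<not> holdsR m B p e"
| "holdsR m B (And p q) e \<longleftrightarrow> holdsR m B p e \<and> holdsR m B q e"
| "holdsR m B (Ex i p) e \<longleftrightarrow> (\<exists>x. B x \<and> holdsR m B p (e(i := x)))"

lemma holdsR_True: "holdsR m (\<lambda>_. True) p e = holds m p e"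
  by (induction p arbitrary: e) auto

lemma tval_vt: "\<forall>c\<in>set_tm t. e (g c) = c \<Longrightarrow> e (vt g f t) = tval (\<lambda>i. e (f i)) t"
  by (cases t) auto

text \<open>Names below \<open>N\<close> are never rebound, so the values of the free names and of
  the names of constants survive the updates at the binders.\<close>

lemma holdsR_named:
  "\<forall>i\<in>dfv p. f i < N \<Longrightarrow> \<forall>c\<in>set_db p. g c < N \<and> e (g c) = c \<Longrightarrow>
   holdsR m B (named g N f p) e = dsat m B p (\<lambda>i. e (f i))"
proof (induction p arbitrary: N f e)
  case (DEx p)
  have "holdsR m B (named g (Suc N) (case_nat N f) p) (e(N := x)) = dsat m B p (case_nat x (\<lambda>i. e (f i)))" for x
  proof -
    have "holdsR m B (named g (Suc N) (case_nat N f) p) (e(N := x))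
        = dsat m B p (\<lambda>i. (e(N := x)) (case_nat N f i))"
      using DEx.prems by (intro DEx.IH) (auto split: nat.split simp: less_Suc_eq)
    also have "\<dots> = dsat m B p (case_nat x (\<lambda>i. e (f i)))"
      using DEx.prems by (intro dsat_cong) (auto split: nat.split)
    finally show ?thesis .
  qed
  then show ?case by simp
next
  case (DMem s t)
  have "e (vt g f s) = tval (\<lambda>i. e (f i)) s" "e (vt g f t) = tval (\<lambda>i. e (f i)) t"
    using DMem.prems by (auto intro!: tval_vt)
  then show ?case by (simp only: named.simps holdsR.simps dsat.simps)
next
  case (DEq s t)
  have "e (vt g f s) = tval (\<lambda>i. e (f i)) s" "e (vt g f t) = tval (\<lambda>i. e (f i)) t"
    using DEq.prems by (auto intro!: tval_vt)
  then show ?case by (simp only: named.simps holdsR.simps dsat.simps)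
next
  case (DNeg p)
  have "holdsR m B (named g N f p) e = dsat m B p (\<lambda>i. e (f i))"
    by (rule DNeg.IH) (use DNeg.prems in \<open>simp_all only: dfv.simps db.set\<close>)
  then show ?case by (simp only: named.simps holdsR.simps dsat.simps)
next
  case (DAnd p q)
  have "holdsR m B (named g N f p) e = dsat m B p (\<lambda>i. e (f i))"
    by (rule DAnd.IH) (use DAnd.prems in \<open>auto simp only: dfv.simps db.set\<close>)
  moreover have "holdsR m B (named g N f q) e = dsat m B q (\<lambda>i. e (f i))"
    by (rule DAnd.IH) (use DAnd.prems in \<open>auto simp only: dfv.simps db.set\<close>)
  ultimately show ?case by (simp only: named.simps holdsR.simps dsat.simps)
qed

lemma finite_set_tm: "finite (set_tm t)"
  by (cases t) simp_all

lemma finite_set_db: "finite (set_db p)"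
  by (induction p) (simp_all only: db.set finite_Un finite_set_tm)

text \<open>Names 0 and 1 are the argument and the value in the replacement scheme. So the finitely
  many constants are named from 2 on, and every index other than 0 is read as name 1.\<close>

lemma holds_of_dsat:
  fixes p :: "'a db"
  obtains q e0 where "\<And>x y. holds m q (e0(0 := x, 1 := y)) = dsat m (\<lambda>_. True) p (\<lambda>i. if i = 0 then x else y)"
proof -
  obtain h :: "'a \<Rightarrow> nat" where h: "inj_on h (set_db p)"
    using finite_set_db finite_imp_inj_to_nat_seg by metis
  define g where "g c = Suc (Suc (h c))" for c
  define e0 where "e0 i = (SOME c. c \<in> set_db p \<and> g c = i)" for i
  have e0: "e0 (g c) = c" if "c \<in> set_db p" for c
  proof -
    have "e0 (g c) \<in> set_db p \<and> g (e0 (g c)) = g c"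
      unfolding e0_def by (rule someI[of _ c]) (use that in simp)
    then show ?thesis using h that by (auto simp: g_def inj_on_def)
  qed
  define f :: "nat \<Rightarrow> nat" where "f i = (if i = 0 then 0 else 1)" for i
  define N where "N = Suc (Suc (Max (insert 0 (g ` set_db p))))"
  have gN: "g c < N" if "c \<in> set_db p" for c
  proof -
    have "g c \<le> Max (insert 0 (g ` set_db p))"
      by (rule Max_ge) (use that finite_set_db[of p] in auto)
    then show ?thesis by (simp add: N_def)
  qed
  have "holds m (named g N f p) (e0(0 := x, 1 := y)) = dsat m (\<lambda>_. True) p (\<lambda>i. if i = 0 then x else y)" for x y
  proof -
    have "holdsR m (\<lambda>_. True) (named g N f p) (e0(0 := x, 1 := y))
       = dsat m (\<lambda>_. True) p (\<lambda>i. (e0(0 := x, 1 := y)) (f i))"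
    proof (rule holdsR_named)
      show "\<forall>i\<in>dfv p. f i < N" by (simp add: f_def N_def)
      show "\<forall>c\<in>set_db p. g c < N \<and> (e0(0 := x, 1 := y)) (g c) = c"
      proof
        fix c assume c: "c \<in> set_db p"
        have "g c \<noteq> 0" "g c \<noteq> 1" by (simp_all add: g_def)
        then show "g c < N \<and> (e0(0 := x, 1 := y)) (g c) = c" using gN[OF c] e0[OF c] by simp
      qed
    qed
    moreover have "(\<lambda>i. (e0(0 := x, 1 := y)) (f i)) = (\<lambda>i. if i = 0 then x else y)"
      by (rule ext) (simp add: f_def)
    ultimately show ?thesis by (simp only: holdsR_True)
  qed
  then show ?thesis using that by blast
qed

primrec fmfv :: "fm \<Rightarrow> nat set" where
  "fmfv (Mem i j) = {i, j}"
| "fmfv (Eq i j) = {i, j}"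
| "fmfv (Neg p) = fmfv p"
| "fmfv (And p q) = fmfv p \<union> fmfv q"
| "fmfv (Ex i p) = fmfv p - {i}"

lemma fv_vt: "set_tm t = {} \<Longrightarrow> vt g f t \<in> f ` tfv t"
  by (cases t) simp_all

lemma fmfv_named: "set_db p = {} \<Longrightarrow> fmfv (named g N f p) \<subseteq> f ` dfv p"
proof (induction p arbitrary: N f)
  case (DMem s t)
  then show ?case using fv_vt[of s g f] fv_vt[of t g f] by auto
next
  case (DEq s t)
  then show ?case using fv_vt[of s g f] fv_vt[of t g f] by auto
next
  case (DEx p)
  have "fmfv (named g (Suc N) (case_nat N f) p) \<subseteq> case_nat N f ` dfv p"
    using DEx by simp
  then show ?case by (auto split: nat.splits)
next
  case (DAnd p q)
  have "fmfv (named g N f p) \<subseteq> f ` dfv p" "fmfv (named g N f q) \<subseteq> f ` dfv q"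
    using DAnd by simp_all
  then show ?case by (simp add: image_Un) blast
qed auto

text \<open>Relativization to the set that is the value of variable \<open>d\<close>.\<close>

primrec drel :: "nat \<Rightarrow> 'a db \<Rightarrow> 'a db" where
  "drel d (DMem s t) = DMem (tren (\<lambda>i. if i < d then i else Suc i) s) (tren (\<lambda>i. if i < d then i else Suc i) t)"
| "drel d (DEq s t) = DEq (tren (\<lambda>i. if i < d then i else Suc i) s) (tren (\<lambda>i. if i < d then i else Suc i) t)"
| "drel d (DNeg p) = DNeg (drel d p)"
| "drel d (DAnd p q) = DAnd (drel d p) (drel d q)"
| "drel d (DEx p) = DEx (DAnd (DMem (Var 0) (Var (Suc d))) (drel (Suc d) p))"

text \<open>By transitivity of \<open>B\<close>, elements of the value of \<open>d\<close> are
  automatically in \<open>B\<close>. The variable \<open>d\<close> is inserted among the free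
  variables and moves up at each binder, hence the shift of the indices from \<open>d\<close>
  on.\<close>

lemma dsat_drel:
  assumes B: "\<And>x y. B x \<Longrightarrow> m y x \<Longrightarrow> B y"
  shows "B (e d) \<Longrightarrow> dsat m B (drel d p) e = dsat m (\<lambda>x. m x (e d)) p (\<lambda>i. if i < d then e i else e (Suc i))"
proof (induction p arbitrary: d e)
  case (DEx p)
  have "dsat m B (drel (Suc d) p) (case_nat x e) =
        dsat m (\<lambda>x. m x (e d)) p (case_nat x (\<lambda>i. if i < d then e i else e (Suc i)))" for x
  proof -
    have "(\<lambda>i. if i < Suc d then case_nat x e i else case_nat x e (Suc i)) =
          case_nat x (\<lambda>i. if i < d then e i else e (Suc i))"
      by (rule ext) (simp split: nat.split)
    then show ?thesis using DEx.IH[of "case_nat x e" "Suc d"] DEx.prems by simp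
  qed
  then show ?case using B DEx.prems by auto
qed (auto simp: tval_tren if_distrib)

lemma set_db_drel [simp]: "set_db (drel d p) = set_db p"
  by (induction p arbitrary: d) auto

subsection \<open>Definable classes and functions\<close>

named_theorems dintro

datatype idx = iU | iG | iT

context ZFC
begin

abbreviation subs where "subs \<equiv> Defs.subs (\<epsilon>)"
abbreviation mkset where "mkset \<equiv> Defs.mkset (\<epsilon>)"
abbreviation emp where "emp \<equiv> Defs.emp (\<epsilon>)"
abbreviation suc where "suc \<equiv> Defs.suc (\<epsilon>)"
abbreviation pow where "pow \<equiv> Defs.pow (\<epsilon>)"
abbreviation upair where "upair \<equiv> Defs.upair (\<epsilon>)"
abbreviation opair where "opair \<equiv> Defs.opair (\<epsilon>)"
abbreviation app where "app \<equiv> Defs.app (\<epsilon>)"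
abbreviation is_fun where "is_fun \<equiv> Defs.is_fun (\<epsilon>)"
abbreviation is_inj where "is_inj \<equiv> Defs.is_inj (\<epsilon>)"
abbreviation upd where "upd \<equiv> Defs.upd (\<epsilon>)"
abbreviation omega where "omega \<equiv> Defs.omega (\<epsilon>)"
abbreviation transitive where "transitive \<equiv> Defs.transitive (\<epsilon>)"
abbreviation Ord where "Ord \<equiv> Defs.Ord (\<epsilon>)"
abbreviation ord_le where "ord_le \<equiv> Defs.ord_le (\<epsilon>)"
abbreviation ord_rec where "ord_rec \<equiv> Defs.ord_rec (\<epsilon>)"
abbreviation V where "V \<equiv> Defs.V (\<epsilon>)"
abbreviation ord_add where "ord_add \<equiv> Defs.ord_add (\<epsilon>)"
abbreviation cardinal where "cardinal \<equiv> Defs.cardinal (\<epsilon>)"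
abbreviation regular where "regular \<equiv> Defs.regular (\<epsilon>)"
abbreviation inaccessible where "inaccessible \<equiv> Defs.inaccessible (\<epsilon>)"
abbreviation is_sup where "is_sup \<equiv> Defs.is_sup (\<epsilon>)"
abbreviation is_least where "is_least \<equiv> Defs.is_least (\<epsilon>)"
abbreviation tag where "tag \<equiv> Defs.tag (\<epsilon>)"
abbreviation cMem where "cMem \<equiv> Defs.cMem (\<epsilon>)"
abbreviation cEq where "cEq \<equiv> Defs.cEq (\<epsilon>)"
abbreviation cMem2 where "cMem2 \<equiv> Defs.cMem2 (\<epsilon>)"
abbreviation cNeg where "cNeg \<equiv> Defs.cNeg (\<epsilon>)"
abbreviation cAnd where "cAnd \<equiv> Defs.cAnd (\<epsilon>)"
abbreviation cEx where "cEx \<equiv> Defs.cEx (\<epsilon>)"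
abbreviation cEx2 where "cEx2 \<equiv> Defs.cEx2 (\<epsilon>)"
abbreviation cAll where "cAll \<equiv> Defs.cAll (\<epsilon>)"
abbreviation fo_closed where "fo_closed \<equiv> Defs.fo_closed (\<epsilon>)"
abbreviation so_closed where "so_closed \<equiv> Defs.so_closed (\<epsilon>)"
abbreviation delta0_closed where "delta0_closed \<equiv> Defs.delta0_closed (\<epsilon>)"
abbreviation fo_formula where "fo_formula \<equiv> Defs.fo_formula (\<epsilon>)"
abbreviation so_formula where "so_formula \<equiv> Defs.so_formula (\<epsilon>)"
abbreviation delta0_formula where "delta0_formula \<equiv> Defs.delta0_formula (\<epsilon>)"
abbreviation Sigma2_formula where "Sigma2_formula \<equiv> Defs.Sigma2_formula (\<epsilon>)"
abbreviation var1 where "var1 \<equiv> Defs.var1 (\<epsilon>)"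
abbreviation var2 where "var2 \<equiv> Defs.var2 (\<epsilon>)"
abbreviation free_closed where "free_closed \<equiv> Defs.free_closed (\<epsilon>)"
abbreviation free_in where "free_in \<equiv> Defs.free_in (\<epsilon>)"
abbreviation fo_sentence where "fo_sentence \<equiv> Defs.fo_sentence (\<epsilon>)"
abbreviation so_sentence where "so_sentence \<equiv> Defs.so_sentence (\<epsilon>)"
abbreviation sat_rel where "sat_rel \<equiv> Defs.sat_rel (\<epsilon>)"
abbreviation Sat where "Sat \<equiv> Defs.Sat (\<epsilon>)"
abbreviation fo_Sat where "fo_Sat \<equiv> Defs.fo_Sat (\<epsilon>)"
abbreviation models where "models \<equiv> Defs.models (\<epsilon>)"
abbreviation V_Sat_delta0 where "V_Sat_delta0 \<equiv> Defs.V_Sat_delta0 (\<epsilon>)"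
abbreviation V_Sat_Sigma2 where "V_Sat_Sigma2 \<equiv> Defs.V_Sat_Sigma2 (\<epsilon>)"
abbreviation V_models_Sigma2 where "V_models_Sigma2 \<equiv> Defs.V_models_Sigma2 (\<epsilon>)"
abbreviation theory_categorical where "theory_categorical \<equiv> Defs.theory_categorical (\<epsilon>)"
abbreviation fresh where "fresh \<equiv> Defs.fresh (\<epsilon>)"
abbreviation fo_theory_categorical where "fo_theory_categorical \<equiv> Defs.fo_theory_categorical (\<epsilon>)"
abbreviation so_theory_categorical where "so_theory_categorical \<equiv> Defs.so_theory_categorical (\<epsilon>)"
abbreviation order_theory_categorical where "order_theory_categorical \<equiv> Defs.order_theory_categorical (\<epsilon>)"
abbreviation fo_fresh where "fo_fresh \<equiv> Defs.fo_fresh (\<epsilon>)"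
abbreviation so_fresh where "so_fresh \<equiv> Defs.so_fresh (\<epsilon>)"
abbreviation order_fresh where "order_fresh \<equiv> Defs.order_fresh (\<epsilon>)"
abbreviation absolutely_definable where "absolutely_definable \<equiv> Defs.absolutely_definable (\<epsilon>)"
abbreviation lightface_Sigma2_correct where "lightface_Sigma2_correct \<equiv> Defs.lightface_Sigma2_correct (\<epsilon>)"
abbreviation Sigma2_real_correct where "Sigma2_real_correct \<equiv> Defs.Sigma2_real_correct (\<epsilon>)"

lemma set_eqI: "(\<And>z. z \<epsilon> x \<longleftrightarrow> z \<epsilon> y) \<Longrightarrow> x = y"
  by (rule extensionality) blast

lemma mkset_unique: "(\<And>z. z \<epsilon> y \<longleftrightarrow> C z) \<Longrightarrow> mkset C = y"
  unfolding Defs.mkset_def by (rule the_equality) (auto intro: set_eqI)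

lemma mkset_iff: "\<exists>y. \<forall>z. z \<epsilon> y \<longleftrightarrow> C z \<Longrightarrow> z \<epsilon> mkset C \<longleftrightarrow> C z"
  using mkset_unique by metis

text \<open>If no set has the extension \<open>C\<close>, then \<open>mkset C\<close> is the fixed
  element \<open>THE x. False\<close>. Hence the graph of a function given by \<open>mkset\<close>
  is definable over the universe, with that element as a parameter, even before its values are known
  to exist.\<close>

lemma eq_mkset_iff:
  "y = mkset C \<longleftrightarrow> (\<forall>z. z \<epsilon> y \<longleftrightarrow> C z) \<or> \<not> (\<exists>x. \<forall>z. z \<epsilon> x \<longleftrightarrow> C z) \<and> y = (THE x. False)"
proof (cases "\<exists>x. \<forall>z. z \<epsilon> x \<longleftrightarrow> C z")
  case True
  then show ?thesis using mkset_iff[OF True] by (metis set_eqI)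
next
  case False
  then have "(\<lambda>x. \<forall>z. z \<epsilon> x \<longleftrightarrow> C z) = (\<lambda>_. False)" by (intro ext) blast
  from arg_cong[OF this, of The] have "mkset C = (THE x. False)" unfolding Defs.mkset_def .
  then show ?thesis using False by (simp only:) blast
qed

definition adj :: "'a \<Rightarrow> 'a \<Rightarrow> 'a" where
  "adj x y = mkset (\<lambda>z. z \<epsilon> x \<or> z = y)"

definition Uni :: "'a \<Rightarrow> 'a" where
  "Uni x = mkset (\<lambda>z. \<exists>y. y \<epsilon> x \<and> z \<epsilon> y)"

definition adj_closed :: "'a \<Rightarrow> bool" where
  "adj_closed H \<longleftrightarrow> emp \<epsilon> H \<and> (\<forall>x. x \<epsilon> H \<longrightarrow> (\<forall>y. y \<epsilon> H \<longrightarrow> adj x y \<epsilon> H))"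

text \<open>These are the hereditarily finite sets in the sense of the model. Generating them by the
  single operation x \<union> {y} gives the simple rule \<open>HF_induct\<close> and, later,
  explicit definitions of all their elements.\<close>

definition HF :: 'a where
  "HF = mkset (\<lambda>z. \<forall>H. adj_closed H \<longrightarrow> z \<epsilon> H)"

text \<open>Also called supertransitive. Every V_a with a > 0 is such a class, successor stages
  included, and in all of them quantifiers over the elements or the subsets of a given element keep
  their meaning.\<close>

definition swelled :: "('a \<Rightarrow> bool) \<Rightarrow> bool" where
  "swelled B \<longleftrightarrow> (\<forall>x y. B x \<and> y \<epsilon> x \<longrightarrow> B y) \<and> (\<forall>x y. B x \<and> subs y x \<longrightarrow> B y) \<and> (\<exists>x. B x)"

text \<open>What is needed to speak of functions and products. \<open>HF\<close> is included because
  all sets of syntactic objects are subsets of it, so good classes contain them.\<close>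

definition good :: "('a \<Rightarrow> bool) \<Rightarrow> bool" where
  "good B \<longleftrightarrow> swelled B \<and> (\<forall>x y. B x \<and> B y \<longrightarrow> B (upair x y)) \<and> (\<forall>x. B x \<longrightarrow> B (pow x)) \<and>
     (\<forall>x. B x \<longrightarrow> B (Uni x)) \<and> B HF"

definition kind_of :: "idx \<Rightarrow> ('a \<Rightarrow> bool) \<Rightarrow> bool" where
  "kind_of u B \<longleftrightarrow> (case u of iU \<Rightarrow> (\<forall>x. B x) | iG \<Rightarrow> good B | iT \<Rightarrow> swelled B)"

text \<open>Definability of \<open>P\<close> uniformly in all classes of a kind: the universe, where parameters are allowed;
  classes that are transitive and closed under subsets and the basic operations; and classes that are just
  transitive and closed under subsets.\<close>

definition D :: "idx \<Rightarrow> (('a \<Rightarrow> bool) \<Rightarrow> (nat \<Rightarrow> 'a) \<Rightarrow> bool) \<Rightarrow> bool" where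
  "D u P \<longleftrightarrow> (\<exists>p. (u = iU \<or> set_db p = {}) \<and>
     (\<forall>B e. kind_of u B \<longrightarrow> (\<forall>i. B (e i)) \<longrightarrow> P B e = dsat (\<epsilon>) B p e))"

text \<open>The value has to lie in the class as well: substitution of \<open>F\<close> into a
  predicate is expressed by a quantifier over the class, which must find the value.\<close>

definition fn :: "idx \<Rightarrow> (('a \<Rightarrow> bool) \<Rightarrow> (nat \<Rightarrow> 'a) \<Rightarrow> 'a) \<Rightarrow> bool" where
  "fn u F \<longleftrightarrow> (\<forall>B e. kind_of u B \<longrightarrow> (\<forall>i. B (e i)) \<longrightarrow> B (F B e)) \<and>
     D u (\<lambda>B e. e 0 = F B (\<lambda>i. e (Suc i)))"

lemma good_swelled: "good B \<Longrightarrow> swelled B"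
  by (simp only: good_def)

lemma good_UNIV: "\<forall>x. B x \<Longrightarrow> good B"
  by (simp add: good_def swelled_def)

lemma kind_of_U: "kind_of iU B \<Longrightarrow> B x"
  by (simp add: kind_of_def)

lemma kind_of_good: "kind_of u B \<Longrightarrow> u \<noteq> iT \<Longrightarrow> good B"
  by (cases u) (simp_all add: kind_of_def good_UNIV)

lemma kind_of_swelled: "kind_of u B \<Longrightarrow> swelled B"
  by (cases u) (simp_all add: kind_of_def good_UNIV good_swelled)

lemma swelled_mem: "swelled B \<Longrightarrow> B x \<Longrightarrow> y \<epsilon> x \<Longrightarrow> B y"
  unfolding swelled_def by blast

lemma swelled_subs: "swelled B \<Longrightarrow> B x \<Longrightarrow> subs y x \<Longrightarrow> B y"
  unfolding swelled_def by blast

text \<open>Agreement is asked only on classes of the given kind and on assignments into the class,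
  so a notion may be replaced by any restatement that is equivalent there.\<close>

lemma D_cong:
  "D u P \<Longrightarrow> (\<And>B e. kind_of u B \<Longrightarrow> \<forall>i. B (e i) \<Longrightarrow> Q B e \<longleftrightarrow> P B e) \<Longrightarrow> D u Q"
  unfolding D_def by metis

lemma D_ren: "D u P \<Longrightarrow> D u (\<lambda>B e. P B (\<lambda>i. e (f i)))"
  unfolding D_def
proof (elim exE conjE)
  fix p assume p: "u = iU \<or> set_db p = {}"
    and P: "\<forall>B e. kind_of u B \<longrightarrow> (\<forall>i. B (e i)) \<longrightarrow> P B e = dsat (\<epsilon>) B p e"
  show "\<exists>p. (u = iU \<or> set_db p = {}) \<and>
     (\<forall>B e. kind_of u B \<longrightarrow> (\<forall>i. B (e i)) \<longrightarrow> P B (\<lambda>i. e (f i)) = dsat (\<epsilon>) B p e)"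
    by (rule exI[of _ "dren f p"]) (use p P in \<open>simp add: dsat_dren\<close>)
qed

lemma D_var_mem: "D u (\<lambda>B e. e i \<epsilon> e j)"
  unfolding D_def by (rule exI[of _ "DMem (Var i) (Var j)"]) simp

lemma D_var_eq: "D u (\<lambda>B e. e i = e j)"
  unfolding D_def by (rule exI[of _ "DEq (Var i) (Var j)"]) simp

lemma D_con_eq: "D iU (\<lambda>B e. e i = c)"
  unfolding D_def by (rule exI[of _ "DEq (Var i) (Con c)"]) simp

lemma D_not [dintro]: "D u P \<Longrightarrow> D u (\<lambda>B e. \<not> P B e)"
  unfolding D_def
proof (elim exE conjE)
  fix p assume p: "u = iU \<or> set_db p = {}"
    and P: "\<forall>B e. kind_of u B \<longrightarrow> (\<forall>i. B (e i)) \<longrightarrow> P B e = dsat (\<epsilon>) B p e"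
  show "\<exists>p. (u = iU \<or> set_db p = {}) \<and>
     (\<forall>B e. kind_of u B \<longrightarrow> (\<forall>i. B (e i)) \<longrightarrow> (\<not> P B e) = dsat (\<epsilon>) B p e)"
    by (rule exI[of _ "DNeg p"]) (use p P in simp)
qed

lemma D_conj [dintro]: "D u P \<Longrightarrow> D u Q \<Longrightarrow> D u (\<lambda>B e. P B e \<and> Q B e)"
  unfolding D_def
proof (elim exE conjE)
  fix p q assume p: "u = iU \<or> set_db p = {}" "u = iU \<or> set_db q = {}"
    and P: "\<forall>B e. kind_of u B \<longrightarrow> (\<forall>i. B (e i)) \<longrightarrow> P B e = dsat (\<epsilon>) B p e"
    and Q: "\<forall>B e. kind_of u B \<longrightarrow> (\<forall>i. B (e i)) \<longrightarrow> Q B e = dsat (\<epsilon>) B q e"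
  show "\<exists>p. (u = iU \<or> set_db p = {}) \<and>
     (\<forall>B e. kind_of u B \<longrightarrow> (\<forall>i. B (e i)) \<longrightarrow> (P B e \<and> Q B e) = dsat (\<epsilon>) B p e)"
    by (rule exI[of _ "DAnd p q"]) (use p P Q in auto)
qed

text \<open>The premise has the assignment shifted by one, so that higher-order unification splits a
  goal at its outermost quantifier and turns the bound variable into \<open>e 0\<close>. The other
  quantifier rules follow this pattern.\<close>

lemma D_exB [dintro]:
  "D u (\<lambda>B e. P B (\<lambda>i. e (Suc i)) (e 0)) \<Longrightarrow> D u (\<lambda>B e. \<exists>x. B x \<and> P B e x)"
  unfolding D_def
proof (elim exE conjE)
  fix p assume p: "u = iU \<or> set_db p = {}"
    and P: "\<forall>B e. kind_of u B \<longrightarrow> (\<forall>i. B (e i)) \<longrightarrow> P B (\<lambda>i. e (Suc i)) (e 0) = dsat (\<epsilon>) B p e"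
  have *: "P B e x = dsat (\<epsilon>) B p (case_nat x e)" if "kind_of u B" "\<forall>i. B (e i)" "B x" for B e x
    using P[rule_format, OF that(1), of "case_nat x e"] that by (simp split: nat.split)
  show "\<exists>p. (u = iU \<or> set_db p = {}) \<and>
     (\<forall>B e. kind_of u B \<longrightarrow> (\<forall>i. B (e i)) \<longrightarrow> (\<exists>x. B x \<and> P B e x) = dsat (\<epsilon>) B p e)"
    by (rule exI[of _ "DEx p"]) (use p * in auto)
qed

lemma D_disj [dintro]: "D u P \<Longrightarrow> D u Q \<Longrightarrow> D u (\<lambda>B e. P B e \<or> Q B e)"
  by (rule D_cong[of u "\<lambda>B e. \<not> (\<not> P B e \<and> \<not> Q B e)"]) (intro dintro | assumption | simp)+

lemma D_imp [dintro]: "D u P \<Longrightarrow> D u Q \<Longrightarrow> D u (\<lambda>B e. P B e \<longrightarrow> Q B e)"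
  by (rule D_cong[of u "\<lambda>B e. \<not> (P B e \<and> \<not> Q B e)"]) (intro dintro | assumption | simp)+

lemma D_iff [dintro]: "D u P \<Longrightarrow> D u Q \<Longrightarrow> D u (\<lambda>B e. P B e \<longleftrightarrow> Q B e)"
  by (rule D_cong[of u "\<lambda>B e. (P B e \<longrightarrow> Q B e) \<and> (Q B e \<longrightarrow> P B e)"]) (intro dintro | assumption | blast)+

lemma D_True [dintro]: "D u (\<lambda>B e. True)"
  by (rule D_cong[OF D_var_eq[of u 0 0]]) simp

lemma D_False [dintro]: "D u (\<lambda>B e. False)"
  by (rule D_cong[OF D_not[OF D_True]]) simp

lemma D_bool [dintro]: "D u (\<lambda>B e. b)"
  by (cases b) (simp_all add: D_True D_False)

lemma D_allB [dintro]:
  "D u (\<lambda>B e. P B (\<lambda>i. e (Suc i)) (e 0)) \<Longrightarrow> D u (\<lambda>B e. \<forall>x. B x \<longrightarrow> P B e x)"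
  by (rule D_cong[of u "\<lambda>B e. \<not> (\<exists>x. B x \<and> \<not> P B e x)"]) (intro dintro | assumption | blast)+

lemma D_exU [dintro]: "D iU (\<lambda>B e. P B (\<lambda>i. e (Suc i)) (e 0)) \<Longrightarrow> D iU (\<lambda>B e. \<exists>x. P B e x)"
  by (rule D_cong[OF D_exB]) (assumption | use kind_of_U in blast)+

lemma D_allU [dintro]: "D iU (\<lambda>B e. P B (\<lambda>i. e (Suc i)) (e 0)) \<Longrightarrow> D iU (\<lambda>B e. \<forall>x. P B e x)"
  by (rule D_cong[OF D_allB]) (assumption | use kind_of_U in blast)+

lemma fn_D: "fn u F \<Longrightarrow> D u (\<lambda>B e. e 0 = F B (\<lambda>i. e (Suc i)))"
  unfolding fn_def by blast

lemma fn_B: "fn u F \<Longrightarrow> kind_of u B \<Longrightarrow> \<forall>i. B (e i) \<Longrightarrow> B (F B e)"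
  unfolding fn_def by blast

lemma fnI: "(\<And>B e. kind_of u B \<Longrightarrow> \<forall>i. B (e i) \<Longrightarrow> B (F B e)) \<Longrightarrow>
    D u (\<lambda>B e. e 0 = F B (\<lambda>i. e (Suc i))) \<Longrightarrow> fn u F"
  unfolding fn_def by blast

lemma fn_var [dintro]: "fn u (\<lambda>B e. e i)"
  by (rule fnI) (auto intro: D_var_eq)

lemma fn_con [dintro]: "fn iU (\<lambda>B e. c)"
  by (rule fnI) (auto simp: kind_of_def intro: D_con_eq)

lemma fn_weaken:
  fixes f :: "nat \<Rightarrow> nat"
  assumes "fn u F" shows "fn u (\<lambda>B e. F B (\<lambda>i. e (f i)))"
proof (rule fnI)
  show "D u (\<lambda>B e. e 0 = F B (\<lambda>i. e (Suc (f i))))"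
    using D_ren[OF fn_D[OF assms], of "case_nat 0 (\<lambda>i. Suc (f i))"] by simp
  fix B and e :: "nat \<Rightarrow> 'a" assume "kind_of u B" "\<forall>i. B (e i)"
  then show "B (F B (\<lambda>i. e (f i)))"
    using fn_B[OF assms, of B "\<lambda>i. e (f i)"] by simp
qed

text \<open>A term is eliminated by a quantifier over its value, so that only graphs of functions,
  and no terms, occur in the underlying formula.\<close>

lemma D_subst:
  assumes P: "D u (\<lambda>B e. P B (\<lambda>i. e (Suc i)) (e 0))" and F: "fn u F"
  shows "D u (\<lambda>B e. P B e (F B e))"
proof (rule D_cong)
  show "D u (\<lambda>B e. \<exists>x. B x \<and> (x = F B e \<and> P B e x))"
    by (intro dintro P fn_D[OF F])
qed (use fn_B[OF F] in auto)

lemma D_comp1: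
  assumes R: "D u (\<lambda>B e. R B (e 0))" and F: "fn u F"
  shows "D u (\<lambda>B e. R B (F B e))"
  by (rule D_subst[OF _ F]) (rule R)

lemma D_comp2:
  assumes R: "D u (\<lambda>B e. R B (e 0) (e (Suc 0)))" and F: "fn u F" and G: "fn u G"
  shows "D u (\<lambda>B e. R B (F B e) (G B e))"
proof (rule D_subst[OF _ F])
  show "D u (\<lambda>B e. R B (e 0) (G B (\<lambda>i. e (Suc i))))"
  proof (rule D_subst[OF _ fn_weaken[OF G]])
    \<comment> \<open>The nested substitutions bind the arguments in reverse order; truncated
      subtraction reverses the indices.\<close>
    show "D u (\<lambda>B e. R B (e (Suc 0)) (e 0))"
      using D_ren[OF R, of "\<lambda>i. Suc 0 - i"] by simp
  qed
qed

lemma D_comp3: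
  assumes R: "D u (\<lambda>B e. R B (e 0) (e (Suc 0)) (e (Suc (Suc 0))))"
    and F: "fn u F" and G: "fn u G" and H: "fn u H"
  shows "D u (\<lambda>B e. R B (F B e) (G B e) (H B e))"
proof (rule D_subst[OF _ F])
  show "D u (\<lambda>B e. R B (e 0) (G B (\<lambda>i. e (Suc i))) (H B (\<lambda>i. e (Suc i))))"
  proof (rule D_subst[OF _ fn_weaken[OF G]])
    show "D u (\<lambda>B e. R B (e (Suc 0)) (e 0) (H B (\<lambda>i. e (Suc (Suc i)))))"
    proof (rule D_subst[OF _ fn_weaken[OF H]])
      show "D u (\<lambda>B e. R B (e (Suc (Suc 0))) (e (Suc 0)) (e 0))"
        using D_ren[OF R, of "\<lambda>i. Suc (Suc 0) - i"] by simp
    qed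
  qed
qed

lemma D_comp4:
  assumes R: "D u (\<lambda>B e. R B (e 0) (e (Suc 0)) (e (Suc (Suc 0))) (e (Suc (Suc (Suc 0)))))"
    and F: "fn u F" and G: "fn u G" and H: "fn u H" and K: "fn u K"
  shows "D u (\<lambda>B e. R B (F B e) (G B e) (H B e) (K B e))"
proof (rule D_subst[OF _ F])
  show "D u (\<lambda>B e. R B (e 0) (G B (\<lambda>i. e (Suc i))) (H B (\<lambda>i. e (Suc i))) (K B (\<lambda>i. e (Suc i))))"
  proof (rule D_subst[OF _ fn_weaken[OF G]])
    show "D u (\<lambda>B e. R B (e (Suc 0)) (e 0) (H B (\<lambda>i. e (Suc (Suc i)))) (K B (\<lambda>i. e (Suc (Suc i)))))"
    proof (rule D_subst[OF _ fn_weaken[OF H]])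
      show "D u (\<lambda>B e. R B (e (Suc (Suc 0))) (e (Suc 0)) (e 0) (K B (\<lambda>i. e (Suc (Suc (Suc i))))))"
      proof (rule D_subst[OF _ fn_weaken[OF K]])
        show "D u (\<lambda>B e. R B (e (Suc (Suc (Suc 0)))) (e (Suc (Suc 0))) (e (Suc 0)) (e 0))"
          using D_ren[OF R, of "\<lambda>i. Suc (Suc (Suc 0)) - i"] by (simp add: numeral_eq_Suc)
      qed
    qed
  qed
qed

lemma fn_comp1:
  assumes k: "fn u (\<lambda>B e. k (e 0))" and F: "fn u F" shows "fn u (\<lambda>B e. k (F B e))"
proof (rule fnI)
  show "D u (\<lambda>B e. e 0 = k (F B (\<lambda>i. e (Suc i))))"
    by (rule D_comp2[where R = "\<lambda>B x y. x = k y", OF _ fn_var fn_weaken[OF F]])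
      (use fn_D[OF k] in simp)
  fix B and e :: "nat \<Rightarrow> 'a" assume "kind_of u B" "\<forall>i. B (e i)"
  then show "B (k (F B e))"
    using fn_B[OF k, of B "\<lambda>_. F B e"] fn_B[OF F, of B e] by simp
qed

lemma fn_comp2:
  assumes k: "fn u (\<lambda>B e. k (e 0) (e (Suc 0)))" and F: "fn u F" and G: "fn u G"
  shows "fn u (\<lambda>B e. k (F B e) (G B e))"
proof (rule fnI)
  show "D u (\<lambda>B e. e 0 = k (F B (\<lambda>i. e (Suc i))) (G B (\<lambda>i. e (Suc i))))"
    by (rule D_comp3[where R = "\<lambda>B x y z. x = k y z", OF _ fn_var fn_weaken[OF F] fn_weaken[OF G]])
      (use fn_D[OF k] in simp)
  fix B and e :: "nat \<Rightarrow> 'a" assume "kind_of u B" "\<forall>i. B (e i)"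
  then show "B (k (F B e) (G B e))"
    using fn_B[OF k, of B "case_nat (F B e) (\<lambda>_. G B e)"] fn_B[OF F, of B e] fn_B[OF G, of B e]
    by (simp split: nat.split)
qed

lemma fn_comp3:
  assumes k: "fn u (\<lambda>B e. k (e 0) (e (Suc 0)) (e (Suc (Suc 0))))"
    and F: "fn u F" and G: "fn u G" and H: "fn u H"
  shows "fn u (\<lambda>B e. k (F B e) (G B e) (H B e))"
proof (rule fnI)
  show "D u (\<lambda>B e. e 0 = k (F B (\<lambda>i. e (Suc i))) (G B (\<lambda>i. e (Suc i))) (H B (\<lambda>i. e (Suc i))))"
    by (rule D_comp4[where R = "\<lambda>B x y z w. x = k y z w", OF _ fn_var fn_weaken[OF F] fn_weaken[OF G] fn_weaken[OF H]])
      (use fn_D[OF k] in simp)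
  fix B and e :: "nat \<Rightarrow> 'a" assume "kind_of u B" "\<forall>i. B (e i)"
  then show "B (k (F B e) (G B e) (H B e))"
    using fn_B[OF k, of B "case_nat (F B e) (case_nat (G B e) (\<lambda>_. H B e))"]
      fn_B[OF F, of B e] fn_B[OF G, of B e] fn_B[OF H, of B e]
    by (simp split: nat.split)
qed

lemma D_mem [dintro]: "fn u F \<Longrightarrow> fn u G \<Longrightarrow> D u (\<lambda>B e. F B e \<epsilon> G B e)"
  by (rule D_comp2[where R = "\<lambda>B x y. x \<epsilon> y", OF D_var_mem])

lemma D_eq [dintro]: "fn u F \<Longrightarrow> fn u G \<Longrightarrow> D u (\<lambda>B e. F B e = G B e)"
  by (rule D_comp2[where R = "\<lambda>B x y. x = y", OF D_var_eq])

lemma D_bex [dintro]: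
  assumes F: "fn u F" and P: "D u (\<lambda>B e. P B (\<lambda>i. e (Suc i)) (e 0))"
  shows "D u (\<lambda>B e. \<exists>x. x \<epsilon> F B e \<and> P B e x)"
proof (rule D_cong)
  show "D u (\<lambda>B e. \<exists>x. B x \<and> (x \<epsilon> F B e \<and> P B e x))"
    by (intro dintro P fn_weaken[OF F])
qed (use fn_B[OF F] swelled_mem kind_of_swelled in blast)

lemma D_ball [dintro]:
  assumes F: "fn u F" and P: "D u (\<lambda>B e. P B (\<lambda>i. e (Suc i)) (e 0))"
  shows "D u (\<lambda>B e. \<forall>x. x \<epsilon> F B e \<longrightarrow> P B e x)"
  by (rule D_cong[of u "\<lambda>B e. \<not> (\<exists>x. x \<epsilon> F B e \<and> \<not> P B e x)"]) (intro dintro P F | blast)+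

lemma D_subs [dintro]:
  assumes F: "fn u F" and G: "fn u G" shows "D u (\<lambda>B e. subs (F B e) (G B e))"
  unfolding Defs.subs_def by (intro dintro fn_weaken[OF G] F)

text \<open>Here closure under subsets enters: a subset of an element of the class is in the class.
  Quantifiers over functions, over second-order objects and over satisfaction relations are later
  bounded in this way.\<close>

lemma D_bexS [dintro]:
  assumes F: "fn u F" and P: "D u (\<lambda>B e. P B (\<lambda>i. e (Suc i)) (e 0))"
  shows "D u (\<lambda>B e. \<exists>x. subs x (F B e) \<and> P B e x)"
proof (rule D_cong)
  show "D u (\<lambda>B e. \<exists>x. B x \<and> (subs x (F B e) \<and> P B e x))"
    by (intro dintro P fn_weaken[OF F])
qed (use fn_B[OF F] swelled_subs kind_of_swelled in blast)

lemma D_ballS [dintro]: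
  assumes F: "fn u F" and P: "D u (\<lambda>B e. P B (\<lambda>i. e (Suc i)) (e 0))"
  shows "D u (\<lambda>B e. \<forall>x. subs x (F B e) \<longrightarrow> P B e x)"
  by (rule D_cong[of u "\<lambda>B e. \<not> (\<exists>x. subs x (F B e) \<and> \<not> P B e x)"]) (intro dintro P F | blast)+

text \<open>The set must exist in the class itself; by transitivity its extension can then be tested
  with elements of the class alone.\<close>

lemma fn_mkset:
  assumes C: "D u (\<lambda>B e. C B (\<lambda>i. e (Suc i)) (e 0))"
    and ex: "\<And>B e. kind_of u B \<Longrightarrow> \<forall>i. B (e i) \<Longrightarrow> \<exists>y. B y \<and> (\<forall>z. z \<epsilon> y \<longleftrightarrow> C B e z)"
  shows "fn u (\<lambda>B e. mkset (C B e))"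
proof (rule fnI)
  show "B (mkset (C B e))" if "kind_of u B" "\<forall>i. B (e i)" for B e
    using ex[OF that] mkset_unique by metis
  have "D u (\<lambda>B e. C B (\<lambda>i. e (Suc (Suc i))) (e 0))"
    using D_ren[OF C, of "case_nat 0 (\<lambda>i. Suc (Suc i))"] by simp
  then have "D u (\<lambda>B e. \<forall>z. B z \<longrightarrow> (z \<epsilon> e 0 \<longleftrightarrow> C B (\<lambda>i. e (Suc i)) z))"
    by (intro dintro)
  then show "D u (\<lambda>B e. e 0 = mkset (C B (\<lambda>i. e (Suc i))))"
  proof (rule D_cong)
    fix B and e :: "nat \<Rightarrow> 'a" assume Be: "kind_of u B" "\<forall>i. B (e i)"
    obtain y where y: "B y" "\<forall>z. z \<epsilon> y \<longleftrightarrow> C B (\<lambda>i. e (Suc i)) z"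
      using ex[of B "\<lambda>i. e (Suc i)"] Be by auto
    have "mkset (C B (\<lambda>i. e (Suc i))) = y" using y(2) by (intro mkset_unique) simp
    moreover have "e 0 = y \<longleftrightarrow> (\<forall>z. B z \<longrightarrow> (z \<epsilon> e 0 \<longleftrightarrow> z \<epsilon> y))"
      using swelled_mem[OF kind_of_swelled[OF Be(1)]] y(1) Be(2) set_eqI by metis
    ultimately show "e 0 = mkset (C B (\<lambda>i. e (Suc i))) \<longleftrightarrow> (\<forall>z. B z \<longrightarrow> (z \<epsilon> e 0 \<longleftrightarrow> C B (\<lambda>i. e (Suc i)) z))"
      using y(2) by simp
  qed
qed

text \<open>Unlike in \<open>fn_mkset\<close> there is no condition of existence, since over the
  universe the default value of \<open>mkset\<close> is definable too.\<close>

lemma fn_mksetU [dintro]: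
  assumes C: "D iU (\<lambda>B e. C B (\<lambda>i. e (Suc i)) (e 0))"
  shows "fn iU (\<lambda>B e. mkset (C B e))"
proof (rule fnI)
  have [dintro]: "D iU (\<lambda>B e. C B (\<lambda>i. e (Suc (Suc i))) (e 0))"
    using D_ren[OF C, of "case_nat 0 (\<lambda>i. Suc (Suc i))"] by simp
  have [dintro]: "D iU (\<lambda>B e. C B (\<lambda>i. e (Suc (Suc (Suc i)))) (e 0))"
    using D_ren[OF C, of "case_nat 0 (\<lambda>i. Suc (Suc (Suc i)))"] by simp
  show "D iU (\<lambda>B e. e 0 = mkset (C B (\<lambda>i. e (Suc i))))"
    unfolding eq_mkset_iff by (intro dintro)
qed (simp add: kind_of_def)

lemma D_U: "D iU P \<Longrightarrow> \<exists>p. \<forall>e. P (\<lambda>_. True) e = dsat (\<epsilon>) (\<lambda>_. True) p e"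
proof -
  assume "D iU P"
  then obtain p where p: "\<And>B e. kind_of iU B \<Longrightarrow> \<forall>i. B (e i) \<Longrightarrow> P B e = dsat (\<epsilon>) B p e"
    unfolding D_def by blast
  have "kind_of iU (\<lambda>_. True)" by (simp add: kind_of_def)
  then show ?thesis using p by blast
qed

lemma sep_ex:
  assumes "D iU (\<lambda>B e. P (e 0))"
  shows "\<exists>y. \<forall>z. z \<epsilon> y \<longleftrightarrow> z \<epsilon> x \<and> P z"
proof -
  obtain p where p: "\<And>e. P (e 0) = dsat (\<epsilon>) (\<lambda>_. True) p e"
    using D_U[OF assms] by blast
  obtain q e0 where q: "\<And>x y. holds (\<epsilon>) q (e0(0 := x, 1 := y)) = dsat (\<epsilon>) (\<lambda>_. True) p (\<lambda>i. if i = 0 then x else y)"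
    by (rule holds_of_dsat) blast
  have "P z = holds (\<epsilon>) q ((e0(1 := x))(0 := z))" for z
    using p[of "\<lambda>i. if i = 0 then z else x"] q[of z x] by (simp add: fun_upd_twist)
  then show ?thesis using separation[of x q "e0(1 := x)"] by simp
qed

lemma sep: "D iU (\<lambda>B e. P (e 0)) \<Longrightarrow> (\<And>z. P z \<Longrightarrow> z \<epsilon> x) \<Longrightarrow> z \<epsilon> mkset P \<longleftrightarrow> P z"
  using sep_ex[of P x] by (intro mkset_iff) blast

lemma repl_ex:
  assumes R: "D iU (\<lambda>B e. R (e 0) (e (Suc 0)))" and ex: "\<And>x. x \<epsilon> A \<Longrightarrow> \<exists>!y. R x y"
  shows "\<exists>Y. \<forall>y. y \<epsilon> Y \<longleftrightarrow> (\<exists>x. x \<epsilon> A \<and> R x y)"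
proof -
  obtain p where p: "\<And>e. R (e 0) (e (Suc 0)) = dsat (\<epsilon>) (\<lambda>_. True) p e"
    using D_U[OF R] by blast
  obtain q e0 where q: "\<And>x y. holds (\<epsilon>) q (e0(0 := x, 1 := y)) = dsat (\<epsilon>) (\<lambda>_. True) p (\<lambda>i. if i = 0 then x else y)"
    by (rule holds_of_dsat) blast
  have *: "R x y = holds (\<epsilon>) q (e0(0 := x, 1 := y))" for x y
    using p[of "\<lambda>i. if i = 0 then x else y"] q[of x y] by simp
  have "\<exists>Y. \<forall>x. x \<epsilon> A \<longrightarrow> (\<exists>y. y \<epsilon> Y \<and> R x y)"
    using replacement[of A q e0] ex unfolding * by blast
  then obtain Y where Y: "\<And>x. x \<epsilon> A \<Longrightarrow> \<exists>y. y \<epsilon> Y \<and> R x y" by blast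
  \<comment> \<open>The axiom only yields a set that contains all values; separation cuts it down to
    the image.\<close>
  have "D iU (\<lambda>B e. \<exists>x. x \<epsilon> A \<and> R x (e 0))"
    by (intro dintro) (rule R)
  from sep_ex[where P = "\<lambda>y. \<exists>x. x \<epsilon> A \<and> R x y", OF this, of Y]
  obtain Z where Z: "\<forall>z. z \<epsilon> Z \<longleftrightarrow> z \<epsilon> Y \<and> (\<exists>x. x \<epsilon> A \<and> R x z)" ..
  have "z \<epsilon> Z \<longleftrightarrow> (\<exists>x. x \<epsilon> A \<and> R x z)" for z
    using Z Y ex by metis
  then show ?thesis by blast
qed

lemma repl:
  assumes "fn iU (\<lambda>B e. F (e 0))"
  shows "y \<epsilon> mkset (\<lambda>y. \<exists>x. x \<epsilon> A \<and> y = F x) \<longleftrightarrow> (\<exists>x. x \<epsilon> A \<and> y = F x)"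
proof (rule mkset_iff)
  have "D iU (\<lambda>B e. e (Suc 0) = F (e 0))"
    using D_comp2[where R = "\<lambda>B x y. x = F y", OF _ fn_var[of _ "Suc 0"] fn_var[of _ 0]] fn_D[OF assms] by simp
  then show "\<exists>Y. \<forall>y. y \<epsilon> Y \<longleftrightarrow> (\<exists>x. x \<epsilon> A \<and> y = F x)"
    by (rule repl_ex[where R = "\<lambda>x y. y = F x"]) blast
qed

subsection \<open>Sets, functions and ordinals\<close>

lemma neq_iT [dintro, simp]: "iU \<noteq> iT" "iG \<noteq> iT"
  by simp_all

lemma emp_iff [simp]: "\<not> z \<epsilon> emp"
proof -
  have "D iU (\<lambda>B e. False)" by (intro dintro)
  from sep_ex[where P = "\<lambda>_. False", OF this] have "\<exists>y. \<forall>z. z \<epsilon> y \<longleftrightarrow> False" by blast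
  from mkset_iff[OF this] show ?thesis unfolding Defs.emp_def by blast
qed

lemma upair_iff [simp]: "z \<epsilon> upair x y \<longleftrightarrow> z = x \<or> z = y"
  unfolding Defs.upair_def
proof -
  obtain w where "x \<epsilon> w \<and> y \<epsilon> w" using pairing by blast
  moreover have "D iU (\<lambda>B e. e 0 = x \<or> e 0 = y)" by (intro dintro)
  ultimately show "z \<epsilon> mkset (\<lambda>z. z = x \<or> z = y) \<longleftrightarrow> z = x \<or> z = y"
    by (intro sep[where P = "\<lambda>z. z = x \<or> z = y" and x = w]) auto
qed

lemma Uni_iff [simp]: "z \<epsilon> Uni x \<longleftrightarrow> (\<exists>y. y \<epsilon> x \<and> z \<epsilon> y)"
  unfolding Uni_def
proof -
  obtain w where "\<forall>y z. z \<epsilon> y \<and> y \<epsilon> x \<longrightarrow> z \<epsilon> w" using union by blast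
  moreover have "D iU (\<lambda>B e. \<exists>y. y \<epsilon> x \<and> e 0 \<epsilon> y)" by (intro dintro)
  ultimately show "z \<epsilon> mkset (\<lambda>z. \<exists>y. y \<epsilon> x \<and> z \<epsilon> y) \<longleftrightarrow> (\<exists>y. y \<epsilon> x \<and> z \<epsilon> y)"
    by (intro sep[where P = "\<lambda>z. \<exists>y. y \<epsilon> x \<and> z \<epsilon> y" and x = w]) blast+
qed

lemma pow_iff [simp]: "z \<epsilon> pow x \<longleftrightarrow> subs z x"
  unfolding Defs.pow_def
proof -
  obtain w where "\<forall>y. (\<forall>z. z \<epsilon> y \<longrightarrow> z \<epsilon> x) \<longrightarrow> y \<epsilon> w" using power by blast
  moreover have "D iU (\<lambda>B e. subs (e 0) x)" by (intro dintro)
  ultimately show "z \<epsilon> mkset (\<lambda>z. subs z x) \<longleftrightarrow> subs z x"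
    by (intro sep[where P = "\<lambda>z. subs z x" and x = w]) (auto simp: Defs.subs_def)
qed

lemma adj_eq: "adj x y = Uni (upair x (upair y y))"
  unfolding adj_def by (rule mkset_unique) auto

lemma adj_iff [simp]: "z \<epsilon> adj x y \<longleftrightarrow> z \<epsilon> x \<or> z = y"
  unfolding adj_eq by auto

lemma suc_adj: "suc x = adj x x"
  unfolding Defs.suc_def adj_def ..

lemma suc_iff [simp]: "z \<epsilon> suc x \<longleftrightarrow> z \<epsilon> x \<or> z = x"
  unfolding suc_adj by simp

lemma subsI: "(\<And>z. z \<epsilon> x \<Longrightarrow> z \<epsilon> y) \<Longrightarrow> subs x y"
  unfolding Defs.subs_def by blast

lemma subsD: "subs x y \<Longrightarrow> z \<epsilon> x \<Longrightarrow> z \<epsilon> y"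
  unfolding Defs.subs_def by blast

lemma subs_refl [simp]: "subs x x"
  by (rule subsI)

lemma subs_trans: "subs x y \<Longrightarrow> subs y z \<Longrightarrow> subs x z"
  unfolding Defs.subs_def by blast

lemma subs_antisym: "subs x y \<Longrightarrow> subs y x \<Longrightarrow> x = y"
  by (rule set_eqI) (blast dest: subsD)

lemma upair_eq: "upair x y = upair u v \<longleftrightarrow> x = u \<and> y = v \<or> x = v \<and> y = u"
proof
  assume "upair x y = upair u v"
  then have "z = x \<or> z = y \<longleftrightarrow> z = u \<or> z = v" for z using upair_iff by metis
  then show "x = u \<and> y = v \<or> x = v \<and> y = u" by metis
qed (auto intro: set_eqI)

lemma opair_eq [simp]: "opair x y = opair u v \<longleftrightarrow> x = u \<and> y = v"
  unfolding Defs.opair_def upair_eq by auto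

lemma good_upair: "good B \<Longrightarrow> B x \<Longrightarrow> B y \<Longrightarrow> B (upair x y)"
  and good_pow: "good B \<Longrightarrow> B x \<Longrightarrow> B (pow x)"
  and good_Uni: "good B \<Longrightarrow> B x \<Longrightarrow> B (Uni x)"
  and good_HF: "good B \<Longrightarrow> B HF"
  unfolding good_def by blast+

lemma good_subs: "good B \<Longrightarrow> B x \<Longrightarrow> subs y x \<Longrightarrow> B y"
  by (rule swelled_subs[of B, OF good_swelled])

lemma good_opair: "good B \<Longrightarrow> B x \<Longrightarrow> B y \<Longrightarrow> B (opair x y)"
  unfolding Defs.opair_def by (intro good_upair[of B])

lemma good_emp: "good B \<Longrightarrow> B emp"
  using good_subs[of B HF emp] good_HF[of B] subsI[of emp HF] by simp

lemma good_adj: "good B \<Longrightarrow> B x \<Longrightarrow> B y \<Longrightarrow> B (adj x y)"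
  unfolding adj_eq by (intro good_upair[of B] good_Uni[of B])

lemma good_suc: "good B \<Longrightarrow> B x \<Longrightarrow> B (suc x)"
  unfolding suc_adj by (intro good_adj[of B])

text \<open>For operations under which every good class is closed, extensionality defines the graph.
  The following variants differ only in the number of arguments.\<close>

lemma fn_mkset0:
  assumes u: "u \<noteq> iT" and d: "k = mkset C" and D: "D u (\<lambda>B e. C (e 0))"
    and k: "\<And>B. good B \<Longrightarrow> B k" and ext: "\<And>z. z \<epsilon> k \<longleftrightarrow> C z"
  shows "fn u (\<lambda>B e. k)"
  unfolding d
  by (rule fn_mkset, rule D) (use ext k[OF kind_of_good[OF _ u]] in auto)

lemma fn_mkset1:
  assumes u: "u \<noteq> iT" and d: "\<And>x. k x = mkset (C x)" and D: "D u (\<lambda>B e. C (e (Suc 0)) (e 0))"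
    and k: "\<And>B x. good B \<Longrightarrow> B x \<Longrightarrow> B (k x)" and ext: "\<And>x z. z \<epsilon> k x \<longleftrightarrow> C x z"
  shows "fn u (\<lambda>B e. k (e 0))"
  unfolding d
proof (rule fn_mkset, rule D)
  fix B and e :: "nat \<Rightarrow> 'a" assume "kind_of u B" "\<forall>i. B (e i)"
  then have "B (k (e 0))" using k kind_of_good u by blast
  then show "\<exists>y. B y \<and> (\<forall>z. z \<epsilon> y \<longleftrightarrow> C (e 0) z)" using ext by blast
qed

lemma fn_mkset2:
  assumes u: "u \<noteq> iT" and d: "\<And>x y. k x y = mkset (C x y)" and D: "D u (\<lambda>B e. C (e (Suc 0)) (e (Suc (Suc 0))) (e 0))"
    and k: "\<And>B x y. good B \<Longrightarrow> B x \<Longrightarrow> B y \<Longrightarrow> B (k x y)" and ext: "\<And>x y z. z \<epsilon> k x y \<longleftrightarrow> C x y z"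
  shows "fn u (\<lambda>B e. k (e 0) (e (Suc 0)))"
  unfolding d
proof (rule fn_mkset, rule D)
  fix B and e :: "nat \<Rightarrow> 'a" assume "kind_of u B" "\<forall>i. B (e i)"
  then have "B (k (e 0) (e (Suc 0)))" using k kind_of_good u by blast
  then show "\<exists>y. B y \<and> (\<forall>z. z \<epsilon> y \<longleftrightarrow> C (e 0) (e (Suc 0)) z)" using ext by blast
qed

lemma fn_mkset3:
  assumes u: "u \<noteq> iT" and d: "\<And>x y w. k x y w = mkset (C x y w)" and D: "D u (\<lambda>B e. C (e (Suc 0)) (e (Suc (Suc 0))) (e (Suc (Suc (Suc 0)))) (e 0))"
    and k: "\<And>B x y w. good B \<Longrightarrow> B x \<Longrightarrow> B y \<Longrightarrow> B w \<Longrightarrow> B (k x y w)"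
    and ext: "\<And>x y w z. z \<epsilon> k x y w \<longleftrightarrow> C x y w z"
  shows "fn u (\<lambda>B e. k (e 0) (e (Suc 0)) (e (Suc (Suc 0))))"
  unfolding d
proof (rule fn_mkset, rule D)
  fix B and e :: "nat \<Rightarrow> 'a" assume "kind_of u B" "\<forall>i. B (e i)"
  then have "B (k (e 0) (e (Suc 0)) (e (Suc (Suc 0))))" using k kind_of_good u by blast
  then show "\<exists>y. B y \<and> (\<forall>z. z \<epsilon> y \<longleftrightarrow> C (e 0) (e (Suc 0)) (e (Suc (Suc 0))) z)" using ext by blast
qed

lemma fn_upair [dintro]:
  assumes "u \<noteq> iT" "fn u F" "fn u G" shows "fn u (\<lambda>B e. upair (F B e) (G B e))"
proof (rule fn_comp2[OF _ assms(2,3)])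
  show "fn u (\<lambda>B e. upair (e 0) (e (Suc 0)))"
    by (rule fn_mkset2[OF assms(1) Defs.upair_def], intro dintro, erule (2) good_upair, rule upair_iff)
qed

lemma fn_emp [dintro]: "u \<noteq> iT \<Longrightarrow> fn u (\<lambda>B e. emp)"
  by (rule fn_mkset0[OF _ Defs.emp_def], assumption, intro dintro, erule good_emp, simp)

lemma fn_pow [dintro]:
  assumes "u \<noteq> iT" "fn u F" shows "fn u (\<lambda>B e. pow (F B e))"
proof (rule fn_comp1[OF _ assms(2)])
  show "fn u (\<lambda>B e. pow (e 0))"
    by (rule fn_mkset1[OF assms(1) Defs.pow_def], intro dintro, erule (1) good_pow, rule pow_iff)
qed

lemma fn_Uni [dintro]:
  assumes "u \<noteq> iT" "fn u F" shows "fn u (\<lambda>B e. Uni (F B e))"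
proof (rule fn_comp1[OF _ assms(2)])
  show "fn u (\<lambda>B e. Uni (e 0))"
    by (rule fn_mkset1[OF assms(1) Uni_def], intro dintro, erule (1) good_Uni, rule Uni_iff)
qed

lemma fn_opair [dintro]:
  "u \<noteq> iT \<Longrightarrow> fn u F \<Longrightarrow> fn u G \<Longrightarrow> fn u (\<lambda>B e. opair (F B e) (G B e))"
  unfolding Defs.opair_def by (intro fn_upair)

lemma fn_adj [dintro]:
  "u \<noteq> iT \<Longrightarrow> fn u F \<Longrightarrow> fn u G \<Longrightarrow> fn u (\<lambda>B e. adj (F B e) (G B e))"
  unfolding adj_eq by (intro dintro)

lemma fn_suc [dintro]: "u \<noteq> iT \<Longrightarrow> fn u F \<Longrightarrow> fn u (\<lambda>B e. suc (F B e))"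
  unfolding suc_adj by (intro dintro)

lemma fn_if [dintro]:
  assumes P: "D u P" and F: "fn u F" and G: "fn u G"
  shows "fn u (\<lambda>B e. if P B e then F B e else G B e)"
proof (rule fnI)
  have P': "D u (\<lambda>B e. P B (\<lambda>i. e (Suc i)))" by (rule D_ren[OF P])
  show "D u (\<lambda>B e. e 0 = (if P B (\<lambda>i. e (Suc i)) then F B (\<lambda>i. e (Suc i)) else G B (\<lambda>i. e (Suc i))))"
    by (rule D_cong[of u "\<lambda>B e. P B (\<lambda>i. e (Suc i)) \<and> e 0 = F B (\<lambda>i. e (Suc i)) \<or>
        \<not> P B (\<lambda>i. e (Suc i)) \<and> e 0 = G B (\<lambda>i. e (Suc i))"])
      (intro dintro P' fn_weaken[OF F] fn_weaken[OF G], simp)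
  fix B and e :: "nat \<Rightarrow> 'a" assume "kind_of u B" "\<forall>i. B (e i)"
  then show "B (if P B e then F B e else G B e)"
    using fn_B[OF F, of B e] fn_B[OF G, of B e] by simp
qed

lemma no_self: "\<not> x \<epsilon> x"
  using foundation[of x "upair x x"] by auto

lemma no_cycle2: "x \<epsilon> y \<Longrightarrow> \<not> y \<epsilon> x"
  using foundation[of x "upair x y"] by auto

lemma minimal:
  assumes "D iU (\<lambda>B e. P (e 0))" "x \<epsilon> A" "P x"
  obtains m where "m \<epsilon> A" "P m" "\<And>z. z \<epsilon> A \<Longrightarrow> P z \<Longrightarrow> \<not> z \<epsilon> m"
proof -
  obtain S where S: "\<And>z. z \<epsilon> S \<longleftrightarrow> z \<epsilon> A \<and> P z" using sep_ex[OF assms(1)] by blast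
  have "x \<epsilon> S" using S assms by blast
  from foundation[OF this] show ?thesis using that S by blast
qed

lemma transD: "transitive x \<Longrightarrow> y \<epsilon> x \<Longrightarrow> z \<epsilon> y \<Longrightarrow> z \<epsilon> x"
  unfolding Defs.transitive_def Defs.subs_def by blast

lemma transI: "(\<And>y z. y \<epsilon> x \<Longrightarrow> z \<epsilon> y \<Longrightarrow> z \<epsilon> x) \<Longrightarrow> transitive x"
  unfolding Defs.transitive_def Defs.subs_def by blast

lemma D_transitive [dintro]:
  assumes F: "fn u F" shows "D u (\<lambda>B e. transitive (F B e))"
  unfolding Defs.transitive_def by (intro dintro fn_weaken[OF F] F)

lemma D_Ord [dintro]:
  assumes F: "fn u F" shows "D u (\<lambda>B e. Ord (F B e))"
  unfolding Defs.Ord_def by (intro dintro F)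

lemma Ord_trans: "Ord a \<Longrightarrow> b \<epsilon> a \<Longrightarrow> c \<epsilon> b \<Longrightarrow> c \<epsilon> a"
  unfolding Defs.Ord_def using transD by blast

lemma Ord_mem: "Ord a \<Longrightarrow> b \<epsilon> a \<Longrightarrow> Ord b"
  unfolding Defs.Ord_def using transD by blast

lemma Ord_subs: "Ord a \<Longrightarrow> b \<epsilon> a \<Longrightarrow> subs b a"
  unfolding Defs.Ord_def Defs.transitive_def by blast

lemma OrdI: "(\<And>b c. b \<epsilon> a \<Longrightarrow> c \<epsilon> b \<Longrightarrow> c \<epsilon> a) \<Longrightarrow> (\<And>b. b \<epsilon> a \<Longrightarrow> Ord b) \<Longrightarrow> Ord a"
  unfolding Defs.Ord_def by (blast intro: transI)

lemma Ord_least: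
  assumes D: "D iU (\<lambda>B e. P (e 0))" and a: "Ord a" "P a"
  obtains m where "Ord m" "P m" "m \<epsilon> a \<or> m = a" "\<And>b. b \<epsilon> m \<Longrightarrow> \<not> P b"
proof -
  obtain m where m: "m \<epsilon> suc a" "P m" "\<And>z. z \<epsilon> suc a \<Longrightarrow> P z \<Longrightarrow> \<not> z \<epsilon> m"
    using minimal[OF D, of a "suc a"] a by auto
  have "m \<epsilon> a \<or> m = a" using m(1) by simp
  then have "Ord m" using a Ord_mem by blast
  have "\<And>b. b \<epsilon> m \<Longrightarrow> b \<epsilon> suc a" using a(1) Ord_trans \<open>m \<epsilon> a \<or> m = a\<close> by (metis suc_iff)
  then show ?thesis using that[OF \<open>Ord m\<close> m(2) \<open>m \<epsilon> a \<or> m = a\<close>] m(3) by blast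
qed

lemma Ord_induct:
  assumes D: "D iU (\<lambda>B e. P (e 0))" and a: "Ord a"
    and step: "\<And>a. Ord a \<Longrightarrow> (\<And>b. b \<epsilon> a \<Longrightarrow> P b) \<Longrightarrow> P a"
  shows "P a"
proof (rule ccontr)
  assume "\<not> P a"
  have "D iU (\<lambda>B e. \<not> P (e 0))" by (intro dintro D)
  then obtain m where m: "Ord m" "\<not> P m" "m \<epsilon> a \<or> m = a" "\<And>b. b \<epsilon> m \<Longrightarrow> \<not> \<not> P b"
    by (rule Ord_least[where P = "\<lambda>a. \<not> P a", OF _ a \<open>\<not> P a\<close>]) blast
  from step[OF m(1)] m(2,4) show False by blast
qed

lemma Ord_linear: "Ord a \<Longrightarrow> Ord b \<Longrightarrow> a \<epsilon> b \<or> a = b \<or> b \<epsilon> a"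
proof -
  have D: "D iU (\<lambda>B e. \<forall>b. Ord b \<longrightarrow> e 0 \<epsilon> b \<or> e 0 = b \<or> b \<epsilon> e 0)" by (intro dintro)
  have main: "\<forall>b. Ord b \<longrightarrow> a \<epsilon> b \<or> a = b \<or> b \<epsilon> a" if "Ord a" for a
  proof (rule Ord_induct[where P = "\<lambda>a. \<forall>b. Ord b \<longrightarrow> a \<epsilon> b \<or> a = b \<or> b \<epsilon> a", OF D that])
    fix a assume a: "Ord a" and IH: "\<And>c. c \<epsilon> a \<Longrightarrow> \<forall>b. Ord b \<longrightarrow> c \<epsilon> b \<or> c = b \<or> b \<epsilon> c"
    have D2: "D iU (\<lambda>B e. a \<epsilon> e 0 \<or> a = e 0 \<or> e 0 \<epsilon> a)" by (intro dintro)
    show "\<forall>b. Ord b \<longrightarrow> a \<epsilon> b \<or> a = b \<or> b \<epsilon> a"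
    proof (intro allI impI)
      fix b assume "Ord b"
      then show "a \<epsilon> b \<or> a = b \<or> b \<epsilon> a"
      proof (rule Ord_induct[where P = "\<lambda>b. a \<epsilon> b \<or> a = b \<or> b \<epsilon> a", OF D2])
        fix b assume b: "Ord b" and IH2: "\<And>c. c \<epsilon> b \<Longrightarrow> a \<epsilon> c \<or> a = c \<or> c \<epsilon> a"
        show "a \<epsilon> b \<or> a = b \<or> b \<epsilon> a"
        proof (rule ccontr)
          assume n: "\<not> (a \<epsilon> b \<or> a = b \<or> b \<epsilon> a)"
          have "z \<epsilon> b" if "z \<epsilon> a" for z using IH[OF that] b n that Ord_trans[OF a that] by blast
          moreover have "z \<epsilon> a" if "z \<epsilon> b" for z using IH2[OF that] n that Ord_trans[OF b that] by blast
          ultimately show False using n set_eqI by blast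
        qed
      qed
    qed
  qed
  show "Ord a \<Longrightarrow> Ord b \<Longrightarrow> a \<epsilon> b \<or> a = b \<or> b \<epsilon> a" using main by blast
qed

lemma Ord_not_mem: "Ord a \<Longrightarrow> Ord b \<Longrightarrow> \<not> a \<epsilon> b \<Longrightarrow> subs b a"
  using Ord_linear Ord_subs subs_refl by metis

lemma Ord_subs_le: "Ord a \<Longrightarrow> Ord b \<Longrightarrow> subs a b \<Longrightarrow> a \<epsilon> b \<or> a = b"
  using Ord_linear[of a b] no_self subsD by metis

lemma Ord_emp [simp]: "Ord emp"
  by (rule OrdI) auto

lemma Ord_suc: "Ord a \<Longrightarrow> Ord (suc a)"
  by (rule OrdI) (metis suc_iff Ord_trans, metis suc_iff Ord_mem)

lemma Ord_Uni: "(\<And>b. b \<epsilon> x \<Longrightarrow> Ord b) \<Longrightarrow> Ord (Uni x)"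
  by (rule OrdI) (metis Uni_iff Ord_trans, metis Uni_iff Ord_mem)

lemma suc_mem_suc: "Ord a \<Longrightarrow> b \<epsilon> a \<Longrightarrow> suc b \<epsilon> suc a"
proof -
  assume a: "Ord a" "b \<epsilon> a"
  have "\<not> a \<epsilon> suc b" using a no_self no_cycle2 by auto
  then show ?thesis using Ord_linear[OF Ord_suc[OF Ord_mem[OF a]] a(1)] by auto
qed

lemma suc_inj [simp]: "suc a = suc b \<longleftrightarrow> a = b"
  by (metis suc_iff no_cycle2)

lemma suc_neq_emp [simp]: "suc a \<noteq> emp" "emp \<noteq> suc a"
  by (metis suc_iff emp_iff)+

section \<open>Natural numbers of the model\<close>

definition inductive_class :: "'a \<Rightarrow> bool" where
  "inductive_class I \<longleftrightarrow> emp \<epsilon> I \<and> (\<forall>x. x \<epsilon> I \<longrightarrow> suc x \<epsilon> I)"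

lemma omega_iff: "n \<epsilon> omega \<longleftrightarrow> (\<forall>I. inductive_class I \<longrightarrow> n \<epsilon> I)"
  unfolding Defs.omega_def inductive_class_def
proof (rule sep[where P = "\<lambda>n. \<forall>I. emp \<epsilon> I \<and> (\<forall>x. x \<epsilon> I \<longrightarrow> suc x \<epsilon> I) \<longrightarrow> n \<epsilon> I"])
  show "D iU (\<lambda>B e. \<forall>I. emp \<epsilon> I \<and> (\<forall>x. x \<epsilon> I \<longrightarrow> suc x \<epsilon> I) \<longrightarrow> e 0 \<epsilon> I)"
    by (intro dintro)
  obtain I where I: "\<exists>x. x \<epsilon> I \<and> (\<forall>z. \<not> z \<epsilon> x)"
    "\<forall>x. x \<epsilon> I \<longrightarrow> (\<exists>y. y \<epsilon> I \<and> (\<forall>z. z \<epsilon> y \<longleftrightarrow> z \<epsilon> x \<or> z = x))" using infinity by blast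
  have "emp \<epsilon> I" using I(1) set_eqI[of emp] emp_iff by metis
  moreover have "suc x \<epsilon> I" if "x \<epsilon> I" for x using I(2) that set_eqI[of "suc x"] suc_iff by metis
  \<comment> \<open>Any fixed inductive set serves as the bound for separation.\<close>
  ultimately show "z \<epsilon> (SOME I. inductive_class I)"
    if "\<forall>I. emp \<epsilon> I \<and> (\<forall>x. x \<epsilon> I \<longrightarrow> suc x \<epsilon> I) \<longrightarrow> z \<epsilon> I" for z
    using that someI[of inductive_class I] unfolding inductive_class_def by blast
qed

lemma emp_omega [simp]: "emp \<epsilon> omega"
  and suc_omega: "n \<epsilon> omega \<Longrightarrow> suc n \<epsilon> omega"
  unfolding omega_iff inductive_class_def by blast+

lemma omega_induct:
  assumes D: "D iU (\<lambda>B e. P (e 0))" and n: "n \<epsilon> omega" and "P emp"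
    and step: "\<And>n. n \<epsilon> omega \<Longrightarrow> P n \<Longrightarrow> P (suc n)"
  shows "P n"
proof -
  obtain S where S: "\<And>z. z \<epsilon> S \<longleftrightarrow> z \<epsilon> omega \<and> P z" using sep_ex[OF D] by blast
  have "inductive_class S" unfolding inductive_class_def using S assms suc_omega by simp
  then show ?thesis using n S omega_iff by blast
qed

lemma Ord_nat: "n \<epsilon> omega \<Longrightarrow> Ord n"
  by (rule omega_induct[where P = Ord], intro dintro, assumption, rule Ord_emp, rule Ord_suc)

lemma omega_subs: "n \<epsilon> omega \<Longrightarrow> m \<epsilon> n \<Longrightarrow> m \<epsilon> omega"
proof -
  have D: "D iU (\<lambda>B e. \<forall>m. m \<epsilon> e 0 \<longrightarrow> m \<epsilon> omega)" by (intro dintro)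
  have "n \<epsilon> omega \<Longrightarrow> \<forall>m. m \<epsilon> n \<longrightarrow> m \<epsilon> omega"
    by (rule omega_induct[where P = "\<lambda>n. \<forall>m. m \<epsilon> n \<longrightarrow> m \<epsilon> omega", OF D]) auto
  then show "n \<epsilon> omega \<Longrightarrow> m \<epsilon> n \<Longrightarrow> m \<epsilon> omega" by blast
qed

lemma Ord_omega [simp]: "Ord omega"
  by (rule OrdI) (erule (1) omega_subs, erule Ord_nat)

lemma omega_cases:
  assumes "n \<epsilon> omega" obtains "n = emp" | m where "m \<epsilon> omega" "n = suc m"
proof -
  have D: "D iU (\<lambda>B e. e 0 = emp \<or> (\<exists>m. m \<epsilon> omega \<and> e 0 = suc m))" by (intro dintro)
  have "n = emp \<or> (\<exists>m. m \<epsilon> omega \<and> n = suc m)"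
    by (rule omega_induct[where P = "\<lambda>n. n = emp \<or> (\<exists>m. m \<epsilon> omega \<and> n = suc m)", OF D assms]) auto
  then show ?thesis using that by blast
qed

text \<open>The union of all values at \<open>x\<close>, as a replacement for \<open>app\<close>. It
  is always a set and has a bounded definition, whereas the description in \<open>app\<close> is not
  visibly definable where the value fails to be unique. Both agree on the arguments of a
  function.\<close>

definition ap :: "'a \<Rightarrow> 'a \<Rightarrow> 'a" where
  "ap f x = mkset (\<lambda>z. \<exists>y. opair x y \<epsilon> f \<and> z \<epsilon> y)"

lemma opair_Uni: "opair x y \<epsilon> f \<Longrightarrow> x \<epsilon> Uni (Uni f)" "opair x y \<epsilon> f \<Longrightarrow> y \<epsilon> Uni (Uni f)"
  unfolding Uni_iff Defs.opair_def by (metis upair_iff)+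

lemma ap_iff: "z \<epsilon> ap f x \<longleftrightarrow> (\<exists>y. opair x y \<epsilon> f \<and> z \<epsilon> y)"
  unfolding ap_def
proof (rule sep[where P = "\<lambda>z. \<exists>y. opair x y \<epsilon> f \<and> z \<epsilon> y" and x = "Uni (Uni (Uni f))"])
  show "D iU (\<lambda>B e. \<exists>y. opair x y \<epsilon> f \<and> e 0 \<epsilon> y)" by (intro dintro)
qed (use opair_Uni(2) Uni_iff in blast)

lemma fn_ap [dintro]:
  assumes "u \<noteq> iT" "fn u F" "fn u G" shows "fn u (\<lambda>B e. ap (F B e) (G B e))"
proof (rule fn_comp2[OF _ assms(2,3)])
  have "D u (\<lambda>B e. \<exists>y. y \<epsilon> Uni (Uni (e (Suc 0))) \<and> (opair (e (Suc (Suc 0))) y \<epsilon> e (Suc 0) \<and> e 0 \<epsilon> y))"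
    using assms(1) by (intro dintro)
  then have 1: "D u (\<lambda>B e. \<exists>y. opair (e (Suc (Suc 0))) y \<epsilon> e (Suc 0) \<and> e 0 \<epsilon> y)"
    by (rule D_cong) (use opair_Uni(2) in blast)
  have 2: "B (ap x y)" if g: "good B" "B x" "B y" for B x y
  proof -
    have "subs (ap x y) (Uni (Uni (Uni x)))" by (rule subsI) (metis ap_iff Uni_iff opair_Uni(2))
    then show ?thesis using g that good_subs[of B] good_Uni[of B] by metis
  qed
  show "fn u (\<lambda>B e. ap (e 0) (e (Suc 0)))"
    by (rule fn_mkset2[OF assms(1) ap_def], rule 1, erule (2) 2, rule ap_iff)
qed

lemma is_funD: "is_fun f A B \<Longrightarrow> z \<epsilon> f \<Longrightarrow> \<exists>x y. x \<epsilon> A \<and> y \<epsilon> B \<and> z = opair x y"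
  unfolding Defs.is_fun_def by blast

lemma is_fun_ex1: "is_fun f A B \<Longrightarrow> x \<epsilon> A \<Longrightarrow> \<exists>!y. opair x y \<epsilon> f"
  unfolding Defs.is_fun_def by blast

lemma fun_ap: "is_fun f A B \<Longrightarrow> x \<epsilon> A \<Longrightarrow> opair x y \<epsilon> f \<longleftrightarrow> y = ap f x"
proof -
  assume f: "is_fun f A B" "x \<epsilon> A"
  obtain w where w: "\<And>y. opair x y \<epsilon> f \<longleftrightarrow> y = w" using is_fun_ex1[OF f] by blast
  have "ap f x = w" by (rule set_eqI) (simp add: ap_iff w)
  with w show ?thesis by simp
qed

lemma app_ap: "is_fun f A B \<Longrightarrow> x \<epsilon> A \<Longrightarrow> app f x = ap f x"
  unfolding Defs.app_def by (simp add: fun_ap)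

lemma ap_in: "is_fun f A B \<Longrightarrow> x \<epsilon> A \<Longrightarrow> ap f x \<epsilon> B"
proof -
  assume f: "is_fun f A B" "x \<epsilon> A"
  then have "opair x (ap f x) \<epsilon> f" using fun_ap by blast
  from is_funD[OF f(1) this] show ?thesis by auto
qed

lemma opair_in_fun: "is_fun f A B \<Longrightarrow> opair x y \<epsilon> f \<longleftrightarrow> x \<epsilon> A \<and> y = ap f x"
proof -
  assume f: "is_fun f A B"
  have "x \<epsilon> A" if "opair x y \<epsilon> f" using is_funD[OF f that] by auto
  then show ?thesis using fun_ap[OF f] by blast
qed

lemma fun_mem_iff:
  assumes f1: "is_fun f A B" shows "z \<epsilon> f \<longleftrightarrow> (\<exists>x. x \<epsilon> A \<and> z = opair x (ap f x))"
proof
  assume "z \<epsilon> f" note f = f1 this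
  from is_funD[OF f] obtain x y where xy: "x \<epsilon> A" "z = opair x y" by blast
  then have "y = ap f x" using opair_in_fun[OF f(1)] f(2) by simp
  then show "\<exists>x. x \<epsilon> A \<and> z = opair x (ap f x)" using xy by blast
next
  assume "\<exists>x. x \<epsilon> A \<and> z = opair x (ap f x)" note f = f1 this
  then show "z \<epsilon> f" using opair_in_fun[OF f(1)] by auto
qed

lemma fun_ext:
  assumes f: "is_fun f A B" and g: "is_fun g A B'" and eq: "\<And>x. x \<epsilon> A \<Longrightarrow> ap f x = ap g x"
  shows "f = g"
proof (rule set_eqI)
  show "z \<epsilon> f \<longleftrightarrow> z \<epsilon> g" for z
    unfolding fun_mem_iff[OF f] fun_mem_iff[OF g] using eq by auto
qed

lemma fun_codomain: "is_fun f A B \<Longrightarrow> (\<And>x. x \<epsilon> A \<Longrightarrow> ap f x \<epsilon> C) \<Longrightarrow> is_fun f A C"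
proof -
  assume f: "is_fun f A B" and C: "\<And>x. x \<epsilon> A \<Longrightarrow> ap f x \<epsilon> C"
  have "\<exists>x y. x \<epsilon> A \<and> y \<epsilon> C \<and> z = opair x y" if "z \<epsilon> f" for z
    using fun_mem_iff[OF f] C that by blast
  then show "is_fun f A C" using is_fun_ex1[OF f] unfolding Defs.is_fun_def by blast
qed

definition lam :: "'a \<Rightarrow> ('a \<Rightarrow> 'a) \<Rightarrow> 'a" where
  "lam A F = mkset (\<lambda>z. \<exists>x. x \<epsilon> A \<and> z = opair x (F x))"

lemma lam_iff: "fn iU (\<lambda>B e. F (e 0)) \<Longrightarrow> z \<epsilon> lam A F \<longleftrightarrow> (\<exists>x. x \<epsilon> A \<and> z = opair x (F x))"
  unfolding lam_def by (rule repl) (intro dintro)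

lemma lam_fun:
  assumes F: "fn iU (\<lambda>B e. F (e 0))" and "\<And>x. x \<epsilon> A \<Longrightarrow> F x \<epsilon> B"
  shows "is_fun (lam A F) A B"
  unfolding Defs.is_fun_def lam_iff[OF F] using assms(2) by auto

lemma ap_lam: "fn iU (\<lambda>B e. F (e 0)) \<Longrightarrow> x \<epsilon> A \<Longrightarrow> ap (lam A F) x = F x"
  by (rule set_eqI) (auto simp: ap_iff lam_iff)

lemma lam_fun_ex:
  assumes F: "fn iU (\<lambda>B e. F (e 0))" shows "\<exists>B. is_fun (lam A F) A B"
  by (rule exI, rule lam_fun[OF F, of A "mkset (\<lambda>y. \<exists>x. x \<epsilon> A \<and> y = F x)"]) (use repl[OF F] in blast)

lemma fn_lamU [dintro]:
  assumes F: "fn iU (\<lambda>B e. F (\<lambda>i. e (Suc i)) (e 0))" and A: "fn iU (\<lambda>B e. A e)"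
  shows "fn iU (\<lambda>B e. lam (A e) (F e))"
proof -
  have "fn iU (\<lambda>B e. F (\<lambda>i. e (Suc (Suc i))) (e 0))"
    using fn_weaken[OF F, of "case_nat 0 (\<lambda>i. Suc (Suc i))"] by simp
  moreover have "fn iU (\<lambda>B e. A (\<lambda>i. e (Suc i)))" by (rule fn_weaken[OF A])
  ultimately show ?thesis unfolding lam_def by (intro dintro)
qed

lemma upd_iff: "z \<epsilon> upd f x y \<longleftrightarrow> z \<epsilon> f \<and> (\<forall>w. z \<noteq> opair x w) \<or> z = opair x y"
  unfolding Defs.upd_def
  by (rule sep[where P = "\<lambda>z. z \<epsilon> f \<and> (\<forall>w. z \<noteq> opair x w) \<or> z = opair x y" and x = "adj f (opair x y)"])
    (intro dintro, auto)

lemma upd_fun: "is_fun f A B \<Longrightarrow> x \<epsilon> A \<Longrightarrow> y \<epsilon> B \<Longrightarrow> is_fun (upd f x y) A B"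
proof -
  assume f: "is_fun f A B" and xy: "x \<epsilon> A" "y \<epsilon> B"
  have "z \<epsilon> upd f x y \<longleftrightarrow> (\<exists>u. u \<epsilon> A \<and> z = opair u (if u = x then y else ap f u))" for z
    unfolding upd_iff fun_mem_iff[OF f] using xy by auto
  then show ?thesis unfolding Defs.is_fun_def using xy ap_in[OF f] by auto
qed

lemma ap_upd: "ap (upd f x y) z = (if z = x then y else ap f z)"
  by (rule set_eqI) (auto simp: ap_iff upd_iff)

lemma fn_upd [dintro]:
  assumes "u \<noteq> iT" "fn u F" "fn u G" "fn u H" shows "fn u (\<lambda>B e. upd (F B e) (G B e) (H B e))"
proof (rule fn_comp3[OF _ assms(2-4)])
  have "D u (\<lambda>B e. e 0 \<epsilon> e (Suc 0) \<and> \<not> (\<exists>w. w \<epsilon> Uni (Uni (e (Suc 0))) \<and> e 0 = opair (e (Suc (Suc 0))) w) \<or>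
      e 0 = opair (e (Suc (Suc 0))) (e (Suc (Suc (Suc 0)))))"
    using assms(1) by (intro dintro)
  then have 1: "D u (\<lambda>B e. e 0 \<epsilon> e (Suc 0) \<and> (\<forall>w. e 0 \<noteq> opair (e (Suc (Suc 0))) w) \<or>
      e 0 = opair (e (Suc (Suc 0))) (e (Suc (Suc (Suc 0)))))"
    by (rule D_cong) (use opair_Uni(2) in metis)
  have 2: "B (upd x y z)" if g: "good B" "B x" "B y" "B z" for B x y z
  proof -
    have "subs (upd x y z) (adj x (opair y z))" by (rule subsI) (use upd_iff in auto)
    then show ?thesis using g that good_subs[of B] good_adj[of B] good_opair[of B] by metis
  qed
  show "fn u (\<lambda>B e. upd (e 0) (e (Suc 0)) (e (Suc (Suc 0))))"
    by (rule fn_mkset3[OF assms(1) Defs.upd_def], rule 1, erule (3) 2, rule upd_iff)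
qed

definition prd :: "'a \<Rightarrow> 'a \<Rightarrow> 'a" where
  "prd A B = mkset (\<lambda>z. \<exists>x. x \<epsilon> A \<and> (\<exists>y. y \<epsilon> B \<and> z = opair x y))"

lemma opair_pow2: "x \<epsilon> A \<Longrightarrow> y \<epsilon> B \<Longrightarrow> opair x y \<epsilon> pow (pow (Uni (upair A B)))"
  by (auto simp: Defs.opair_def Defs.subs_def)

lemma prd_iff: "z \<epsilon> prd A B \<longleftrightarrow> (\<exists>x. x \<epsilon> A \<and> (\<exists>y. y \<epsilon> B \<and> z = opair x y))"
  unfolding prd_def
  by (rule sep[where P = "\<lambda>z. \<exists>x. x \<epsilon> A \<and> (\<exists>y. y \<epsilon> B \<and> z = opair x y)" and x = "pow (pow (Uni (upair A B)))"])
    (intro dintro, use opair_pow2 in blast)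

lemma opair_prd [simp]: "opair x y \<epsilon> prd A B \<longleftrightarrow> x \<epsilon> A \<and> y \<epsilon> B"
  unfolding prd_iff by auto

lemma good_prd: "good B \<Longrightarrow> B x \<Longrightarrow> B y \<Longrightarrow> B (prd x y)"
proof -
  assume B: "good B" "B x" "B y"
  have "subs (prd x y) (pow (pow (Uni (upair x y))))" by (rule subsI) (use prd_iff opair_pow2 in metis)
  with B show ?thesis by (metis good_subs[of B] good_pow[of B] good_Uni[of B] good_upair[of B])
qed

lemma fn_prd [dintro]:
  assumes "u \<noteq> iT" "fn u F" "fn u G" shows "fn u (\<lambda>B e. prd (F B e) (G B e))"
proof (rule fn_comp2[OF _ assms(2,3)])
  have 1: "D u (\<lambda>B e. \<exists>x. x \<epsilon> e (Suc 0) \<and> (\<exists>y. y \<epsilon> e (Suc (Suc 0)) \<and> e 0 = opair x y))"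
    using assms(1) by (intro dintro)
  show "fn u (\<lambda>B e. prd (e 0) (e (Suc 0)))"
    by (rule fn_mkset2[OF assms(1) prd_def], rule 1, erule (2) good_prd, rule prd_iff)
qed

lemma is_fun_subs: "is_fun f A B \<Longrightarrow> subs f (prd A B)"
proof (rule subsI)
  fix z assume "is_fun f A B" "z \<epsilon> f"
  from is_funD[OF this] show "z \<epsilon> prd A B" by auto
qed

definition FunS :: "'a \<Rightarrow> 'a \<Rightarrow> 'a" where
  "FunS A B = mkset (\<lambda>f. is_fun f A B)"

text \<open>Uniqueness of the value is tested only inside the codomain, and the inclusion in the
  product takes care of the rest; in this form every quantifier is bounded.\<close>

lemma is_fun_iff: "is_fun f A B \<longleftrightarrow> subs f (prd A B) \<and>
   (\<forall>x. x \<epsilon> A \<longrightarrow> (\<exists>y. y \<epsilon> B \<and> opair x y \<epsilon> f \<and> (\<forall>w. w \<epsilon> B \<longrightarrow> opair x w \<epsilon> f \<longrightarrow> w = y)))"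
proof
  assume f: "is_fun f A B"
  then show "subs f (prd A B) \<and>
   (\<forall>x. x \<epsilon> A \<longrightarrow> (\<exists>y. y \<epsilon> B \<and> opair x y \<epsilon> f \<and> (\<forall>w. w \<epsilon> B \<longrightarrow> opair x w \<epsilon> f \<longrightarrow> w = y)))"
    using is_fun_subs[OF f] fun_ap[OF f] ap_in[OF f] by blast
next
  assume R: "subs f (prd A B) \<and>
   (\<forall>x. x \<epsilon> A \<longrightarrow> (\<exists>y. y \<epsilon> B \<and> opair x y \<epsilon> f \<and> (\<forall>w. w \<epsilon> B \<longrightarrow> opair x w \<epsilon> f \<longrightarrow> w = y)))"
  have 1: "\<exists>x y. x \<epsilon> A \<and> y \<epsilon> B \<and> z = opair x y" if "z \<epsilon> f" for z
    using R subsD[of f "prd A B" z] that prd_iff[of z A B] by blast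
  have 2: "\<exists>!y. opair x y \<epsilon> f" if "x \<epsilon> A" for x
  proof -
    obtain y where y: "y \<epsilon> B" "opair x y \<epsilon> f" "\<forall>w. w \<epsilon> B \<longrightarrow> opair x w \<epsilon> f \<longrightarrow> w = y" using R \<open>x \<epsilon> A\<close> by blast
    have "w = y" if "opair x w \<epsilon> f" for w using 1[OF that] y(3) that by auto
    then show ?thesis using y(2) by blast
  qed
  show "is_fun f A B" unfolding Defs.is_fun_def using 1 2 by blast
qed

lemma D_is_fun [dintro]:
  assumes u: "u \<noteq> iT" and F: "fn u F" and G: "fn u G" and H: "fn u H"
  shows "D u (\<lambda>B e. is_fun (F B e) (G B e) (H B e))"
proof (rule D_comp3[where R = "\<lambda>B. is_fun", OF _ F G H])
  show "D u (\<lambda>B e. is_fun (e 0) (e (Suc 0)) (e (Suc (Suc 0))))"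
    unfolding is_fun_iff using u by (intro dintro)
qed

text \<open>Functions are subsets of a product, so this is a quantifier over the subsets of a set in
  the class.\<close>

lemma D_bexF [dintro]:
  assumes u: "u \<noteq> iT" and F: "fn u F" and G: "fn u G" and P: "D u (\<lambda>B e. P B (\<lambda>i. e (Suc i)) (e 0))"
  shows "D u (\<lambda>B e. \<exists>x. is_fun x (F B e) (G B e) \<and> P B e x)"
proof (rule D_cong)
  show "D u (\<lambda>B e. \<exists>x. subs x (prd (F B e) (G B e)) \<and> (is_fun x (F B e) (G B e) \<and> P B e x))"
    by (intro dintro P fn_weaken[OF F] fn_weaken[OF G] F G u)
qed (use is_fun_subs in blast)

lemma D_ballF [dintro]:
  assumes u: "u \<noteq> iT" and F: "fn u F" and G: "fn u G" and P: "D u (\<lambda>B e. P B (\<lambda>i. e (Suc i)) (e 0))"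
  shows "D u (\<lambda>B e. \<forall>x. is_fun x (F B e) (G B e) \<longrightarrow> P B e x)"
  by (rule D_cong[of u "\<lambda>B e. \<not> (\<exists>x. is_fun x (F B e) (G B e) \<and> \<not> P B e x)"]) (intro dintro P F G u, blast)

lemma FunS_iff [simp]: "f \<epsilon> FunS A B \<longleftrightarrow> is_fun f A B"
  unfolding FunS_def
  by (rule sep[where P = "\<lambda>f. is_fun f A B" and x = "pow (prd A B)"]) (intro dintro, simp add: is_fun_subs)

lemma good_FunS: "good B \<Longrightarrow> B x \<Longrightarrow> B y \<Longrightarrow> B (FunS x y)"
proof -
  assume B: "good B" "B x" "B y"
  have "subs (FunS x y) (pow (prd x y))" by (rule subsI) (simp add: is_fun_subs)
  with B show ?thesis by (metis good_subs[of B] good_pow[of B] good_prd[of B])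
qed

lemma fn_FunS [dintro]:
  assumes "u \<noteq> iT" "fn u F" "fn u G" shows "fn u (\<lambda>B e. FunS (F B e) (G B e))"
proof (rule fn_comp2[OF _ assms(2,3)])
  have 1: "D u (\<lambda>B e. is_fun (e 0) (e (Suc 0)) (e (Suc (Suc 0))))"
    using assms(1) by (intro dintro)
  show "fn u (\<lambda>B e. FunS (e 0) (e (Suc 0)))"
    by (rule fn_mkset2[OF assms(1) FunS_def], rule 1, erule (2) good_FunS, rule FunS_iff)
qed

lemma is_inj_iff: "is_inj f A B \<longleftrightarrow> is_fun f A B \<and>
    (\<forall>x. x \<epsilon> A \<longrightarrow> (\<forall>y. y \<epsilon> A \<longrightarrow> ap f x = ap f y \<longrightarrow> x = y))"
proof (cases "is_fun f A B")
  case True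
  have "x \<epsilon> A \<and> y \<epsilon> A \<and> app f x = app f y \<longleftrightarrow> x \<epsilon> A \<and> y \<epsilon> A \<and> ap f x = ap f y" for x y
    using app_ap[OF True] by metis
  then show ?thesis unfolding Defs.is_inj_def by blast
qed (simp add: Defs.is_inj_def)

lemma D_is_inj [dintro]:
  assumes u: "u \<noteq> iT" and F: "fn u F" and G: "fn u G" and H: "fn u H"
  shows "D u (\<lambda>B e. is_inj (F B e) (G B e) (H B e))"
proof (rule D_comp3[where R = "\<lambda>B. is_inj", OF _ F G H])
  show "D u (\<lambda>B e. is_inj (e 0) (e (Suc 0)) (e (Suc (Suc 0))))"
    unfolding is_inj_iff using u by (intro dintro)
qed

subsection \<open>Recursion and the cumulative hierarchy\<close>

definition attempt :: "('a \<Rightarrow> 'a \<Rightarrow> 'a) \<Rightarrow> 'a \<Rightarrow> 'a \<Rightarrow> bool" where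
  "attempt H f a \<longleftrightarrow> (\<exists>B. is_fun f (suc a) B) \<and> (\<forall>b. b \<epsilon> suc a \<longrightarrow> ap f b = H f b)"

text \<open>The union over all attempts, for the same reason as in \<open>ap\<close>: the operation
  is definable on every argument without a proof that attempts exist and agree.\<close>

definition ordrec :: "('a \<Rightarrow> 'a \<Rightarrow> 'a) \<Rightarrow> 'a \<Rightarrow> 'a" where
  "ordrec H a = mkset (\<lambda>z. \<exists>f. attempt H f a \<and> z \<epsilon> ap f a)"

definition local_rec :: "('a \<Rightarrow> 'a \<Rightarrow> 'a) \<Rightarrow> bool" where
  "local_rec H \<longleftrightarrow> fn iU (\<lambda>B e. H (e 0) (e (Suc 0))) \<and>
     (\<forall>f g b. (\<forall>c. c \<epsilon> b \<longrightarrow> ap f c = ap g c) \<longrightarrow> H f b = H g b)"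

lemma local_rec_fn: "local_rec H \<Longrightarrow> fn iU (\<lambda>B e. H (e 0) (e (Suc 0)))"
  and local_rec_eq: "local_rec H \<Longrightarrow> (\<And>c. c \<epsilon> b \<Longrightarrow> ap f c = ap g c) \<Longrightarrow> H f b = H g b"
  unfolding local_rec_def by blast+

lemma D_attempt:
  assumes H: "local_rec H" and F: "fn iU F" and G: "fn iU G"
  shows "D iU (\<lambda>B e. attempt H (F B e) (G B e))"
proof (rule D_comp2[where R = "\<lambda>B. attempt H", OF _ F G])
  show "D iU (\<lambda>B e. attempt H (e 0) (e (Suc 0)))"
    unfolding attempt_def by (intro dintro fn_comp2[OF local_rec_fn[OF H]])
qed

lemma fn_ordrec: "local_rec H \<Longrightarrow> fn iU F \<Longrightarrow> fn iU (\<lambda>B e. ordrec H (F B e))"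
proof -
  assume H: "local_rec H" and F: "fn iU F"
  have "fn iU (\<lambda>B e. ordrec H (e 0))"
    unfolding ordrec_def by (intro dintro D_attempt[OF H])
  from fn_comp1[OF this F] show ?thesis .
qed

lemma attempt_unique:
  assumes H: "local_rec H" and a: "Ord a" "attempt H f a" "Ord a'" "attempt H g a'" and b: "b \<epsilon> suc a" "b \<epsilon> suc a'"
  shows "ap f b = ap g b"
proof -
  have D: "D iU (\<lambda>B e. e 0 \<epsilon> suc a \<longrightarrow> e 0 \<epsilon> suc a' \<longrightarrow> ap f (e 0) = ap g (e 0))" by (intro dintro)
  have "Ord b" using Ord_mem[OF Ord_suc[OF a(1)] b(1)] .
  have "b \<epsilon> suc a \<longrightarrow> b \<epsilon> suc a' \<longrightarrow> ap f b = ap g b"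
  proof (rule Ord_induct[where P = "\<lambda>b. b \<epsilon> suc a \<longrightarrow> b \<epsilon> suc a' \<longrightarrow> ap f b = ap g b", OF D \<open>Ord b\<close>], intro impI)
    fix b assume IH: "\<And>c. c \<epsilon> b \<Longrightarrow> c \<epsilon> suc a \<longrightarrow> c \<epsilon> suc a' \<longrightarrow> ap f c = ap g c"
      and b: "b \<epsilon> suc a" "b \<epsilon> suc a'"
    have "ap f c = ap g c" if c: "c \<epsilon> b" for c
      using IH[OF c] Ord_trans[OF Ord_suc[OF a(1)] b(1) c] Ord_trans[OF Ord_suc[OF a(3)] b(2) c] by blast
    then have "H f b = H g b" by (rule local_rec_eq[OF H])
    then show "ap f b = ap g b" using a b unfolding attempt_def by metis
  qed
  then show ?thesis using b by blast
qed

lemma ordrec_ap: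
  assumes H: "local_rec H" and a: "Ord a" "attempt H f a"
  shows "ordrec H a = ap f a"
  unfolding ordrec_def
proof (rule mkset_unique)
  fix z show "z \<epsilon> ap f a \<longleftrightarrow> (\<exists>f. attempt H f a \<and> z \<epsilon> ap f a)"
    using attempt_unique[OF H a(1) _ a, of _ a] a(2) suc_iff by metis
qed

text \<open>Below \<open>a\<close> the attempts given by induction agree, hence
  \<open>ordrec\<close> has the right values there. Only the value at \<open>a\<close> is new, and
  it is computed from the restriction of \<open>ordrec\<close> to \<open>a\<close>.\<close>

lemma attempt_ex: assumes H: "local_rec H" and a: "Ord a" shows "\<exists>f. attempt H f a"
proof (rule Ord_induct[where P = "\<lambda>a. \<exists>f. attempt H f a", OF _ a])
  show "D iU (\<lambda>B e. \<exists>f. attempt H f (e 0))" by (intro dintro D_attempt[OF H])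
next
  fix a assume a: "Ord a" and IH: "\<And>b. b \<epsilon> a \<Longrightarrow> \<exists>f. attempt H f b"
  define v where "v = H (lam a (ordrec H)) a"
  define f where "f = lam (suc a) (\<lambda>b. if b = a then v else ordrec H b)"
  have fr: "fn iU (\<lambda>B e. ordrec H (e 0))" by (intro fn_ordrec[OF H] dintro)
  have fi: "fn iU (\<lambda>B e. if e 0 = a then v else ordrec H (e 0))" by (intro fr dintro)
  have f1: "ap f a = v" unfolding f_def using ap_lam[OF fi, of a "suc a"] by simp
  have f2: "ap f b = ordrec H b" if "b \<epsilon> a" for b
    unfolding f_def using ap_lam[OF fi, of b "suc a"] that no_self by auto
  have f0: "ap (lam a (ordrec H)) b = ordrec H b" if "b \<epsilon> a" for b
    by (rule ap_lam[OF fr that])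
  have "ap f b = H f b" if b: "b \<epsilon> suc a" for b
  proof (cases "b = a")
    case True
    have "H f a = H (lam a (ordrec H)) a" by (rule local_rec_eq[OF H]) (simp add: f2 f0)
    then show ?thesis using True f1 v_def by simp
  next
    case False
    then have ba: "b \<epsilon> a" using b by simp
    obtain g where g: "attempt H g b" using IH[OF ba] by blast
    have Ob: "Ord b" using Ord_mem[OF a ba] .
    have "ap f c = ap g c" if c: "c \<epsilon> b" for c
    proof -
      have ca: "c \<epsilon> a" using Ord_trans[OF a ba c] .
      obtain g' where g': "attempt H g' c" using IH[OF ca] by blast
      have Oc: "Ord c" using Ord_mem[OF a ca] .
      have "ordrec H c = ap g' c" by (rule ordrec_ap[OF H Oc g'])
      also have "\<dots> = ap g c" by (rule attempt_unique[OF H Oc g' Ob g]) (use c in simp_all)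
      finally show ?thesis using f2[OF ca] by simp
    qed
    then have "H f b = H g b" by (rule local_rec_eq[OF H])
    moreover have "ap g b = H g b" using g unfolding attempt_def by simp
    ultimately show ?thesis using f2[OF ba] ordrec_ap[OF H Ob g] by simp
  qed
  then have "attempt H f a" unfolding attempt_def f_def using lam_fun_ex[OF fi] by blast
  then show "\<exists>f. attempt H f a" by blast
qed

lemma attempt_ordrec:
  assumes H: "local_rec H" and a: "Ord a" "attempt H f a" and c: "c \<epsilon> suc a"
  shows "ap f c = ordrec H c"
proof -
  have Oc: "Ord c" using Ord_mem[OF Ord_suc[OF a(1)] c] .
  obtain g where g: "attempt H g c" using attempt_ex[OF H Oc] by blast
  have "ap g c = ap f c" by (rule attempt_unique[OF H Oc g a]) (use c in simp_all)
  then show ?thesis using ordrec_ap[OF H Oc g] by simp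
qed

lemma ordrec_eq:
  assumes H: "local_rec H" and a: "Ord a"
  shows "ordrec H a = H (lam a (ordrec H)) a"
proof -
  obtain f where f: "attempt H f a" using attempt_ex[OF H a] by blast
  have fr: "fn iU (\<lambda>B e. ordrec H (e 0))" by (intro fn_ordrec[OF H] dintro)
  have "H f a = H (lam a (ordrec H)) a"
  proof (rule local_rec_eq[OF H])
    fix c assume c: "c \<epsilon> a"
    then show "ap f c = ap (lam a (ordrec H)) c"
      using ap_lam[OF fr c] attempt_ordrec[OF H a f, of c] by simp
  qed
  moreover have "ordrec H a = H f a" using ordrec_ap[OF H a f] f unfolding attempt_def by simp
  ultimately show ?thesis by simp
qed

text \<open>The given recursive definitions use \<open>app\<close>, whereas recursion is developed
  for \<open>ap\<close>. The two step functions are compared only on functions with domain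
  \<open>suc a\<close>, where \<open>app\<close> and \<open>ap\<close> agree.\<close>

lemma ord_rec_eq:
  assumes H: "local_rec H" and a: "Ord a"
    and H': "\<And>f B b. is_fun f (suc a) B \<Longrightarrow> b \<epsilon> suc a \<Longrightarrow> H' f b = H f b"
  shows "ord_rec H' a = ordrec H a"
  unfolding Defs.ord_rec_def
proof (rule the_equality)
  obtain f where f: "attempt H f a" using attempt_ex[OF H a] by blast
  then obtain B where B: "is_fun f (suc a) B" unfolding attempt_def by blast
  have "app f b = H' f b" if "b \<epsilon> suc a" for b
    using app_ap[OF B that] H'[OF B that] f that unfolding attempt_def by metis
  moreover have "ordrec H a = app f a"
    using ordrec_ap[OF H a f] app_ap[OF B, of a] by simp
  ultimately show "\<exists>f B. is_fun f (suc a) B \<and> (\<forall>b. b \<epsilon> suc a \<longrightarrow> app f b = H' f b) \<and> ordrec H a = app f a"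
    using B by blast
next
  fix v assume "\<exists>f B. is_fun f (suc a) B \<and> (\<forall>b. b \<epsilon> suc a \<longrightarrow> app f b = H' f b) \<and> v = app f a"
  then obtain f B where f: "is_fun f (suc a) B" "\<And>b. b \<epsilon> suc a \<Longrightarrow> app f b = H' f b" "v = app f a" by blast
  have "ap f b = H f b" if "b \<epsilon> suc a" for b
    using app_ap[OF f(1) that] H'[OF f(1) that] f(2)[OF that] by simp
  then have "attempt H f a" unfolding attempt_def using f(1) by blast
  from ordrec_ap[OF H a this] show "v = ordrec H a" using f(3) app_ap[OF f(1), of a] by simp
qed

definition HV :: "'a \<Rightarrow> 'a \<Rightarrow> 'a" where
  "HV f b = mkset (\<lambda>x. \<exists>c. c \<epsilon> b \<and> subs x (ap f c))"

lemma HV_iff: "z \<epsilon> HV f b \<longleftrightarrow> (\<exists>c. c \<epsilon> b \<and> subs z (ap f c))"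
  unfolding HV_def
proof (rule sep[where P = "\<lambda>x. \<exists>c. c \<epsilon> b \<and> subs x (ap f c)"])
  show "D iU (\<lambda>B e. \<exists>c. c \<epsilon> b \<and> subs (e 0) (ap f c))" by (intro dintro)
  have "fn iU (\<lambda>B e. pow (ap f (e 0)))" by (intro dintro)
  then have R: "y \<epsilon> mkset (\<lambda>y. \<exists>c. c \<epsilon> b \<and> y = pow (ap f c)) \<longleftrightarrow> (\<exists>c. c \<epsilon> b \<and> y = pow (ap f c))" for y
    by (rule repl[where F = "\<lambda>c. pow (ap f c)"])
  fix x assume "\<exists>c. c \<epsilon> b \<and> subs x (ap f c)"
  then show "x \<epsilon> Uni (mkset (\<lambda>y. \<exists>c. c \<epsilon> b \<and> y = pow (ap f c)))"
    unfolding Uni_iff R using pow_iff by blast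
qed

lemma local_HV: "local_rec HV"
  unfolding local_rec_def
proof (intro conjI allI impI)
  show "fn iU (\<lambda>B e. HV (e 0) (e (Suc 0)))" unfolding HV_def by (intro dintro)
  fix f g b assume "\<forall>c. c \<epsilon> b \<longrightarrow> ap f c = ap g c"
  then show "HV f b = HV g b" by (intro set_eqI) (auto simp: HV_iff)
qed

text \<open>\<open>Vr\<close> is the cumulative hierarchy with a value on non-ordinals that keeps it definable.\<close>

definition Vr :: "'a \<Rightarrow> 'a" where
  "Vr a = ordrec HV a"

lemma fn_Vr [dintro]: "fn iU F \<Longrightarrow> fn iU (\<lambda>B e. Vr (F B e))"
  unfolding Vr_def by (rule fn_ordrec[OF local_HV])

lemma V_Vr: "Ord a \<Longrightarrow> V a = Vr a"
  unfolding Defs.V_def Vr_def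
proof (rule ord_rec_eq[OF local_HV])
  fix f B b assume a: "Ord a" and f: "is_fun f (suc a) B" and b: "b \<epsilon> suc a"
  have "app f c = ap f c" if "c \<epsilon> b" for c
    using app_ap[OF f Ord_trans[OF Ord_suc[OF a] b that]] .
  then have "(\<lambda>x. \<exists>c. c \<epsilon> b \<and> subs x (app f c)) = (\<lambda>x. \<exists>c. c \<epsilon> b \<and> subs x (ap f c))" by (intro ext) metis
  then show "mkset (\<lambda>x. \<exists>c. c \<epsilon> b \<and> subs x (app f c)) = HV f b" unfolding HV_def by (rule arg_cong)
qed assumption

lemma Vr_iff: "Ord a \<Longrightarrow> x \<epsilon> Vr a \<longleftrightarrow> (\<exists>c. c \<epsilon> a \<and> subs x (Vr c))"
proof -
  assume a: "Ord a"
  have fr: "fn iU (\<lambda>B e. ordrec HV (e 0))" by (intro fn_ordrec[OF local_HV] dintro)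
  show ?thesis unfolding Vr_def ordrec_eq[OF local_HV a] HV_iff using ap_lam[OF fr] by auto
qed

lemma Vr_mem_subs: "Ord a \<Longrightarrow> x \<epsilon> Vr a \<Longrightarrow> y \<epsilon> x \<Longrightarrow> y \<epsilon> Vr a"
proof -
  assume a: "Ord a" and x: "x \<epsilon> Vr a" "y \<epsilon> x"
  obtain c where c: "c \<epsilon> a" "subs x (Vr c)" using Vr_iff[OF a] x by blast
  have "y \<epsilon> Vr c" using subsD[OF c(2) x(2)] .
  then obtain d where d: "d \<epsilon> c" "subs y (Vr d)" using Vr_iff[OF Ord_mem[OF a c(1)]] by blast
  then show ?thesis using Vr_iff[OF a] Ord_trans[OF a c(1) d(1)] by blast
qed

lemma Vr_subs_mem: "Ord a \<Longrightarrow> x \<epsilon> Vr a \<Longrightarrow> subs y x \<Longrightarrow> y \<epsilon> Vr a"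
  using Vr_iff[of a] subs_trans by metis

lemma transitive_Vr: "Ord a \<Longrightarrow> transitive (Vr a)"
  by (rule transI) (rule Vr_mem_subs)

lemma Vr_mem: "Ord a \<Longrightarrow> b \<epsilon> a \<Longrightarrow> Vr b \<epsilon> Vr a"
  using Vr_iff[of a] subs_refl by metis

lemma Vr_mono: "Ord a \<Longrightarrow> b \<epsilon> a \<Longrightarrow> subs (Vr b) (Vr a)"
  using Vr_mem Vr_mem_subs by (metis subsI)

lemma Vr_mono_le: "Ord a \<Longrightarrow> Ord b \<Longrightarrow> subs b a \<Longrightarrow> subs (Vr b) (Vr a)"
  using Ord_subs_le[of b a] Vr_mono subs_refl by metis

lemma Ord_subs_Vr: "Ord a \<Longrightarrow> subs a (Vr a)"
proof (rule Ord_induct[where P = "\<lambda>a. subs a (Vr a)"])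
  show "D iU (\<lambda>B e. subs (e 0) (Vr (e 0)))" by (intro dintro)
  fix a assume "Ord a" "\<And>b. b \<epsilon> a \<Longrightarrow> subs b (Vr b)"
  then show "subs a (Vr a)" using Vr_iff[of a] by (intro subsI) blast
qed

lemma Ord_Vr_self: "Ord a \<Longrightarrow> \<not> a \<epsilon> Vr a"
proof (rule Ord_induct[where P = "\<lambda>a. \<not> a \<epsilon> Vr a"])
  show "D iU (\<lambda>B e. \<not> e 0 \<epsilon> Vr (e 0))" by (intro dintro)
  fix a assume a: "Ord a" "\<And>b. b \<epsilon> a \<Longrightarrow> \<not> b \<epsilon> Vr b"
  show "\<not> a \<epsilon> Vr a"
  proof
    assume "a \<epsilon> Vr a"
    then obtain c where "c \<epsilon> a" "subs a (Vr c)" using Vr_iff[OF a(1)] by blast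
    then show False using a(2) subsD by blast
  qed
qed

lemma Ord_Vr_iff: "Ord a \<Longrightarrow> Ord b \<Longrightarrow> b \<epsilon> Vr a \<longleftrightarrow> b \<epsilon> a"
proof
  assume a: "Ord a" "Ord b" "b \<epsilon> Vr a"
  have "\<not> a \<epsilon> b" using Vr_mem_subs[OF a(1) a(3)] Ord_Vr_self[OF a(1)] by blast
  then show "b \<epsilon> a" using Ord_linear[OF a(1,2)] a(3) Ord_Vr_self[OF a(1)] by blast
qed (use Ord_subs_Vr subsD in blast)

lemma swelled_Vr: "Ord a \<Longrightarrow> b \<epsilon> a \<Longrightarrow> swelled (\<lambda>x. x \<epsilon> Vr a)"
  unfolding swelled_def using Vr_mem_subs Vr_subs_mem Vr_mem by blast

section \<open>Transitive closures and ranks\<close>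

lemma TC_ex: "\<exists>t. transitive t \<and> x \<epsilon> t"
proof -
  \<comment> \<open>Each stage consists of x and of the elements of elements of earlier stages;
    stage \<omega> is the transitive closure of {x}.\<close>
  define HT where "HT f b = mkset (\<lambda>z. z = x \<or> (\<exists>c. c \<epsilon> b \<and> (\<exists>y. y \<epsilon> ap f c \<and> z \<epsilon> y)))" for f b
  have HT: "z \<epsilon> HT f b \<longleftrightarrow> z = x \<or> (\<exists>c. c \<epsilon> b \<and> (\<exists>y. y \<epsilon> ap f c \<and> z \<epsilon> y))" for z f b
    unfolding HT_def
  proof (rule sep[where P = "\<lambda>z. z = x \<or> (\<exists>c. c \<epsilon> b \<and> (\<exists>y. y \<epsilon> ap f c \<and> z \<epsilon> y))"])
    show "D iU (\<lambda>B e. e 0 = x \<or> (\<exists>c. c \<epsilon> b \<and> (\<exists>y. y \<epsilon> ap f c \<and> e 0 \<epsilon> y)))" by (intro dintro)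
    have F: "fn iU (\<lambda>B e. ap f (e 0))" by (intro dintro)
    fix z assume "z = x \<or> (\<exists>c. c \<epsilon> b \<and> (\<exists>y. y \<epsilon> ap f c \<and> z \<epsilon> y))"
    then show "z \<epsilon> adj (Uni (Uni (mkset (\<lambda>y. \<exists>c. c \<epsilon> b \<and> y = ap f c)))) x"
      unfolding adj_iff Uni_iff repl[where F = "\<lambda>c. ap f c", OF F] by blast
  qed
  have loc: "local_rec HT"
    unfolding local_rec_def
  proof (intro conjI allI impI)
    show "fn iU (\<lambda>B e. HT (e 0) (e (Suc 0)))" unfolding HT_def by (intro dintro)
    fix f g b assume "\<forall>c. c \<epsilon> b \<longrightarrow> ap f c = ap g c"
    then show "HT f b = HT g b" by (intro set_eqI) (simp only: HT, metis)
  qed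
  have fr: "fn iU (\<lambda>B e. ordrec HT (e 0))" by (intro fn_ordrec[OF loc] dintro)
  have R: "z \<epsilon> ordrec HT a \<longleftrightarrow> z = x \<or> (\<exists>c. c \<epsilon> a \<and> (\<exists>y. y \<epsilon> ordrec HT c \<and> z \<epsilon> y))" if "Ord a" for a z
    unfolding ordrec_eq[OF loc that] HT using ap_lam[OF fr, of _ a] by metis
  have "transitive (ordrec HT omega)"
  proof (rule transI)
    fix y z assume y: "y \<epsilon> ordrec HT omega" and z: "z \<epsilon> y"
    obtain c where c: "c \<epsilon> omega" "y \<epsilon> ordrec HT c"
    proof (cases "y = x")
      case True
      then have "y \<epsilon> ordrec HT emp" using R[of emp] by simp
      then show ?thesis using that emp_omega by blast
    next
      case False
      then obtain c where "c \<epsilon> omega" "\<exists>w. w \<epsilon> ordrec HT c \<and> y \<epsilon> w" using y R[of omega] by auto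
      then have "y \<epsilon> ordrec HT (suc c)" using R[of "suc c"] Ord_suc[OF Ord_nat] by auto
      then show ?thesis using that suc_omega \<open>c \<epsilon> omega\<close> by blast
    qed
    then show "z \<epsilon> ordrec HT omega" using R[of omega z] z by auto
  qed
  moreover have "x \<epsilon> ordrec HT omega" using R[of omega] by simp
  ultimately show ?thesis by blast
qed

text \<open>The intersection of all ordinals a with x \<subseteq> V_a, thus the least one, which is
  the usual rank. As an intersection it is definable before such an ordinal is known to
  exist.\<close>

definition rk :: "'a \<Rightarrow> 'a" where
  "rk x = mkset (\<lambda>b. Ord b \<and> (\<forall>a. Ord a \<longrightarrow> subs x (Vr a) \<longrightarrow> b \<epsilon> a))"

lemma fn_rk [dintro]: "fn iU F \<Longrightarrow> fn iU (\<lambda>B e. rk (F B e))"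
proof (rule fn_comp1[where k = rk])
  show "fn iU (\<lambda>B e. rk (e 0))" unfolding rk_def by (intro dintro)
qed

lemma rk_least:
  assumes a: "Ord a" "subs x (Vr a)"
  shows "Ord (rk x) \<and> subs x (Vr (rk x)) \<and> (rk x \<epsilon> a \<or> rk x = a)"
proof -
  have D: "D iU (\<lambda>B e. subs x (Vr (e 0)))" by (intro dintro)
  obtain m where m: "Ord m" "subs x (Vr m)" "m \<epsilon> a \<or> m = a" "\<And>b. b \<epsilon> m \<Longrightarrow> \<not> subs x (Vr b)"
    by (rule Ord_least[where P = "\<lambda>a. subs x (Vr a)", OF D a]) blast
  have "rk x = m" unfolding rk_def
  proof (rule mkset_unique)
    fix z show "z \<epsilon> m \<longleftrightarrow> Ord z \<and> (\<forall>a. Ord a \<longrightarrow> subs x (Vr a) \<longrightarrow> z \<epsilon> a)"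
    proof
      assume z: "z \<epsilon> m"
      have "z \<epsilon> a" if "Ord a" "subs x (Vr a)" for a
        using Ord_linear[OF that(1) m(1)] m(4) that z Ord_trans by blast
      then show "Ord z \<and> (\<forall>a. Ord a \<longrightarrow> subs x (Vr a) \<longrightarrow> z \<epsilon> a)" using Ord_mem[OF m(1) z] by blast
    qed (use m in blast)
  qed
  then show ?thesis using m by blast
qed

text \<open>In a transitive set, an \<in>-minimal counterexample has only elements with a rank; by
  replacement the successors of these ranks have a supremum, whose stage covers the
  counterexample.\<close>

lemma V_cover: "\<exists>a. Ord a \<and> subs x (Vr a)"
proof (rule ccontr)
  assume n: "\<not> (\<exists>a. Ord a \<and> subs x (Vr a))"
  obtain t where t: "transitive t" "x \<epsilon> t" using TC_ex by blast
  have "D iU (\<lambda>B e. \<not> (\<exists>a. Ord a \<and> subs (e 0) (Vr a)))" by (intro dintro)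
  then obtain m where m: "m \<epsilon> t" "\<not> (\<exists>a. Ord a \<and> subs m (Vr a))"
    "\<And>z. z \<epsilon> t \<Longrightarrow> \<not> (\<exists>a. Ord a \<and> subs z (Vr a)) \<Longrightarrow> \<not> z \<epsilon> m"
    by (rule minimal[where P = "\<lambda>x. \<not> (\<exists>a. Ord a \<and> subs x (Vr a))", OF _ t(2) n]) blast
  have W: "Ord (rk y) \<and> subs y (Vr (rk y))" if "y \<epsilon> m" for y
    using m(3)[OF transD[OF t(1) m(1) that]] that rk_least by blast
  define S where "S = mkset (\<lambda>z. \<exists>y. y \<epsilon> m \<and> z = suc (rk y))"
  have "fn iU (\<lambda>B e. suc (rk (e 0)))" by (intro dintro)
  then have S: "z \<epsilon> S \<longleftrightarrow> (\<exists>y. y \<epsilon> m \<and> z = suc (rk y))" for z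
    unfolding S_def by (rule repl[where F = "\<lambda>y. suc (rk y)"])
  have O: "Ord (Uni S)" by (rule Ord_Uni) (use S W Ord_suc in metis)
  have "y \<epsilon> Vr (Uni S)" if "y \<epsilon> m" for y
  proof -
    have "rk y \<epsilon> Uni S" unfolding Uni_iff S using that suc_iff by blast
    then show ?thesis using Vr_iff[OF O] W[OF that] by blast
  qed
  then have "subs m (Vr (Uni S))" by (rule subsI)
  then show False using m(2) O by blast
qed

lemma Ord_rk [simp]: "Ord (rk x)"
  and subs_Vr_rk [simp]: "subs x (Vr (rk x))"
  using V_cover[of x] rk_least by blast+

lemma mem_Vr_iff: "Ord a \<Longrightarrow> x \<epsilon> Vr a \<longleftrightarrow> rk x \<epsilon> a"
proof
  assume a: "Ord a" "x \<epsilon> Vr a"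
  then obtain c where c: "c \<epsilon> a" "subs x (Vr c)" using Vr_iff by blast
  then show "rk x \<epsilon> a" using rk_least[of c x] Ord_mem[OF a(1) c(1)] Ord_trans[OF a(1) c(1)] by blast
qed (use Vr_iff subs_Vr_rk in blast)

lemma rk_mem: "y \<epsilon> x \<Longrightarrow> rk y \<epsilon> rk x"
  using mem_Vr_iff[OF Ord_rk, of y x] subsD[OF subs_Vr_rk] by blast

lemma eps_induct:
  assumes D: "D iU (\<lambda>B e. P (e 0))" and step: "\<And>x. (\<And>y. y \<epsilon> x \<Longrightarrow> P y) \<Longrightarrow> P x"
  shows "P x"
proof (rule ccontr)
  assume n: "\<not> P x"
  have D': "D iU (\<lambda>B e. \<not> P (e 0))" by (intro dintro D)
  have x: "x \<epsilon> Vr (suc (rk x))" using mem_Vr_iff[OF Ord_suc[OF Ord_rk]] by simp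
  obtain m where m: "m \<epsilon> Vr (suc (rk x))" "\<not> P m" "\<And>z. z \<epsilon> Vr (suc (rk x)) \<Longrightarrow> \<not> P z \<Longrightarrow> \<not> z \<epsilon> m"
    by (rule minimal[where P = "\<lambda>x. \<not> P x", OF D' x n]) blast
  have "P z" if "z \<epsilon> m" for z
    using m(3)[OF Vr_mem_subs[OF Ord_suc[OF Ord_rk] m(1) that]] that by blast
  then show False using step m(2) by blast
qed

section \<open>Limit stages and hereditarily finite sets\<close>

definition limit :: "'a \<Rightarrow> bool" where
  "limit a \<longleftrightarrow> Ord a \<and> emp \<epsilon> a \<and> (\<forall>b. b \<epsilon> a \<longrightarrow> suc b \<epsilon> a)"

lemma limit_omega: "limit omega"
  unfolding limit_def using suc_omega by simp

lemma limit_Ord: "limit a \<Longrightarrow> Ord a"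
  unfolding limit_def by blast

lemma limit_suc: "limit a \<Longrightarrow> b \<epsilon> a \<Longrightarrow> suc b \<epsilon> a"
  unfolding limit_def by blast

lemma Ord_max: "Ord a \<Longrightarrow> b \<epsilon> a \<Longrightarrow> c \<epsilon> a \<Longrightarrow> \<exists>d. d \<epsilon> a \<and> subs b d \<and> subs c d"
  using Ord_linear[of b c] Ord_mem[of a] Ord_subs subs_refl by metis

lemma limit_Vr_pow: "limit a \<Longrightarrow> x \<epsilon> Vr a \<Longrightarrow> pow x \<epsilon> Vr a"
proof -
  assume a: "limit a" and x: "x \<epsilon> Vr a"
  note O = limit_Ord[OF a]
  obtain c where c: "c \<epsilon> a" "subs x (Vr c)" using Vr_iff[OF O] x by blast
  have "subs (pow x) (Vr (suc c))"
    using Vr_iff[OF Ord_suc[OF Ord_mem[OF O c(1)]]] c(2) subs_trans by (intro subsI) (metis pow_iff suc_iff)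
  then show ?thesis using Vr_iff[OF O] limit_suc[OF a c(1)] by blast
qed

lemma limit_Vr_upair: "limit a \<Longrightarrow> x \<epsilon> Vr a \<Longrightarrow> y \<epsilon> Vr a \<Longrightarrow> upair x y \<epsilon> Vr a"
proof -
  assume a: "limit a" and x: "x \<epsilon> Vr a" "y \<epsilon> Vr a"
  note O = limit_Ord[OF a]
  obtain c d where c: "c \<epsilon> a" "subs x (Vr c)" and d: "d \<epsilon> a" "subs y (Vr d)" using Vr_iff[OF O] x by blast
  obtain k where k: "k \<epsilon> a" "subs c k" "subs d k" using Ord_max[OF O c(1) d(1)] by blast
  have Ok: "Ord k" "Ord c" "Ord d" using Ord_mem[OF O] k c d by blast+
  have "subs x (Vr k)" "subs y (Vr k)" using subs_trans Vr_mono_le Ok k c(2) d(2) by blast+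
  then have "subs (upair x y) (Vr (suc k))" using Vr_iff[OF Ord_suc[OF Ok(1)]] by (intro subsI) (metis upair_iff suc_iff)
  then show ?thesis using Vr_iff[OF O] limit_suc[OF a k(1)] by blast
qed

lemma Vr_Uni: "Ord a \<Longrightarrow> x \<epsilon> Vr a \<Longrightarrow> Uni x \<epsilon> Vr a"
proof -
  assume a: "Ord a" "x \<epsilon> Vr a"
  then obtain c where c: "c \<epsilon> a" "subs x (Vr c)" using Vr_iff by blast
  have "subs (Uni x) (Vr c)" using Vr_mem_subs[OF Ord_mem[OF a(1) c(1)]] subsD[OF c(2)] by (intro subsI) (metis Uni_iff)
  then show ?thesis using Vr_iff[OF a(1)] c by blast
qed

lemma limit_emp: "limit a \<Longrightarrow> emp \<epsilon> Vr a"
  using Vr_iff[OF limit_Ord] subsI[of emp] emp_iff unfolding limit_def by metis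

lemma adj_closed_Vr: "limit a \<Longrightarrow> adj_closed (Vr a)"
proof -
  assume a: "limit a"
  have "Uni (upair x (upair y y)) \<epsilon> Vr a" if "x \<epsilon> Vr a" "y \<epsilon> Vr a" for x y
    by (intro Vr_Uni[OF limit_Ord[OF a]] limit_Vr_upair[OF a] that)
  then show ?thesis unfolding adj_closed_def adj_eq using limit_emp[OF a] by simp
qed

lemma D_adj_closed [dintro]:
  assumes "u \<noteq> iT" "fn u F" shows "D u (\<lambda>B e. adj_closed (F B e))"
proof (rule D_comp1[where R = "\<lambda>B. adj_closed", OF _ assms(2)])
  show "D u (\<lambda>B e. adj_closed (e 0))" unfolding adj_closed_def using assms(1) by (intro dintro)
qed

lemma HF_iff: "z \<epsilon> HF \<longleftrightarrow> (\<forall>H. adj_closed H \<longrightarrow> z \<epsilon> H)"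
  unfolding HF_def
  by (rule sep[where P = "\<lambda>z. \<forall>H. adj_closed H \<longrightarrow> z \<epsilon> H" and x = "Vr omega"])
    (intro dintro, use adj_closed_Vr[OF limit_omega] in blast)

lemma adj_closed_HF: "adj_closed HF"
  unfolding adj_closed_def HF_iff by blast

lemma HF_subs: "adj_closed H \<Longrightarrow> subs HF H"
  using HF_iff by (blast intro: subsI)

lemma emp_HF [simp]: "emp \<epsilon> HF"
  and adj_HF: "x \<epsilon> HF \<Longrightarrow> y \<epsilon> HF \<Longrightarrow> adj x y \<epsilon> HF"
  using adj_closed_HF unfolding adj_closed_def by blast+

lemma upair_adj: "upair x y = adj (adj emp x) y"
  by (rule set_eqI) simp

lemma upair_HF: "x \<epsilon> HF \<Longrightarrow> y \<epsilon> HF \<Longrightarrow> upair x y \<epsilon> HF"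
  unfolding upair_adj by (intro adj_HF emp_HF)

lemma opair_HF: "x \<epsilon> HF \<Longrightarrow> y \<epsilon> HF \<Longrightarrow> opair x y \<epsilon> HF"
  unfolding Defs.opair_def by (intro upair_HF)

lemma suc_HF: "x \<epsilon> HF \<Longrightarrow> suc x \<epsilon> HF"
  unfolding suc_adj by (intro adj_HF)

lemma omega_HF: "n \<epsilon> omega \<Longrightarrow> n \<epsilon> HF"
  using omega_iff unfolding inductive_class_def using emp_HF suc_HF by blast

lemma good_omega: "good B \<Longrightarrow> B omega"
  using good_subs[of B HF omega] good_HF[of B] subsI[of omega HF] omega_HF by blast

lemma good_Vr: "limit a \<Longrightarrow> omega \<epsilon> a \<Longrightarrow> good (\<lambda>x. x \<epsilon> Vr a)"
  unfolding good_def
proof (intro conjI allI impI)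
  assume a: "limit a" "omega \<epsilon> a"
  note O = limit_Ord[OF a(1)]
  show "swelled (\<lambda>x. x \<epsilon> Vr a)" by (rule swelled_Vr[OF O a(2)])
  show "HF \<epsilon> Vr a" using Vr_iff[OF O] a(2) HF_subs[OF adj_closed_Vr[OF limit_omega]] by blast
qed (use limit_Vr_upair limit_Vr_pow Vr_Uni[OF limit_Ord] in blast)+

text \<open>A least closed set is defined by an unbounded quantifier over all closed sets. That
  quantifier is replaced by minimality among the subsets of the candidate, which is evaluated
  correctly in every good class.\<close>

lemma fn_least:
  assumes u: "u \<noteq> iT" and C: "\<And>v. v \<noteq> iT \<Longrightarrow> D v (\<lambda>B e. C (e 0))" and k: "C k" "\<And>X. C X \<Longrightarrow> subs k X"
    and B: "\<And>B. good B \<Longrightarrow> B k"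
  shows "fn u (\<lambda>B e. k)"
proof (rule fnI)
  show "B k" if "kind_of u B" for B using B kind_of_good[OF that u] by blast
  have C1: "D u (\<lambda>B e. C (e i))" for i using D_ren[OF C[OF u], of "\<lambda>_. i"] by simp
  have "D u (\<lambda>B e. C (e 0) \<and> (\<forall>X. subs X (e 0) \<longrightarrow> C X \<longrightarrow> X = e 0))"
    by (intro dintro C1)
  then show "D u (\<lambda>B e. e 0 = k)"
    by (rule D_cong) (use k subs_antisym subs_refl in metis)
qed

lemma fn_HF [dintro]: "u \<noteq> iT \<Longrightarrow> fn u (\<lambda>B e. HF)"
  by (rule fn_least[where C = adj_closed], assumption, intro dintro, assumption, rule adj_closed_HF, erule HF_subs, erule good_HF)

lemma fn_omega [dintro]: "u \<noteq> iT \<Longrightarrow> fn u (\<lambda>B e. omega)"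
proof (rule fn_least[where C = inductive_class])
  show "D v (\<lambda>B e. inductive_class (e 0))" if "v \<noteq> iT" for v
    unfolding inductive_class_def using that by (intro dintro)
  show "inductive_class omega" unfolding inductive_class_def using suc_omega by simp
  show "subs omega X" if "inductive_class X" for X using omega_iff that by (blast intro: subsI)
  show "\<And>B. good B \<Longrightarrow> B omega" by (erule good_omega)
qed

lemma HF_induct:
  assumes D: "D iU (\<lambda>B e. P (e 0))" and x: "x \<epsilon> HF" and "P emp"
    and step: "\<And>x y. P x \<Longrightarrow> P y \<Longrightarrow> P (adj x y)"
  shows "P x"
proof -
  obtain S where S: "\<And>z. z \<epsilon> S \<longleftrightarrow> z \<epsilon> HF \<and> P z" using sep_ex[OF D] by blast
  have "adj_closed S" unfolding adj_closed_def using S assms adj_HF emp_HF by blast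
  then show ?thesis using HF_iff x S by blast
qed

text \<open>The axiom of choice is given for disjoint families only. So each Y is replaced by {Y}
  \<times> Y, and a selector for this family is read as a graph.\<close>

lemma choice_fun: "\<exists>h. \<forall>Y. Y \<epsilon> A \<longrightarrow> (\<exists>y. y \<epsilon> Y) \<longrightarrow> ap h Y \<epsilon> Y"
proof -
  have D: "D iU (\<lambda>B e. \<exists>y. y \<epsilon> e 0)" by (intro dintro)
  obtain A' where A': "\<And>Y. Y \<epsilon> A' \<longleftrightarrow> Y \<epsilon> A \<and> (\<exists>y. y \<epsilon> Y)"
    using sep_ex[where P = "\<lambda>Y. \<exists>y. y \<epsilon> Y", OF D, of A] by blast
  define K where "K = mkset (\<lambda>z. \<exists>Y. Y \<epsilon> A' \<and> z = prd (upair Y Y) Y)"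
  have "fn iU (\<lambda>B e. prd (upair (e 0) (e 0)) (e 0))" by (intro dintro)
  then have K: "z \<epsilon> K \<longleftrightarrow> (\<exists>Y. Y \<epsilon> A' \<and> z = prd (upair Y Y) Y)" for z
    unfolding K_def by (rule repl[where F = "\<lambda>Y. prd (upair Y Y) Y"])
  have P: "w \<epsilon> prd (upair Y Y) Y \<longleftrightarrow> (\<exists>y. y \<epsilon> Y \<and> w = opair Y y)" for w Y
    unfolding prd_iff by auto
  have "\<exists>C. \<forall>x. x \<epsilon> K \<longrightarrow> (\<exists>!z. z \<epsilon> x \<and> z \<epsilon> C)"
  proof (rule choice; intro allI impI)
    fix x assume "x \<epsilon> K"
    then show "\<exists>z. z \<epsilon> x" using K A' P by metis
  next
    fix x y z assume a: "x \<epsilon> K \<and> y \<epsilon> K \<and> z \<epsilon> x \<and> z \<epsilon> y"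
    from a K obtain Y where Y: "x = prd (upair Y Y) Y" by metis
    from a K obtain Y' where Y': "y = prd (upair Y' Y') Y'" by metis
    show "x = y" using a unfolding Y Y' P by auto
  qed
  then obtain C where C: "\<And>x. x \<epsilon> K \<Longrightarrow> \<exists>!z. z \<epsilon> x \<and> z \<epsilon> C" by blast
  define g where "g Y = mkset (\<lambda>z. \<exists>y. y \<epsilon> Y \<and> (opair Y y \<epsilon> C \<and> z \<epsilon> y))" for Y
  have g: "fn iU (\<lambda>B e. g (e 0))" unfolding g_def by (intro dintro)
  have "ap (lam A g) Y \<epsilon> Y" if Y: "Y \<epsilon> A" "\<exists>y. y \<epsilon> Y" for Y
  proof -
    have "Y \<epsilon> A'" using A' Y by blast
    then have "prd (upair Y Y) Y \<epsilon> K" using K by blast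
    from C[OF this] obtain z where z: "z \<epsilon> prd (upair Y Y) Y" "z \<epsilon> C"
      "\<And>z'. z' \<epsilon> prd (upair Y Y) Y \<Longrightarrow> z' \<epsilon> C \<Longrightarrow> z' = z" by blast
    then obtain y where y: "y \<epsilon> Y" "z = opair Y y" using P by blast
    have u: "y' = y" if "y' \<epsilon> Y" "opair Y y' \<epsilon> C" for y'
      using z(3)[of "opair Y y'"] that y by simp
    have "g Y = y" unfolding g_def
      by (rule mkset_unique) (use u y z(2) in blast)
    then show ?thesis using ap_lam[OF g Y(1)] y(1) by simp
  qed
  then show ?thesis by blast
qed

subsection \<open>Formulas of the model\<close>

lemma HF_trans: "x \<epsilon> HF \<Longrightarrow> y \<epsilon> x \<Longrightarrow> y \<epsilon> HF"
proof -
  have D: "D iU (\<lambda>B e. e 0 \<epsilon> HF \<and> subs (e 0) HF)" by (intro dintro)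
  have "x \<epsilon> HF \<Longrightarrow> x \<epsilon> HF \<and> subs x HF"
    by (rule HF_induct[where P = "\<lambda>x. x \<epsilon> HF \<and> subs x HF", OF D])
      (auto simp: Defs.subs_def intro: adj_HF)
  then show "x \<epsilon> HF \<Longrightarrow> y \<epsilon> x \<Longrightarrow> y \<epsilon> HF" using subsD by blast
qed

lemma opair_HF_iff [simp]: "opair x y \<epsilon> HF \<longleftrightarrow> x \<epsilon> HF \<and> y \<epsilon> HF"
proof
  assume a: "opair x y \<epsilon> HF"
  have "upair x y \<epsilon> opair x y" by (simp add: Defs.opair_def)
  then have "upair x y \<epsilon> HF" using HF_trans a by blast
  then show "x \<epsilon> HF \<and> y \<epsilon> HF" using HF_trans upair_iff by blast
qed (blast intro: opair_HF)

lemma tag_0 [simp]: "tag 0 = emp" and tag_Suc: "tag (Suc n) = suc (tag n)"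
  by (simp_all add: Defs.tag_def)

lemma tag_omega [simp]: "tag n \<epsilon> omega"
  by (induction n) (simp_all add: tag_Suc suc_omega)

lemma tag_HF [simp]: "tag n \<epsilon> HF"
  by (rule omega_HF) simp

lemma tag_eq [simp]: "tag m = tag n \<longleftrightarrow> m = n"
proof (induction m arbitrary: n)
  case 0 show ?case by (cases n) (simp_all add: tag_Suc)
next
  case (Suc m) then show ?case by (cases n) (simp_all add: tag_Suc)
qed

lemma emp_tag [simp]: "emp = tag n \<longleftrightarrow> n = 0" "tag n = emp \<longleftrightarrow> n = 0"
  using tag_eq[of 0 n] tag_eq[of n 0] by auto

lemma fn_tag [dintro]: "u \<noteq> iT \<Longrightarrow> fn u (\<lambda>B e. tag n)"
proof (induction n)
  case 0 then show ?case unfolding tag_0 by (intro dintro)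
next
  case (Suc n) then show ?case unfolding tag_Suc by (intro dintro)
qed

lemmas code_defs = Defs.cMem_def Defs.cEq_def Defs.cMem2_def Defs.cNeg_def Defs.cAnd_def Defs.cEx_def Defs.cEx2_def

lemma code_inject [simp]:
  "cMem i j = cMem i' j' \<longleftrightarrow> i = i' \<and> j = j'" "cEq i j = cEq i' j' \<longleftrightarrow> i = i' \<and> j = j'"
  "cMem2 i j = cMem2 i' j' \<longleftrightarrow> i = i' \<and> j = j'" "cNeg p = cNeg p' \<longleftrightarrow> p = p'"
  "cAnd p q = cAnd p' q' \<longleftrightarrow> p = p' \<and> q = q'" "cEx i p = cEx i' p' \<longleftrightarrow> i = i' \<and> p = p'"
  "cEx2 i p = cEx2 i' p' \<longleftrightarrow> i = i' \<and> p = p'"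
  unfolding code_defs by simp_all

lemma code_distinct1:
  "cMem i j \<noteq> cEq i' j'" "cMem i j \<noteq> cMem2 i' j'" "cMem i j \<noteq> cNeg p'" "cMem i j \<noteq> cAnd p' q'"
  "cMem i j \<noteq> cEx i' p'" "cMem i j \<noteq> cEx2 i' p'"
  "cEq i j \<noteq> cMem2 i' j'" "cEq i j \<noteq> cNeg p'" "cEq i j \<noteq> cAnd p' q'"
  "cEq i j \<noteq> cEx i' p'" "cEq i j \<noteq> cEx2 i' p'"
  "cMem2 i j \<noteq> cNeg p'" "cMem2 i j \<noteq> cAnd p' q'" "cMem2 i j \<noteq> cEx i' p'" "cMem2 i j \<noteq> cEx2 i' p'"
  "cNeg p \<noteq> cAnd p' q'" "cNeg p \<noteq> cEx i' p'" "cNeg p \<noteq> cEx2 i' p'"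
  "cAnd p q \<noteq> cEx i' p'" "cAnd p q \<noteq> cEx2 i' p'" "cEx i p \<noteq> cEx2 i' p'"
  unfolding code_defs by simp_all

lemmas code_distinct [simp] = code_distinct1 code_distinct1[symmetric]

lemma code_HF [simp]:
  "cMem i j \<epsilon> HF \<longleftrightarrow> i \<epsilon> HF \<and> j \<epsilon> HF" "cEq i j \<epsilon> HF \<longleftrightarrow> i \<epsilon> HF \<and> j \<epsilon> HF"
  "cMem2 i j \<epsilon> HF \<longleftrightarrow> i \<epsilon> HF \<and> j \<epsilon> HF" "cNeg p \<epsilon> HF \<longleftrightarrow> p \<epsilon> HF"
  "cAnd p q \<epsilon> HF \<longleftrightarrow> p \<epsilon> HF \<and> q \<epsilon> HF" "cEx i p \<epsilon> HF \<longleftrightarrow> i \<epsilon> HF \<and> p \<epsilon> HF"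
  "cEx2 i p \<epsilon> HF \<longleftrightarrow> i \<epsilon> HF \<and> p \<epsilon> HF"
  unfolding code_defs by simp_all

lemma fn_code [dintro]:
  assumes u: "u \<noteq> iT" "fn u F"
  shows "fn u G \<Longrightarrow> fn u (\<lambda>B e. cMem (F B e) (G B e))" "fn u G \<Longrightarrow> fn u (\<lambda>B e. cEq (F B e) (G B e))"
    "fn u G \<Longrightarrow> fn u (\<lambda>B e. cMem2 (F B e) (G B e))" "fn u (\<lambda>B e. cNeg (F B e))"
    "fn u G \<Longrightarrow> fn u (\<lambda>B e. cAnd (F B e) (G B e))" "fn u G \<Longrightarrow> fn u (\<lambda>B e. cEx (F B e) (G B e))"
    "fn u G \<Longrightarrow> fn u (\<lambda>B e. cEx2 (F B e) (G B e))"
    "fn u (\<lambda>B e. var1 (F B e))" "fn u (\<lambda>B e. var2 (F B e))"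
  unfolding code_defs Defs.var1_def Defs.var2_def by ((intro dintro u | assumption)+)

lemma var_eq [simp]: "var1 i = var1 j \<longleftrightarrow> i = j" "var2 i = var2 j \<longleftrightarrow> i = j" "var1 i \<noteq> var2 j" "var2 i \<noteq> var1 j"
  unfolding Defs.var1_def Defs.var2_def by simp_all

lemma fo_closed_iff: "fo_closed X \<longleftrightarrow>
   (\<forall>i. i \<epsilon> omega \<longrightarrow> (\<forall>j. j \<epsilon> omega \<longrightarrow> cMem i j \<epsilon> X \<and> cEq i j \<epsilon> X)) \<and>
   (\<forall>p. p \<epsilon> X \<longrightarrow> cNeg p \<epsilon> X) \<and> (\<forall>p. p \<epsilon> X \<longrightarrow> (\<forall>q. q \<epsilon> X \<longrightarrow> cAnd p q \<epsilon> X)) \<and>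
   (\<forall>i. i \<epsilon> omega \<longrightarrow> (\<forall>p. p \<epsilon> X \<longrightarrow> cEx i p \<epsilon> X))"
  unfolding Defs.fo_closed_def by blast

lemma so_closed_iff: "so_closed X \<longleftrightarrow> fo_closed X \<and>
   (\<forall>i. i \<epsilon> omega \<longrightarrow> (\<forall>j. j \<epsilon> omega \<longrightarrow> cMem2 i j \<epsilon> X)) \<and>
   (\<forall>i. i \<epsilon> omega \<longrightarrow> (\<forall>p. p \<epsilon> X \<longrightarrow> cEx2 i p \<epsilon> X))"
  unfolding Defs.so_closed_def by blast

lemma delta0_closed_iff: "delta0_closed X \<longleftrightarrow>
   (\<forall>i. i \<epsilon> omega \<longrightarrow> (\<forall>j. j \<epsilon> omega \<longrightarrow> cMem i j \<epsilon> X \<and> cEq i j \<epsilon> X)) \<and>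
   (\<forall>p. p \<epsilon> X \<longrightarrow> cNeg p \<epsilon> X) \<and> (\<forall>p. p \<epsilon> X \<longrightarrow> (\<forall>q. q \<epsilon> X \<longrightarrow> cAnd p q \<epsilon> X)) \<and>
   (\<forall>i. i \<epsilon> omega \<longrightarrow> (\<forall>j. j \<epsilon> omega \<longrightarrow> (\<forall>p. p \<epsilon> X \<longrightarrow> i \<noteq> j \<longrightarrow> cEx i (cAnd (cMem i j) p) \<epsilon> X)))"
  unfolding Defs.delta0_closed_def by blast

lemma D_fo_closed: "u \<noteq> iT \<Longrightarrow> D u (\<lambda>B e. fo_closed (e i))"
  unfolding fo_closed_iff by (intro dintro)

lemma D_so_closed: "u \<noteq> iT \<Longrightarrow> D u (\<lambda>B e. so_closed (e i))"
  unfolding so_closed_iff by (intro dintro D_fo_closed)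

lemma D_delta0_closed: "u \<noteq> iT \<Longrightarrow> D u (\<lambda>B e. delta0_closed (e i))"
  unfolding delta0_closed_iff by (intro dintro)

lemma HF_closed: "so_closed HF" "fo_closed HF" "delta0_closed HF"
  unfolding so_closed_iff fo_closed_iff delta0_closed_iff by (simp_all add: omega_HF)

text \<open>The classes of formulas are sets because \<open>HF\<close> is closed under the formation
  rules.\<close>

definition FoF where "FoF = mkset (\<lambda>p. fo_formula p)"
definition SoF where "SoF = mkset (\<lambda>p. so_formula p)"
definition D0F where "D0F = mkset (\<lambda>p. delta0_formula p)"

lemma FoF_iff: "p \<epsilon> FoF \<longleftrightarrow> fo_formula p"
  unfolding FoF_def Defs.fo_formula_def
  by (rule sep[where P = "\<lambda>p. \<forall>X. fo_closed X \<longrightarrow> p \<epsilon> X" and x = HF])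
    (intro dintro D_fo_closed, use HF_closed in blast)

lemma SoF_iff: "p \<epsilon> SoF \<longleftrightarrow> so_formula p"
  unfolding SoF_def Defs.so_formula_def
  by (rule sep[where P = "\<lambda>p. \<forall>X. so_closed X \<longrightarrow> p \<epsilon> X" and x = HF])
    (intro dintro D_so_closed, use HF_closed in blast)

lemma D0F_iff: "p \<epsilon> D0F \<longleftrightarrow> delta0_formula p"
  unfolding D0F_def Defs.delta0_formula_def
  by (rule sep[where P = "\<lambda>p. \<forall>X. delta0_closed X \<longrightarrow> p \<epsilon> X" and x = HF])
    (intro dintro D_delta0_closed, use HF_closed in blast)

lemma fo_closedD:
  assumes "fo_closed X"
  shows "i \<epsilon> omega \<Longrightarrow> j \<epsilon> omega \<Longrightarrow> cMem i j \<epsilon> X" "i \<epsilon> omega \<Longrightarrow> j \<epsilon> omega \<Longrightarrow> cEq i j \<epsilon> X"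
    "p \<epsilon> X \<Longrightarrow> cNeg p \<epsilon> X" "p \<epsilon> X \<Longrightarrow> q \<epsilon> X \<Longrightarrow> cAnd p q \<epsilon> X" "i \<epsilon> omega \<Longrightarrow> p \<epsilon> X \<Longrightarrow> cEx i p \<epsilon> X"
  using assms unfolding fo_closed_iff by simp_all

lemma so_closedD:
  assumes "so_closed X"
  shows "fo_closed X" "i \<epsilon> omega \<Longrightarrow> j \<epsilon> omega \<Longrightarrow> cMem2 i j \<epsilon> X" "i \<epsilon> omega \<Longrightarrow> p \<epsilon> X \<Longrightarrow> cEx2 i p \<epsilon> X"
  using assms unfolding so_closed_iff by simp_all

lemma delta0_closedD:
  assumes "delta0_closed X"
  shows "i \<epsilon> omega \<Longrightarrow> j \<epsilon> omega \<Longrightarrow> cMem i j \<epsilon> X" "i \<epsilon> omega \<Longrightarrow> j \<epsilon> omega \<Longrightarrow> cEq i j \<epsilon> X"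
    "p \<epsilon> X \<Longrightarrow> cNeg p \<epsilon> X" "p \<epsilon> X \<Longrightarrow> q \<epsilon> X \<Longrightarrow> cAnd p q \<epsilon> X"
    "i \<epsilon> omega \<Longrightarrow> j \<epsilon> omega \<Longrightarrow> i \<noteq> j \<Longrightarrow> p \<epsilon> X \<Longrightarrow> cEx i (cAnd (cMem i j) p) \<epsilon> X"
  using assms unfolding delta0_closed_iff by simp_all

lemma fo_intros:
  "i \<epsilon> omega \<Longrightarrow> j \<epsilon> omega \<Longrightarrow> fo_formula (cMem i j)" "i \<epsilon> omega \<Longrightarrow> j \<epsilon> omega \<Longrightarrow> fo_formula (cEq i j)"
  "fo_formula p \<Longrightarrow> fo_formula (cNeg p)" "fo_formula p \<Longrightarrow> fo_formula q \<Longrightarrow> fo_formula (cAnd p q)"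
  "i \<epsilon> omega \<Longrightarrow> fo_formula p \<Longrightarrow> fo_formula (cEx i p)"
  unfolding Defs.fo_formula_def by (blast intro: fo_closedD)+

lemma so_intros:
  "i \<epsilon> omega \<Longrightarrow> j \<epsilon> omega \<Longrightarrow> so_formula (cMem i j)" "i \<epsilon> omega \<Longrightarrow> j \<epsilon> omega \<Longrightarrow> so_formula (cEq i j)"
  "i \<epsilon> omega \<Longrightarrow> j \<epsilon> omega \<Longrightarrow> so_formula (cMem2 i j)"
  "so_formula p \<Longrightarrow> so_formula (cNeg p)" "so_formula p \<Longrightarrow> so_formula q \<Longrightarrow> so_formula (cAnd p q)"
  "i \<epsilon> omega \<Longrightarrow> so_formula p \<Longrightarrow> so_formula (cEx i p)" "i \<epsilon> omega \<Longrightarrow> so_formula p \<Longrightarrow> so_formula (cEx2 i p)"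
  unfolding Defs.so_formula_def by (blast intro: fo_closedD so_closedD)+

lemma delta0_intros:
  "i \<epsilon> omega \<Longrightarrow> j \<epsilon> omega \<Longrightarrow> delta0_formula (cMem i j)" "i \<epsilon> omega \<Longrightarrow> j \<epsilon> omega \<Longrightarrow> delta0_formula (cEq i j)"
  "delta0_formula p \<Longrightarrow> delta0_formula (cNeg p)" "delta0_formula p \<Longrightarrow> delta0_formula q \<Longrightarrow> delta0_formula (cAnd p q)"
  "i \<epsilon> omega \<Longrightarrow> j \<epsilon> omega \<Longrightarrow> i \<noteq> j \<Longrightarrow> delta0_formula p \<Longrightarrow> delta0_formula (cEx i (cAnd (cMem i j) p))"
  unfolding Defs.delta0_formula_def by (blast intro: delta0_closedD)+

lemma fo_so: "fo_formula p \<Longrightarrow> so_formula p"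
  unfolding Defs.fo_formula_def Defs.so_formula_def by (blast intro: so_closedD)

lemma delta0_fo: "delta0_formula p \<Longrightarrow> fo_formula p"
proof -
  have "delta0_closed FoF" unfolding delta0_closed_iff FoF_iff by (simp add: fo_intros)
  then show "delta0_formula p \<Longrightarrow> fo_formula p" unfolding Defs.delta0_formula_def using FoF_iff by blast
qed

lemma formula_HF: "so_formula p \<Longrightarrow> p \<epsilon> HF"
  unfolding Defs.so_formula_def using HF_closed by blast

text \<open>Formulas of the model may be nonstandard, so induction is available for definable
  properties only: separation gives the set of formulas with the property, and this set is closed
  under the rules.\<close>

lemma so_induct [consumes 2, case_names Mem Eq Mem2 Neg And Ex Ex2]:
  assumes D: "D iU (\<lambda>B e. P (e 0))" and p: "so_formula p"
    and c: "\<And>i j. i \<epsilon> omega \<Longrightarrow> j \<epsilon> omega \<Longrightarrow> P (cMem i j)"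
    "\<And>i j. i \<epsilon> omega \<Longrightarrow> j \<epsilon> omega \<Longrightarrow> P (cEq i j)"
    "\<And>i j. i \<epsilon> omega \<Longrightarrow> j \<epsilon> omega \<Longrightarrow> P (cMem2 i j)"
    "\<And>p. so_formula p \<Longrightarrow> P p \<Longrightarrow> P (cNeg p)"
    "\<And>p q. so_formula p \<Longrightarrow> P p \<Longrightarrow> so_formula q \<Longrightarrow> P q \<Longrightarrow> P (cAnd p q)"
    "\<And>i p. i \<epsilon> omega \<Longrightarrow> so_formula p \<Longrightarrow> P p \<Longrightarrow> P (cEx i p)"
    "\<And>i p. i \<epsilon> omega \<Longrightarrow> so_formula p \<Longrightarrow> P p \<Longrightarrow> P (cEx2 i p)"
  shows "P p"
proof -
  obtain S where S: "\<And>z. z \<epsilon> S \<longleftrightarrow> z \<epsilon> SoF \<and> P z" using sep_ex[OF D] by blast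
  have "so_closed S" unfolding so_closed_iff fo_closed_iff S SoF_iff by (simp add: c so_intros)
  then show ?thesis using p S unfolding Defs.so_formula_def by blast
qed

lemma fo_induct [consumes 2, case_names Mem Eq Neg And Ex]:
  assumes D: "D iU (\<lambda>B e. P (e 0))" and p: "fo_formula p"
    and c: "\<And>i j. i \<epsilon> omega \<Longrightarrow> j \<epsilon> omega \<Longrightarrow> P (cMem i j)"
    "\<And>i j. i \<epsilon> omega \<Longrightarrow> j \<epsilon> omega \<Longrightarrow> P (cEq i j)"
    "\<And>p. fo_formula p \<Longrightarrow> P p \<Longrightarrow> P (cNeg p)"
    "\<And>p q. fo_formula p \<Longrightarrow> P p \<Longrightarrow> fo_formula q \<Longrightarrow> P q \<Longrightarrow> P (cAnd p q)"
    "\<And>i p. i \<epsilon> omega \<Longrightarrow> fo_formula p \<Longrightarrow> P p \<Longrightarrow> P (cEx i p)"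
  shows "P p"
proof -
  obtain S where S: "\<And>z. z \<epsilon> S \<longleftrightarrow> z \<epsilon> FoF \<and> P z" using sep_ex[OF D] by blast
  have "fo_closed S" unfolding fo_closed_iff S FoF_iff by (simp add: c fo_intros)
  then show ?thesis using p S unfolding Defs.fo_formula_def by blast
qed

lemma delta0_induct [consumes 2, case_names Mem Eq Neg And Ex]:
  assumes D: "D iU (\<lambda>B e. P (e 0))" and p: "delta0_formula p"
    and c: "\<And>i j. i \<epsilon> omega \<Longrightarrow> j \<epsilon> omega \<Longrightarrow> P (cMem i j)"
    "\<And>i j. i \<epsilon> omega \<Longrightarrow> j \<epsilon> omega \<Longrightarrow> P (cEq i j)"
    "\<And>p. delta0_formula p \<Longrightarrow> P p \<Longrightarrow> P (cNeg p)"
    "\<And>p q. delta0_formula p \<Longrightarrow> P p \<Longrightarrow> delta0_formula q \<Longrightarrow> P q \<Longrightarrow> P (cAnd p q)"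
    "\<And>i j p. i \<epsilon> omega \<Longrightarrow> j \<epsilon> omega \<Longrightarrow> i \<noteq> j \<Longrightarrow> delta0_formula p \<Longrightarrow> P p \<Longrightarrow> P (cEx i (cAnd (cMem i j) p))"
  shows "P p"
proof -
  obtain S where S: "\<And>z. z \<epsilon> S \<longleftrightarrow> z \<epsilon> D0F \<and> P z" using sep_ex[OF D] by blast
  have "delta0_closed S" unfolding delta0_closed_iff S D0F_iff by (simp add: c delta0_intros)
  then show ?thesis using p S unfolding Defs.delta0_formula_def by blast
qed

lemma good_SoF: "good B \<Longrightarrow> B SoF"
  using good_subs[of B HF SoF] good_HF[of B] subsI[of SoF HF] formula_HF SoF_iff by blast

lemma good_FoF: "good B \<Longrightarrow> B FoF"
  using good_subs[of B HF FoF] good_HF[of B] subsI[of FoF HF] formula_HF fo_so FoF_iff by blast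

lemma fn_SoF [dintro]: "u \<noteq> iT \<Longrightarrow> fn u (\<lambda>B e. SoF)"
proof (rule fn_least[where C = so_closed])
  show "D v (\<lambda>B e. so_closed (e 0))" if "v \<noteq> iT" for v using that by (rule D_so_closed)
  show "so_closed SoF" unfolding so_closed_iff fo_closed_iff SoF_iff by (simp add: so_intros)
  show "subs SoF X" if "so_closed X" for X using that SoF_iff unfolding Defs.so_formula_def by (blast intro: subsI)
  show "\<And>B. good B \<Longrightarrow> B SoF" by (erule good_SoF)
qed

lemma fn_FoF [dintro]: "u \<noteq> iT \<Longrightarrow> fn u (\<lambda>B e. FoF)"
proof (rule fn_least[where C = fo_closed])
  show "D v (\<lambda>B e. fo_closed (e 0))" if "v \<noteq> iT" for v using that by (rule D_fo_closed)
  show "fo_closed FoF" unfolding fo_closed_iff FoF_iff by (simp add: fo_intros)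
  show "subs FoF X" if "fo_closed X" for X using that FoF_iff unfolding Defs.fo_formula_def by (blast intro: subsI)
  show "\<And>B. good B \<Longrightarrow> B FoF" by (erule good_FoF)
qed

lemma D_so_formula [dintro]: "u \<noteq> iT \<Longrightarrow> fn u F \<Longrightarrow> D u (\<lambda>B e. so_formula (F B e))"
  unfolding SoF_iff[symmetric] by (intro dintro)

lemma D_fo_formula [dintro]: "u \<noteq> iT \<Longrightarrow> fn u F \<Longrightarrow> D u (\<lambda>B e. fo_formula (F B e))"
  unfolding FoF_iff[symmetric] by (intro dintro)

lemma D_delta0_formula [dintro]: "fn iU F \<Longrightarrow> D iU (\<lambda>B e. delta0_formula (F B e))"
  unfolding D0F_iff[symmetric] by (intro dintro)

text \<open>Both components of a pair in \<open>F\<close> lie in the double union of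
  \<open>F\<close>, which bounds the quantifiers over variables and formulas.\<close>

lemma free_closed_iff: "free_closed F \<longleftrightarrow>
   (\<forall>i. i \<epsilon> omega \<longrightarrow> (\<forall>j. j \<epsilon> omega \<longrightarrow>
      opair (var1 i) (cMem i j) \<epsilon> F \<and> opair (var1 j) (cMem i j) \<epsilon> F \<and>
      opair (var1 i) (cEq i j) \<epsilon> F \<and> opair (var1 j) (cEq i j) \<epsilon> F \<and>
      opair (var1 i) (cMem2 i j) \<epsilon> F \<and> opair (var2 j) (cMem2 i j) \<epsilon> F)) \<and>
   (\<forall>v. v \<epsilon> Uni (Uni F) \<longrightarrow> (\<forall>p. p \<epsilon> Uni (Uni F) \<longrightarrow> opair v p \<epsilon> F \<longrightarrow> opair v (cNeg p) \<epsilon> F)) \<and>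
   (\<forall>v. v \<epsilon> Uni (Uni F) \<longrightarrow> (\<forall>p. p \<epsilon> Uni (Uni F) \<longrightarrow> (\<forall>q. q \<epsilon> SoF \<longrightarrow> opair v p \<epsilon> F \<longrightarrow>
      opair v (cAnd p q) \<epsilon> F \<and> opair v (cAnd q p) \<epsilon> F))) \<and>
   (\<forall>v. v \<epsilon> Uni (Uni F) \<longrightarrow> (\<forall>p. p \<epsilon> Uni (Uni F) \<longrightarrow> (\<forall>i. i \<epsilon> omega \<longrightarrow> opair v p \<epsilon> F \<longrightarrow>
      v \<noteq> var1 i \<longrightarrow> opair v (cEx i p) \<epsilon> F))) \<and>
   (\<forall>v. v \<epsilon> Uni (Uni F) \<longrightarrow> (\<forall>p. p \<epsilon> Uni (Uni F) \<longrightarrow> (\<forall>i. i \<epsilon> omega \<longrightarrow> opair v p \<epsilon> F \<longrightarrow>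
      v \<noteq> var2 i \<longrightarrow> opair v (cEx2 i p) \<epsilon> F)))"
proof -
  have *: "opair v p \<epsilon> F \<longleftrightarrow> v \<epsilon> Uni (Uni F) \<and> p \<epsilon> Uni (Uni F) \<and> opair v p \<epsilon> F" for v p
    using opair_Uni by blast
  show ?thesis
    unfolding Defs.free_closed_def SoF_iff
  proof (intro conj_cong refl, goal_cases)
    case 1 show ?case by blast
  next
    case 2 show ?case using * by metis
  next
    case 3 show ?case using * by metis
  next
    case 4 show ?case using * by metis
  next
    case 5 show ?case using * by metis
  qed
qed

lemma D_free_closed: "u \<noteq> iT \<Longrightarrow> D u (\<lambda>B e. free_closed (e i))"
  unfolding free_closed_iff by (intro dintro)

lemma free_closed_HF: "free_closed HF"
  unfolding free_closed_iff using formula_HF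
  by (simp add: omega_HF Defs.var1_def Defs.var2_def SoF_iff)

definition Free where "Free = mkset (\<lambda>z. \<forall>F. free_closed F \<longrightarrow> z \<epsilon> F)"

lemma Free_iff: "z \<epsilon> Free \<longleftrightarrow> (\<forall>F. free_closed F \<longrightarrow> z \<epsilon> F)"
  unfolding Free_def
  by (rule sep[where P = "\<lambda>z. \<forall>F. free_closed F \<longrightarrow> z \<epsilon> F" and x = HF])
    (intro dintro D_free_closed, use free_closed_HF in blast)

lemma free_in_iff: "free_in v p \<longleftrightarrow> opair v p \<epsilon> Free"
  unfolding Defs.free_in_def Free_iff ..

lemma free_closed_Free: "free_closed Free"
  unfolding Defs.free_closed_def Free_iff by blast

lemma free_in_HF: "free_in v p \<Longrightarrow> v \<epsilon> HF \<and> p \<epsilon> HF"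
  unfolding Defs.free_in_def using free_closed_HF opair_HF_iff by blast

lemma good_Free: "good B \<Longrightarrow> B Free"
  using good_subs[of B HF Free] good_HF[of B] subsI[of Free HF] Free_iff free_closed_HF by blast

lemma fn_Free [dintro]: "u \<noteq> iT \<Longrightarrow> fn u (\<lambda>B e. Free)"
proof (rule fn_least[where C = free_closed])
  show "D v (\<lambda>B e. free_closed (e 0))" if "v \<noteq> iT" for v using that by (rule D_free_closed)
  show "free_closed Free" by (rule free_closed_Free)
  show "subs Free X" if "free_closed X" for X using that Free_iff by (blast intro: subsI)
  show "\<And>B. good B \<Longrightarrow> B Free" by (erule good_Free)
qed

lemma D_free_in [dintro]: "u \<noteq> iT \<Longrightarrow> fn u F \<Longrightarrow> fn u G \<Longrightarrow> D u (\<lambda>B e. free_in (F B e) (G B e))"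
  unfolding free_in_iff by (intro dintro)

lemma sentence_iff:
  "fo_sentence p \<longleftrightarrow> fo_formula p \<and> \<not> (\<exists>v. v \<epsilon> HF \<and> free_in v p)"
  "so_sentence p \<longleftrightarrow> so_formula p \<and> \<not> (\<exists>v. v \<epsilon> HF \<and> free_in v p)"
  unfolding Defs.fo_sentence_def Defs.so_sentence_def using free_in_HF by blast+

lemma D_sentence [dintro]:
  assumes u: "u \<noteq> iT" and F: "fn u F"
  shows "D u (\<lambda>B e. fo_sentence (F B e))" "D u (\<lambda>B e. so_sentence (F B e))"
  unfolding sentence_iff by (intro dintro u F fn_weaken[OF F])+

lemma free_intros:
  "i \<epsilon> omega \<Longrightarrow> j \<epsilon> omega \<Longrightarrow> free_in (var1 i) (cMem i j)"
  "i \<epsilon> omega \<Longrightarrow> j \<epsilon> omega \<Longrightarrow> free_in (var1 j) (cMem i j)"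
  "i \<epsilon> omega \<Longrightarrow> j \<epsilon> omega \<Longrightarrow> free_in (var1 i) (cEq i j)"
  "i \<epsilon> omega \<Longrightarrow> j \<epsilon> omega \<Longrightarrow> free_in (var1 j) (cEq i j)"
  "i \<epsilon> omega \<Longrightarrow> j \<epsilon> omega \<Longrightarrow> free_in (var1 i) (cMem2 i j)"
  "i \<epsilon> omega \<Longrightarrow> j \<epsilon> omega \<Longrightarrow> free_in (var2 j) (cMem2 i j)"
  "free_in v p \<Longrightarrow> free_in v (cNeg p)"
  "free_in v p \<Longrightarrow> so_formula q \<Longrightarrow> free_in v (cAnd p q)"
  "free_in v p \<Longrightarrow> so_formula q \<Longrightarrow> free_in v (cAnd q p)"
  "free_in v p \<Longrightarrow> i \<epsilon> omega \<Longrightarrow> v \<noteq> var1 i \<Longrightarrow> free_in v (cEx i p)"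
  "free_in v p \<Longrightarrow> i \<epsilon> omega \<Longrightarrow> v \<noteq> var2 i \<Longrightarrow> free_in v (cEx2 i p)"
  using free_closed_Free unfolding Defs.free_closed_def free_in_iff by blast+

definition free_step :: "'a \<Rightarrow> 'a \<Rightarrow> bool" where
  "free_step v p \<longleftrightarrow>
    (\<exists>i j. i \<epsilon> omega \<and> j \<epsilon> omega \<and> (p = cMem i j \<and> (v = var1 i \<or> v = var1 j) \<or>
      p = cEq i j \<and> (v = var1 i \<or> v = var1 j) \<or> p = cMem2 i j \<and> (v = var1 i \<or> v = var2 j))) \<or>
    (\<exists>q. p = cNeg q \<and> free_in v q) \<or> (\<exists>q r. p = cAnd q r \<and> (free_in v q \<or> free_in v r)) \<or>
    (\<exists>i q. p = cEx i q \<and> v \<noteq> var1 i \<and> free_in v q) \<or> (\<exists>i q. p = cEx2 i q \<and> v \<noteq> var2 i \<and> free_in v q)"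

text \<open>The pairs in \<open>Free\<close> that arise by a last rule from pairs in
  \<open>Free\<close> again form a closed set, which therefore is all of
  \<open>Free\<close>.\<close>

lemma free_step: "free_in v p \<Longrightarrow> free_step v p"
proof -
  assume f: "free_in v p"
  have "D iU (\<lambda>B e. \<exists>v p. e 0 = opair v p \<and> free_step v p)"
    unfolding free_step_def by (intro dintro)
  then obtain S where S: "\<And>z. z \<epsilon> S \<longleftrightarrow> z \<epsilon> Free \<and> (\<exists>v p. z = opair v p \<and> free_step v p)"
    using sep_ex[where P = "\<lambda>z. \<exists>v p. z = opair v p \<and> free_step v p" and x = Free] by blast
  have S': "opair v p \<epsilon> S \<longleftrightarrow> free_in v p \<and> free_step v p" for v p
    unfolding S free_in_iff by auto
  have "free_closed S"
    unfolding Defs.free_closed_def S'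
  proof (intro conjI allI impI)
    fix i j assume "i \<epsilon> omega \<and> j \<epsilon> omega"
    then show "free_step (var1 i) (cMem i j)" "free_step (var1 j) (cMem i j)" "free_step (var1 i) (cEq i j)"
      "free_step (var1 j) (cEq i j)" "free_step (var1 i) (cMem2 i j)" "free_step (var2 j) (cMem2 i j)"
      unfolding free_step_def by blast+
  next
    fix v p assume "free_in v p \<and> free_step v p" then show "free_step v (cNeg p)" unfolding free_step_def by blast
  next
    fix v p q assume "(free_in v p \<and> free_step v p) \<and> so_formula q"
    then show "free_step v (cAnd p q)" "free_step v (cAnd q p)" unfolding free_step_def by blast+
  next
    fix v p i assume "(free_in v p \<and> free_step v p) \<and> i \<epsilon> omega \<and> v \<noteq> var1 i"
    then show "free_step v (cEx i p)" unfolding free_step_def by blast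
  next
    fix v p i assume "(free_in v p \<and> free_step v p) \<and> i \<epsilon> omega \<and> v \<noteq> var2 i"
    then show "free_step v (cEx2 i p)" unfolding free_step_def by blast
  qed (simp_all add: free_intros)
  then show ?thesis using f S' unfolding Defs.free_in_def by blast
qed

lemma free_invs:
  "free_in v (cMem i j) \<Longrightarrow> v = var1 i \<or> v = var1 j"
  "free_in v (cEq i j) \<Longrightarrow> v = var1 i \<or> v = var1 j"
  "free_in v (cMem2 i j) \<Longrightarrow> v = var1 i \<or> v = var2 j"
  "free_in v (cNeg p) \<Longrightarrow> free_in v p"
  "free_in v (cAnd p q) \<Longrightarrow> free_in v p \<or> free_in v q"
  "free_in v (cEx i p) \<Longrightarrow> v \<noteq> var1 i \<and> free_in v p"
  "free_in v (cEx2 i p) \<Longrightarrow> v \<noteq> var2 i \<and> free_in v p"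
  by (drule free_step, simp add: free_step_def, (auto)?)+

lemma fo_no_var2: "fo_formula p \<Longrightarrow> \<not> free_in (var2 i) p"
proof -
  have D: "D iU (\<lambda>B e. \<not> free_in (var2 i) (e 0))" by (intro dintro)
  show "fo_formula p \<Longrightarrow> \<not> free_in (var2 i) p"
    by (rule fo_induct[where P = "\<lambda>p. \<not> free_in (var2 i) p", OF D]) (auto dest: free_invs)
qed

subsection \<open>Satisfaction\<close>

text \<open>The graph is the least relation closed under the recursion equations; it exists because
  \<open>Val\<close> is a set that bounds the values. Inversion of the last rule and unique
  readability show that it is single-valued.\<close>

lemma so_rec:
  assumes fn: "fn iU (\<lambda>B e. m1 (e 0) (e (Suc 0)))" "fn iU (\<lambda>B e. m2 (e 0) (e (Suc 0)))"
      "fn iU (\<lambda>B e. m3 (e 0) (e (Suc 0)))" "fn iU (\<lambda>B e. ng (e 0))" "fn iU (\<lambda>B e. an (e 0) (e (Suc 0)))"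
      "fn iU (\<lambda>B e. x1 (e 0) (e (Suc 0)))" "fn iU (\<lambda>B e. x2 (e 0) (e (Suc 0)))"
    and Val: "\<And>i j. i \<epsilon> omega \<Longrightarrow> j \<epsilon> omega \<Longrightarrow> m1 i j \<epsilon> Val \<and> m2 i j \<epsilon> Val \<and> m3 i j \<epsilon> Val"
      "\<And>v. v \<epsilon> Val \<Longrightarrow> ng v \<epsilon> Val" "\<And>v w. v \<epsilon> Val \<Longrightarrow> w \<epsilon> Val \<Longrightarrow> an v w \<epsilon> Val"
      "\<And>i v. i \<epsilon> omega \<Longrightarrow> v \<epsilon> Val \<Longrightarrow> x1 i v \<epsilon> Val \<and> x2 i v \<epsilon> Val"
  obtains f where "is_fun f SoF Val"
    "\<And>i j. i \<epsilon> omega \<Longrightarrow> j \<epsilon> omega \<Longrightarrow> ap f (cMem i j) = m1 i j"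
    "\<And>i j. i \<epsilon> omega \<Longrightarrow> j \<epsilon> omega \<Longrightarrow> ap f (cEq i j) = m2 i j"
    "\<And>i j. i \<epsilon> omega \<Longrightarrow> j \<epsilon> omega \<Longrightarrow> ap f (cMem2 i j) = m3 i j"
    "\<And>p. so_formula p \<Longrightarrow> ap f (cNeg p) = ng (ap f p)"
    "\<And>p q. so_formula p \<Longrightarrow> so_formula q \<Longrightarrow> ap f (cAnd p q) = an (ap f p) (ap f q)"
    "\<And>i p. i \<epsilon> omega \<Longrightarrow> so_formula p \<Longrightarrow> ap f (cEx i p) = x1 i (ap f p)"
    "\<And>i p. i \<epsilon> omega \<Longrightarrow> so_formula p \<Longrightarrow> ap f (cEx2 i p) = x2 i (ap f p)"
proof -
  note fc = fn_comp2[OF fn(1)] fn_comp2[OF fn(2)] fn_comp2[OF fn(3)] fn_comp1[OF fn(4)]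
    fn_comp2[OF fn(5)] fn_comp2[OF fn(6)] fn_comp2[OF fn(7)]
  define C where "C X \<longleftrightarrow> (\<forall>i j. i \<epsilon> omega \<longrightarrow> j \<epsilon> omega \<longrightarrow> opair (cMem i j) (m1 i j) \<epsilon> X) \<and>
    (\<forall>i j. i \<epsilon> omega \<longrightarrow> j \<epsilon> omega \<longrightarrow> opair (cEq i j) (m2 i j) \<epsilon> X) \<and>
    (\<forall>i j. i \<epsilon> omega \<longrightarrow> j \<epsilon> omega \<longrightarrow> opair (cMem2 i j) (m3 i j) \<epsilon> X) \<and>
    (\<forall>p v. opair p v \<epsilon> X \<longrightarrow> opair (cNeg p) (ng v) \<epsilon> X) \<and>
    (\<forall>p v q w. opair p v \<epsilon> X \<longrightarrow> opair q w \<epsilon> X \<longrightarrow> opair (cAnd p q) (an v w) \<epsilon> X) \<and>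
    (\<forall>i p v. i \<epsilon> omega \<longrightarrow> opair p v \<epsilon> X \<longrightarrow> opair (cEx i p) (x1 i v) \<epsilon> X) \<and>
    (\<forall>i p v. i \<epsilon> omega \<longrightarrow> opair p v \<epsilon> X \<longrightarrow> opair (cEx2 i p) (x2 i v) \<epsilon> X)" for X
  have CD: "D iU (\<lambda>B e. C (e i))" for i unfolding C_def by (intro dintro fc)
  have CP: "C (prd SoF Val)" unfolding C_def by (simp add: Val SoF_iff so_intros)
  define R where "R = mkset (\<lambda>z. \<forall>X. C X \<longrightarrow> z \<epsilon> X)"
  have R: "z \<epsilon> R \<longleftrightarrow> (\<forall>X. C X \<longrightarrow> z \<epsilon> X)" for z
    unfolding R_def
    by (rule sep[where P = "\<lambda>z. \<forall>X. C X \<longrightarrow> z \<epsilon> X" and x = "prd SoF Val"]) (intro dintro CD, use CP in blast)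
  have CX: "C X \<Longrightarrow> i \<epsilon> omega \<Longrightarrow> j \<epsilon> omega \<Longrightarrow> opair (cMem i j) (m1 i j) \<epsilon> X"
    "C X \<Longrightarrow> i \<epsilon> omega \<Longrightarrow> j \<epsilon> omega \<Longrightarrow> opair (cEq i j) (m2 i j) \<epsilon> X"
    "C X \<Longrightarrow> i \<epsilon> omega \<Longrightarrow> j \<epsilon> omega \<Longrightarrow> opair (cMem2 i j) (m3 i j) \<epsilon> X"
    "C X \<Longrightarrow> opair p v \<epsilon> X \<Longrightarrow> opair (cNeg p) (ng v) \<epsilon> X"
    "C X \<Longrightarrow> opair p v \<epsilon> X \<Longrightarrow> opair q w \<epsilon> X \<Longrightarrow> opair (cAnd p q) (an v w) \<epsilon> X"
    "C X \<Longrightarrow> i \<epsilon> omega \<Longrightarrow> opair p v \<epsilon> X \<Longrightarrow> opair (cEx i p) (x1 i v) \<epsilon> X"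
    "C X \<Longrightarrow> i \<epsilon> omega \<Longrightarrow> opair p v \<epsilon> X \<Longrightarrow> opair (cEx2 i p) (x2 i v) \<epsilon> X" for X i j p q v w
    unfolding C_def by simp_all
  have CR: "C R" unfolding C_def R by (simp add: CX)
  \<comment> \<open>\<open>st p v\<close> says that the pair comes from pairs in \<open>R\<close> by
    one of the seven rules; the pairs of \<open>R\<close> with this property are closed under the
    rules.\<close>
  define st where "st p v \<longleftrightarrow> (\<exists>i j. p = cMem i j \<and> v = m1 i j) \<or> (\<exists>i j. p = cEq i j \<and> v = m2 i j) \<or>
    (\<exists>i j. p = cMem2 i j \<and> v = m3 i j) \<or> (\<exists>q w. p = cNeg q \<and> opair q w \<epsilon> R \<and> v = ng w) \<or>
    (\<exists>q w q' w'. p = cAnd q q' \<and> opair q w \<epsilon> R \<and> opair q' w' \<epsilon> R \<and> v = an w w') \<or>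
    (\<exists>i q w. p = cEx i q \<and> opair q w \<epsilon> R \<and> v = x1 i w) \<or> (\<exists>i q w. p = cEx2 i q \<and> opair q w \<epsilon> R \<and> v = x2 i w)" for p v
  have "D iU (\<lambda>B e. \<exists>p v. e 0 = opair p v \<and> st p v)" unfolding st_def by (intro dintro fc)
  then obtain S where S: "\<And>z. z \<epsilon> S \<longleftrightarrow> z \<epsilon> R \<and> (\<exists>p v. z = opair p v \<and> st p v)"
    using sep_ex[where P = "\<lambda>z. \<exists>p v. z = opair p v \<and> st p v" and x = R] by blast
  have S': "opair p v \<epsilon> S \<longleftrightarrow> opair p v \<epsilon> R \<and> st p v" for p v unfolding S by auto
  have "C S" unfolding C_def S'
  proof (intro conjI allI impI)
    show "st (cMem i j) (m1 i j)" "st (cEq i j) (m2 i j)" "st (cMem2 i j) (m3 i j)" for i j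
      unfolding st_def by blast+
    show "st (cNeg p) (ng v)" if "opair p v \<epsilon> R \<and> st p v" for p v using that unfolding st_def by blast
    show "st (cAnd p q) (an v w)" if "opair p v \<epsilon> R \<and> st p v" "opair q w \<epsilon> R \<and> st q w" for p q v w
      using that unfolding st_def by blast
    show "st (cEx i p) (x1 i v)" if "opair p v \<epsilon> R \<and> st p v" for i p v using that unfolding st_def by blast
    show "st (cEx2 i p) (x2 i v)" if "opair p v \<epsilon> R \<and> st p v" for i p v using that unfolding st_def by blast
  qed (simp_all add: CX[OF CR])
  then have inv: "st p v" if "opair p v \<epsilon> R" for p v using that R S' by blast
  have inv1: "opair (cMem i j) v \<epsilon> R \<Longrightarrow> v = m1 i j" "opair (cEq i j) v \<epsilon> R \<Longrightarrow> v = m2 i j"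
    "opair (cMem2 i j) v \<epsilon> R \<Longrightarrow> v = m3 i j" for i j v
    by (drule inv, simp add: st_def)+
  have inv2: "opair (cNeg p) v \<epsilon> R \<Longrightarrow> \<exists>w. opair p w \<epsilon> R \<and> v = ng w"
    "opair (cAnd p q) v \<epsilon> R \<Longrightarrow> \<exists>w w'. opair p w \<epsilon> R \<and> opair q w' \<epsilon> R \<and> v = an w w'"
    "opair (cEx i p) v \<epsilon> R \<Longrightarrow> \<exists>w. opair p w \<epsilon> R \<and> v = x1 i w"
    "opair (cEx2 i p) v \<epsilon> R \<Longrightarrow> \<exists>w. opair p w \<epsilon> R \<and> v = x2 i w" for p q i v
    by (drule inv, simp add: st_def, blast?)+
  have ex1: "\<exists>!v. opair p v \<epsilon> R" if "so_formula p" for p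
  proof (rule so_induct[where P = "\<lambda>p. \<exists>!v. opair p v \<epsilon> R", OF _ that])
    have "D iU (\<lambda>B e. \<exists>v. opair (e 0) v \<epsilon> R \<and> (\<forall>w. opair (e 0) w \<epsilon> R \<longrightarrow> w = v))" by (intro dintro)
    then show "D iU (\<lambda>B e. \<exists>!v. opair (e 0) v \<epsilon> R)" unfolding Ex1_def .
  next
    fix i j assume "i \<epsilon> omega" "j \<epsilon> omega"
    then show "\<exists>!v. opair (cMem i j) v \<epsilon> R" "\<exists>!v. opair (cEq i j) v \<epsilon> R" "\<exists>!v. opair (cMem2 i j) v \<epsilon> R"
      using CX(1-3)[OF CR] inv1 by metis+
  next
    fix p assume "\<exists>!v. opair p v \<epsilon> R"
    then show "\<exists>!v. opair (cNeg p) v \<epsilon> R" using CX(4)[OF CR] inv2(1) by metis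
  next
    fix p q assume "\<exists>!v. opair p v \<epsilon> R" "\<exists>!v. opair q v \<epsilon> R"
    then obtain v w where v: "opair p v \<epsilon> R" "\<And>v'. opair p v' \<epsilon> R \<Longrightarrow> v' = v"
      and w: "opair q w \<epsilon> R" "\<And>v'. opair q v' \<epsilon> R \<Longrightarrow> v' = w" by metis
    show "\<exists>!v. opair (cAnd p q) v \<epsilon> R"
    proof (rule ex1I)
      show "opair (cAnd p q) (an v w) \<epsilon> R" using CX(5)[OF CR] v w by blast
      show "u = an v w" if "opair (cAnd p q) u \<epsilon> R" for u using inv2(2)[OF that] v(2) w(2) by blast
    qed
  next
    fix i p assume i: "i \<epsilon> omega" and "\<exists>!v. opair p v \<epsilon> R"
    then show "\<exists>!v. opair (cEx i p) v \<epsilon> R" "\<exists>!v. opair (cEx2 i p) v \<epsilon> R"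
      using CX(6,7)[OF CR i] inv2(3,4) by metis+
  qed
  define F where "F p = mkset (\<lambda>z. \<exists>v. opair p v \<epsilon> R \<and> z \<epsilon> v)" for p
  have Ffn: "fn iU (\<lambda>B e. F (e 0))" unfolding F_def by (intro dintro)
  have FI: "F p = v" if "so_formula p" "opair p v \<epsilon> R" for p v
    unfolding F_def by (rule mkset_unique) (use ex1[OF that(1)] that(2) in blast)
  have FR: "opair p (F p) \<epsilon> R" if "so_formula p" for p using ex1[OF that] FI[OF that] by metis
  have FV: "F p \<epsilon> Val" if "so_formula p" for p
    using FR[OF that] CP R by (meson opair_prd)
  have ap: "ap (lam SoF F) p = F p" if "so_formula p" for p
    using ap_lam[OF Ffn] that SoF_iff by blast
  show thesis
  proof (rule that[of "lam SoF F"])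
    show "is_fun (lam SoF F) SoF Val" by (rule lam_fun[OF Ffn]) (simp add: FV SoF_iff)
  qed (simp_all add: ap so_intros FI CX[OF CR] FR)
qed

text \<open>Tarski's clauses for an arbitrary ternary predicate, so that they can be stated for a
  set of triples as well as for \<open>Sat A\<close> itself. All quantifiers are bounded.\<close>

definition satP :: "'a \<Rightarrow> ('a \<Rightarrow> 'a \<Rightarrow> 'a \<Rightarrow> bool) \<Rightarrow> bool" where
  "satP A R \<longleftrightarrow> (\<forall>s. is_fun s omega A \<longrightarrow> (\<forall>t. is_fun t omega (pow A) \<longrightarrow>
      (\<forall>i. i \<epsilon> omega \<longrightarrow> (\<forall>j. j \<epsilon> omega \<longrightarrow>
          (R (cMem i j) s t \<longleftrightarrow> ap s i \<epsilon> ap s j) \<and>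
          (R (cEq i j) s t \<longleftrightarrow> ap s i = ap s j) \<and>
          (R (cMem2 i j) s t \<longleftrightarrow> ap s i \<epsilon> ap t j))) \<and>
      (\<forall>p. p \<epsilon> SoF \<longrightarrow> (R (cNeg p) s t \<longleftrightarrow> \<not> R p s t)) \<and>
      (\<forall>p. p \<epsilon> SoF \<longrightarrow> (\<forall>q. q \<epsilon> SoF \<longrightarrow> (R (cAnd p q) s t \<longleftrightarrow> R p s t \<and> R q s t))) \<and>
      (\<forall>i. i \<epsilon> omega \<longrightarrow> (\<forall>p. p \<epsilon> SoF \<longrightarrow>
          (R (cEx i p) s t \<longleftrightarrow> (\<exists>x. x \<epsilon> A \<and> R p (upd s i x) t)) \<and>
          (R (cEx2 i p) s t \<longleftrightarrow> (\<exists>X. subs X A \<and> R p s (upd t i X)))))))"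

lemma sat_rel_satP: "sat_rel A S \<longleftrightarrow> satP A (\<lambda>p s t. opair p (opair s t) \<epsilon> S)"
proof -
  have "sat_rel A S \<longleftrightarrow> (\<forall>s t. is_fun s omega A \<and> is_fun t omega (pow A) \<longrightarrow>
       (\<forall>i j. i \<epsilon> omega \<and> j \<epsilon> omega \<longrightarrow>
          (opair (cMem i j) (opair s t) \<epsilon> S \<longleftrightarrow> ap s i \<epsilon> ap s j) \<and>
          (opair (cEq i j) (opair s t) \<epsilon> S \<longleftrightarrow> ap s i = ap s j) \<and>
          (opair (cMem2 i j) (opair s t) \<epsilon> S \<longleftrightarrow> ap s i \<epsilon> ap t j)) \<and>
       (\<forall>p. so_formula p \<longrightarrow> (opair (cNeg p) (opair s t) \<epsilon> S \<longleftrightarrow> \<not> opair p (opair s t) \<epsilon> S)) \<and>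
       (\<forall>p q. so_formula p \<and> so_formula q \<longrightarrow> (opair (cAnd p q) (opair s t) \<epsilon> S \<longleftrightarrow>
          opair p (opair s t) \<epsilon> S \<and> opair q (opair s t) \<epsilon> S)) \<and>
       (\<forall>i p. i \<epsilon> omega \<and> so_formula p \<longrightarrow>
          (opair (cEx i p) (opair s t) \<epsilon> S \<longleftrightarrow> (\<exists>x. x \<epsilon> A \<and> opair p (opair (upd s i x) t) \<epsilon> S)) \<and>
          (opair (cEx2 i p) (opair s t) \<epsilon> S \<longleftrightarrow> (\<exists>X. subs X A \<and> opair p (opair s (upd t i X)) \<epsilon> S))))"
    unfolding Defs.sat_rel_def Let_def
    by (intro arg_cong[where f = All] ext imp_cong refl conj_cong) (metis app_ap)+
  also have "\<dots> \<longleftrightarrow> satP A (\<lambda>p s t. opair p (opair s t) \<epsilon> S)"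
    unfolding satP_def SoF_iff imp_conjL all_simps ..
  finally show ?thesis .
qed

lemma satP_cong:
  assumes "\<And>p s t. so_formula p \<Longrightarrow> is_fun s omega A \<Longrightarrow> is_fun t omega (pow A) \<Longrightarrow> R p s t = R' p s t"
  shows "satP A R = satP A R'"
  unfolding satP_def SoF_iff
proof (intro arg_cong[where f = All] ext imp_cong refl conj_cong, goal_cases)
  case (1 s t i j) then show ?case using assms so_intros by simp
next
  case (2 s t i j) then show ?case using assms so_intros by simp
next
  case (3 s t i j) then show ?case using assms so_intros by simp
next
  case (4 s t p) then show ?case using assms so_intros by simp
next
  case (5 s t p q) then show ?case using assms so_intros by simp
next
  case (6 s t i p)
  have "R p (upd s i x) t = R' p (upd s i x) t" if "x \<epsilon> A" for x
    using assms 6 upd_fun that by blast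
  then show ?case using 6 assms[of "cEx i p" s t] so_intros(6) by metis
next
  case (7 s t i p)
  have "R p s (upd t i X) = R' p s (upd t i X)" if "subs X A" for X
    using assms[of p s "upd t i X"] 7 upd_fun[of t omega "pow A" i X] that pow_iff by simp
  then show ?case using 7 assms[of "cEx2 i p" s t] so_intros(7) by metis
qed

definition Asg where "Asg A = prd (FunS omega A) (FunS omega (pow A))"

lemma fn_Asg [dintro]: "u \<noteq> iT \<Longrightarrow> fn u F \<Longrightarrow> fn u (\<lambda>B e. Asg (F B e))"
  unfolding Asg_def by (intro dintro)

lemma Asg_iff: "opair s t \<epsilon> Asg A \<longleftrightarrow> is_fun s omega A \<and> is_fun t omega (pow A)"
  unfolding Asg_def by simp

text \<open>The recursion assigns to each formula the set of all pairs of assignments satisfying it,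
  so that the quantifier clauses can refer to modified assignments.\<close>

lemma sat_rel_ex: "\<exists>S. subs S (prd SoF (Asg A)) \<and> sat_rel A S"
proof -
  define m1 where "m1 i j = mkset (\<lambda>z. z \<epsilon> Asg A \<and> (\<exists>s t. z = opair s t \<and> ap s i \<epsilon> ap s j))" for i j
  define m2 where "m2 i j = mkset (\<lambda>z. z \<epsilon> Asg A \<and> (\<exists>s t. z = opair s t \<and> ap s i = ap s j))" for i j
  define m3 where "m3 i j = mkset (\<lambda>z. z \<epsilon> Asg A \<and> (\<exists>s t. z = opair s t \<and> ap s i \<epsilon> ap t j))" for i j
  define ng where "ng v = mkset (\<lambda>z. z \<epsilon> Asg A \<and> \<not> z \<epsilon> v)" for v
  define an where "an v w = mkset (\<lambda>z. z \<epsilon> Asg A \<and> (z \<epsilon> v \<and> z \<epsilon> w))" for v w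
  define x1 where "x1 i v = mkset (\<lambda>z. z \<epsilon> Asg A \<and> (\<exists>s t. z = opair s t \<and> (\<exists>x. x \<epsilon> A \<and> opair (upd s i x) t \<epsilon> v)))" for i v
  define x2 where "x2 i v = mkset (\<lambda>z. z \<epsilon> Asg A \<and> (\<exists>s t. z = opair s t \<and> (\<exists>x. subs x A \<and> opair s (upd t i x) \<epsilon> v)))" for i v
  have sepA: "z \<epsilon> mkset (\<lambda>z. z \<epsilon> Asg A \<and> Q z) \<longleftrightarrow> z \<epsilon> Asg A \<and> Q z" if "D iU (\<lambda>B e. Q (e 0))" for Q z
    by (rule mkset_iff, rule sep_ex[OF that])
  have m1: "z \<epsilon> m1 i j \<longleftrightarrow> z \<epsilon> Asg A \<and> (\<exists>s t. z = opair s t \<and> ap s i \<epsilon> ap s j)" for z i j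
    unfolding m1_def by (rule sepA) (intro dintro)
  have m2: "z \<epsilon> m2 i j \<longleftrightarrow> z \<epsilon> Asg A \<and> (\<exists>s t. z = opair s t \<and> ap s i = ap s j)" for z i j
    unfolding m2_def by (rule sepA) (intro dintro)
  have m3: "z \<epsilon> m3 i j \<longleftrightarrow> z \<epsilon> Asg A \<and> (\<exists>s t. z = opair s t \<and> ap s i \<epsilon> ap t j)" for z i j
    unfolding m3_def by (rule sepA) (intro dintro)
  have ng: "z \<epsilon> ng v \<longleftrightarrow> z \<epsilon> Asg A \<and> \<not> z \<epsilon> v" for z v
    unfolding ng_def by (rule sepA) (intro dintro)
  have an: "z \<epsilon> an v w \<longleftrightarrow> z \<epsilon> Asg A \<and> (z \<epsilon> v \<and> z \<epsilon> w)" for z v w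
    unfolding an_def by (rule sepA) (intro dintro)
  have x1: "z \<epsilon> x1 i v \<longleftrightarrow> z \<epsilon> Asg A \<and> (\<exists>s t. z = opair s t \<and> (\<exists>x. x \<epsilon> A \<and> opair (upd s i x) t \<epsilon> v))" for z i v
    unfolding x1_def by (rule sepA) (intro dintro)
  have x2: "z \<epsilon> x2 i v \<longleftrightarrow> z \<epsilon> Asg A \<and> (\<exists>s t. z = opair s t \<and> (\<exists>x. subs x A \<and> opair s (upd t i x) \<epsilon> v))" for z i v
    unfolding x2_def by (rule sepA) (intro dintro)
  note ext = m1 m2 m3 ng an x1 x2
  obtain f where f: "is_fun f SoF (pow (Asg A))"
    "\<And>i j. i \<epsilon> omega \<Longrightarrow> j \<epsilon> omega \<Longrightarrow> ap f (cMem i j) = m1 i j"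
    "\<And>i j. i \<epsilon> omega \<Longrightarrow> j \<epsilon> omega \<Longrightarrow> ap f (cEq i j) = m2 i j"
    "\<And>i j. i \<epsilon> omega \<Longrightarrow> j \<epsilon> omega \<Longrightarrow> ap f (cMem2 i j) = m3 i j"
    "\<And>p. so_formula p \<Longrightarrow> ap f (cNeg p) = ng (ap f p)"
    "\<And>p q. so_formula p \<Longrightarrow> so_formula q \<Longrightarrow> ap f (cAnd p q) = an (ap f p) (ap f q)"
    "\<And>i p. i \<epsilon> omega \<Longrightarrow> so_formula p \<Longrightarrow> ap f (cEx i p) = x1 i (ap f p)"
    "\<And>i p. i \<epsilon> omega \<Longrightarrow> so_formula p \<Longrightarrow> ap f (cEx2 i p) = x2 i (ap f p)"
  proof (rule so_rec[of m1 m2 m3 ng an x1 x2 "pow (Asg A)"])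
    show "fn iU (\<lambda>B e. m1 (e 0) (e (Suc 0)))" unfolding m1_def by (intro dintro)
    show "fn iU (\<lambda>B e. m2 (e 0) (e (Suc 0)))" unfolding m2_def by (intro dintro)
    show "fn iU (\<lambda>B e. m3 (e 0) (e (Suc 0)))" unfolding m3_def by (intro dintro)
    show "fn iU (\<lambda>B e. ng (e 0))" unfolding ng_def by (intro dintro)
    show "fn iU (\<lambda>B e. an (e 0) (e (Suc 0)))" unfolding an_def by (intro dintro)
    show "fn iU (\<lambda>B e. x1 (e 0) (e (Suc 0)))" unfolding x1_def by (intro dintro)
    show "fn iU (\<lambda>B e. x2 (e 0) (e (Suc 0)))" unfolding x2_def by (intro dintro)
    show "m1 i j \<epsilon> pow (Asg A) \<and> m2 i j \<epsilon> pow (Asg A) \<and> m3 i j \<epsilon> pow (Asg A)" for i j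
      by (simp add: Defs.subs_def ext)
    show "ng v \<epsilon> pow (Asg A)" "an v w \<epsilon> pow (Asg A)" "x1 i v \<epsilon> pow (Asg A) \<and> x2 i v \<epsilon> pow (Asg A)" for v w i
      by (simp_all add: Defs.subs_def ext)
  qed (rule that)
  define S where "S = mkset (\<lambda>z. z \<epsilon> prd SoF (Asg A) \<and> (\<exists>p y. z = opair p y \<and> y \<epsilon> ap f p))"
  have S0: "z \<epsilon> S \<longleftrightarrow> z \<epsilon> prd SoF (Asg A) \<and> (\<exists>p y. z = opair p y \<and> y \<epsilon> ap f p)" for z
    unfolding S_def by (rule mkset_iff, rule sep_ex) (intro dintro)
  have S: "opair p (opair s t) \<epsilon> S \<longleftrightarrow> opair s t \<epsilon> ap f p"
    if "so_formula p" "is_fun s omega A" "is_fun t omega (pow A)" for p s t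
    unfolding S0 using that by (simp add: SoF_iff Asg_iff)
  have "satP A (\<lambda>p s t. opair s t \<epsilon> ap f p)"
    unfolding satP_def SoF_iff
    by (simp add: f(2-8) ext Asg_iff upd_fun ap_in[OF f(1)] pow_iff cong: conj_cong)
  moreover have "satP A (\<lambda>p s t. opair p (opair s t) \<epsilon> S) = satP A (\<lambda>p s t. opair s t \<epsilon> ap f p)"
    by (rule satP_cong) (rule S)
  ultimately have "sat_rel A S" unfolding sat_rel_satP by simp
  moreover have "subs S (prd SoF (Asg A))" using S0 by (blast intro: subsI)
  ultimately show ?thesis by blast
qed

lemma satP_D:
  assumes "satP A R" and s: "is_fun s omega A" and t: "is_fun t omega (pow A)"
  shows "i \<epsilon> omega \<Longrightarrow> j \<epsilon> omega \<Longrightarrow> R (cMem i j) s t \<longleftrightarrow> ap s i \<epsilon> ap s j"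
    "i \<epsilon> omega \<Longrightarrow> j \<epsilon> omega \<Longrightarrow> R (cEq i j) s t \<longleftrightarrow> ap s i = ap s j"
    "i \<epsilon> omega \<Longrightarrow> j \<epsilon> omega \<Longrightarrow> R (cMem2 i j) s t \<longleftrightarrow> ap s i \<epsilon> ap t j"
    "so_formula p \<Longrightarrow> R (cNeg p) s t \<longleftrightarrow> \<not> R p s t"
    "so_formula p \<Longrightarrow> so_formula q \<Longrightarrow> R (cAnd p q) s t \<longleftrightarrow> R p s t \<and> R q s t"
    "i \<epsilon> omega \<Longrightarrow> so_formula p \<Longrightarrow> R (cEx i p) s t \<longleftrightarrow> (\<exists>x. x \<epsilon> A \<and> R p (upd s i x) t)"
    "i \<epsilon> omega \<Longrightarrow> so_formula p \<Longrightarrow> R (cEx2 i p) s t \<longleftrightarrow> (\<exists>X. subs X A \<and> R p s (upd t i X))"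
  using assms unfolding satP_def SoF_iff by simp_all

lemma D_sat_rel: "u \<noteq> iT \<Longrightarrow> D u (\<lambda>B e. sat_rel (e i) (e j))"
  unfolding sat_rel_satP satP_def by (intro dintro)

lemma sat_rel_unique:
  assumes S: "sat_rel A S" "sat_rel A S'" and p: "so_formula p"
    and st: "is_fun s omega A" "is_fun t omega (pow A)"
  shows "opair p (opair s t) \<epsilon> S \<longleftrightarrow> opair p (opair s t) \<epsilon> S'"
proof -
  let ?P = "\<lambda>p. \<forall>s. is_fun s omega A \<longrightarrow> (\<forall>t. is_fun t omega (pow A) \<longrightarrow>
      (opair p (opair s t) \<epsilon> S \<longleftrightarrow> opair p (opair s t) \<epsilon> S'))"
  note c = satP_D[OF S(1)[unfolded sat_rel_satP]] satP_D[OF S(2)[unfolded sat_rel_satP]]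
  have D: "D iU (\<lambda>B e. ?P (e 0))" by (intro dintro)
  have "?P p"
  proof (rule so_induct[where P = ?P, OF D p])
    fix i p assume i: "i \<epsilon> omega" "so_formula p" and IH: "?P p"
    show "?P (cEx i p)"
    proof (intro allI impI)
      fix s t assume st: "is_fun s omega A" "is_fun t omega (pow A)"
      have "opair p (opair (upd s i x) t) \<epsilon> S \<longleftrightarrow> opair p (opair (upd s i x) t) \<epsilon> S'" if "x \<epsilon> A" for x
        using IH upd_fun[OF st(1) i(1) that] st by blast
      then show "opair (cEx i p) (opair s t) \<epsilon> S \<longleftrightarrow> opair (cEx i p) (opair s t) \<epsilon> S'"
        using c(6)[OF st i] c(13)[OF st i] by blast
    qed
    show "?P (cEx2 i p)"
    proof (intro allI impI)
      fix s t assume st: "is_fun s omega A" "is_fun t omega (pow A)"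
      have "opair p (opair s (upd t i x)) \<epsilon> S \<longleftrightarrow> opair p (opair s (upd t i x)) \<epsilon> S'" if "subs x A" for x
        using IH upd_fun[OF st(2) i(1)] that st pow_iff by blast
      then show "opair (cEx2 i p) (opair s t) \<epsilon> S \<longleftrightarrow> opair (cEx2 i p) (opair s t) \<epsilon> S'"
        using c(7)[OF st i] c(14)[OF st i] by blast
    qed
  qed (simp_all add: c)
  then show ?thesis using st by blast
qed

lemma Sat_rel: "sat_rel A S \<Longrightarrow> so_formula p \<Longrightarrow> is_fun s omega A \<Longrightarrow> is_fun t omega (pow A) \<Longrightarrow>
    Sat A p s t \<longleftrightarrow> opair p (opair s t) \<epsilon> S"
  unfolding Defs.Sat_def using sat_rel_unique by blast

lemma satP_Sat: "satP A (Sat A)"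
proof -
  obtain S where S: "sat_rel A S" using sat_rel_ex by blast
  have "satP A (Sat A) = satP A (\<lambda>p s t. opair p (opair s t) \<epsilon> S)"
    by (rule satP_cong) (rule Sat_rel[OF S])
  then show ?thesis using S unfolding sat_rel_satP by simp
qed

lemmas Sat_simps = satP_D[OF satP_Sat]

text \<open>\<open>sat_rel\<close> says nothing about triples that do not consist of a formula and
  two assignments, so any such triple can be added to a satisfaction relation. This default is
  recorded because \<open>Sat\<close> has to be described exactly in order to be definable.\<close>

lemma Sat_junk:
  assumes "\<not> (so_formula p \<and> is_fun s omega A \<and> is_fun t omega (pow A))"
  shows "Sat A p s t"
proof -
  obtain S where S: "sat_rel A S" using sat_rel_ex by blast
  have "satP A (\<lambda>p' s' t'. opair p' (opair s' t') \<epsilon> adj S (opair p (opair s t))) =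
      satP A (\<lambda>p s t. opair p (opair s t) \<epsilon> S)"
    by (rule satP_cong) (use assms in auto)
  then have "sat_rel A (adj S (opair p (opair s t)))" using S unfolding sat_rel_satP by simp
  then show ?thesis unfolding Defs.Sat_def using adj_iff by blast
qed

text \<open>A satisfaction relation can be found among the subsets of a product that lies in every
  good class containing \<open>A\<close>. Hence satisfaction in \<open>A\<close>, including
  second-order satisfaction, means the same in such a class as in the universe.\<close>

lemma Sat_bounded: "Sat A p s t \<longleftrightarrow>
    (p \<epsilon> SoF \<and> is_fun s omega A \<and> is_fun t omega (pow A) \<longrightarrow>
    (\<exists>S. subs S (prd SoF (Asg A)) \<and> (sat_rel A S \<and> opair p (opair s t) \<epsilon> S)))"
proof (cases "so_formula p \<and> is_fun s omega A \<and> is_fun t omega (pow A)")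
  case True
  obtain S where S: "subs S (prd SoF (Asg A))" "sat_rel A S" using sat_rel_ex by blast
  show ?thesis using True S Sat_rel[of A _ p s t] SoF_iff by metis
next
  case False
  then show ?thesis using Sat_junk[OF False] SoF_iff by blast
qed

lemma D_Sat [dintro]:
  assumes u: "u \<noteq> iT" and F: "fn u F" and G: "fn u G" and H: "fn u H" and K: "fn u K"
  shows "D u (\<lambda>B e. Sat (F B e) (G B e) (H B e) (K B e))"
proof (rule D_comp4[where R = "\<lambda>B. Sat", OF _ F G H K])
  show "D u (\<lambda>B e. Sat (e 0) (e (Suc 0)) (e (Suc (Suc 0))) (e (Suc (Suc (Suc 0)))))"
    unfolding Sat_bounded using u by (intro dintro D_sat_rel)
qed

lemma D_models [dintro]:
  assumes u: "u \<noteq> iT" and F: "fn u F" and G: "fn u G"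
  shows "D u (\<lambda>B e. models (F B e) (G B e))"
proof (rule D_comp2[where R = "\<lambda>B. models", OF _ F G])
  have *: "models A p \<longleftrightarrow> (\<forall>s. is_fun s omega A \<longrightarrow> (\<forall>t. is_fun t omega (pow A) \<longrightarrow> Sat A p s t))" for A p
    unfolding Defs.models_def by blast
  show "D u (\<lambda>B e. models (e 0) (e (Suc 0)))" unfolding * using u by (intro dintro)
qed

lemma D_fo_Sat [dintro]:
  assumes u: "u \<noteq> iT" and F: "fn u F" and G: "fn u G" and H: "fn u H"
  shows "D u (\<lambda>B e. fo_Sat (F B e) (G B e) (H B e))"
proof (rule D_comp3[where R = "\<lambda>B. fo_Sat", OF _ F G H])
  show "D u (\<lambda>B e. fo_Sat (e 0) (e (Suc 0)) (e (Suc (Suc 0))))"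
    unfolding Defs.fo_Sat_def using u by (intro dintro)
qed

lemma Sat_cong:
  assumes p: "so_formula p" and s: "is_fun s omega A" "is_fun s' omega A"
    and t: "is_fun t omega (pow A)" "is_fun t' omega (pow A)"
    and eq: "\<And>i. i \<epsilon> omega \<Longrightarrow> free_in (var1 i) p \<Longrightarrow> ap s i = ap s' i"
      "\<And>i. i \<epsilon> omega \<Longrightarrow> free_in (var2 i) p \<Longrightarrow> ap t i = ap t' i"
  shows "Sat A p s t \<longleftrightarrow> Sat A p s' t'"
proof -
  let ?P = "\<lambda>p. \<forall>s. is_fun s omega A \<longrightarrow> (\<forall>s'. is_fun s' omega A \<longrightarrow> (\<forall>t. is_fun t omega (pow A) \<longrightarrow>
    (\<forall>t'. is_fun t' omega (pow A) \<longrightarrow> (\<forall>i. i \<epsilon> omega \<longrightarrow> free_in (var1 i) p \<longrightarrow> ap s i = ap s' i) \<longrightarrow>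
      (\<forall>i. i \<epsilon> omega \<longrightarrow> free_in (var2 i) p \<longrightarrow> ap t i = ap t' i) \<longrightarrow> (Sat A p s t \<longleftrightarrow> Sat A p s' t'))))"
  have D: "D iU (\<lambda>B e. ?P (e 0))" by (intro dintro)
  have "?P p"
  proof (rule so_induct[where P = ?P, OF D p]; (intro allI impI)?)
    fix i j s s' t t' assume "i \<epsilon> omega" "j \<epsilon> omega" "is_fun s omega A" "is_fun s' omega A" "is_fun t omega (pow A)"
      "is_fun t' omega (pow A)" "\<forall>k. k \<epsilon> omega \<longrightarrow> free_in (var1 k) (cMem i j) \<longrightarrow> ap s k = ap s' k"
    then show "Sat A (cMem i j) s t \<longleftrightarrow> Sat A (cMem i j) s' t'" by (simp add: Sat_simps free_intros)
  next
    fix i j s s' t t' assume "i \<epsilon> omega" "j \<epsilon> omega" "is_fun s omega A" "is_fun s' omega A" "is_fun t omega (pow A)"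
      "is_fun t' omega (pow A)" "\<forall>k. k \<epsilon> omega \<longrightarrow> free_in (var1 k) (cEq i j) \<longrightarrow> ap s k = ap s' k"
    then show "Sat A (cEq i j) s t \<longleftrightarrow> Sat A (cEq i j) s' t'" by (simp add: Sat_simps free_intros)
  next
    fix i j s s' t t' assume "i \<epsilon> omega" "j \<epsilon> omega" "is_fun s omega A" "is_fun s' omega A" "is_fun t omega (pow A)"
      "is_fun t' omega (pow A)" "\<forall>k. k \<epsilon> omega \<longrightarrow> free_in (var1 k) (cMem2 i j) \<longrightarrow> ap s k = ap s' k"
      "\<forall>k. k \<epsilon> omega \<longrightarrow> free_in (var2 k) (cMem2 i j) \<longrightarrow> ap t k = ap t' k"
    then show "Sat A (cMem2 i j) s t \<longleftrightarrow> Sat A (cMem2 i j) s' t'" by (simp add: Sat_simps free_intros)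
  next
    fix p s s' t t' assume p: "so_formula p" and IH: "?P p"
      and st: "is_fun s omega A" "is_fun s' omega A" "is_fun t omega (pow A)" "is_fun t' omega (pow A)"
      and eq: "\<forall>k. k \<epsilon> omega \<longrightarrow> free_in (var1 k) (cNeg p) \<longrightarrow> ap s k = ap s' k"
      "\<forall>k. k \<epsilon> omega \<longrightarrow> free_in (var2 k) (cNeg p) \<longrightarrow> ap t k = ap t' k"
    have "Sat A p s t \<longleftrightarrow> Sat A p s' t'"
      by (rule IH[rule_format, OF st]) (use eq free_intros(7) in blast)+
    then show "Sat A (cNeg p) s t \<longleftrightarrow> Sat A (cNeg p) s' t'" using p st by (simp add: Sat_simps)
  next
    fix p q s s' t t' assume p: "so_formula p" "so_formula q" and IH: "?P p" "?P q"
      and st: "is_fun s omega A" "is_fun s' omega A" "is_fun t omega (pow A)" "is_fun t' omega (pow A)"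
      and eq: "\<forall>k. k \<epsilon> omega \<longrightarrow> free_in (var1 k) (cAnd p q) \<longrightarrow> ap s k = ap s' k"
      "\<forall>k. k \<epsilon> omega \<longrightarrow> free_in (var2 k) (cAnd p q) \<longrightarrow> ap t k = ap t' k"
    have "Sat A p s t \<longleftrightarrow> Sat A p s' t'"
      by (rule IH(1)[rule_format, OF st]) (use eq free_intros(8) p in blast)+
    moreover have "Sat A q s t \<longleftrightarrow> Sat A q s' t'"
      by (rule IH(2)[rule_format, OF st]) (use eq free_intros(9) p in blast)+
    ultimately show "Sat A (cAnd p q) s t \<longleftrightarrow> Sat A (cAnd p q) s' t'" using p st by (simp add: Sat_simps)
  next
    fix i p s s' t t' assume i: "i \<epsilon> omega" and p: "so_formula p" and IH: "?P p"
      and st: "is_fun s omega A" "is_fun s' omega A" "is_fun t omega (pow A)" "is_fun t' omega (pow A)"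
      and eq: "\<forall>k. k \<epsilon> omega \<longrightarrow> free_in (var1 k) (cEx i p) \<longrightarrow> ap s k = ap s' k"
      "\<forall>k. k \<epsilon> omega \<longrightarrow> free_in (var2 k) (cEx i p) \<longrightarrow> ap t k = ap t' k"
    have "Sat A p (upd s i x) t \<longleftrightarrow> Sat A p (upd s' i x) t'" if x: "x \<epsilon> A" for x
      by (rule IH[rule_format, OF upd_fun[OF st(1) i x] upd_fun[OF st(2) i x] st(3,4)])
        (use eq free_intros(10)[OF _ i] ap_upd var_eq in metis)+
    then show "Sat A (cEx i p) s t \<longleftrightarrow> Sat A (cEx i p) s' t'"
      using Sat_simps(6)[OF st(1,3) i p] Sat_simps(6)[OF st(2,4) i p] by blast
  next
    fix i p s s' t t' assume i: "i \<epsilon> omega" and p: "so_formula p" and IH: "?P p"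
      and st: "is_fun s omega A" "is_fun s' omega A" "is_fun t omega (pow A)" "is_fun t' omega (pow A)"
      and eq: "\<forall>k. k \<epsilon> omega \<longrightarrow> free_in (var1 k) (cEx2 i p) \<longrightarrow> ap s k = ap s' k"
      "\<forall>k. k \<epsilon> omega \<longrightarrow> free_in (var2 k) (cEx2 i p) \<longrightarrow> ap t k = ap t' k"
    have "Sat A p s (upd t i x) \<longleftrightarrow> Sat A p s' (upd t' i x)" if x: "x \<epsilon> pow A" for x
      by (rule IH[rule_format, OF st(1,2) upd_fun[OF st(3) i x] upd_fun[OF st(4) i x]])
        (use eq free_intros(11)[OF _ i] ap_upd var_eq in metis)+
    then show "Sat A (cEx2 i p) s t \<longleftrightarrow> Sat A (cEx2 i p) s' t'"
      using Sat_simps(7)[OF st(1,3) i p] Sat_simps(7)[OF st(2,4) i p] pow_iff by blast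
  qed
  then show ?thesis using s t eq by blast
qed

text \<open>A second-order assignment that is available for every structure; by
  \<open>fo_no_var2\<close> the truth of first-order formulas is the same for it as for any
  other.\<close>

definition empty_asg :: 'a where "empty_asg = lam omega (\<lambda>_. emp)"

lemma empty_asg_fun [simp]: "is_fun empty_asg omega (pow A)"
  unfolding empty_asg_def by (rule lam_fun) (intro dintro, simp add: Defs.subs_def)

lemma fo_Sat_empty_asg:
  assumes p: "fo_formula p" and s: "is_fun s omega A" shows "fo_Sat A p s \<longleftrightarrow> Sat A p s empty_asg"
proof -
  have "Sat A p s t \<longleftrightarrow> Sat A p s empty_asg" if "is_fun t omega (pow A)" for t
    by (rule Sat_cong[OF fo_so[OF p] s s that empty_asg_fun]) (use fo_no_var2[OF p] in blast)+
  then show ?thesis unfolding Defs.fo_Sat_def using empty_asg_fun by blast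
qed

lemma fo_Sat_simps:
  assumes s: "is_fun s omega A"
  shows "i \<epsilon> omega \<Longrightarrow> j \<epsilon> omega \<Longrightarrow> fo_Sat A (cMem i j) s \<longleftrightarrow> ap s i \<epsilon> ap s j"
    "i \<epsilon> omega \<Longrightarrow> j \<epsilon> omega \<Longrightarrow> fo_Sat A (cEq i j) s \<longleftrightarrow> ap s i = ap s j"
    "fo_formula p \<Longrightarrow> fo_Sat A (cNeg p) s \<longleftrightarrow> \<not> fo_Sat A p s"
    "fo_formula p \<Longrightarrow> fo_formula q \<Longrightarrow> fo_Sat A (cAnd p q) s \<longleftrightarrow> fo_Sat A p s \<and> fo_Sat A q s"
    "i \<epsilon> omega \<Longrightarrow> fo_formula p \<Longrightarrow> fo_Sat A (cEx i p) s \<longleftrightarrow> (\<exists>x. x \<epsilon> A \<and> fo_Sat A p (upd s i x))"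
  using s by (simp_all add: fo_Sat_empty_asg fo_intros fo_so Sat_simps upd_fun cong: conj_cong)

lemma fo_Sat_All: "is_fun s omega A \<Longrightarrow> i \<epsilon> omega \<Longrightarrow> fo_formula p \<Longrightarrow>
    fo_Sat A (cAll i p) s \<longleftrightarrow> (\<forall>x. x \<epsilon> A \<longrightarrow> fo_Sat A p (upd s i x))"
  unfolding Defs.cAll_def by (simp add: fo_Sat_simps fo_intros upd_fun cong: conj_cong)

lemma fo_Sat_cong:
  assumes p: "fo_formula p" and s: "is_fun s omega A" "is_fun s' omega A"
    and eq: "\<And>i. i \<epsilon> omega \<Longrightarrow> free_in (var1 i) p \<Longrightarrow> ap s i = ap s' i"
  shows "fo_Sat A p s \<longleftrightarrow> fo_Sat A p s'"
  unfolding fo_Sat_empty_asg[OF p s(1)] fo_Sat_empty_asg[OF p s(2)]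
  by (rule Sat_cong[OF fo_so[OF p] s empty_asg_fun empty_asg_fun eq]) simp_all

lemma const_fun: "x \<epsilon> A \<Longrightarrow> is_fun (lam omega (\<lambda>_. x)) omega A"
  by (rule lam_fun) (intro dintro)

lemma sentence_so: "fo_sentence p \<Longrightarrow> so_sentence p"
  unfolding Defs.fo_sentence_def Defs.so_sentence_def using fo_so by blast

lemma models_Sat: "so_sentence p \<Longrightarrow> is_fun s omega A \<Longrightarrow> is_fun t omega (pow A) \<Longrightarrow> models A p \<longleftrightarrow> Sat A p s t"
  unfolding Defs.models_def Defs.so_sentence_def using Sat_cong by metis

lemma models_fo_Sat: "fo_sentence p \<Longrightarrow> is_fun s omega A \<Longrightarrow> models A p \<longleftrightarrow> fo_Sat A p s"
  using models_Sat[OF sentence_so _ empty_asg_fun] fo_Sat_empty_asg unfolding Defs.fo_sentence_def by blast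

lemma models_Neg: "so_sentence p \<Longrightarrow> x \<epsilon> A \<Longrightarrow> models A (cNeg p) \<longleftrightarrow> \<not> models A p"
proof -
  assume p: "so_sentence p" and x: "x \<epsilon> A"
  have "so_sentence (cNeg p)" using p so_intros free_invs(4) unfolding Defs.so_sentence_def by blast
  then show ?thesis using models_Sat[OF _ const_fun[OF x] empty_asg_fun] p Sat_simps(4)[OF const_fun[OF x] empty_asg_fun]
    unfolding Defs.so_sentence_def by blast
qed

lemma fo_sentence_Neg: "fo_sentence p \<Longrightarrow> fo_sentence (cNeg p)"
  using fo_intros(3) free_invs(4) unfolding Defs.fo_sentence_def by blast

subsection \<open>Formulas of the metatheory as formulas of the model\<close>

primrec code :: "fm \<Rightarrow> 'a" where
  "code (Mem i j) = cMem (tag i) (tag j)"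
| "code (Eq i j) = cEq (tag i) (tag j)"
| "code (Neg p) = cNeg (code p)"
| "code (And p q) = cAnd (code p) (code q)"
| "code (fm.Ex i p) = cEx (tag i) (code p)"

lemma code_fo [simp]: "fo_formula (code q)"
  by (induction q) (simp_all add: fo_intros)

lemma code_free: "free_in v (code q) \<Longrightarrow> \<exists>i\<in>fmfv q. v = var1 (tag i)"
proof (induction q)
  case (Mem i j) then show ?case using free_invs(1) by fastforce
next
  case (Eq i j) then show ?case using free_invs(2) by fastforce
next
  case (Neg q) then show ?case using free_invs(4) by fastforce
next
  case (And p q) then show ?case using free_invs(5) by fastforce
next
  case (Ex i q)
  then have "v \<noteq> var1 (tag i)" "free_in v (code q)" using free_invs(6)[of v "tag i" "code q"] by simp_all
  then show ?case using Ex.IH by auto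
qed

lemma code_sat: "is_fun s omega A \<Longrightarrow> fo_Sat A (code q) s \<longleftrightarrow> holdsR (\<epsilon>) (\<lambda>x. x \<epsilon> A) q (\<lambda>i. ap s (tag i))"
proof (induction q arbitrary: s)
  case (Ex i q)
  have "fo_Sat A (code q) (upd s (tag i) x) \<longleftrightarrow> holdsR (\<epsilon>) (\<lambda>x. x \<epsilon> A) q ((\<lambda>i. ap s (tag i))(i := x))" if "x \<epsilon> A" for x
  proof -
    have "(\<lambda>k. ap (upd s (tag i) x) (tag k)) = (\<lambda>i. ap s (tag i))(i := x)"
      by (rule ext) (simp add: ap_upd)
    then show ?thesis using Ex.IH[OF upd_fun[OF Ex.prems _ that], of "tag i"] by simp
  qed
  then show ?case using fo_Sat_simps(5)[OF Ex.prems, of "tag i" "code q"] by auto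
qed (simp_all add: fo_Sat_simps)

lemma D_pure: "D u P \<Longrightarrow> u \<noteq> iU \<Longrightarrow> \<exists>p. set_db p = {} \<and>
    (\<forall>B e. kind_of u B \<longrightarrow> (\<forall>i. B (e i)) \<longrightarrow> P B e = dsat (\<epsilon>) B p e)"
  unfolding D_def by blast

text \<open>A formula provided by \<open>D\<close> may contain any indices. If the predicate depends
  on the first \<open>n\<close> coordinates only, all further indices can be identified with index
  0, which controls the free variables of the resulting code.\<close>

definition depends :: "nat \<Rightarrow> (('a \<Rightarrow> bool) \<Rightarrow> (nat \<Rightarrow> 'a) \<Rightarrow> bool) \<Rightarrow> bool" where
  "depends n P \<longleftrightarrow> (\<forall>B e e'. (\<forall>i<n. e i = e' i) \<longrightarrow> P B e = P B e')"

lemma depD: "depends n P \<Longrightarrow> (\<And>i. i < n \<Longrightarrow> e i = e' i) \<Longrightarrow> P B e = P B e'"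
  unfolding depends_def by blast

lemma D_code:
  assumes D: "D u P" "u \<noteq> iU" and depends: "depends n P" and n: "0 < n"
  obtains q where "fo_formula q" "\<And>v. free_in v q \<Longrightarrow> \<exists>i<n. v = var1 (tag i)"
    "\<And>A s. kind_of u (\<lambda>x. x \<epsilon> A) \<Longrightarrow> is_fun s omega A \<Longrightarrow> fo_Sat A q s \<longleftrightarrow> P (\<lambda>x. x \<epsilon> A) (\<lambda>i. ap s (tag i))"
proof -
  obtain p where p: "set_db p = {}" "\<And>B e. kind_of u B \<Longrightarrow> \<forall>i. B (e i) \<Longrightarrow> P B e = dsat (\<epsilon>) B p e"
    using D_pure[OF D] by blast
  define f where "f i = (if i < n then i else 0)" for i :: nat
  define q where "q = named (\<lambda>_. 0) n f p"
  have f: "f i < n" for i using n by (simp add: f_def)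
  have "f ` dfv p \<subseteq> {..<n}" using f by blast
  then have fv: "fmfv q \<subseteq> {..<n}" unfolding q_def using fmfv_named[OF p(1), of "\<lambda>_. 0" n f] by (rule order_trans[rotated])
  show thesis
  proof (rule that[of "code q"])
    show "\<exists>i<n. v = var1 (tag i)" if "free_in v (code q)" for v using code_free[OF that] fv by auto
    fix A s assume A: "kind_of u (\<lambda>x. x \<epsilon> A)" and s: "is_fun s omega A"
    have "fo_Sat A (code q) s \<longleftrightarrow> dsat (\<epsilon>) (\<lambda>x. x \<epsilon> A) p (\<lambda>i. ap s (tag (f i)))"
      unfolding code_sat[OF s] q_def by (rule holdsR_named) (use f p(1) in auto)
    also have "\<dots> \<longleftrightarrow> P (\<lambda>x. x \<epsilon> A) (\<lambda>i. ap s (tag (f i)))"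
      using p(2)[OF A, of "\<lambda>i. ap s (tag (f i))"] ap_in[OF s] by simp
    also have "\<dots> \<longleftrightarrow> P (\<lambda>x. x \<epsilon> A) (\<lambda>i. ap s (tag i))"
      by (rule depD[OF depends]) (simp add: f_def)
    finally show "fo_Sat A (code q) s \<longleftrightarrow> P (\<lambda>x. x \<epsilon> A) (\<lambda>i. ap s (tag i))" .
  qed simp
qed

section \<open>Speaking about good sets from within swelled classes\<close>

lemma good_iff:
  assumes B: "swelled B"
  shows "good B \<longleftrightarrow> (\<forall>x. B x \<longrightarrow> (\<forall>y. B y \<longrightarrow> (\<exists>z. B z \<and> (x \<epsilon> z \<and> y \<epsilon> z)))) \<and>
    (\<forall>x. B x \<longrightarrow> (\<exists>p. B p \<and> (\<forall>y. subs y x \<longrightarrow> y \<epsilon> p))) \<and>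
    (\<forall>x. B x \<longrightarrow> (\<exists>w. B w \<and> (\<forall>z. z \<epsilon> x \<longrightarrow> (\<forall>y. y \<epsilon> z \<longrightarrow> y \<epsilon> w)))) \<and>
    (\<exists>H. B H \<and> ((\<exists>x. x \<epsilon> H \<and> (\<forall>z. z \<epsilon> x \<longrightarrow> False)) \<and>
      (\<forall>x. x \<epsilon> H \<longrightarrow> (\<forall>y. y \<epsilon> H \<longrightarrow> (\<exists>z. z \<epsilon> H \<and> (subs x z \<and> y \<epsilon> z \<and> (\<forall>w. w \<epsilon> z \<longrightarrow> w \<epsilon> x \<or> w = y)))))))"
    (is "_ \<longleftrightarrow> ?A \<and> ?P \<and> ?U \<and> ?H")
proof -
  \<comment> \<open>Closure under subsets reduces each condition to the existence in
    \<open>B\<close> of some set that includes the required one. So goodness is stated without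
    terms, whose values a swelled class may lack.\<close>
  have sb: "B y" if "B x" "\<And>z. z \<epsilon> y \<Longrightarrow> z \<epsilon> x" for x y
    using swelled_subs[OF B that(1)] subsI that(2) by blast
  have 1: "?A \<longleftrightarrow> (\<forall>x y. B x \<and> B y \<longrightarrow> B (upair x y))"
  proof
    assume A: ?A
    show "\<forall>x y. B x \<and> B y \<longrightarrow> B (upair x y)"
    proof (intro allI impI)
      fix x y assume "B x \<and> B y"
      then obtain z where "B z" "x \<epsilon> z" "y \<epsilon> z" using A by blast
      then show "B (upair x y)" using sb[of z "upair x y"] by auto
    qed
  next
    assume "\<forall>x y. B x \<and> B y \<longrightarrow> B (upair x y)"
    then show ?A using upair_iff by blast
  qed
  have 2: "?P \<longleftrightarrow> (\<forall>x. B x \<longrightarrow> B (pow x))"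
  proof
    assume A: ?P
    show "\<forall>x. B x \<longrightarrow> B (pow x)"
    proof (intro allI impI)
      fix x assume "B x"
      then obtain p where "B p" "\<forall>y. subs y x \<longrightarrow> y \<epsilon> p" using A by blast
      then show "B (pow x)" using sb[of p "pow x"] by simp
    qed
  next
    assume "\<forall>x. B x \<longrightarrow> B (pow x)"
    then show ?P using pow_iff by blast
  qed
  have 3: "?U \<longleftrightarrow> (\<forall>x. B x \<longrightarrow> B (Uni x))"
  proof
    assume A: ?U
    show "\<forall>x. B x \<longrightarrow> B (Uni x)"
    proof (intro allI impI)
      fix x assume "B x"
      then obtain w where "B w" "\<forall>z. z \<epsilon> x \<longrightarrow> (\<forall>y. y \<epsilon> z \<longrightarrow> y \<epsilon> w)" using A by blast
      then show "B (Uni x)" using sb[of w "Uni x"] Uni_iff by blast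
    qed
  next
    assume "\<forall>x. B x \<longrightarrow> B (Uni x)"
    then show ?U using Uni_iff by blast
  qed
  have 4: "?H \<longleftrightarrow> B HF"
  proof
    assume ?H
    then obtain H where H: "B H" "\<exists>x. x \<epsilon> H \<and> (\<forall>z. z \<epsilon> x \<longrightarrow> False)"
      "\<And>x y. x \<epsilon> H \<Longrightarrow> y \<epsilon> H \<Longrightarrow> \<exists>z. z \<epsilon> H \<and> (subs x z \<and> y \<epsilon> z \<and> (\<forall>w. w \<epsilon> z \<longrightarrow> w \<epsilon> x \<or> w = y))" by blast
    obtain x where x: "x \<epsilon> H" "\<forall>z. z \<epsilon> x \<longrightarrow> False" using H(2) by blast
    have "x = emp" by (rule set_eqI) (use x(2) emp_iff in blast)
    then have e: "emp \<epsilon> H" using x(1) by simp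
    have "adj x y \<epsilon> H" if xy: "x \<epsilon> H" "y \<epsilon> H" for x y
    proof -
      obtain z where z: "z \<epsilon> H" "subs x z" "y \<epsilon> z" "\<forall>w. w \<epsilon> z \<longrightarrow> w \<epsilon> x \<or> w = y" using H(3)[OF xy] by blast
      have "adj x y = z" by (rule set_eqI) (use z subsD[OF z(2)] in auto)
      then show ?thesis using z(1) by simp
    qed
    then have "adj_closed H" unfolding adj_closed_def using e by blast
    from HF_subs[OF this] show "B HF" using swelled_subs[OF B H(1)] by blast
  next
    assume HF: "B HF"
    have "\<exists>z. z \<epsilon> HF \<and> (subs x z \<and> y \<epsilon> z \<and> (\<forall>w. w \<epsilon> z \<longrightarrow> w \<epsilon> x \<or> w = y))" if "x \<epsilon> HF" "y \<epsilon> HF" for x y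
      by (rule exI[of _ "adj x y"]) (use that adj_HF in \<open>auto intro: subsI\<close>)
    then show ?H using HF emp_HF emp_iff by blast
  qed
  show ?thesis unfolding 1 2 3 4 good_def using B by simp
qed

lemma D_good: "D iT (\<lambda>B e. good B)"
proof (rule D_cong)
  show "D iT (\<lambda>B e. (\<forall>x. B x \<longrightarrow> (\<forall>y. B y \<longrightarrow> (\<exists>z. B z \<and> (x \<epsilon> z \<and> y \<epsilon> z)))) \<and>
    (\<forall>x. B x \<longrightarrow> (\<exists>p. B p \<and> (\<forall>y. subs y x \<longrightarrow> y \<epsilon> p))) \<and>
    (\<forall>x. B x \<longrightarrow> (\<exists>w. B w \<and> (\<forall>z. z \<epsilon> x \<longrightarrow> (\<forall>y. y \<epsilon> z \<longrightarrow> y \<epsilon> w)))) \<and>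
    (\<exists>H. B H \<and> ((\<exists>x. x \<epsilon> H \<and> (\<forall>z. z \<epsilon> x \<longrightarrow> False)) \<and>
      (\<forall>x. x \<epsilon> H \<longrightarrow> (\<forall>y. y \<epsilon> H \<longrightarrow> (\<exists>z. z \<epsilon> H \<and> (subs x z \<and> y \<epsilon> z \<and> (\<forall>w. w \<epsilon> z \<longrightarrow> w \<epsilon> x \<or> w = y))))))))"
    by (intro dintro)
qed (use good_iff kind_of_swelled in simp)

text \<open>A formula that works only over good classes may be used over all swelled ones if
  goodness is asserted beside it: where goodness fails, the conjunction is false whatever the
  formula says.\<close>

lemma D_good_conj: "D iG Q \<Longrightarrow> D iT (\<lambda>B e. good B \<and> Q B e)"
proof -
  assume "D iG Q"
  then obtain p where p: "set_db p = {}" "\<And>B e. good B \<Longrightarrow> \<forall>i. B (e i) \<Longrightarrow> Q B e = dsat (\<epsilon>) B p e"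
    unfolding D_def kind_of_def by auto
  obtain g where g: "set_db g = {}" "\<And>B e. swelled B \<Longrightarrow> \<forall>i. B (e i) \<Longrightarrow> good B = dsat (\<epsilon>) B g e"
    using D_good unfolding D_def kind_of_def by auto
  show ?thesis unfolding D_def
    by (rule exI[of _ "DAnd g p"]) (use p g in \<open>auto simp: kind_of_def\<close>)
qed

lemma swelled_set: "swelled (\<lambda>x. x \<epsilon> G) \<longleftrightarrow> (\<exists>x. x \<epsilon> G) \<and> (\<forall>x. x \<epsilon> G \<longrightarrow> (\<forall>y. y \<epsilon> x \<longrightarrow> y \<epsilon> G)) \<and>
    (\<forall>x. x \<epsilon> G \<longrightarrow> (\<forall>y. subs y x \<longrightarrow> y \<epsilon> G))"
  unfolding swelled_def by blast

lemma D_swelled_set: "D iT (\<lambda>B e. swelled (\<lambda>x. x \<epsilon> e i))"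
proof (rule D_cong)
  show "D iT (\<lambda>B e. (\<exists>x. x \<epsilon> e i \<and> True) \<and> (\<forall>x. x \<epsilon> e i \<longrightarrow> (\<forall>y. y \<epsilon> x \<longrightarrow> y \<epsilon> e i)) \<and>
    (\<forall>x. x \<epsilon> e i \<longrightarrow> (\<forall>y. subs y x \<longrightarrow> y \<epsilon> e i)))" by (intro dintro)
qed (simp add: swelled_set)

lemma D_ball_less:
  fixes n :: nat
  shows "(\<And>i. i < n \<Longrightarrow> D u (P i)) \<Longrightarrow> D u (\<lambda>B e. \<forall>i<n. P i B e)"
proof (induction n)
  case 0 show ?case by (rule D_cong[OF D_True]) simp
next
  case (Suc n)
  have "D u (\<lambda>B e. (\<forall>i<n. P i B e) \<and> P n B e)" using Suc by (intro dintro) simp_all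
  then show ?case by (rule D_cong) (simp add: All_less_Suc conj_commute)
qed

text \<open>Relativization to the element \<open>e 0\<close>. In this way a stage V_a with a
  successor a, where pairs may be missing, can speak about what holds in a good set that is one of
  its elements.\<close>

lemma D_lift:
  assumes Q: "D iT Q" and depends: "depends n Q" and n: "0 < n"
  shows "D iT (\<lambda>B e. swelled (\<lambda>x. x \<epsilon> e 0) \<and> (\<forall>i<n. e (Suc i) \<epsilon> e 0) \<and> Q (\<lambda>x. x \<epsilon> e 0) (\<lambda>i. e (Suc i)))"
proof -
  obtain p where p: "set_db p = {}" "\<And>B e. swelled B \<Longrightarrow> \<forall>i. B (e i) \<Longrightarrow> Q B e = dsat (\<epsilon>) B p e"
    using D_pure[OF Q] unfolding kind_of_def by auto
  define f where "f i = (if i < n then i else 0)" for i :: nat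
  define P where "P B e = dsat (\<epsilon>) B (drel 0 (dren f p)) e" for B e
  have "D iT P" unfolding D_def P_def by (rule exI[of _ "drel 0 (dren f p)"]) (simp add: p(1))
  then have "D iT (\<lambda>B e. swelled (\<lambda>x. x \<epsilon> e 0) \<and> (\<forall>i<n. e (Suc i) \<epsilon> e 0) \<and> P B e)"
    by (intro dintro D_swelled_set D_ball_less)
  then show ?thesis
  proof (rule D_cong, intro conj_cong refl)
    fix B and e :: "nat \<Rightarrow> 'a" assume B: "kind_of iT B" "\<forall>i. B (e i)" and t: "swelled (\<lambda>x. x \<epsilon> e 0)"
      and el: "\<forall>i<n. e (Suc i) \<epsilon> e 0"
    have "P B e = dsat (\<epsilon>) (\<lambda>x. x \<epsilon> e 0) p (\<lambda>i. e (Suc (f i)))"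
      unfolding P_def using dsat_drel[of B "(\<epsilon>)" e 0 "dren f p"] swelled_mem[OF kind_of_swelled[OF B(1)]] B(2)
      by (simp add: dsat_dren)
    also have "\<dots> = Q (\<lambda>x. x \<epsilon> e 0) (\<lambda>i. e (Suc (f i)))"
      using p(2)[OF t, of "\<lambda>i. e (Suc (f i))"] el n by (simp add: f_def)
    also have "\<dots> = Q (\<lambda>x. x \<epsilon> e 0) (\<lambda>i. e (Suc i))"
      by (rule depD[OF depends]) (simp add: f_def)
    finally show "Q (\<lambda>x. x \<epsilon> e 0) (\<lambda>i. e (Suc i)) = P B e" by simp
  qed
qed

text \<open>Relativized quantifiers have the shape of the bounded quantifiers of the object
  language. The new name \<open>N\<close> of the binder differs from the name of the bound, as that
  formation rule requires.\<close>

lemma delta0_named: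
  "(\<And>i. f i < N) \<Longrightarrow> set_db p = {} \<Longrightarrow> delta0_formula (code (named g N f (drel d p)))"
proof (induction p arbitrary: N f d)
  case (DEx p)
  have "case_nat N f i < Suc N" for i using DEx.prems(1) by (simp split: nat.split add: less_SucI)
  then have "delta0_formula (code (named g (Suc N) (case_nat N f) (drel (Suc d) p)))"
    using DEx by simp
  moreover have "f d \<noteq> N" using DEx.prems(1)[of d] by simp
  ultimately show ?case by (simp add: delta0_intros)
qed (simp_all add: delta0_intros)

text \<open>The value of x_0 plays the role of the class. The formula speaks only about that set, so
  the truth value is the same in all transitive sets in which it is evaluated.\<close>

lemma delta0_code:
  assumes Q: "D iT Q" and depends: "depends n Q" and n: "0 < n"
  obtains q where "delta0_formula q"
    "\<And>A s. transitive A \<Longrightarrow> is_fun s omega A \<Longrightarrow> swelled (\<lambda>x. x \<epsilon> ap s (tag 0)) \<Longrightarrow>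
      (\<And>i. i < n \<Longrightarrow> ap s (tag (Suc i)) \<epsilon> ap s (tag 0)) \<Longrightarrow>
      fo_Sat A q s \<longleftrightarrow> Q (\<lambda>x. x \<epsilon> ap s (tag 0)) (\<lambda>i. ap s (tag (Suc i)))"
proof -
  obtain p where p: "set_db p = {}" "\<And>B e. swelled B \<Longrightarrow> \<forall>i. B (e i) \<Longrightarrow> Q B e = dsat (\<epsilon>) B p e"
    using D_pure[OF Q] unfolding kind_of_def by auto
  define f where "f i = (if i < Suc n then i else 1)" for i :: nat
  define q where "q = named (\<lambda>_. 0) (Suc n) f (drel 0 p)"
  have f: "f i < Suc n" for i using n by (simp add: f_def)
  show thesis
  proof (rule that[of "code q"])
    show "delta0_formula (code q)" unfolding q_def by (rule delta0_named) (use f p in auto)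
    fix A s assume A: "transitive A" and s: "is_fun s omega A" and t: "swelled (\<lambda>x. x \<epsilon> ap s (tag 0))"
      and el: "\<And>i. i < n \<Longrightarrow> ap s (tag (Suc i)) \<epsilon> ap s (tag 0)"
    have f0: "f 0 = 0" by (simp add: f_def)
    have "fo_Sat A (code q) s \<longleftrightarrow> dsat (\<epsilon>) (\<lambda>x. x \<epsilon> A) (drel 0 p) (\<lambda>i. ap s (tag (f i)))"
      unfolding code_sat[OF s] q_def by (rule holdsR_named) (use f p(1) in auto)
    also have "\<dots> \<longleftrightarrow> dsat (\<epsilon>) (\<lambda>x. x \<epsilon> ap s (tag 0)) p (\<lambda>i. ap s (tag (f (Suc i))))"
      using dsat_drel[of "\<lambda>x. x \<epsilon> A" "(\<epsilon>)" "\<lambda>i. ap s (tag (f i))" 0 p] transD[OF A] ap_in[OF s] f0 by simp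
    also have "\<dots> \<longleftrightarrow> Q (\<lambda>x. x \<epsilon> ap s (tag 0)) (\<lambda>i. ap s (tag (f (Suc i))))"
    proof -
      have "ap s (tag (f (Suc i))) \<epsilon> ap s (tag 0)" for i
        using el[of i] el[of 0] n unfolding f_def by (cases "Suc i < Suc n") simp_all
      then show ?thesis using p(2)[OF t, of "\<lambda>i. ap s (tag (f (Suc i)))"] by blast
    qed
    also have "\<dots> \<longleftrightarrow> Q (\<lambda>x. x \<epsilon> ap s (tag 0)) (\<lambda>i. ap s (tag (Suc i)))"
      by (rule depD[OF depends]) (simp add: f_def)
    finally show "fo_Sat A (code q) s \<longleftrightarrow> Q (\<lambda>x. x \<epsilon> ap s (tag 0)) (\<lambda>i. ap s (tag (Suc i)))" .
  qed
qed

subsection \<open>Ordinal addition and inaccessible cardinals\<close>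

lemma HV_ext_iff: "w = HV f b \<longleftrightarrow> (\<forall>z. z \<epsilon> w \<longrightarrow> (\<exists>c. c \<epsilon> b \<and> subs z (ap f c))) \<and>
    (\<forall>c. c \<epsilon> b \<longrightarrow> (\<forall>z. subs z (ap f c) \<longrightarrow> z \<epsilon> w))"
proof
  assume "w = HV f b"
  then show "(\<forall>z. z \<epsilon> w \<longrightarrow> (\<exists>c. c \<epsilon> b \<and> subs z (ap f c))) \<and> (\<forall>c. c \<epsilon> b \<longrightarrow> (\<forall>z. subs z (ap f c) \<longrightarrow> z \<epsilon> w))"
    using HV_iff by blast
next
  assume "(\<forall>z. z \<epsilon> w \<longrightarrow> (\<exists>c. c \<epsilon> b \<and> subs z (ap f c))) \<and> (\<forall>c. c \<epsilon> b \<longrightarrow> (\<forall>z. subs z (ap f c) \<longrightarrow> z \<epsilon> w))"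
  then show "w = HV f b" by (intro set_eqI) (use HV_iff in blast)
qed

text \<open>A relation instead of a function, since a good class need not contain V_a along with
  a.\<close>

definition isV :: "'a \<Rightarrow> 'a \<Rightarrow> bool" where
  "isV a y \<longleftrightarrow> Ord a \<and> y = Vr a"

text \<open>Every V_b with b \<le> a is a subset of y = V_a. So the function witnessing the
  recursion is included in the product of \<open>suc a\<close> and \<open>pow y\<close>, which is in
  every good class containing a and y.\<close>

lemma isV_iff: "isV a y \<longleftrightarrow> Ord a \<and> (\<exists>f. is_fun f (suc a) (pow y) \<and>
    ((\<forall>b. b \<epsilon> suc a \<longrightarrow> ap f b = HV f b) \<and> y = ap f a))"
proof
  assume "isV a y"
  then have a: "Ord a" "y = Vr a" unfolding isV_def by blast+
  have F: "fn iU (\<lambda>B e. Vr (e 0))" by (intro dintro)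
  define f where "f = lam (suc a) Vr"
  have 1: "is_fun f (suc a) (pow y)" unfolding f_def
  proof (rule lam_fun[OF F])
    fix x assume x: "x \<epsilon> suc a"
    have "Ord x" using Ord_mem[OF Ord_suc[OF a(1)] x] .
    moreover have "subs x a" using x Ord_subs[OF a(1)] by auto
    ultimately show "Vr x \<epsilon> pow y" using Vr_mono_le[OF a(1)] a(2) by simp
  qed
  have 2: "ap f b = Vr b" if "b \<epsilon> suc a" for b unfolding f_def by (rule ap_lam[OF F that])
  have 3: "ap f b = HV f b" if b: "b \<epsilon> suc a" for b
  proof -
    have O: "Ord b" using Ord_mem[OF Ord_suc[OF a(1)] b] .
    have "HV f b = HV (lam b Vr) b"
    proof (rule local_rec_eq[OF local_HV])
      fix c assume c: "c \<epsilon> b"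
      show "ap f c = ap (lam b Vr) c"
        using 2[OF Ord_trans[OF Ord_suc[OF a(1)] b c]] ap_lam[OF F c] by (rule trans[OF _ sym])
    qed
    then show ?thesis using 2[OF b] ordrec_eq[OF local_HV O] unfolding Vr_def by (simp add: fun_eq_iff[symmetric] Vr_def[abs_def])
  qed
  show "Ord a \<and> (\<exists>f. is_fun f (suc a) (pow y) \<and> ((\<forall>b. b \<epsilon> suc a \<longrightarrow> ap f b = HV f b) \<and> y = ap f a))"
    using 1 3 2[of a] a by auto
next
  assume R: "Ord a \<and> (\<exists>f. is_fun f (suc a) (pow y) \<and> ((\<forall>b. b \<epsilon> suc a \<longrightarrow> ap f b = HV f b) \<and> y = ap f a))"
  then obtain f where f: "is_fun f (suc a) (pow y)" "\<forall>b. b \<epsilon> suc a \<longrightarrow> ap f b = HV f b" "y = ap f a" by blast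
  have "attempt HV f a" unfolding attempt_def using f by blast
  then show "isV a y" unfolding isV_def Vr_def using ordrec_ap[OF local_HV] R f(3) by simp
qed

lemma D_isV [dintro]:
  assumes u: "u \<noteq> iT" and F: "fn u F" and G: "fn u G"
  shows "D u (\<lambda>B e. isV (F B e) (G B e))"
proof (rule D_comp2[where R = "\<lambda>B. isV", OF _ F G])
  show "D u (\<lambda>B e. isV (e 0) (e (Suc 0)))" unfolding isV_iff HV_ext_iff using u by (intro dintro)
qed

section \<open>Ordinal addition\<close>

definition HA :: "'a \<Rightarrow> 'a \<Rightarrow> 'a \<Rightarrow> 'a" where
  "HA k f b = mkset (\<lambda>x. x \<epsilon> k \<or> (\<exists>c. c \<epsilon> b \<and> x = ap f c))"

lemma HA_iff: "z \<epsilon> HA k f b \<longleftrightarrow> z \<epsilon> k \<or> (\<exists>c. c \<epsilon> b \<and> z = ap f c)"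
  unfolding HA_def
proof (rule sep[where P = "\<lambda>x. x \<epsilon> k \<or> (\<exists>c. c \<epsilon> b \<and> x = ap f c)"])
  show "D iU (\<lambda>B e. e 0 \<epsilon> k \<or> (\<exists>c. c \<epsilon> b \<and> e 0 = ap f c))" by (intro dintro)
  have F: "fn iU (\<lambda>B e. ap f (e 0))" by (intro dintro)
  fix z assume z: "z \<epsilon> k \<or> (\<exists>c. c \<epsilon> b \<and> z = ap f c)"
  show "z \<epsilon> Uni (upair k (mkset (\<lambda>y. \<exists>c. c \<epsilon> b \<and> y = ap f c)))"
    unfolding Uni_iff upair_iff using z repl[where F = "\<lambda>c. ap f c", OF F, of z b] by blast
qed

lemma local_HA: "local_rec (HA k)"
  unfolding local_rec_def
proof (intro conjI allI impI)
  show "fn iU (\<lambda>B e. HA k (e 0) (e (Suc 0)))" unfolding HA_def by (intro dintro)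
  fix f g b assume "\<forall>c. c \<epsilon> b \<longrightarrow> ap f c = ap g c"
  then show "HA k f b = HA k g b" by (intro set_eqI) (auto simp: HA_iff)
qed

definition Oadd :: "'a \<Rightarrow> 'a \<Rightarrow> 'a" where
  "Oadd k a = ordrec (HA k) a"

lemma fn_Oadd [dintro]: "fn iU F \<Longrightarrow> fn iU G \<Longrightarrow> fn iU (\<lambda>B e. Oadd (F B e) (G B e))"
proof (rule fn_comp2[where k = Oadd])
  show "fn iU (\<lambda>B e. Oadd (e 0) (e (Suc 0)))"
    unfolding Oadd_def ordrec_def attempt_def HA_def by (intro dintro)
qed

lemma ord_add_Oadd: "Ord a \<Longrightarrow> ord_add k a = Oadd k a"
  unfolding Defs.ord_add_def Oadd_def
proof (rule ord_rec_eq[OF local_HA])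
  fix f B b assume a: "Ord a" and f: "is_fun f (suc a) B" and b: "b \<epsilon> suc a"
  have "app f c = ap f c" if "c \<epsilon> b" for c
    using app_ap[OF f Ord_trans[OF Ord_suc[OF a] b that]] .
  then have "(\<lambda>x. x \<epsilon> k \<or> (\<exists>c. c \<epsilon> b \<and> x = app f c)) = (\<lambda>x. x \<epsilon> k \<or> (\<exists>c. c \<epsilon> b \<and> x = ap f c))" by (intro ext) metis
  then show "mkset (\<lambda>x. x \<epsilon> k \<or> (\<exists>c. c \<epsilon> b \<and> x = app f c)) = HA k f b" unfolding HA_def by (rule arg_cong)
qed assumption

lemma fn_Oadd1: "fn iU (\<lambda>B e. Oadd k (e 0))"
  by (intro dintro)

lemma Oadd_iff: "Ord a \<Longrightarrow> x \<epsilon> Oadd k a \<longleftrightarrow> x \<epsilon> k \<or> (\<exists>c. c \<epsilon> a \<and> x = Oadd k c)"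
proof -
  assume a: "Ord a"
  have "ap (lam a (ordrec (HA k))) c = ordrec (HA k) c" if "c \<epsilon> a" for c
    by (rule ap_lam[OF _ that]) (intro fn_ordrec[OF local_HA] dintro)
  then show ?thesis unfolding Oadd_def ordrec_eq[OF local_HA a] HA_iff by auto
qed

lemma Ord_Oadd: "Ord k \<Longrightarrow> Ord a \<Longrightarrow> Ord (Oadd k a)"
proof -
  assume k: "Ord k" and a: "Ord a"
  have D: "D iU (\<lambda>B e. Ord (Oadd k (e 0)))" by (intro dintro)
  show ?thesis
  proof (rule Ord_induct[where P = "\<lambda>a. Ord (Oadd k a)", OF D a])
    fix a assume a: "Ord a" and IH: "\<And>b. b \<epsilon> a \<Longrightarrow> Ord (Oadd k b)"
    show "Ord (Oadd k a)"
    proof (rule OrdI)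
      fix b c assume b: "b \<epsilon> Oadd k a" and c: "c \<epsilon> b"
      show "c \<epsilon> Oadd k a"
      proof (cases "b \<epsilon> k")
        case True
        then show ?thesis using Oadd_iff[OF a] Ord_trans[OF k True c] by blast
      next
        case False
        then obtain d where d: "d \<epsilon> a" "b = Oadd k d" using b Oadd_iff[OF a] by blast
        then have "c \<epsilon> k \<or> (\<exists>e. e \<epsilon> d \<and> c = Oadd k e)" using c Oadd_iff[OF Ord_mem[OF a d(1)]] by blast
        then show ?thesis using Oadd_iff[OF a] Ord_trans[OF a d(1)] by blast
      qed
    next
      fix b assume "b \<epsilon> Oadd k a"
      then show "Ord b" using Oadd_iff[OF a] IH Ord_mem[OF k] by blast
    qed
  qed
qed

lemma Oadd_emp [simp]: "Oadd k emp = k"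
  by (rule set_eqI) (simp add: Oadd_iff)

lemma Oadd_suc: "Ord a \<Longrightarrow> Oadd k (suc a) = suc (Oadd k a)"
  by (rule set_eqI) (auto simp: Oadd_iff Ord_suc)

lemma Oadd_mono: "Ord a \<Longrightarrow> c \<epsilon> a \<Longrightarrow> Oadd k c \<epsilon> Oadd k a"
  using Oadd_iff[of a] by blast

lemma Oadd_subs: "Ord a \<Longrightarrow> subs k (Oadd k a)"
  using Oadd_iff[of a] by (blast intro: subsI)

lemma limit_Oadd_omega: "Ord k \<Longrightarrow> limit (Oadd k omega)"
  unfolding limit_def
proof (intro conjI allI impI)
  assume k: "Ord k"
  show O: "Ord (Oadd k omega)" by (rule Ord_Oadd[OF k Ord_omega])
  have k': "k \<epsilon> Oadd k omega" using Oadd_mono[OF Ord_omega emp_omega, of k] by simp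
  have "emp \<epsilon> suc k" using Ord_linear[OF Ord_emp Ord_suc[OF k]] by (metis emp_iff suc_neq_emp(2))
  then show "emp \<epsilon> Oadd k omega" using k' Ord_trans[OF O k'] by auto
  fix b assume b: "b \<epsilon> Oadd k omega"
  show "suc b \<epsilon> Oadd k omega"
  proof (cases "b \<epsilon> k")
    case True
    then have "suc b \<epsilon> suc k" by (rule suc_mem_suc[OF k])
    then show ?thesis using k' Ord_trans[OF O k'] by auto
  next
    case False
    then obtain c where c: "c \<epsilon> omega" "b = Oadd k c" using b Oadd_iff[OF Ord_omega] by blast
    then have "suc b = Oadd k (suc c)" using Oadd_suc[OF Ord_nat] by simp
    then show ?thesis using Oadd_mono[OF Ord_omega suc_omega[OF c(1)]] by simp
  qed
qed

definition isAdd :: "'a \<Rightarrow> 'a \<Rightarrow> 'a \<Rightarrow> bool" where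
  "isAdd k a y \<longleftrightarrow> Ord k \<and> Ord a \<and> y = Oadd k a"

lemma HA_ext_iff: "w = HA k f b \<longleftrightarrow> (\<forall>z. z \<epsilon> w \<longrightarrow> z \<epsilon> k \<or> (\<exists>c. c \<epsilon> b \<and> z = ap f c)) \<and>
    subs k w \<and> (\<forall>c. c \<epsilon> b \<longrightarrow> ap f c \<epsilon> w)"
proof
  assume "w = HA k f b"
  then show "(\<forall>z. z \<epsilon> w \<longrightarrow> z \<epsilon> k \<or> (\<exists>c. c \<epsilon> b \<and> z = ap f c)) \<and> subs k w \<and> (\<forall>c. c \<epsilon> b \<longrightarrow> ap f c \<epsilon> w)"
    using HA_iff[of _ k f b] by (auto intro: subsI)
next
  assume R: "(\<forall>z. z \<epsilon> w \<longrightarrow> z \<epsilon> k \<or> (\<exists>c. c \<epsilon> b \<and> z = ap f c)) \<and> subs k w \<and> (\<forall>c. c \<epsilon> b \<longrightarrow> ap f c \<epsilon> w)"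
  show "w = HA k f b" by (rule set_eqI) (use R HA_iff[of _ k f b] subsD[of k w] in blast)
qed

text \<open>The intermediate sums k + b with b \<le> a lie in \<open>suc y\<close>, which bounds the
  witnessing function as in \<open>isV_iff\<close>.\<close>

lemma isAdd_iff: "isAdd k a y \<longleftrightarrow> Ord k \<and> Ord a \<and> (\<exists>f. is_fun f (suc a) (suc y) \<and>
    ((\<forall>b. b \<epsilon> suc a \<longrightarrow> ap f b = HA k f b) \<and> y = ap f a))"
proof
  assume "isAdd k a y"
  then have a: "Ord k" "Ord a" "y = Oadd k a" unfolding isAdd_def by blast+
  define f where "f = lam (suc a) (Oadd k)"
  have 2: "ap f b = Oadd k b" if "b \<epsilon> suc a" for b unfolding f_def by (rule ap_lam[OF fn_Oadd1 that])
  have 1: "is_fun f (suc a) (suc y)" unfolding f_def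
    by (rule lam_fun[OF fn_Oadd1]) (use Oadd_mono[OF a(2)] a(3) in auto)
  have 3: "ap f b = HA k f b" if b: "b \<epsilon> suc a" for b
  proof (rule set_eqI)
    fix z
    have O: "Ord b" using Ord_mem[OF Ord_suc[OF a(2)] b] .
    have "ap f c = Oadd k c" if "c \<epsilon> b" for c using 2 Ord_trans[OF Ord_suc[OF a(2)] b that] by blast
    then show "z \<epsilon> ap f b \<longleftrightarrow> z \<epsilon> HA k f b" unfolding HA_iff 2[OF b] Oadd_iff[OF O] by auto
  qed
  show "Ord k \<and> Ord a \<and> (\<exists>f. is_fun f (suc a) (suc y) \<and> ((\<forall>b. b \<epsilon> suc a \<longrightarrow> ap f b = HA k f b) \<and> y = ap f a))"
    using 1 3 2[of a] a by auto
next
  assume R: "Ord k \<and> Ord a \<and> (\<exists>f. is_fun f (suc a) (suc y) \<and> ((\<forall>b. b \<epsilon> suc a \<longrightarrow> ap f b = HA k f b) \<and> y = ap f a))"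
  then obtain f where f: "is_fun f (suc a) (suc y)" "\<forall>b. b \<epsilon> suc a \<longrightarrow> ap f b = HA k f b" "y = ap f a" by blast
  have "attempt (HA k) f a" unfolding attempt_def using f by blast
  then show "isAdd k a y" unfolding isAdd_def Oadd_def using ordrec_ap[OF local_HA] R f(3) by simp
qed

lemma D_isAdd [dintro]:
  assumes u: "u \<noteq> iT" and F: "fn u F" and G: "fn u G" and H: "fn u H"
  shows "D u (\<lambda>B e. isAdd (F B e) (G B e) (H B e))"
proof (rule D_comp3[where R = "\<lambda>B. isAdd", OF _ F G H])
  show "D u (\<lambda>B e. isAdd (e 0) (e (Suc 0)) (e (Suc (Suc 0))))" unfolding isAdd_iff HA_ext_iff using u by (intro dintro)
qed

section \<open>Sizes of sets below an inaccessible cardinal\<close>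

lemma inaccessible_iff: "inaccessible k \<longleftrightarrow>
   (Ord k \<and> \<not> (\<exists>b. b \<epsilon> k \<and> (\<exists>f. is_fun f k b \<and> is_inj f k b))) \<and> omega \<epsilon> k \<and>
   (\<forall>m. m \<epsilon> k \<longrightarrow> (\<forall>f. is_fun f m k \<longrightarrow> (\<exists>b. b \<epsilon> k \<and> (\<forall>x. x \<epsilon> m \<longrightarrow> ap f x \<epsilon> b)))) \<and>
   (\<forall>m. m \<epsilon> k \<longrightarrow> (\<exists>n. n \<epsilon> k \<and> (\<exists>f. is_fun f (pow m) n \<and> is_inj f (pow m) n)))"
proof -
  have "regular k \<longleftrightarrow> (\<forall>m. m \<epsilon> k \<longrightarrow> (\<forall>f. is_fun f m k \<longrightarrow> (\<exists>b. b \<epsilon> k \<and> (\<forall>x. x \<epsilon> m \<longrightarrow> ap f x \<epsilon> b))))"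
    unfolding Defs.regular_def using app_ap by metis
  then show ?thesis
    unfolding Defs.inaccessible_def Defs.cardinal_def Defs.strong_limit_def Defs.is_inj_def by blast
qed

lemma D_inaccessible [dintro]:
  assumes u: "u \<noteq> iT" and F: "fn u F"
  shows "D u (\<lambda>B e. inaccessible (F B e))"
proof (rule D_comp1[where R = "\<lambda>B. inaccessible", OF _ F])
  show "D u (\<lambda>B e. inaccessible (e 0))" unfolding inaccessible_iff using u by (intro dintro)
qed

text \<open>An intersection again, so that choosing the least ordinal with a property is a definable
  operation.\<close>

definition least_ord :: "('a \<Rightarrow> bool) \<Rightarrow> 'a" where
  "least_ord P = mkset (\<lambda>b. Ord b \<and> (\<forall>a. Ord a \<longrightarrow> P a \<longrightarrow> b \<epsilon> a))"

lemma least_ord_least: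
  assumes D: "D iU (\<lambda>B e. P (e 0))" and a: "Ord a" "P a"
  shows "Ord (least_ord P)" "P (least_ord P)" "least_ord P \<epsilon> a \<or> least_ord P = a"
proof -
  obtain m where m: "Ord m" "P m" "m \<epsilon> a \<or> m = a" "\<And>b. b \<epsilon> m \<Longrightarrow> \<not> P b"
    by (rule Ord_least[OF D a]) blast
  have "least_ord P = m" unfolding least_ord_def
  proof (rule mkset_unique)
    fix z show "z \<epsilon> m \<longleftrightarrow> Ord z \<and> (\<forall>a. Ord a \<longrightarrow> P a \<longrightarrow> z \<epsilon> a)"
    proof
      assume z: "z \<epsilon> m"
      have "z \<epsilon> a" if a: "Ord a" "P a" for a
      proof -
        have "m \<epsilon> a \<or> m = a" using Ord_linear[OF m(1) a(1)] m(4) a(2) by blast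
        then show ?thesis using z Ord_trans[OF a(1)] by blast
      qed
      then show "Ord z \<and> (\<forall>a. Ord a \<longrightarrow> P a \<longrightarrow> z \<epsilon> a)" using Ord_mem[OF m(1) z] by blast
    qed (use m in blast)
  qed
  then show "Ord (least_ord P)" "P (least_ord P)" "least_ord P \<epsilon> a \<or> least_ord P = a" using m by simp_all
qed

lemma fn_least_ord [dintro]:
  assumes "D iU (\<lambda>B e. P (\<lambda>i. e (Suc i)) (e 0))" shows "fn iU (\<lambda>B e. least_ord (P e))"
proof -
  have [dintro]: "D iU (\<lambda>B e. P (\<lambda>i. e (Suc (Suc i))) (e 0))"
    using D_ren[OF assms, of "case_nat 0 (\<lambda>i. Suc (Suc i))"] by simp
  show ?thesis unfolding least_ord_def by (intro dintro)
qed

lemma inj_fun: "is_inj f A B \<Longrightarrow> is_fun f A B"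
  and inj_eq: "is_inj f A B \<Longrightarrow> x \<epsilon> A \<Longrightarrow> y \<epsilon> A \<Longrightarrow> ap f x = ap f y \<Longrightarrow> x = y"
  unfolding is_inj_iff by blast+

lemma inj_lam:
  assumes F: "fn iU (\<lambda>B e. F (e 0))" and "\<And>x. x \<epsilon> A \<Longrightarrow> F x \<epsilon> B"
    and "\<And>x y. x \<epsilon> A \<Longrightarrow> y \<epsilon> A \<Longrightarrow> F x = F y \<Longrightarrow> x = y"
  shows "is_inj (lam A F) A B"
  unfolding is_inj_iff using lam_fun[OF F assms(2)] ap_lam[OF F] assms(3) by auto

lemma inj_comp: "is_inj f A B \<Longrightarrow> is_inj g B C \<Longrightarrow> \<exists>h. is_inj h A C"
proof -
  assume f: "is_inj f A B" and g: "is_inj g B C"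
  have "is_inj (lam A (\<lambda>x. ap g (ap f x))) A C"
  proof (rule inj_lam)
    show "fn iU (\<lambda>B e. ap g (ap f (e 0)))" by (intro dintro)
    show "ap g (ap f x) \<epsilon> C" if "x \<epsilon> A" for x using ap_in[OF inj_fun[OF g] ap_in[OF inj_fun[OF f] that]] .
    show "x = y" if "x \<epsilon> A" "y \<epsilon> A" "ap g (ap f x) = ap g (ap f y)" for x y
      using inj_eq[OF g _ _ that(3)] inj_eq[OF f that(1,2)] ap_in[OF inj_fun[OF f]] that by blast
  qed
  then show ?thesis by blast
qed

lemma inj_subs: "subs A B \<Longrightarrow> \<exists>h. is_inj h A B"
proof -
  assume s: "subs A B"
  have "is_inj (lam A (\<lambda>x. x)) A B" by (rule inj_lam) (intro dintro, use subsD[OF s] in simp_all)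
  then show ?thesis by blast
qed

lemma inj_pow: "is_inj f A B \<Longrightarrow> \<exists>h. is_inj h (pow A) (pow B)"
proof -
  assume f: "is_inj f A B"
  define F where "F X = mkset (\<lambda>z. \<exists>x. x \<epsilon> X \<and> z = ap f x)" for X
  have F: "z \<epsilon> F X \<longleftrightarrow> (\<exists>x. x \<epsilon> X \<and> z = ap f x)" for z X
    unfolding F_def by (rule repl[where F = "\<lambda>x. ap f x"]) (intro dintro)
  have "is_inj (lam (pow A) F) (pow A) (pow B)"
  proof (rule inj_lam)
    show "fn iU (\<lambda>B e. F (e 0))" unfolding F_def by (intro dintro)
    show "F X \<epsilon> pow B" if "X \<epsilon> pow A" for X
      using that ap_in[OF inj_fun[OF f]] F subsD[of X A] by (auto intro!: subsI)
    show "X = Y" if "X \<epsilon> pow A" "Y \<epsilon> pow A" "F X = F Y" for X Y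
    proof (rule set_eqI)
      have *: "x \<epsilon> X \<longleftrightarrow> ap f x \<epsilon> F X" if "X \<epsilon> pow A" "x \<epsilon> A" for x X
        unfolding F using inj_eq[OF f] subsD[of X A] that by (metis pow_iff)
      fix z show "z \<epsilon> X \<longleftrightarrow> z \<epsilon> Y"
        using *[OF that(1)] *[OF that(2)] that subsD[of X A z] subsD[of Y A z] pow_iff by metis
    qed
  qed
  then show ?thesis by blast
qed

context
  fixes k assumes k: "inaccessible k"
begin

lemma inac_Ord: "Ord k" and inac_omega: "omega \<epsilon> k"
  and inac_regular: "m \<epsilon> k \<Longrightarrow> is_fun f m k \<Longrightarrow> \<exists>b. b \<epsilon> k \<and> (\<forall>x. x \<epsilon> m \<longrightarrow> ap f x \<epsilon> b)"
  and inac_strong: "m \<epsilon> k \<Longrightarrow> \<exists>n. n \<epsilon> k \<and> (\<exists>f. is_inj f (pow m) n)"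
  using k unfolding inaccessible_iff by blast+

lemma inac_limit: "limit k"
  unfolding limit_def
proof (intro conjI allI impI)
  show "Ord k" by (rule inac_Ord)
  show "emp \<epsilon> k" using Ord_trans[OF inac_Ord inac_omega emp_omega] .
  fix b assume b: "b \<epsilon> k"
  have "suc b \<noteq> k"
  proof
    assume kb: "suc b = k"
    \<comment> \<open>If k were b + 1, the function with domain 1 = {0} and value b would be
      unbounded in k.\<close>
    have "suc emp \<epsilon> k" using Ord_trans[OF inac_Ord inac_omega suc_omega[OF emp_omega]] .
    moreover have f: "is_fun (lam (suc emp) (\<lambda>_. b)) (suc emp) k" by (rule lam_fun) (intro dintro, rule b)
    ultimately obtain c where c: "c \<epsilon> k" "\<forall>x. x \<epsilon> suc emp \<longrightarrow> ap (lam (suc emp) (\<lambda>_. b)) x \<epsilon> c"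
      using inac_regular by blast
    have "ap (lam (suc emp) (\<lambda>_. b)) emp = b" by (rule ap_lam) (intro dintro, simp)
    then have "b \<epsilon> c" using c(2) by (metis suc_iff)
    then show False using c(1) no_self no_cycle2 unfolding kb[symmetric] by auto
  qed
  moreover have "\<not> k \<epsilon> suc b" using b no_self no_cycle2 by auto
  ultimately show "suc b \<epsilon> k" using Ord_linear[OF Ord_suc[OF Ord_mem[OF inac_Ord b]] inac_Ord] by blast
qed

lemma inac_regularF:
  assumes F: "fn iU (\<lambda>B e. F (e 0))" and m: "m \<epsilon> k" and "\<And>x. x \<epsilon> m \<Longrightarrow> F x \<epsilon> k"
  shows "\<exists>b. b \<epsilon> k \<and> (\<forall>x. x \<epsilon> m \<longrightarrow> F x \<epsilon> b)"
  using inac_regular[OF m lam_fun[OF F assms(3)]] ap_lam[OF F] by auto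

lemma inac_strong2: "m \<epsilon> k \<Longrightarrow> \<exists>n. n \<epsilon> k \<and> (\<exists>f. is_inj f (pow (pow m)) n)"
  using inac_strong inj_pow inj_comp by meson

text \<open>By induction and strong limitness, the sets \<open>pow (Vr c)\<close> with c < a inject
  into ordinals below k, and by regularity into a single N below k. After a choice of injections, x
  in V_a is determined by its rank and its index in N, hence by a pair of ordinals below some M in
  k. Such pairs are elements of \<open>pow (pow M)\<close>, and k is a strong limit.\<close>

lemma inac_inj_Vr: "a \<epsilon> k \<Longrightarrow> \<exists>n. n \<epsilon> k \<and> (\<exists>f. is_inj f (Vr a) n)"
proof -
  have D: "D iU (\<lambda>B e. e 0 \<epsilon> k \<longrightarrow> (\<exists>n. n \<epsilon> k \<and> (\<exists>f. is_inj f (Vr (e 0)) n)))" by (intro dintro)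
  have "a \<epsilon> k \<longrightarrow> (\<exists>n. n \<epsilon> k \<and> (\<exists>f. is_inj f (Vr a) n))" if "Ord a" for a
  proof (rule Ord_induct[where P = "\<lambda>a. a \<epsilon> k \<longrightarrow> (\<exists>n. n \<epsilon> k \<and> (\<exists>f. is_inj f (Vr a) n))", OF D that], rule impI)
    fix a assume Oa: "Ord a" and IH: "\<And>b. b \<epsilon> a \<Longrightarrow> b \<epsilon> k \<longrightarrow> (\<exists>n. n \<epsilon> k \<and> (\<exists>f. is_inj f (Vr b) n))"
      and a: "a \<epsilon> k"
    define P where "P c n \<longleftrightarrow> n \<epsilon> k \<and> (\<exists>f. is_inj f (pow (Vr c)) n)" for c n
    have PD: "D iU (\<lambda>B e. P (e i) (e j))" for i j unfolding P_def by (intro dintro)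
    have PD': "D iU (\<lambda>B e. P c (e j))" for j c unfolding P_def by (intro dintro)
    have ex: "\<exists>n. P c n" if c: "c \<epsilon> a" for c
    proof -
      obtain n f where "n \<epsilon> k" "is_inj f (Vr c) n" using IH[OF c] Ord_trans[OF inac_Ord a c] by blast
      then show ?thesis unfolding P_def using inac_strong inj_pow inj_comp by meson
    qed
    \<comment> \<open>Taking the least bound gives a definable function of c, to which regularity
      can be applied.\<close>
    define nn where "nn c = least_ord (P c)" for c
    have nn: "P c (nn c)" if c: "c \<epsilon> a" for c
    proof -
      obtain n where n: "P c n" using ex[OF c] by blast
      then have "Ord n" unfolding P_def using Ord_mem[OF inac_Ord] by blast
      then show ?thesis unfolding nn_def using least_ord_least(2)[where P = "P c", OF PD' _ n] by blast
    qed
    have "fn iU (\<lambda>B e. nn (e 0))" unfolding nn_def by (intro dintro PD)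
    then obtain N where N: "N \<epsilon> k" "\<And>c. c \<epsilon> a \<Longrightarrow> nn c \<epsilon> N"
      using inac_regularF[where F = nn, OF _ a] nn unfolding P_def by blast
    have ON: "Ord N" using Ord_mem[OF inac_Ord N(1)] .
    have injN: "\<exists>f. is_inj f (pow (Vr c)) N" if "c \<epsilon> a" for c
      using nn[OF that] inj_subs[OF Ord_subs[OF ON N(2)[OF that]]] inj_comp unfolding P_def by blast
    define J where "J c = mkset (\<lambda>f. f \<epsilon> FunS (pow (Vr c)) N \<and> is_inj f (pow (Vr c)) N)" for c
    have J: "f \<epsilon> J c \<longleftrightarrow> is_inj f (pow (Vr c)) N" for f c
    proof -
      have "f \<epsilon> J c \<longleftrightarrow> f \<epsilon> FunS (pow (Vr c)) N \<and> is_inj f (pow (Vr c)) N"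
        unfolding J_def by (rule mkset_iff, rule sep_ex) (intro dintro)
      then show ?thesis using inj_fun by auto
    qed
    have Jfn: "fn iU (\<lambda>B e. J (e 0))" unfolding J_def by (intro dintro)
    obtain h where h: "\<And>Y. Y \<epsilon> mkset (\<lambda>z. \<exists>c. c \<epsilon> a \<and> z = J c) \<Longrightarrow> \<exists>y. y \<epsilon> Y \<Longrightarrow> ap h Y \<epsilon> Y"
      using choice_fun by blast
    have g: "is_inj (ap h (J c)) (pow (Vr c)) N" if "c \<epsilon> a" for c
      using h[of "J c"] repl[where F = J, OF Jfn, of "J c" a] that injN[OF that] J by blast
    define F where "F x = opair (rk x) (ap (ap h (J (rk x))) x)" for x
    have rx: "rk x \<epsilon> a" "x \<epsilon> pow (Vr (rk x))" if "x \<epsilon> Vr a" for x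
      using that mem_Vr_iff[OF Oa] by simp_all
    obtain M where M: "M \<epsilon> k" "subs a M" "subs N M" using Ord_max[OF inac_Ord a N(1)] by blast
    have FM: "F x \<epsilon> pow (pow M)" if "x \<epsilon> Vr a" for x
    proof -
      have "rk x \<epsilon> M" "ap (ap h (J (rk x))) x \<epsilon> M"
        using rx[OF that] ap_in[OF inj_fun[OF g]] M subsD by blast+
      then show ?thesis unfolding F_def Defs.opair_def by (auto intro!: subsI)
    qed
    have "is_inj (lam (Vr a) F) (Vr a) (pow (pow M))"
    proof (rule inj_lam)
      show "fn iU (\<lambda>B e. F (e 0))" unfolding F_def by (intro dintro fn_comp1[OF Jfn])
      show "F x \<epsilon> pow (pow M)" if "x \<epsilon> Vr a" for x by (rule FM[OF that])
      fix x y assume x: "x \<epsilon> Vr a" and y: "y \<epsilon> Vr a" and eq: "F x = F y"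
      from eq have re: "rk x = rk y \<and> ap (ap h (J (rk x))) x = ap (ap h (J (rk y))) y" unfolding F_def opair_eq .
      from re have r: "rk x = rk y" ..
      have e: "ap (ap h (J (rk x))) x = ap (ap h (J (rk x))) y" using conjunct2[OF re] unfolding r .
      show "x = y" by (rule inj_eq[OF g[OF rx(1)[OF x]] rx(2)[OF x] _ e]) (use rx(2)[OF y] r in simp)
    qed
    then show "\<exists>n. n \<epsilon> k \<and> (\<exists>f. is_inj f (Vr a) n)" using inac_strong2[OF M(1)] inj_comp by blast
  qed
  then show "a \<epsilon> k \<Longrightarrow> \<exists>n. n \<epsilon> k \<and> (\<exists>f. is_inj f (Vr a) n)" using Ord_mem[OF inac_Ord] by blast
qed

text \<open>The property of inaccessible cardinals that replaces cardinality arguments.\<close>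

lemma inac_bounded:
  assumes x: "x \<epsilon> Vr k" and F: "fn iU (\<lambda>B e. F (e 0))" and Fk: "\<And>y. y \<epsilon> x \<Longrightarrow> F y \<epsilon> k"
  shows "\<exists>b. b \<epsilon> k \<and> (\<forall>y. y \<epsilon> x \<longrightarrow> F y \<epsilon> b)"
proof -
  obtain a where a: "a \<epsilon> k" "subs x (Vr a)" using Vr_iff[OF inac_Ord] x by blast
  obtain n g where n: "n \<epsilon> k" and g: "is_inj g x n"
    using inac_inj_Vr[OF a(1)] inj_subs[OF a(2)] inj_comp by meson
  \<comment> \<open>The function \<open>F\<close> transported along the injection into n. Off the
    range of the injection the value is 0, which is below k.\<close>
  define G where "G i = mkset (\<lambda>z. \<exists>y. y \<epsilon> x \<and> (ap g y = i \<and> z \<epsilon> F y))" for i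
  have GF: "G (ap g y) = F y" if "y \<epsilon> x" for y
    unfolding G_def by (rule mkset_unique) (use that inj_eq[OF g] in blast)
  have Ge: "G i = emp" if "\<not> (\<exists>y. y \<epsilon> x \<and> ap g y = i)" for i
    unfolding G_def by (rule mkset_unique) (use that emp_iff in blast)
  have "fn iU (\<lambda>B e. G (e 0))" unfolding G_def by (intro dintro fn_comp1[OF F])
  moreover have "G i \<epsilon> k" for i
  proof (cases "\<exists>y. y \<epsilon> x \<and> ap g y = i")
    case True then show ?thesis using GF Fk by auto
  next
    case False then show ?thesis using Ge inac_limit unfolding limit_def by simp
  qed
  ultimately obtain b where b: "b \<epsilon> k" "\<forall>i. i \<epsilon> n \<longrightarrow> G i \<epsilon> b"
    using inac_regularF[where F = G, OF _ n] by blast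
  have "F y \<epsilon> b" if "y \<epsilon> x" for y using b(2) ap_in[OF inj_fun[OF g] that] GF[OF that] by metis
  then show ?thesis using b(1) by blast
qed

lemma inac_Oadd: "a \<epsilon> k \<Longrightarrow> b \<epsilon> k \<Longrightarrow> Oadd a b \<epsilon> k"
proof -
  assume a: "a \<epsilon> k" and b: "b \<epsilon> k"
  have Oa: "Ord a" and Ob: "Ord b" using Ord_mem[OF inac_Ord] a b by blast+
  have D: "D iU (\<lambda>B e. e 0 \<epsilon> k \<longrightarrow> Oadd a (e 0) \<epsilon> k)" by (intro dintro)
  have "b \<epsilon> k \<longrightarrow> Oadd a b \<epsilon> k"
  proof (rule Ord_induct[where P = "\<lambda>b. b \<epsilon> k \<longrightarrow> Oadd a b \<epsilon> k", OF D Ob], rule impI)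
    fix b assume Ob: "Ord b" and IH: "\<And>c. c \<epsilon> b \<Longrightarrow> c \<epsilon> k \<longrightarrow> Oadd a c \<epsilon> k" and b: "b \<epsilon> k"
    obtain d where d: "d \<epsilon> k" "\<And>c. c \<epsilon> b \<Longrightarrow> Oadd a c \<epsilon> d"
      using inac_regularF[where F = "Oadd a", OF fn_Oadd1 b] IH Ord_trans[OF inac_Ord b] by blast
    obtain m where m: "m \<epsilon> k" "subs a m" "subs d m" using Ord_max[OF inac_Ord a d(1)] by blast
    have "subs (Oadd a b) m" unfolding Defs.subs_def Oadd_iff[OF Ob] using m subsD d(2) by blast
    then show "Oadd a b \<epsilon> k"
      using Ord_subs_le[OF Ord_Oadd[OF Oa Ob] Ord_mem[OF inac_Ord m(1)]] m(1) Ord_trans[OF inac_Ord m(1)] by blast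
  qed
  then show "Oadd a b \<epsilon> k" using b by blast
qed

lemma good_inac: "good (\<lambda>x. x \<epsilon> Vr k)"
  by (rule good_Vr[OF inac_limit inac_omega])

text \<open>The ranks of the values are bounded below k by \<open>inac_bounded\<close>, so the
  function is included in a product that is an element of V_k.\<close>

lemma inac_fun_mem: "x \<epsilon> Vr k \<Longrightarrow> is_fun f x (Vr k) \<Longrightarrow> f \<epsilon> Vr k"
proof -
  assume x: "x \<epsilon> Vr k" and f: "is_fun f x (Vr k)"
  have "fn iU (\<lambda>B e. rk (ap f (e 0)))" by (intro dintro)
  moreover have "rk (ap f y) \<epsilon> k" if "y \<epsilon> x" for y
    using ap_in[OF f that] mem_Vr_iff[OF inac_Ord] by blast
  ultimately obtain b where b: "b \<epsilon> k" "\<And>y. y \<epsilon> x \<Longrightarrow> rk (ap f y) \<epsilon> b"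
    using inac_bounded[OF x, where F = "\<lambda>y. rk (ap f y)"] by blast
  have "subs f (prd x (Vr b))"
    using fun_mem_iff[OF f] b(2) mem_Vr_iff[OF Ord_mem[OF inac_Ord b(1)]] by (auto intro!: subsI)
  moreover have "prd x (Vr b) \<epsilon> Vr k" using good_prd[OF good_inac x] Vr_mem[OF inac_Ord b(1)] by blast
  ultimately show "f \<epsilon> Vr k" using Vr_subs_mem[OF inac_Ord] by blast
qed

end

subsection \<open>Categoricity of the next inaccessible cardinal\<close>

text \<open>One formula must work in all transitive sets that include \<open>HF\<close>, so that the
  same sentence can be compared in different stages V_(l+b). The index \<open>emp\<close> is that of
  the variable x_0.\<close>

definition defined_by :: "'a \<Rightarrow> 'a \<Rightarrow> bool" where
  "defined_by d x \<longleftrightarrow> fo_formula d \<and> (\<forall>v. free_in v d \<longrightarrow> v = var1 emp) \<and>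
     (\<forall>A s. transitive A \<longrightarrow> subs HF A \<longrightarrow> is_fun s omega A \<longrightarrow> (fo_Sat A d s \<longleftrightarrow> ap s emp = x))"

text \<open>Moves the free variable of \<open>d\<close> from x_0 to x_i by a quantifier over x_0,
  which avoids defining substitution for formulas of the model. For this i has to differ from
  0.\<close>

definition elem_eq :: "'a \<Rightarrow> 'a \<Rightarrow> 'a" where
  "elem_eq d i = cEx emp (cAnd d (cEq emp i))"

lemma elem_eq_fo: "defined_by d x \<Longrightarrow> i \<epsilon> omega \<Longrightarrow> fo_formula (elem_eq d i)"
  unfolding elem_eq_def defined_by_def by (simp add: fo_intros)

lemma elem_eq_free: "defined_by d x \<Longrightarrow> free_in v (elem_eq d i) \<Longrightarrow> v = var1 i"
  unfolding elem_eq_def defined_by_def using free_invs(2,5,6) by blast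

lemma elem_eq_sat:
  assumes d: "defined_by d x" and x: "x \<epsilon> HF" and i: "i \<epsilon> omega" "i \<noteq> emp"
    and A: "transitive A" "subs HF A" and s: "is_fun s omega A"
  shows "fo_Sat A (elem_eq d i) s \<longleftrightarrow> ap s i = x"
proof -
  have fd: "fo_formula d" using d unfolding defined_by_def by blast
  have "fo_Sat A (cAnd d (cEq emp i)) (upd s emp w) \<longleftrightarrow> w = x \<and> w = ap s i" if w: "w \<epsilon> A" for w
  proof -
    have u: "is_fun (upd s emp w) omega A" by (rule upd_fun[OF s emp_omega w])
    have "fo_Sat A d (upd s emp w) \<longleftrightarrow> w = x"
      using d A u unfolding defined_by_def by (simp add: ap_upd)
    then show ?thesis using fo_Sat_simps(4)[OF u fd fo_intros(2)[OF emp_omega i(1)]] fo_Sat_simps(2)[OF u emp_omega i(1)] i(2)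
      by (simp add: ap_upd)
  qed
  then show ?thesis unfolding elem_eq_def
    using fo_Sat_simps(5)[OF s emp_omega fo_intros(4)[OF fd fo_intros(2)[OF emp_omega i(1)]]] subsD[OF A(2) x] by auto
qed

lemma sat_Ex: "is_fun s omega A \<Longrightarrow> fo_formula p \<Longrightarrow>
    fo_Sat A (cEx (tag i) p) s \<longleftrightarrow> (\<exists>x. x \<epsilon> A \<and> fo_Sat A p (upd s (tag i) x))"
  by (rule fo_Sat_simps(5)) simp_all

text \<open>The definitions \<open>d\<close> and \<open>d'\<close> force the quantified variables
  x_1 and x_2 to take the values x and y.\<close>

lemma param_fo:
  assumes d: "defined_by d x" "x \<epsilon> HF" and d': "defined_by d' y" "y \<epsilon> HF" and q: "fo_formula q"
    and A: "transitive A" "subs HF A" and s: "is_fun s omega A"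
  shows "fo_Sat A (cEx (tag 1) (cEx (tag 2) (cAnd (elem_eq d (tag 1)) (cAnd (elem_eq d' (tag 2)) q)))) s \<longleftrightarrow>
    fo_Sat A q (upd (upd s (tag 1) x) (tag 2) y)"
proof -
  let ?q = "cAnd (elem_eq d (tag 1)) (cAnd (elem_eq d' (tag 2)) q)"
  note f = elem_eq_fo[OF d(1) tag_omega[of 1]] elem_eq_fo[OF d'(1) tag_omega[of 2]]
  have fq: "fo_formula ?q" using f q fo_intros(4) by blast
  have xA: "x \<epsilon> A" "y \<epsilon> A" using subsD[OF A(2)] d d' by blast+
  have 1: "fo_Sat A ?q (upd (upd s (tag 1) u) (tag 2) v) \<longleftrightarrow> u = x \<and> v = y \<and> fo_Sat A q (upd (upd s (tag 1) u) (tag 2) v)"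
    if uv: "u \<epsilon> A" "v \<epsilon> A" for u v
  proof -
    have s2: "is_fun (upd (upd s (tag 1) u) (tag 2) v) omega A"
      by (intro upd_fun s tag_omega uv)
    have "tag 1 \<noteq> emp" "tag 2 \<noteq> emp" by simp_all
    then show ?thesis
      using fo_Sat_simps(4)[OF s2 f(1) fo_intros(4)[OF f(2) q]] fo_Sat_simps(4)[OF s2 f(2) q]
        elem_eq_sat[OF d tag_omega _ A s2, of 1] elem_eq_sat[OF d' tag_omega _ A s2, of 2]
      by (simp add: ap_upd)
  qed
  have "fo_Sat A (cEx (tag 1) (cEx (tag 2) ?q)) s \<longleftrightarrow> (\<exists>u. u \<epsilon> A \<and> (\<exists>v. v \<epsilon> A \<and> fo_Sat A ?q (upd (upd s (tag 1) u) (tag 2) v)))"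
  proof -
    have "fo_Sat A (cEx (tag 2) ?q) (upd s (tag 1) u) \<longleftrightarrow> (\<exists>v. v \<epsilon> A \<and> fo_Sat A ?q (upd (upd s (tag 1) u) (tag 2) v))"
      if "u \<epsilon> A" for u
      by (rule sat_Ex[OF upd_fun[OF s tag_omega that] fq])
    moreover have "fo_Sat A (cEx (tag 1) (cEx (tag 2) ?q)) s \<longleftrightarrow> (\<exists>u. u \<epsilon> A \<and> fo_Sat A (cEx (tag 2) ?q) (upd s (tag 1) u))"
      by (rule sat_Ex[OF s fo_intros(5)[OF tag_omega fq]])
    ultimately show ?thesis by blast
  qed
  then show ?thesis using 1 xA by metis
qed

lemma HF_defined_by: "x \<epsilon> HF \<Longrightarrow> \<exists>d. defined_by d x"
proof -
  have D: "D iU (\<lambda>B e. e 0 \<epsilon> HF \<and> (\<exists>d. defined_by d (e 0)))" unfolding defined_by_def by (intro dintro)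
  assume "x \<epsilon> HF"
  then have "x \<epsilon> HF \<and> (\<exists>d. defined_by d x)"
  proof (rule HF_induct[where P = "\<lambda>x. x \<epsilon> HF \<and> (\<exists>d. defined_by d x)", OF D])
    let ?q = "fm.Neg (fm.Ex 1 (fm.Mem 1 0))"
    have "defined_by (code ?q) emp" unfolding defined_by_def
    proof (intro conjI allI impI)
      show "v = var1 emp" if "free_in v (code ?q)" for v using code_free[OF that] by auto
      fix A s assume A: "transitive A" "is_fun s omega A"
      have "fo_Sat A (code ?q) s \<longleftrightarrow> \<not> (\<exists>x. x \<epsilon> A \<and> x \<epsilon> ap s emp)" unfolding code_sat[OF A(2)] by simp
      also have "\<dots> \<longleftrightarrow> ap s emp = emp"
        using transD[OF A(1) ap_in[OF A(2) emp_omega]] set_eqI[of "ap s emp" emp] emp_iff by metis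
      finally show "fo_Sat A (code ?q) s \<longleftrightarrow> ap s emp = emp" .
    qed (rule code_fo)
    then show "emp \<epsilon> HF \<and> (\<exists>d. defined_by d emp)" using emp_HF by blast
  next
    fix x y assume "x \<epsilon> HF \<and> (\<exists>d. defined_by d x)" "y \<epsilon> HF \<and> (\<exists>d. defined_by d y)"
    then obtain d d' where d: "defined_by d x" "x \<epsilon> HF" and d': "defined_by d' y" "y \<epsilon> HF" by blast
    \<comment> \<open>\<open>?q\<close> says x_0 = x_1 \<union> {x_2}; in \<open>?p\<close> the
      variables x_1 and x_2 are bound to x and y through their definitions.\<close>
    let ?q = "fm.Neg (fm.Ex 3 (fm.Neg (fm.And (fm.Neg (fm.And (fm.Mem 3 0) (fm.And (fm.Neg (fm.Mem 3 1)) (fm.Neg (fm.Eq 3 2)))))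
        (fm.And (fm.Neg (fm.And (fm.Mem 3 1) (fm.Neg (fm.Mem 3 0)))) (fm.Neg (fm.And (fm.Eq 3 2) (fm.Neg (fm.Mem 3 0))))))))"
    let ?p = "cEx (tag 1) (cEx (tag 2) (cAnd (elem_eq d (tag 1)) (cAnd (elem_eq d' (tag 2)) (code ?q))))"
    have "defined_by ?p (adj x y)" unfolding defined_by_def
    proof (intro conjI allI impI)
      show "fo_formula ?p" using elem_eq_fo[OF d(1) tag_omega] elem_eq_fo[OF d'(1) tag_omega] by (intro fo_intros tag_omega code_fo)
      show "v = var1 emp" if "free_in v ?p" for v
      proof -
        have a: "v \<noteq> var1 (tag 1)" "v \<noteq> var1 (tag 2)" and b: "free_in v (elem_eq d (tag 1)) \<or> free_in v (elem_eq d' (tag 2)) \<or> free_in v (code ?q)"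
          using free_invs(5,6) that by blast+
        from b a have "free_in v (code ?q)" using elem_eq_free[OF d(1)] elem_eq_free[OF d'(1)] by blast
        from code_free[OF this] a show ?thesis by auto
      qed
      fix A s assume A: "transitive A" "subs HF A" and s: "is_fun s omega A"
      have xy: "x \<epsilon> A" "y \<epsilon> A" using subsD[OF A(2)] d d' by blast+
      let ?s = "upd (upd s (tag 1) x) (tag 2) y"
      have s2: "is_fun ?s omega A" by (intro upd_fun s tag_omega xy)
      have "fo_Sat A ?p s \<longleftrightarrow> fo_Sat A (code ?q) ?s" by (rule param_fo[OF d d' code_fo A s])
      also have "\<dots> \<longleftrightarrow> (\<forall>z. z \<epsilon> A \<longrightarrow> (z \<epsilon> ap s emp \<longleftrightarrow> z \<epsilon> x \<or> z = y))"
        unfolding code_sat[OF s2] by (auto simp: ap_upd)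
      also have "\<dots> \<longleftrightarrow> ap s emp = adj x y"
      proof
        assume R: "\<forall>z. z \<epsilon> A \<longrightarrow> (z \<epsilon> ap s emp \<longleftrightarrow> z \<epsilon> x \<or> z = y)"
        show "ap s emp = adj x y"
        proof (rule set_eqI)
          fix z show "z \<epsilon> ap s emp \<longleftrightarrow> z \<epsilon> adj x y"
            using R transD[OF A(1) ap_in[OF s emp_omega]] transD[OF A(1) xy(1)] xy(2) adj_iff by metis
        qed
      qed simp
      finally show "fo_Sat A ?p s \<longleftrightarrow> ap s emp = adj x y" .
    qed
    then show "adj x y \<epsilon> HF \<and> (\<exists>d. defined_by d (adj x y))" using adj_HF d d' by blast
  qed
  then show ?thesis by blast
qed

text \<open>A standard formula with two parameters from \<open>HF\<close> becomes a sentence of the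
  model once definitions of the parameters are inserted. In this way one sentence can assert that a
  given p, possibly nonstandard, is true in some stage.\<close>

lemma param_sentence:
  assumes D: "D iT (\<lambda>B e. R B (e 1) (e 2))" and x: "x \<epsilon> HF" and y: "y \<epsilon> HF"
  obtains \<sigma> where "fo_sentence \<sigma>"
    "\<And>A. swelled (\<lambda>x. x \<epsilon> A) \<Longrightarrow> subs HF A \<Longrightarrow> models A \<sigma> \<longleftrightarrow> R (\<lambda>x. x \<epsilon> A) x y"
proof -
  obtain d d' where d: "defined_by d x" and d': "defined_by d' y" using HF_defined_by x y by blast
  have depends: "depends 3 (\<lambda>B e. R B (e 1) (e 2))" unfolding depends_def by simp
  obtain q where q: "fo_formula q" "\<And>v. free_in v q \<Longrightarrow> \<exists>i<3. v = var1 (tag i)"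
    "\<And>A s. kind_of iT (\<lambda>x. x \<epsilon> A) \<Longrightarrow> is_fun s omega A \<Longrightarrow> fo_Sat A q s \<longleftrightarrow> R (\<lambda>x. x \<epsilon> A) (ap s (tag 1)) (ap s (tag 2))"
    by (rule D_code[OF D _ depends]) (simp, simp, rule that)
  let ?p = "cEx (tag 1) (cEx (tag 2) (cAnd (elem_eq d (tag 1)) (cAnd (elem_eq d' (tag 2)) q)))"
  have fp: "fo_formula ?p" using elem_eq_fo[OF d tag_omega] elem_eq_fo[OF d' tag_omega] q(1) by (intro fo_intros tag_omega)
  show thesis
  \<comment> \<open>The variable x_0 may be free in \<open>q\<close>, although its value has no
    influence on the truth of \<open>q\<close>; an outer quantifier over the nonempty set
    \<open>A\<close> binds it.\<close>
  proof (rule that[of "cEx (tag 0) ?p"])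
    have "\<not> free_in v (cEx (tag 0) ?p)" for v
    proof
      assume "free_in v (cEx (tag 0) ?p)"
      then have a: "v \<noteq> var1 (tag 0)" "v \<noteq> var1 (tag 1)" "v \<noteq> var1 (tag 2)"
        and b: "free_in v (elem_eq d (tag 1)) \<or> free_in v (elem_eq d' (tag 2)) \<or> free_in v q"
        using free_invs(5,6) by blast+
      from b a have "free_in v q" using elem_eq_free[OF d] elem_eq_free[OF d'] by blast
      then obtain i :: nat where "i < 3" "v = var1 (tag i)" using q(2) by blast
      then show False using a by (auto simp: less_Suc_eq numeral_3_eq_3 numeral_2_eq_2)
    qed
    then show sn: "fo_sentence (cEx (tag 0) ?p)" unfolding Defs.fo_sentence_def using fp fo_intros(5) tag_omega by blast
    fix A assume A: "swelled (\<lambda>x. x \<epsilon> A)" and H: "subs HF A"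
    have tr: "transitive A" by (rule transI) (rule swelled_mem[OF A])
    have eA: "emp \<epsilon> A" using subsD[OF H emp_HF] .
    let ?s = "lam omega (\<lambda>_. emp)"
    have s: "is_fun ?s omega A" by (rule const_fun[OF eA])
    have "fo_Sat A ?p (upd ?s (tag 0) w) \<longleftrightarrow> R (\<lambda>x. x \<epsilon> A) x y" if w: "w \<epsilon> A" for w
    proof -
      let ?t = "upd (upd (upd ?s (tag 0) w) (tag 1) x) (tag 2) y"
      have s2: "is_fun ?t omega A" by (intro upd_fun s tag_omega w subsD[OF H x] subsD[OF H y])
      have "fo_Sat A ?p (upd ?s (tag 0) w) \<longleftrightarrow> fo_Sat A q ?t"
        by (rule param_fo[OF d x d' y q(1) tr H upd_fun[OF s tag_omega w]])
      also have "\<dots> \<longleftrightarrow> R (\<lambda>x. x \<epsilon> A) x y"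
        using q(3)[OF _ s2] A by (simp add: kind_of_def ap_upd)
      finally show ?thesis .
    qed
    then show "models A (cEx (tag 0) ?p) \<longleftrightarrow> R (\<lambda>x. x \<epsilon> A) x y"
      unfolding models_fo_Sat[OF sn s] sat_Ex[OF s fp] using eA by blast
  qed
qed

definition abs_defines :: "'a \<Rightarrow> 'a \<Rightarrow> 'a \<Rightarrow> bool" where
  "abs_defines p M a \<longleftrightarrow> a \<epsilon> M \<and> (\<forall>s. is_fun s omega M \<longrightarrow> (fo_Sat M p s \<longleftrightarrow> ap s emp = a))"

lemma abs_defines_unique: "abs_defines p M a \<Longrightarrow> abs_defines p M b \<Longrightarrow> a = b"
proof -
  assume a: "abs_defines p M a" and b: "abs_defines p M b"
  have f: "is_fun (lam omega (\<lambda>_. a)) omega M" using const_fun a unfolding abs_defines_def by blast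
  have "ap (lam omega (\<lambda>_. a)) emp = a" by (rule ap_lam) (intro dintro, simp)
  then show "a = b" using a b f unfolding abs_defines_def by metis
qed

text \<open>Covers first-order and second-order sentences at once, so that freshness in either sense
  is treated by one argument.\<close>

definition language :: "('a \<Rightarrow> bool) \<Rightarrow> bool" where
  "language L \<longleftrightarrow> (\<forall>u i. u \<noteq> iT \<longrightarrow> D u (\<lambda>B e. L (e i))) \<and> (\<forall>p. L p \<longrightarrow> so_sentence p) \<and>
     (\<forall>p. fo_sentence p \<longrightarrow> L p)"

lemma language_fo: "language fo_sentence" and language_so: "language so_sentence"
  unfolding language_def using sentence_so by (auto intro!: D_sentence fn_var)

lemma language_HF: "language L \<Longrightarrow> L p \<Longrightarrow> p \<epsilon> HF"
  unfolding language_def Defs.so_sentence_def using formula_HF by blast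

text \<open>The stage V_(d+a) is sought inside \<open>M\<close>, which will be V_k, so that the
  comparison of theories stays bounded.\<close>

definition differs :: "('a \<Rightarrow> bool) \<Rightarrow> 'a \<Rightarrow> 'a \<Rightarrow> 'a \<Rightarrow> 'a \<Rightarrow> bool" where
  "differs L M a d W \<longleftrightarrow> (\<exists>W'. W' \<epsilon> M \<and> (\<exists>o'. o' \<epsilon> M \<and> (isAdd d a o' \<and> isV o' W' \<and>
     (\<exists>q. q \<epsilon> HF \<and> (L q \<and> \<not> (models W' q \<longleftrightarrow> models W q))))))"

text \<open>With M = V_k and W = V_(k+a), this says that k is fresh for a-order truth of sentences
  of \<open>L\<close> and that p belongs to its theory. The auxiliary objects are arguments, so that
  the statement is absolute for good sets containing them. The ordinal a is tied to its definition
  r, since the sentences to be formed may only use parameters from \<open>HF\<close>.\<close>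

definition first_model :: "('a \<Rightarrow> bool) \<Rightarrow> 'a \<Rightarrow> 'a \<Rightarrow> 'a \<Rightarrow> 'a \<Rightarrow> 'a \<Rightarrow> 'a \<Rightarrow> 'a \<Rightarrow> bool" where
  "first_model L k p r M W a u \<longleftrightarrow> inaccessible k \<and> isV k M \<and> abs_defines r M a \<and> isAdd k a u \<and> isV u W \<and> models W p \<and>
     (\<forall>d. d \<epsilon> k \<longrightarrow> inaccessible d \<longrightarrow> differs L M a d W)"

definition good_set :: "'a \<Rightarrow> bool" where
  "good_set G \<longleftrightarrow> good (\<lambda>x. x \<epsilon> G)"

lemma good_set_swelled: "good_set G \<longleftrightarrow> swelled (\<lambda>x. x \<epsilon> G) \<and> good (\<lambda>x. x \<epsilon> G)"
  unfolding good_set_def using good_swelled by blast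

text \<open>In \<open>B = V\<^bsub>l+b\<^esub>\<close>, the class \<open>inac_in B\<close> consists of the inaccessible cardinals below \<open>l\<close>, and of
  \<open>l\<close> itself if \<open>\<omega> < b\<close>.  The flag \<open>c\<close> below is \<open>\<omega> < b\<close> and serves to exclude \<open>l\<close> in that case.\<close>

definition inac_in :: "('a \<Rightarrow> bool) \<Rightarrow> 'a \<Rightarrow> bool" where
  "inac_in B k \<longleftrightarrow> (\<exists>G. B G \<and> (good_set G \<and> k \<epsilon> G \<and> inaccessible k))"

text \<open>If l itself is visible, it is the greatest visible inaccessible, so the demand for a
  greater one removes exactly l.\<close>

definition inac_bounded_in :: "bool \<Rightarrow> ('a \<Rightarrow> bool) \<Rightarrow> 'a \<Rightarrow> bool" where
  "inac_bounded_in c B k \<longleftrightarrow> inac_in B k \<and> (c \<longrightarrow> (\<exists>l. B l \<and> (inac_in B l \<and> k \<epsilon> l)))"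

definition first_model_in :: "('a \<Rightarrow> bool) \<Rightarrow> 'a \<Rightarrow> 'a \<Rightarrow> 'a \<Rightarrow> 'a \<Rightarrow> 'a \<Rightarrow> 'a \<Rightarrow> 'a \<Rightarrow> 'a \<Rightarrow> bool" where
  "first_model_in L G k p r M W a u \<longleftrightarrow> good_set G \<and> k \<epsilon> G \<and> p \<epsilon> G \<and> r \<epsilon> G \<and> M \<epsilon> G \<and> W \<epsilon> G \<and> a \<epsilon> G \<and> u \<epsilon> G \<and> first_model L k p r M W a u"

text \<open>For B = V_(l+b): there is a greatest inaccessible below l, it is fresh, and p is in its
  theory. Letting p vary over all sentences recovers the whole theory of that cardinal.\<close>

definition greatest_first_model :: "('a \<Rightarrow> bool) \<Rightarrow> bool \<Rightarrow> ('a \<Rightarrow> bool) \<Rightarrow> 'a \<Rightarrow> 'a \<Rightarrow> bool" where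
  "greatest_first_model L c B p r \<longleftrightarrow> (\<exists>k. B k \<and> (inac_bounded_in c B k \<and> (\<forall>l. B l \<longrightarrow> inac_bounded_in c B l \<longrightarrow> l = k \<or> l \<epsilon> k) \<and>
     (\<exists>G. B G \<and> (\<exists>M. B M \<and> (\<exists>W. B W \<and> (\<exists>a. B a \<and> (\<exists>u. B u \<and> first_model_in L G k p r M W a u)))))))"

text \<open>Inaccessibility cannot be expressed over \<open>B\<close> directly, as \<open>B\<close>
  may lack pairs; \<open>D_lift\<close> expresses it in a good element of \<open>B\<close>.\<close>

lemma D_inac_in: "D iT (\<lambda>B e. inac_in B (e i))"
proof -
  have "D iG (\<lambda>B e. inaccessible (e 0))" by (intro dintro)
  from D_lift[OF D_good_conj[OF this], of 1]
  have "D iT (\<lambda>B e. swelled (\<lambda>x. x \<epsilon> e 0) \<and> (\<forall>i<1. e (Suc i) \<epsilon> e 0) \<and> good (\<lambda>x. x \<epsilon> e 0) \<and> inaccessible (e (Suc 0)))"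
    by (simp add: depends_def)
  then have 1: "D iT (\<lambda>B e. good_set (e 0) \<and> e (Suc 0) \<epsilon> e 0 \<and> inaccessible (e (Suc 0)))"
    by (rule D_cong) (auto simp: good_set_swelled)
  have "D iT (\<lambda>B e. good_set (e 0) \<and> e (Suc i) \<epsilon> e 0 \<and> inaccessible (e (Suc i)))"
    using D_ren[OF 1, of "case_nat 0 (\<lambda>_. Suc i)"] by simp
  then show ?thesis unfolding inac_in_def by (rule D_exB)
qed

lemma D_inac_bounded_in: "D iT (\<lambda>B e. inac_bounded_in c B (e i))"
  unfolding inac_bounded_in_def by (intro dintro D_inac_in)

lemma D_first_model_in:
  assumes L: "language L"
  shows "D iT (\<lambda>B e. first_model_in L (e i0) (e i1) (e i2) (e i3) (e i4) (e i5) (e i6) (e i7))"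
proof -
  have [dintro]: "D iG (\<lambda>B e. L (e i))" for i using L unfolding language_def by (metis neq_iT(2))
  define Q where "Q B e \<longleftrightarrow> good B \<and> first_model L (e 0) (e 1) (e 2) (e 3) (e 4) (e 5) (e 6)" for B :: "'a \<Rightarrow> bool" and e :: "nat \<Rightarrow> 'a"
  have "D iG (\<lambda>B e. first_model L (e 0) (e 1) (e 2) (e 3) (e 4) (e 5) (e 6))"
    unfolding first_model_def abs_defines_def differs_def by (intro dintro)
  then have "D iT Q" unfolding Q_def by (rule D_good_conj)
  moreover have "depends 7 Q" unfolding depends_def Q_def by simp
  ultimately have "D iT (\<lambda>B e. swelled (\<lambda>x. x \<epsilon> e 0) \<and> (\<forall>i<7. e (Suc i) \<epsilon> e 0) \<and> Q (\<lambda>x. x \<epsilon> e 0) (\<lambda>i. e (Suc i)))"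
    by (rule D_lift) simp
  then have "D iT (\<lambda>B e. first_model_in L (e 0) (e 1) (e 2) (e 3) (e 4) (e 5) (e 6) (e 7))"
    by (rule D_cong) (auto simp: Q_def first_model_in_def good_set_swelled numeral_eq_Suc All_less_Suc)
  from D_ren[OF this, of "\<lambda>i. [i0, i1, i2, i3, i4, i5, i6, i7] ! i"] show ?thesis
    by (simp add: numeral_eq_Suc)
qed

lemma D_greatest_first_model: "language L \<Longrightarrow> D iT (\<lambda>B e. greatest_first_model L c B (e i) (e j))"
  unfolding greatest_first_model_def by (intro dintro D_inac_bounded_in D_first_model_in)

lemma HF_Vr: "omega \<epsilon> a \<Longrightarrow> Ord a \<Longrightarrow> subs HF (Vr a)"
  using HF_subs[OF adj_closed_Vr[OF limit_omega]] Vr_mono subs_trans by blast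

lemma inac_Oadd_omega: "inaccessible l \<Longrightarrow> k \<epsilon> l \<Longrightarrow> Oadd k omega \<epsilon> l"
  using inac_Oadd inac_omega by blast

text \<open>k + \<omega> is the least limit ordinal above k: its stage has enough room to discuss k,
  and the index is still below every inaccessible above k.\<close>

lemma good_set_Oadd: "Ord k \<Longrightarrow> omega \<epsilon> k \<or> omega = k \<Longrightarrow> good_set (Vr (Oadd k omega))"
proof -
  assume k: "Ord k" "omega \<epsilon> k \<or> omega = k"
  have "k \<epsilon> Oadd k omega" using Oadd_mono[OF Ord_omega emp_omega, of k] by simp
  then have "omega \<epsilon> Oadd k omega" using k(2) Ord_trans[OF Ord_Oadd[OF k(1) Ord_omega]] by blast
  then show ?thesis unfolding good_set_def by (rule good_Vr[OF limit_Oadd_omega[OF k(1)]])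
qed

context
  fixes l b assumes l: "inaccessible l" and b: "b \<epsilon> l"
begin

lemma Ord_l: "Ord l" by (rule inac_Ord[OF l])
lemma Ord_b: "Ord b" by (rule Ord_mem[OF Ord_l b])
lemma Ord_lb: "Ord (Oadd l b)" by (rule Ord_Oadd[OF Ord_l Ord_b])

lemma l_subs: "subs l (Oadd l b)"
  by (rule Oadd_subs[OF Ord_b])

text \<open>A good set containing l contains every l + n with n < \<omega>, so its rank is at least
  l + \<omega>, and it is an element of V_(l+b) only if \<omega> < b. An inaccessible above l is
  also above l + b, because b < l.\<close>

lemma inac_in_sem: "inac_in (\<lambda>x. x \<epsilon> Vr (Oadd l b)) k \<longleftrightarrow> inaccessible k \<and> (k \<epsilon> l \<or> k = l \<and> omega \<epsilon> b)"
proof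
  assume "inac_in (\<lambda>x. x \<epsilon> Vr (Oadd l b)) k"
  then obtain G where G: "G \<epsilon> Vr (Oadd l b)" "good_set G" "k \<epsilon> G" and k: "inaccessible k" unfolding inac_in_def by blast
  have Ok: "Ord k" by (rule inac_Ord[OF k])
  have k2: "k \<epsilon> Oadd l b" using Vr_mem_subs[OF Ord_lb G(1,3)] Ord_Vr_iff[OF Ord_lb Ok] by blast
  have "\<not> l \<epsilon> k"
  proof
    assume lk: "l \<epsilon> k"
    then have "Oadd l b \<epsilon> k" using inac_Oadd[OF k lk] Ord_trans[OF Ok lk b] by blast
    then show False using k2 no_cycle2 by blast
  qed
  then have kl: "k \<epsilon> l \<or> k = l" using Ord_linear[OF Ok Ord_l] by blast
  have "omega \<epsilon> b" if kl: "k = l"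
  proof (rule ccontr)
    assume "\<not> omega \<epsilon> b"
    then have bo: "subs b omega" using Ord_not_mem[OF Ord_omega Ord_b] by blast
    obtain c where c: "c \<epsilon> Oadd l b" "subs G (Vr c)" using Vr_iff[OF Ord_lb] G(1) by blast
    have Oc: "Ord c" using Ord_mem[OF Ord_lb c(1)] .
    have D: "D iU (\<lambda>B e. Oadd l (e 0) \<epsilon> G)" by (intro dintro)
    have Gn: "Oadd l n \<epsilon> G" if "n \<epsilon> omega" for n
    proof (rule omega_induct[where P = "\<lambda>n. Oadd l n \<epsilon> G", OF D that])
      show "Oadd l emp \<epsilon> G" using G(3) kl by simp
      show "Oadd l (suc n) \<epsilon> G" if "n \<epsilon> omega" "Oadd l n \<epsilon> G" for n
        using good_suc[of "\<lambda>x. x \<epsilon> G"] G(2) that Oadd_suc[OF Ord_nat[OF that(1)]] unfolding good_set_def by simp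
    qed
    have nc: "Oadd l n \<epsilon> c" if n: "n \<epsilon> omega" for n
      using subsD[OF c(2) Gn[OF n]] Ord_Vr_iff[OF Oc Ord_Oadd[OF Ord_l Ord_nat[OF n]]] by blast
    show False
    proof (cases "c \<epsilon> l")
      case True
      then show False using nc[OF emp_omega] no_cycle2[of l c] by simp
    next
      case False
      then obtain n where n: "n \<epsilon> b" "c = Oadd l n" using c(1) Oadd_iff[OF Ord_b] by blast
      then show False using nc[of n] subsD[OF bo n(1)] no_self by simp
    qed
  qed
  then show "inaccessible k \<and> (k \<epsilon> l \<or> k = l \<and> omega \<epsilon> b)" using k kl by blast
next
  assume R: "inaccessible k \<and> (k \<epsilon> l \<or> k = l \<and> omega \<epsilon> b)"
  then have k: "inaccessible k" by blast
  note Ok = inac_Ord[OF k]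
  let ?G = "Vr (Oadd k omega)"
  have "good_set ?G" by (rule good_set_Oadd[OF Ok]) (use inac_omega[OF k] in blast)
  moreover have "k \<epsilon> ?G" using Ord_Vr_iff[OF Ord_Oadd[OF Ok Ord_omega] Ok] Oadd_mono[OF Ord_omega emp_omega, of k] by simp
  moreover have "Oadd k omega \<epsilon> Oadd l b"
    using R inac_Oadd_omega[OF l] subsD[OF l_subs] Oadd_mono[OF Ord_b] by blast
  ultimately show "inac_in (\<lambda>x. x \<epsilon> Vr (Oadd l b)) k"
    unfolding inac_in_def using Vr_mem[OF Ord_lb] k by blast
qed

lemma inac_bounded_in_sem: "inac_bounded_in (omega \<epsilon> b) (\<lambda>x. x \<epsilon> Vr (Oadd l b)) k \<longleftrightarrow> inaccessible k \<and> k \<epsilon> l"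
proof (cases "omega \<epsilon> b")
  case True
  have "l \<epsilon> Vr (Oadd l b)"
    using Ord_Vr_iff[OF Ord_lb Ord_l] Oadd_iff[OF Ord_b, of l l] Oadd_emp[of l] Ord_linear[OF Ord_emp Ord_b] True emp_iff by metis
  then show ?thesis unfolding inac_bounded_in_def inac_in_sem using True l Ord_trans[OF Ord_l] no_cycle2 no_self by metis
next
  case False
  then show ?thesis unfolding inac_bounded_in_def inac_in_sem by blast
qed

lemma greatest_first_model_sem:
  assumes L: "language L" and p: "p \<epsilon> HF" and r: "r \<epsilon> HF" and Oa: "Ord a"
    and ad: "\<And>k. inaccessible k \<Longrightarrow> abs_defines r (Vr k) a"
  shows "greatest_first_model L (omega \<epsilon> b) (\<lambda>x. x \<epsilon> Vr (Oadd l b)) p r \<longleftrightarrow>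
    (\<exists>k. inaccessible k \<and> k \<epsilon> l \<and> (\<forall>k'. inaccessible k' \<longrightarrow> k' \<epsilon> l \<longrightarrow> k' = k \<or> k' \<epsilon> k) \<and> models (Vr (Oadd k a)) p \<and>
      (\<forall>d. d \<epsilon> k \<longrightarrow> inaccessible d \<longrightarrow> (\<exists>q. L q \<and> \<not> (models (Vr (Oadd d a)) q \<longleftrightarrow> models (Vr (Oadd k a)) q))))"
    (is "_ \<longleftrightarrow> ?R")
proof
  assume "greatest_first_model L (omega \<epsilon> b) (\<lambda>x. x \<epsilon> Vr (Oadd l b)) p r"
  then obtain k G M W a' u where N: "inaccessible k" "k \<epsilon> l"
    and mx: "\<forall>k'. k' \<epsilon> Vr (Oadd l b) \<longrightarrow> inaccessible k' \<and> k' \<epsilon> l \<longrightarrow> k' = k \<or> k' \<epsilon> k"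
    and Lm: "first_model L k p r M W a' u"
    unfolding greatest_first_model_def inac_bounded_in_sem first_model_in_def by blast
  have M: "M = Vr k" using Lm unfolding first_model_def isV_def by blast
  have "abs_defines r (Vr k) a'" using Lm M unfolding first_model_def by blast
  then have a: "a' = a" using abs_defines_unique ad[OF N(1)] by blast
  have u: "u = Oadd k a" "W = Vr u" using Lm a unfolding first_model_def isV_def isAdd_def by blast+
  have "\<exists>q. L q \<and> \<not> (models (Vr (Oadd d a)) q \<longleftrightarrow> models (Vr (Oadd k a)) q)" if d: "d \<epsilon> k" "inaccessible d" for d
  proof -
    have "differs L M a d W" using Lm d a unfolding first_model_def by blast
    then obtain W' o' q where "isAdd d a o'" "isV o' W'" "L q" "\<not> (models W' q \<longleftrightarrow> models W q)" unfolding differs_def by blast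
    then show ?thesis using u unfolding isAdd_def isV_def by blast
  qed
  moreover have "k' \<epsilon> Vr (Oadd l b)" if "inaccessible k'" "k' \<epsilon> l" for k'
    using Ord_Vr_iff[OF Ord_lb inac_Ord[OF that(1)]] subsD[OF l_subs that(2)] by blast
  moreover have "models (Vr (Oadd k a)) p" using Lm u unfolding first_model_def by blast
  ultimately show ?R using N mx by blast
next
  assume ?R
  then obtain k where k: "inaccessible k" "k \<epsilon> l" and mx: "\<And>k'. inaccessible k' \<Longrightarrow> k' \<epsilon> l \<Longrightarrow> k' = k \<or> k' \<epsilon> k"
    and mp: "models (Vr (Oadd k a)) p"
    and df: "\<And>d. d \<epsilon> k \<Longrightarrow> inaccessible d \<Longrightarrow> \<exists>q. L q \<and> \<not> (models (Vr (Oadd d a)) q \<longleftrightarrow> models (Vr (Oadd k a)) q)" by blast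
  note Ok = inac_Ord[OF k(1)]
  define u where "u = Oadd k a"
  have Ou: "Ord u" unfolding u_def by (rule Ord_Oadd[OF Ok Oa])
  have ak: "a \<epsilon> k" using ad[OF k(1)] Ord_Vr_iff[OF Ok Oa] unfolding abs_defines_def by blast
  have ul: "u \<epsilon> l" unfolding u_def using inac_Oadd[OF l k(2)] Ord_trans[OF Ord_l k(2) ak] by blast
  have ku: "k \<epsilon> u \<or> k = u" unfolding u_def using Ord_subs_le[OF Ok] Oadd_subs[OF Oa] Ord_Oadd[OF Ok Oa] by blast
  have ou: "omega \<epsilon> u" using ku inac_omega[OF k(1)] Ord_trans[OF Ou] by blast
  \<comment> \<open>V_t is the good set holding everything that \<open>first_model\<close> mentions:
    k, p, r, a, u = k + a, and the stages V_k and V_u. Its index is still below l.\<close>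
  define t where "t = Oadd u omega"
  have Ot: "Ord t" unfolding t_def by (rule Ord_Oadd[OF Ou Ord_omega])
  have ut: "u \<epsilon> t" unfolding t_def using Oadd_mono[OF Ord_omega emp_omega, of u] by simp
  have kt: "k \<epsilon> t" using ku ut Ord_trans[OF Ot] by blast
  have at: "a \<epsilon> t" using Ord_trans[OF Ot kt ak] .
  have tl: "t \<epsilon> Oadd l b" unfolding t_def using subsD[OF l_subs inac_Oadd_omega[OF l ul]] .
  have g: "good_set (Vr t)" unfolding t_def by (rule good_set_Oadd[OF Ou]) (use ou in blast)
  have mem: "Vr t \<epsilon> Vr (Oadd l b)" by (rule Vr_mem[OF Ord_lb tl])
  have ot: "omega \<epsilon> t" using Ord_trans[OF Ot ut ou] .
  have el: "k \<epsilon> Vr t" "p \<epsilon> Vr t" "r \<epsilon> Vr t" "Vr k \<epsilon> Vr t" "Vr u \<epsilon> Vr t" "a \<epsilon> Vr t" "u \<epsilon> Vr t"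
    using Ord_Vr_iff[OF Ot Ok] Ord_Vr_iff[OF Ot Oa] Ord_Vr_iff[OF Ot Ou] kt at ut Vr_mem[OF Ot] subsD[OF HF_Vr[OF ot Ot]] p r by blast+
  have elB: "x \<epsilon> Vr (Oadd l b)" if "x \<epsilon> Vr t" for x using Vr_mem_subs[OF Ord_lb mem that] .
  have "differs L (Vr k) a d (Vr u)" if d: "d \<epsilon> k" "inaccessible d" for d
  proof -
    have da: "Oadd d a \<epsilon> k" using inac_Oadd[OF k(1) d(1) ak] .
    have Od: "Ord d" by (rule inac_Ord[OF d(2)])
    have O: "Ord (Oadd d a)" by (rule Ord_Oadd[OF Od Oa])
    obtain q where q: "L q" "\<not> (models (Vr (Oadd d a)) q \<longleftrightarrow> models (Vr (Oadd k a)) q)" using df[OF d] by blast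
    show ?thesis unfolding differs_def
      by (rule exI[of _ "Vr (Oadd d a)"], intro conjI, rule Vr_mem[OF Ok da], rule exI[of _ "Oadd d a"])
        (use da Ord_Vr_iff[OF Ok O] q language_HF[OF L] Od Oa O in \<open>auto simp: isAdd_def isV_def u_def\<close>)
  qed
  then have "first_model L k p r (Vr k) (Vr u) a u" unfolding first_model_def isV_def isAdd_def
    using k ad Ok Oa Ou mp u_def by blast
  then have "first_model_in L (Vr t) k p r (Vr k) (Vr u) a u" unfolding first_model_in_def using g el by blast
  then have "\<exists>u'. u' \<epsilon> Vr (Oadd l b) \<and> first_model_in L (Vr t) k p r (Vr k) (Vr u) a u'"
    using elB[OF el(7)] by blast
  then have "\<exists>a'. a' \<epsilon> Vr (Oadd l b) \<and> (\<exists>u'. u' \<epsilon> Vr (Oadd l b) \<and> first_model_in L (Vr t) k p r (Vr k) (Vr u) a' u')"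
    using elB[OF el(6)] by blast
  then have "\<exists>W. W \<epsilon> Vr (Oadd l b) \<and> (\<exists>a'. a' \<epsilon> Vr (Oadd l b) \<and> (\<exists>u'. u' \<epsilon> Vr (Oadd l b) \<and> first_model_in L (Vr t) k p r (Vr k) W a' u'))"
    using elB[OF el(5)] by blast
  then have "\<exists>M. M \<epsilon> Vr (Oadd l b) \<and> (\<exists>W. W \<epsilon> Vr (Oadd l b) \<and> (\<exists>a'. a' \<epsilon> Vr (Oadd l b) \<and> (\<exists>u'. u' \<epsilon> Vr (Oadd l b) \<and> first_model_in L (Vr t) k p r M W a' u')))"
    using elB[OF el(4)] by blast
  then have 1: "\<exists>G. G \<epsilon> Vr (Oadd l b) \<and> (\<exists>M. M \<epsilon> Vr (Oadd l b) \<and> (\<exists>W. W \<epsilon> Vr (Oadd l b) \<and> (\<exists>a'. a' \<epsilon> Vr (Oadd l b) \<and> (\<exists>u'. u' \<epsilon> Vr (Oadd l b) \<and> first_model_in L G k p r M W a' u'))))"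
    using mem by blast
  have 2: "\<forall>l'. l' \<epsilon> Vr (Oadd l b) \<longrightarrow> inaccessible l' \<and> l' \<epsilon> l \<longrightarrow> l' = k \<or> l' \<epsilon> k" using mx by blast
  show "greatest_first_model L (omega \<epsilon> b) (\<lambda>x. x \<epsilon> Vr (Oadd l b)) p r"
    unfolding greatest_first_model_def inac_bounded_in_sem by (rule exI[of _ k]) (intro conjI elB[OF el(1)] k 1 2)
qed

end

lemma absdefD:
  assumes "absolutely_definable a"
  obtains r where "Ord a" "r \<epsilon> HF" "\<And>k. inaccessible k \<Longrightarrow> abs_defines r (Vr k) a \<and> a \<epsilon> k"
proof -
  obtain r where O: "Ord a" and r: "fo_formula r" "\<And>k. inaccessible k \<Longrightarrow> a \<epsilon> V k \<and>
           (\<forall>s. is_fun s omega (V k) \<longrightarrow> (fo_Sat (V k) r s \<longleftrightarrow> app s emp = a))"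
    using assms unfolding Defs.absolutely_definable_def by blast
  have "abs_defines r (Vr k) a \<and> a \<epsilon> k" if k: "inaccessible k" for k
  proof -
    have "abs_defines r (Vr k) a" using r(2)[OF k] app_ap[of _ omega "Vr k" emp] unfolding abs_defines_def V_Vr[OF inac_Ord[OF k]] by simp
    then show ?thesis using Ord_Vr_iff[OF inac_Ord[OF k] O] unfolding abs_defines_def by blast
  qed
  then show thesis using that O r(1) formula_HF fo_so by blast
qed

text \<open>First-order truth about V_k is the case of order 0, since V_(k+0) = V_k. This makes the
  results about arbitrary absolutely definable orders applicable to it.\<close>

lemma absdef_emp: "absolutely_definable emp"
proof -
  obtain d where d: "defined_by d emp" using HF_defined_by emp_HF by blast
  have "emp \<epsilon> V k \<and> (\<forall>s. is_fun s omega (V k) \<longrightarrow> (fo_Sat (V k) d s \<longleftrightarrow> app s emp = emp))" if k: "inaccessible k" for k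
    unfolding V_Vr[OF inac_Ord[OF k]]
  proof (intro conjI allI impI)
    show "emp \<epsilon> Vr k" by (rule limit_emp[OF inac_limit[OF k]])
    fix s assume s: "is_fun s omega (Vr k)"
    show "fo_Sat (Vr k) d s \<longleftrightarrow> app s emp = emp"
      using d s transitive_Vr[OF inac_Ord[OF k]] HF_Vr[OF inac_omega[OF k] inac_Ord[OF k]] app_ap[OF s emp_omega]
      unfolding defined_by_def by metis
  qed
  then show ?thesis unfolding Defs.absolutely_definable_def using d unfolding defined_by_def by auto
qed

definition next_inac :: "'a \<Rightarrow> 'a \<Rightarrow> bool" where
  "next_inac k l \<longleftrightarrow> inaccessible l \<and> k \<epsilon> l \<and> (\<forall>m. inaccessible m \<longrightarrow> m \<epsilon> l \<longrightarrow> m = k \<or> m \<epsilon> k)"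

definition order_true :: "'a \<Rightarrow> 'a \<Rightarrow> 'a \<Rightarrow> bool" where
  "order_true a k p = models (V (ord_add k a)) p"

lemma order_true_Vr: "Ord k \<Longrightarrow> Ord a \<Longrightarrow> order_true a k p \<longleftrightarrow> models (Vr (Oadd k a)) p"
  unfolding order_true_def using ord_add_Oadd V_Vr[OF Ord_Oadd] by simp

lemma next_categorical:
  assumes L: "language L" and a: "absolutely_definable a" and b: "absolutely_definable b"
    and fr: "fresh L (order_true a) k" and nx: "next_inac k l"
  shows "order_theory_categorical b l"
proof -
  obtain r where Oa: "Ord a" and r: "r \<epsilon> HF" and ad: "\<And>k. inaccessible k \<Longrightarrow> abs_defines r (Vr k) a \<and> a \<epsilon> k"
    by (rule absdefD[OF a]) blast
  obtain r' where Ob: "Ord b" and "r' \<epsilon> HF" and bd': "\<And>k. inaccessible k \<Longrightarrow> abs_defines r' (Vr k) b \<and> b \<epsilon> k"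
    by (rule absdefD[OF b]) blast
  have bd: "b \<epsilon> k" if "inaccessible k" for k using bd'[OF that] by blast
  have k: "inaccessible k" using fr unfolding Defs.fresh_def by blast
  have l: "inaccessible l" "k \<epsilon> l" "\<And>m. inaccessible m \<Longrightarrow> m \<epsilon> l \<Longrightarrow> m = k \<or> m \<epsilon> k" using nx unfolding next_inac_def by blast+
  define Bs where "Bs m = Vr (Oadd m b)" for m
  have B0: "emp \<epsilon> Bs m" "subs HF (Bs m)" "swelled (\<lambda>x. x \<epsilon> Bs m)" if m: "inaccessible m" for m
  proof -
    have O: "Ord (Oadd m b)" by (rule Ord_Oadd[OF inac_Ord[OF m] Ob])
    have o: "omega \<epsilon> Oadd m b" using subsD[OF Oadd_subs[OF Ob] inac_omega[OF m]] .
    show "subs HF (Bs m)" unfolding Bs_def by (rule HF_Vr[OF o O])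
    then show "emp \<epsilon> Bs m" using subsD emp_HF by blast
    show "swelled (\<lambda>x. x \<epsilon> Bs m)" unfolding Bs_def by (rule swelled_Vr[OF O o])
  qed
  \<comment> \<open>T is the full first-order theory of V_(l+b). As it is complete, any V_(m+b)
    satisfying it is elementarily equivalent to V_(l+b).\<close>
  define T where "T = mkset (\<lambda>p. p \<epsilon> FoF \<and> (fo_sentence p \<and> models (Bs l) p))"
  have "D iU (\<lambda>B e. fo_sentence (e 0) \<and> models (Bs l) (e 0))" by (intro dintro)
  then have T0: "p \<epsilon> T \<longleftrightarrow> p \<epsilon> FoF \<and> (fo_sentence p \<and> models (Bs l) p)" for p
    unfolding T_def using mkset_iff[OF sep_ex[where P = "\<lambda>p. fo_sentence p \<and> models (Bs l) p"]] by blast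
  have T: "p \<epsilon> T \<longleftrightarrow> fo_sentence p \<and> models (Bs l) p" for p
    unfolding T0 FoF_iff Defs.fo_sentence_def by blast
  have uniq: "m = l" if m: "inaccessible m" and mT: "\<And>p. p \<epsilon> T \<Longrightarrow> models (Bs m) p" for m
  proof -
    have eqv: "models (Bs m) p \<longleftrightarrow> models (Bs l) p" if p: "fo_sentence p" for p
    proof
      assume mp: "models (Bs m) p"
      show "models (Bs l) p"
      proof (rule ccontr)
        assume "\<not> models (Bs l) p"
        then have "cNeg p \<epsilon> T" unfolding T using models_Neg[OF sentence_so[OF p] B0(1)[OF l(1)]] fo_sentence_Neg[OF p] by blast
        then show False using mT models_Neg[OF sentence_so[OF p] B0(1)[OF m]] mp by blast
      qed
    qed (use mT T p in blast)
    \<comment> \<open>Elementary equivalence is applied to the sentence that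
      \<open>param_sentence\<close> provides for each p, standard or not.\<close>
    have XE: "greatest_first_model L (omega \<epsilon> b) (\<lambda>x. x \<epsilon> Bs m) p r \<longleftrightarrow> greatest_first_model L (omega \<epsilon> b) (\<lambda>x. x \<epsilon> Bs l) p r" if p: "p \<epsilon> HF" for p
    proof -
      obtain \<sigma> where s: "fo_sentence \<sigma>"
        "\<And>A. swelled (\<lambda>x. x \<epsilon> A) \<Longrightarrow> subs HF A \<Longrightarrow> models A \<sigma> \<longleftrightarrow> greatest_first_model L (omega \<epsilon> b) (\<lambda>x. x \<epsilon> A) p r"
        by (rule param_sentence[where R = "greatest_first_model L (omega \<epsilon> b)", OF D_greatest_first_model[OF L] p r]) blast
      show ?thesis using eqv[OF s(1)] s(2)[OF B0(3,2)[OF m]] s(2)[OF B0(3,2)[OF l(1)]] by blast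
    qed
    have ad1: "\<And>k. inaccessible k \<Longrightarrow> abs_defines r (Vr k) a" using ad by blast
    define RR where "RR n p \<longleftrightarrow> (\<exists>k. inaccessible k \<and> k \<epsilon> n \<and> (\<forall>k'. inaccessible k' \<longrightarrow> k' \<epsilon> n \<longrightarrow> k' = k \<or> k' \<epsilon> k) \<and>
      models (Vr (Oadd k a)) p \<and>
      (\<forall>d. d \<epsilon> k \<longrightarrow> inaccessible d \<longrightarrow> (\<exists>q. L q \<and> \<not> (models (Vr (Oadd d a)) q \<longleftrightarrow> models (Vr (Oadd k a)) q))))" for n p
    have sem: "greatest_first_model L (omega \<epsilon> b) (\<lambda>x. x \<epsilon> Bs n) p r \<longleftrightarrow> RR n p" if "inaccessible n" "p \<epsilon> HF" for n p
      unfolding Bs_def RR_def by (rule greatest_first_model_sem[OF that(1) bd[OF that(1)] L that(2) r Oa ad1])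
    have frk: "\<forall>d. d \<epsilon> k \<longrightarrow> inaccessible d \<longrightarrow> (\<exists>q. L q \<and> \<not> (models (Vr (Oadd d a)) q \<longleftrightarrow> models (Vr (Oadd k a)) q))"
      using fr order_true_Vr[OF inac_Ord Oa] k unfolding Defs.fresh_def by metis
    have Xl: "greatest_first_model L (omega \<epsilon> b) (\<lambda>x. x \<epsilon> Bs l) p r \<longleftrightarrow> models (Vr (Oadd k a)) p" if p: "p \<epsilon> HF" for p
    proof
      assume "greatest_first_model L (omega \<epsilon> b) (\<lambda>x. x \<epsilon> Bs l) p r"
      then obtain k' where k': "inaccessible k'" "k' \<epsilon> l" "\<forall>k''. inaccessible k'' \<longrightarrow> k'' \<epsilon> l \<longrightarrow> k'' = k' \<or> k'' \<epsilon> k'"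
        "models (Vr (Oadd k' a)) p" using sem[OF l(1) p] unfolding RR_def by blast
      have "k' = k" using l(3)[OF k'(1,2)] k'(3) k l(2) no_cycle2 by blast
      then show "models (Vr (Oadd k a)) p" using k'(4) by simp
    next
      assume "models (Vr (Oadd k a)) p"
      then have "RR l p" unfolding RR_def by (intro exI[of _ k] conjI k l(2) frk) (use l(3) in blast)+
      then show "greatest_first_model L (omega \<epsilon> b) (\<lambda>x. x \<epsilon> Bs l) p r" using sem[OF l(1) p] by blast
    qed
    \<comment> \<open>A valid sentence, every x equals itself. With it the statement says only that
      there is a greatest inaccessible below m and that it is fresh.\<close>
    let ?p0 = "code (fm.Neg (fm.Ex 0 (fm.Neg (fm.Eq 0 0))))"
    have p0: "fo_sentence ?p0" unfolding Defs.fo_sentence_def using code_free[of _ "fm.Neg (fm.Ex 0 (fm.Neg (fm.Eq 0 0)))"] code_fo by fastforce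
    have p0H: "?p0 \<epsilon> HF" using formula_HF fo_so code_fo by blast
    have emp_k: "emp \<epsilon> Vr (Oadd k a)"
      using limit_emp[OF inac_limit[OF k]] Vr_mono_le[OF Ord_Oadd[OF inac_Ord[OF k] Oa] inac_Ord[OF k] Oadd_subs[OF Oa]] subsD by blast
    have "models (Vr (Oadd k a)) ?p0"
      unfolding models_fo_Sat[OF p0 const_fun[OF emp_k]] code_sat[OF const_fun[OF emp_k]] by simp
    then have "greatest_first_model L (omega \<epsilon> b) (\<lambda>x. x \<epsilon> Bs m) ?p0 r" using XE[OF p0H] Xl[OF p0H] by blast
    then obtain k' where k': "inaccessible k'" "k' \<epsilon> m" and mx: "\<And>k''. inaccessible k'' \<Longrightarrow> k'' \<epsilon> m \<Longrightarrow> k'' = k' \<or> k'' \<epsilon> k'"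
      and frk': "\<forall>d. d \<epsilon> k' \<longrightarrow> inaccessible d \<longrightarrow> (\<exists>q. L q \<and> \<not> (models (Vr (Oadd d a)) q \<longleftrightarrow> models (Vr (Oadd k' a)) q))"
      using sem[OF m p0H] unfolding RR_def by blast
    have Xm: "greatest_first_model L (omega \<epsilon> b) (\<lambda>x. x \<epsilon> Bs m) p r \<longleftrightarrow> models (Vr (Oadd k' a)) p" if p: "p \<epsilon> HF" for p
    proof
      assume "greatest_first_model L (omega \<epsilon> b) (\<lambda>x. x \<epsilon> Bs m) p r"
      then obtain j where j: "inaccessible j" "j \<epsilon> m" "\<forall>k''. inaccessible k'' \<longrightarrow> k'' \<epsilon> m \<longrightarrow> k'' = j \<or> k'' \<epsilon> j"
        "models (Vr (Oadd j a)) p" using sem[OF m p] unfolding RR_def by blast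
      have "j = k'" using mx[OF j(1,2)] j(3) k' no_cycle2 by blast
      then show "models (Vr (Oadd k' a)) p" using j(4) by simp
    next
      assume "models (Vr (Oadd k' a)) p"
      then have "RR m p" unfolding RR_def by (intro exI[of _ k'] conjI k' frk') (use mx in blast)+
      then show "greatest_first_model L (omega \<epsilon> b) (\<lambda>x. x \<epsilon> Bs m) p r" using sem[OF m p] by blast
    qed
    have same: "models (Vr (Oadd k' a)) q \<longleftrightarrow> models (Vr (Oadd k a)) q" if "L q" for q
      using XE Xl Xm language_HF[OF L that] by blast
    \<comment> \<open>The cardinals k and k' are fresh with the same theory, so neither is below the
      other. Then l and m have the same greatest inaccessible below them and coincide.\<close>
    have "k' = k" using Ord_linear[OF inac_Ord[OF k'(1)] inac_Ord[OF k]] frk frk' k'(1) k same by blast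
    then show "m = l"
      using Ord_linear[OF inac_Ord[OF m] inac_Ord[OF l(1)]] l mx m k'(2) no_cycle2 no_self by metis
  qed
  have Tr: "models (V (ord_add m b)) p \<longleftrightarrow> models (Bs m) p" if "inaccessible m" for m p
    using order_true_Vr[OF inac_Ord[OF that] Ob] unfolding order_true_def Bs_def .
  show ?thesis unfolding Defs.order_theory_categorical_def Defs.theory_categorical_def
  proof (intro conjI l(1) exI[of _ T] allI impI notI; (elim conjE)?)
    show "fo_sentence p" if "p \<epsilon> T" for p using that T by blast
    show "models (V (ord_add l b)) p" if "p \<epsilon> T" for p using that T Tr[OF l(1)] by blast
    show False if "inaccessible m" "m \<noteq> l" "\<forall>p. p \<epsilon> T \<longrightarrow> models (V (ord_add m b)) p" for m
      using uniq[OF that(1)] Tr[OF that(1)] that(2,3) by blast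
  qed
qed

subsection \<open>The common supremum\<close>

lemma theory_categorical_cong:
  "(\<And>k p. inaccessible k \<Longrightarrow> Tr k p = Tr' k p) \<Longrightarrow> theory_categorical L Tr k = theory_categorical L Tr' k"
  unfolding Defs.theory_categorical_def by (simp cong: conj_cong)

lemma fresh_cong:
  "(\<And>k p. inaccessible k \<Longrightarrow> Tr k p = Tr' k p) \<Longrightarrow> fresh L Tr k = fresh L Tr' k"
  unfolding Defs.fresh_def by (simp cong: conj_cong)

text \<open>A smaller inaccessible with the same theory would satisfy the categorical theory as
  well.\<close>

lemma categorical_fresh: "theory_categorical L Tr k \<Longrightarrow> fresh L Tr k"
  unfolding Defs.theory_categorical_def Defs.fresh_def using no_self by metis

lemma order_true_emp: "inaccessible k \<Longrightarrow> order_true emp k p = models (V k) p"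
  unfolding order_true_def using ord_add_Oadd[OF Ord_emp] by simp

lemma order_defs: "order_theory_categorical a = theory_categorical fo_sentence (order_true a)"
  "order_fresh a = fresh fo_sentence (order_true a)"
  unfolding Defs.order_theory_categorical_def Defs.order_fresh_def order_true_def[abs_def] by blast+

lemma fo_order: "fo_theory_categorical k \<longleftrightarrow> order_theory_categorical emp k" "fo_fresh k \<longleftrightarrow> order_fresh emp k"
  unfolding order_defs Defs.fo_theory_categorical_def Defs.fo_fresh_def
  by (rule theory_categorical_cong fresh_cong, simp add: order_true_emp)+

lemma so_order: "so_theory_categorical k \<longleftrightarrow> theory_categorical so_sentence (order_true emp) k"
  "so_fresh k \<longleftrightarrow> fresh so_sentence (order_true emp) k"
  unfolding Defs.so_theory_categorical_def Defs.so_fresh_def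
  by (rule theory_categorical_cong fresh_cong, simp add: order_true_emp)+

lemma fo_so_categorical: "fo_theory_categorical k \<Longrightarrow> so_theory_categorical k"
  unfolding Defs.fo_theory_categorical_def Defs.so_theory_categorical_def Defs.theory_categorical_def
  using sentence_so by blast

lemma fresh_Ord: "fresh L Tr k \<Longrightarrow> Ord k"
  unfolding Defs.fresh_def using inac_Ord by blast

lemma is_sup_Uni:
  assumes S: "\<And>k. k \<epsilon> S \<longleftrightarrow> C k" and C: "\<And>k. C k \<Longrightarrow> Ord k"
  shows "is_sup C (Uni S)"
  unfolding Defs.is_sup_def Defs.ord_le_def
proof (intro conjI allI impI)
  show O: "Ord (Uni S)" by (rule Ord_Uni) (use S C in blast)
  show "k \<epsilon> Uni S \<or> k = Uni S" if "C k" for k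
    by (rule Ord_subs_le[OF C[OF that] O]) (rule subsI, use S that Uni_iff in blast)
  fix t assume t: "Ord t \<and> (\<forall>k. C k \<longrightarrow> k \<epsilon> t \<or> k = t)"
  have "subs (Uni S) t"
  proof (rule subsI)
    fix z assume "z \<epsilon> Uni S"
    then obtain k where "C k" "z \<epsilon> k" using S by auto
    then show "z \<epsilon> t" using t Ord_trans[of t k z] by blast
  qed
  then show "Uni S \<epsilon> t \<or> Uni S = t" using Ord_subs_le[OF O] t by blast
qed

lemma is_sup_cofinal:
  assumes s: "is_sup C s" and C: "\<And>k. C k \<Longrightarrow> \<exists>l. C' l \<and> k \<epsilon> l" and C': "\<And>k. C' k \<Longrightarrow> \<exists>l. C l \<and> k \<epsilon> l"
  shows "is_sup C' s"
proof -
  have *: "ord_le k t" if "k \<epsilon> l" "ord_le l t" "Ord t" for k l t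
    using that Ord_trans[of t l k] unfolding Defs.ord_le_def by blast
  have "Ord s" using s unfolding Defs.is_sup_def by blast
  show ?thesis unfolding Defs.is_sup_def
  proof (intro conjI allI impI)
    show "ord_le k s" if k: "C' k" for k
    proof -
      obtain l where l: "C l" "k \<epsilon> l" using C'[OF k] by blast
      then have "ord_le l s" using s unfolding Defs.is_sup_def by blast
      then show ?thesis using *[OF l(2)] \<open>Ord s\<close> by blast
    qed
    fix t assume t: "Ord t \<and> (\<forall>k. C' k \<longrightarrow> ord_le k t)"
    have "ord_le k t" if k: "C k" for k
    proof -
      obtain l where l: "C' l" "k \<epsilon> l" using C[OF k] by blast
      then show ?thesis using *[OF l(2)] t by blast
    qed
    then show "ord_le s t" using s t unfolding Defs.is_sup_def by blast
  qed fact
qed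

lemma D_fo_fresh [dintro]: "fn iU F \<Longrightarrow> D iU (\<lambda>B e. fo_fresh (F B e))"
proof (rule D_comp1[where R = "\<lambda>B. fo_fresh"])
  have *: "fo_fresh k \<longleftrightarrow> inaccessible k \<and> \<not> (\<exists>d. inaccessible d \<and> d \<epsilon> k \<and> (\<forall>p. fo_sentence p \<longrightarrow> (models (Vr d) p \<longleftrightarrow> models (Vr k) p)))" for k
    unfolding Defs.fo_fresh_def Defs.fresh_def using V_Vr inac_Ord by metis
  show "D iU (\<lambda>B e. fo_fresh (e 0))" unfolding * by (intro dintro)
qed

lemma fo_fresh_same:
  assumes "fo_fresh k" "fo_fresh l" "\<And>p. fo_sentence p \<Longrightarrow> models (Vr k) p \<longleftrightarrow> models (Vr l) p"
  shows "k = l"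
proof -
  have k: "inaccessible k" "inaccessible l" using assms unfolding Defs.fo_fresh_def Defs.fresh_def by blast+
  have s: "models (V k) p \<longleftrightarrow> models (V l) p" if "fo_sentence p" for p
    using assms(3)[OF that] V_Vr inac_Ord k by metis
  show ?thesis using Ord_linear[OF inac_Ord[OF k(1)] inac_Ord[OF k(2)]] assms(1,2) k s
    unfolding Defs.fo_fresh_def Defs.fresh_def by blast
qed

text \<open>Fresh cardinals are determined by their theories, so they form a set.\<close>

lemma fo_fresh_set: "\<exists>S. \<forall>k. k \<epsilon> S \<longleftrightarrow> fo_fresh k"
proof -
  define Th where "Th k = mkset (\<lambda>p. p \<epsilon> FoF \<and> (fo_sentence p \<and> models (Vr k) p))" for k
  have Th: "p \<epsilon> Th k \<longleftrightarrow> p \<epsilon> FoF \<and> (fo_sentence p \<and> models (Vr k) p)" for p k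
    unfolding Th_def
    by (rule mkset_iff, rule sep_ex[where P = "\<lambda>p. fo_sentence p \<and> models (Vr k) p"]) (intro dintro)
  have Thfn: "fn iU (\<lambda>B e. Th (e i))" for i unfolding Th_def by (intro dintro)
  \<comment> \<open>From a theory to the fresh cardinal that has it. Sets that are not the theory of
    a fresh cardinal are sent to the empty set, because replacement asks for a total function on the
    power set of \<open>FoF\<close>.\<close>
  define R where "R t y \<longleftrightarrow> (fo_fresh y \<and> Th y = t) \<or> (\<not> (\<exists>k. fo_fresh k \<and> Th k = t)) \<and> y = emp" for t y
  have u: "k = l" if "fo_fresh k" "fo_fresh l" "Th k = Th l" for k l
  proof (rule fo_fresh_same[OF that(1,2)])
    fix p assume "fo_sentence p"
    then show "models (Vr k) p \<longleftrightarrow> models (Vr l) p" using Th[of p k] Th[of p l] that(3) FoF_iff Defs.fo_sentence_def by metis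
  qed
  have "D iU (\<lambda>B e. R (e 0) (e (Suc 0)))" unfolding R_def by (intro dintro Thfn)
  moreover have "\<exists>!y. R t y" for t unfolding R_def using u by metis
  ultimately obtain Y where Y: "\<forall>y. y \<epsilon> Y \<longleftrightarrow> (\<exists>t. t \<epsilon> pow FoF \<and> R t y)"
    using repl_ex[of R "pow FoF"] by blast
  have "k \<epsilon> Y" if "fo_fresh k" for k
  proof -
    have "Th k \<epsilon> pow FoF" using Th by (simp add: Defs.subs_def)
    moreover have "R (Th k) k" unfolding R_def using that by blast
    ultimately show ?thesis using Y by blast
  qed
  moreover have "D iU (\<lambda>B e. fo_fresh (e 0))" by (intro dintro)
  ultimately show ?thesis using sep_ex[where P = fo_fresh and x = Y] by blast
qed

lemma next_inac_ex:
  assumes nl: "\<not> (\<exists>k. inaccessible k \<and> (\<forall>l. inaccessible l \<longrightarrow> ord_le l k))" and k: "inaccessible k"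
  shows "\<exists>l. next_inac k l"
proof -
  obtain l where l: "inaccessible l" "\<not> ord_le l k" using nl k by blast
  then have kl: "k \<epsilon> l" using Ord_linear[OF inac_Ord[OF k] inac_Ord[OF l(1)]] unfolding Defs.ord_le_def by blast
  have "D iU (\<lambda>B e. inaccessible (e 0) \<and> k \<epsilon> e 0)" by (intro dintro)
  then obtain m where m: "Ord m" "inaccessible m \<and> k \<epsilon> m" "\<And>b. b \<epsilon> m \<Longrightarrow> \<not> (inaccessible b \<and> k \<epsilon> b)"
    by (rule Ord_least[where P = "\<lambda>m. inaccessible m \<and> k \<epsilon> m", OF _ inac_Ord[OF l(1)] conjI[OF l(1) kl]]) blast
  have "j = k \<or> j \<epsilon> k" if "inaccessible j" "j \<epsilon> m" for j
    using m(3)[OF that(2)] that(1) Ord_linear[OF inac_Ord[OF that(1)] inac_Ord[OF k]] by blast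
  then show ?thesis unfolding next_inac_def using m by blast
qed

context
  assumes nl: "\<not> (\<exists>k. inaccessible k \<and> (\<forall>l. inaccessible l \<longrightarrow> ord_le l k))"
begin

lemma fresh_below_categorical:
  assumes L: "language L" and a: "absolutely_definable a" and b: "absolutely_definable b"
    and fr: "fresh L (order_true a) k"
  shows "\<exists>l. order_theory_categorical b l \<and> k \<epsilon> l"
proof -
  have "inaccessible k" using fr unfolding Defs.fresh_def by blast
  then obtain l where l: "next_inac k l" using next_inac_ex[OF nl] by blast
  from next_categorical[OF L a b fr l] l show ?thesis unfolding next_inac_def by blast
qed

lemma fresh_below_fo_fresh:
  assumes L: "language L" and a: "absolutely_definable a" and fr: "fresh L (order_true a) k"
  shows "\<exists>l. fo_fresh l \<and> k \<epsilon> l"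
  using fresh_below_categorical[OF L a absdef_emp fr] categorical_fresh
  unfolding fo_order order_defs by blast

lemma fo_fresh_below_categorical:
  assumes b: "absolutely_definable b" and fr: "fo_fresh k"
  shows "\<exists>l. order_theory_categorical b l \<and> k \<epsilon> l"
  using fresh_below_categorical[OF language_fo absdef_emp b] fr unfolding fo_order order_defs by blast

text \<open>Above each member of any of the classes there is a first-order fresh cardinal, and above
  each first-order fresh cardinal there is a member of each class. For second-order categoricity
  this uses that a first-order theory is also a second-order one.\<close>

lemma common_sup:
  assumes s: "is_sup fo_fresh s"
  shows "is_sup fo_theory_categorical s" "is_sup so_theory_categorical s"
    "absolutely_definable a \<Longrightarrow> is_sup (order_theory_categorical a) s"
    "is_sup so_fresh s" "absolutely_definable a \<Longrightarrow> is_sup (order_fresh a) s"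
proof -
  have fc: "\<exists>l. fo_theory_categorical l \<and> k \<epsilon> l" if "fo_fresh k" for k
    using fo_fresh_below_categorical[OF absdef_emp that] unfolding fo_order by blast
  show "is_sup fo_theory_categorical s"
    by (rule is_sup_cofinal[OF s], erule fc)
      (use fresh_below_fo_fresh[OF language_fo absdef_emp] categorical_fresh in \<open>unfold fo_order order_defs, blast\<close>)
  have sf: "\<exists>l. fo_fresh l \<and> k \<epsilon> l" if "so_fresh k" for k
    using fresh_below_fo_fresh[OF language_so absdef_emp] that unfolding so_order by blast
  have sc: "so_fresh k" if "so_theory_categorical k" for k
    using that categorical_fresh unfolding so_order by blast
  show "is_sup so_theory_categorical s"
    by (rule is_sup_cofinal[OF s]) (use fc fo_so_categorical sf sc in blast)+
  show "is_sup so_fresh s"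
    by (rule is_sup_cofinal[OF s]) (use fc fo_so_categorical sf sc in blast)+
  assume a: "absolutely_definable a"
  have of: "\<exists>l. fo_fresh l \<and> k \<epsilon> l" if "order_fresh a k" for k
    using fresh_below_fo_fresh[OF language_fo a] that unfolding order_defs by blast
  have oc: "order_fresh a k" if "order_theory_categorical a k" for k
    using that categorical_fresh unfolding order_defs by blast
  show "is_sup (order_theory_categorical a) s"
    by (rule is_sup_cofinal[OF s]) (use fo_fresh_below_categorical[OF a] of oc in blast)+
  show "is_sup (order_fresh a) s"
    by (rule is_sup_cofinal[OF s]) (use fo_fresh_below_categorical[OF a] of oc in blast)+
qed

end

section \<open>Absoluteness of Delta_0 formulas\<close>

lemma delta0_abs:
  assumes A: "transitive A" "transitive A'" and q: "delta0_formula q"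
    and s: "is_fun s omega A" "is_fun s omega A'"
  shows "fo_Sat A q s \<longleftrightarrow> fo_Sat A' q s"
proof -
  let ?P = "\<lambda>q. \<forall>s. is_fun s omega A \<longrightarrow> is_fun s omega A' \<longrightarrow> (fo_Sat A q s \<longleftrightarrow> fo_Sat A' q s)"
  have D: "D iU (\<lambda>B e. ?P (e 0))" by (intro dintro)
  have "?P q"
  proof (rule delta0_induct[where P = ?P, OF D q]; (intro allI impI)?)
    fix i j s assume "i \<epsilon> omega" "j \<epsilon> omega" "is_fun s omega A" "is_fun s omega A'"
    then show "fo_Sat A (cMem i j) s \<longleftrightarrow> fo_Sat A' (cMem i j) s" "fo_Sat A (cEq i j) s \<longleftrightarrow> fo_Sat A' (cEq i j) s"
      by (simp_all add: fo_Sat_simps)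
  next
    fix p s assume "delta0_formula p" "?P p" "is_fun s omega A" "is_fun s omega A'"
    then show "fo_Sat A (cNeg p) s \<longleftrightarrow> fo_Sat A' (cNeg p) s" by (simp add: fo_Sat_simps delta0_fo)
  next
    fix p q s assume "delta0_formula p" "?P p" "delta0_formula q" "?P q" "is_fun s omega A" "is_fun s omega A'"
    then show "fo_Sat A (cAnd p q) s \<longleftrightarrow> fo_Sat A' (cAnd p q) s" by (simp add: fo_Sat_simps delta0_fo)
  next
    fix i j p s assume ij: "i \<epsilon> omega" "j \<epsilon> omega" "i \<noteq> j" and p: "delta0_formula p" and IH: "?P p"
      and s: "is_fun s omega A" "is_fun s omega A'"
    have fp: "fo_formula (cAnd (cMem i j) p)" using fo_intros ij delta0_fo[OF p] by blast
    have *: "fo_Sat C (cEx i (cAnd (cMem i j) p)) s \<longleftrightarrow> (\<exists>x. x \<epsilon> ap s j \<and> fo_Sat C p (upd s i x))"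
      if C: "transitive C" "is_fun s omega C" for C
    proof -
      have "fo_Sat C (cAnd (cMem i j) p) (upd s i x) \<longleftrightarrow> x \<epsilon> ap s j \<and> fo_Sat C p (upd s i x)" if x: "x \<epsilon> C" for x
        using upd_fun[OF C(2) ij(1) x] ij delta0_fo[OF p] by (simp add: fo_Sat_simps fo_intros ap_upd)
      then show ?thesis unfolding fo_Sat_simps(5)[OF C(2) ij(1) fp]
        using transD[OF C(1) ap_in[OF C(2) ij(2)]] by blast
    qed
    have "fo_Sat A p (upd s i x) \<longleftrightarrow> fo_Sat A' p (upd s i x)" if x: "x \<epsilon> ap s j" for x
    proof -
      have "x \<epsilon> A" "x \<epsilon> A'" using transD[OF A(1) ap_in[OF s(1) ij(2)] x] transD[OF A(2) ap_in[OF s(2) ij(2)] x] by blast+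
      then show ?thesis using IH upd_fun[OF s(1) ij(1)] upd_fun[OF s(2) ij(1)] by blast
    qed
    then show "fo_Sat A (cEx i (cAnd (cMem i j) p)) s \<longleftrightarrow> fo_Sat A' (cEx i (cAnd (cMem i j) p)) s"
      unfolding *[OF A(1) s(1)] *[OF A(2) s(2)] by blast
  qed
  then show ?thesis using s by blast
qed

lemma V_Sat_delta0_iff:
  "transitive A \<Longrightarrow> is_fun s omega A \<Longrightarrow> delta0_formula q \<Longrightarrow> V_Sat_delta0 q s \<longleftrightarrow> fo_Sat A q s"
  unfolding Defs.V_Sat_delta0_def using delta0_abs by blast

lemma D_V_Sat_delta0 [dintro]:
  assumes F: "fn iU F" and G: "fn iU G" shows "D iU (\<lambda>B e. V_Sat_delta0 (F B e) (G B e))"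
  unfolding Defs.V_Sat_delta0_def by (intro dintro fn_weaken[OF F] fn_weaken[OF G])

text \<open>Every assignment has its values in some transitive set, so \<open>V_Sat_delta0\<close>
  is never false for lack of a set in which to evaluate.\<close>

lemma fun_trans_ex: "is_fun s omega B \<Longrightarrow> \<exists>A. transitive A \<and> is_fun s omega A \<and> x \<epsilon> A"
proof -
  assume s: "is_fun s omega B"
  let ?A = "Vr (rk (adj B x))"
  have t: "transitive ?A" by (rule transitive_Vr) simp
  have sb: "subs (adj B x) ?A" by simp
  have "is_fun s omega ?A" by (rule fun_codomain[OF s]) (use ap_in[OF s] subsD[OF sb] in auto)
  then show ?thesis using t subsD[OF sb] by auto
qed

lemma V_Sat_delta0_Neg: "is_fun s omega B \<Longrightarrow> delta0_formula q \<Longrightarrow> V_Sat_delta0 (cNeg q) s \<longleftrightarrow> \<not> V_Sat_delta0 q s"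
proof -
  assume s: "is_fun s omega B" and q: "delta0_formula q"
  obtain A where A: "transitive A" "is_fun s omega A" using fun_trans_ex[OF s] by blast
  show ?thesis using V_Sat_delta0_iff[OF A] q delta0_intros(3)[OF q] fo_Sat_simps(3)[OF A(2) delta0_fo[OF q]] by blast
qed

text \<open>Size less than k, expressed by a map on an element of V_k whose values cover
  \<open>Y\<close>. Unlike the elements of V_k, such a \<open>Y\<close> may have arbitrary rank, as
  the stages of the Skolem hull do.\<close>

definition small :: "'a \<Rightarrow> 'a \<Rightarrow> bool" where
  "small k Y \<longleftrightarrow> (\<exists>Z F. Z \<epsilon> Vr k \<and> (\<forall>y. y \<epsilon> Y \<longrightarrow> (\<exists>z. z \<epsilon> Z \<and> ap F z = y)))"

text \<open>Only the values below k are bounded. For the collapsed hull it is not known beforehand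
  that the ranks are below k; the bound serves to prove this.\<close>

lemma small_bounded:
  assumes k: "inaccessible k" and Y: "small k Y" and G: "fn iU (\<lambda>B e. G (e 0))"
  shows "\<exists>b. b \<epsilon> k \<and> (\<forall>y. y \<epsilon> Y \<longrightarrow> G y \<epsilon> k \<longrightarrow> G y \<epsilon> b)"
proof -
  obtain Z F where Z: "Z \<epsilon> Vr k" "\<And>y. y \<epsilon> Y \<Longrightarrow> \<exists>z. z \<epsilon> Z \<and> ap F z = y" using Y unfolding small_def by blast
  define H where "H z = (if G (ap F z) \<epsilon> k then G (ap F z) else emp)" for z
  have "fn iU (\<lambda>B e. H (e 0))" unfolding H_def by (intro dintro fn_comp1[OF G])
  moreover have "H z \<epsilon> k" for z unfolding H_def using inac_limit[OF k] unfolding limit_def by simp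
  ultimately obtain b where b: "b \<epsilon> k" "\<And>z. z \<epsilon> Z \<Longrightarrow> H z \<epsilon> b"
    using inac_bounded[OF k Z(1), where F = H] by blast
  have "G y \<epsilon> b" if y: "y \<epsilon> Y" "G y \<epsilon> k" for y
  proof -
    obtain z where z: "z \<epsilon> Z" "ap F z = y" using Z(2)[OF y(1)] by blast
    then show ?thesis using b(2)[OF z(1)] y(2) unfolding H_def by simp
  qed
  then show ?thesis using b(1) by blast
qed

lemma small_Un:
  assumes k: "inaccessible k" and Y: "small k Y" "small k Y'" and W: "\<And>w. w \<epsilon> W \<Longrightarrow> w \<epsilon> Y \<or> w \<epsilon> Y'"
  shows "small k W"
proof -
  obtain Z F where Z: "Z \<epsilon> Vr k" "\<And>y. y \<epsilon> Y \<Longrightarrow> \<exists>z. z \<epsilon> Z \<and> ap F z = y" using Y unfolding small_def by blast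
  obtain Z' F' where Z': "Z' \<epsilon> Vr k" "\<And>y. y \<epsilon> Y' \<Longrightarrow> \<exists>z. z \<epsilon> Z' \<and> ap F' z = y" using Y unfolding small_def by blast
  \<comment> \<open>A map on tagged elements of Z and Z': the tag 0 selects F, the tag 1 selects
    F'.\<close>
  define H where "H z = mkset (\<lambda>w. \<exists>u. z = opair emp u \<and> w \<epsilon> ap F u \<or> z = opair (suc emp) u \<and> w \<epsilon> ap F' u)" for z
  have H1: "H (opair emp u) = ap F u" for u unfolding H_def by (rule mkset_unique) simp
  have H2: "H (opair (suc emp) u) = ap F' u" for u unfolding H_def by (rule mkset_unique) simp
  have Hfn: "fn iU (\<lambda>B e. H (e 0))" unfolding H_def by (intro dintro)
  define X where "X = prd (upair emp (suc emp)) (Uni (upair Z Z'))"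
  note g = good_inac[OF k]
  have e: "emp \<epsilon> Vr k" using good_emp[OF g] .
  have "upair emp (suc emp) \<epsilon> Vr k" using good_upair[OF g e good_suc[OF g e]] .
  moreover have "Uni (upair Z Z') \<epsilon> Vr k" using good_Uni[OF g good_upair[OF g Z(1) Z'(1)]] .
  ultimately have XV: "X \<epsilon> Vr k" unfolding X_def using good_prd[OF g] by blast
  have "\<exists>z. z \<epsilon> X \<and> ap (lam X H) z = w" if "w \<epsilon> W" for w
    using W[OF that]
  proof
    assume "w \<epsilon> Y"
    then obtain z where z: "z \<epsilon> Z" "ap F z = w" using Z(2) by blast
    have "opair emp z \<epsilon> X" unfolding X_def using z(1) by auto
    then show ?thesis using ap_lam[OF Hfn] H1 z(2) by metis
  next
    assume "w \<epsilon> Y'"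
    then obtain z where z: "z \<epsilon> Z'" "ap F' z = w" using Z'(2) by blast
    have "opair (suc emp) z \<epsilon> X" unfolding X_def using z(1) by auto
    then show ?thesis using ap_lam[OF Hfn] H2 z(2) by metis
  qed
  then show ?thesis unfolding small_def using XV by blast
qed

lemma small_elem: assumes k: "inaccessible k" and Z: "Z \<epsilon> Vr k" shows "small k Z"
proof -
  have "fn iU (\<lambda>B e. e 0)" by (intro dintro)
  from ap_lam[where F = "\<lambda>x. x", OF this] show ?thesis unfolding small_def using Z by blast
qed

lemma small_single: assumes k: "inaccessible k" shows "small k (upair y y)"
proof -
  have "fn iU (\<lambda>B e. y)" by (intro dintro)
  from ap_lam[where F = "\<lambda>x. y", OF this, of emp "suc emp"] have "ap (lam (suc emp) (\<lambda>x. y)) emp = y" by simp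
  moreover have "suc emp \<epsilon> Vr k" using good_suc[OF good_inac[OF k]] good_emp[OF good_inac[OF k]] by blast
  moreover have "emp \<epsilon> suc emp" by simp
  ultimately show ?thesis unfolding small_def by (metis upair_iff)
qed

end

subsection \<open>Skolem hulls below an inaccessible cardinal\<close>

text \<open>The setting for Levy's theorem. The parameters of the formula lie in V_bb with bb < k,
  the witness y0 is an arbitrary set, and the formula is evaluated in the transitive set A. The
  Skolem hull in A of V_bb and y0, once collapsed, contains a witness in V_k. The choice function h
  selects the Skolem values.\<close>

locale hull = ZFC +
  fixes k y0 bb A h
  assumes k: "inaccessible k" and bb: "bb \<epsilon> k"
    and A: "transitive A" "subs (Vr bb) A" "y0 \<epsilon> A"
    and h: "\<And>Y. Y \<epsilon> pow A \<Longrightarrow> \<exists>y. y \<epsilon> Y \<Longrightarrow> ap h Y \<epsilon> Y"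
begin

definition witnesses :: "'a \<Rightarrow> 'a \<Rightarrow> 'a \<Rightarrow> 'a" where
  "witnesses p i t = mkset (\<lambda>x. x \<epsilon> A \<and> fo_Sat A p (upd t i x))"

lemma witnesses_iff: "x \<epsilon> witnesses p i t \<longleftrightarrow> x \<epsilon> A \<and> fo_Sat A p (upd t i x)"
  unfolding witnesses_def by (rule mkset_iff, rule sep_ex) (intro dintro)

definition skolem_fun :: "'a \<Rightarrow> 'a \<Rightarrow> 'a \<Rightarrow> 'a" where
  "skolem_fun p i t = ap h (witnesses p i t)"

lemma fn_skolem_fun [dintro]: "fn iU F \<Longrightarrow> fn iU G \<Longrightarrow> fn iU H \<Longrightarrow> fn iU (\<lambda>B e. skolem_fun (F B e) (G B e) (H B e))"
proof (rule fn_comp3[where k = skolem_fun])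
  show "fn iU (\<lambda>B e. skolem_fun (e 0) (e (Suc 0)) (e (Suc (Suc 0))))" unfolding skolem_fun_def witnesses_def by (intro dintro)
qed

text \<open>Assignments are total on \<omega> and may take infinitely many values, so they are
  required to stay inside one set \<open>X\<close>, later a single stage of the hull.\<close>

definition skolem_value :: "'a \<Rightarrow> 'a \<Rightarrow> bool" where
  "skolem_value X z \<longleftrightarrow> (\<exists>p. p \<epsilon> FoF \<and> (\<exists>i. i \<epsilon> omega \<and> (\<exists>t. is_fun t omega X \<and>
     ((\<exists>x. x \<epsilon> A \<and> fo_Sat A p (upd t i x)) \<and> z = skolem_fun p i t))))"

lemma D_skolem_value [dintro]: "fn iU F \<Longrightarrow> fn iU G \<Longrightarrow> D iU (\<lambda>B e. skolem_value (F B e) (G B e))"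
proof (rule D_comp2[where R = "\<lambda>B. skolem_value"])
  show "D iU (\<lambda>B e. skolem_value (e 0) (e (Suc 0)))" unfolding skolem_value_def by (intro dintro)
qed

lemma skolem_fun_witnesses: "\<exists>x. x \<epsilon> A \<and> fo_Sat A p (upd t i x) \<Longrightarrow> skolem_fun p i t \<epsilon> A \<and> fo_Sat A p (upd t i (skolem_fun p i t))"
proof -
  assume "\<exists>x. x \<epsilon> A \<and> fo_Sat A p (upd t i x)"
  then have "\<exists>x. x \<epsilon> witnesses p i t" using witnesses_iff by blast
  moreover have "witnesses p i t \<epsilon> pow A" using witnesses_iff by (simp add: Defs.subs_def)
  ultimately have "skolem_fun p i t \<epsilon> witnesses p i t" unfolding skolem_fun_def using h by blast
  then show ?thesis using witnesses_iff by blast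
qed

lemma new_A: "skolem_value X z \<Longrightarrow> z \<epsilon> A"
  unfolding skolem_value_def using skolem_fun_witnesses by blast

definition HX :: "'a \<Rightarrow> 'a \<Rightarrow> 'a" where
  "HX f b = mkset (\<lambda>z. z \<epsilon> A \<and> (z \<epsilon> Vr bb \<or> z = y0 \<or> (\<exists>c. c \<epsilon> b \<and> skolem_value (ap f c) z)))"

lemma HX_iff: "z \<epsilon> HX f b \<longleftrightarrow> z \<epsilon> A \<and> (z \<epsilon> Vr bb \<or> z = y0 \<or> (\<exists>c. c \<epsilon> b \<and> skolem_value (ap f c) z))"
  unfolding HX_def by (rule mkset_iff, rule sep_ex) (intro dintro)

lemma local_HX: "local_rec HX"
  unfolding local_rec_def
proof (intro conjI allI impI)
  show "fn iU (\<lambda>B e. HX (e 0) (e (Suc 0)))" unfolding HX_def by (intro dintro)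
  fix f g b assume *: "\<forall>c. c \<epsilon> b \<longrightarrow> ap f c = ap g c"
  have "(\<exists>c. c \<epsilon> b \<and> skolem_value (ap f c) z) \<longleftrightarrow> (\<exists>c. c \<epsilon> b \<and> skolem_value (ap g c) z)" for z using * by metis
  then show "HX f b = HX g b" by (intro set_eqI) (simp only: HX_iff)
qed

definition hull_stage :: "'a \<Rightarrow> 'a" where "hull_stage n = ordrec HX n"

lemma fn_hull_stage [dintro]: "fn iU F \<Longrightarrow> fn iU (\<lambda>B e. hull_stage (F B e))"
  unfolding hull_stage_def by (rule fn_ordrec[OF local_HX])

lemma hull_stage_iff: "Ord n \<Longrightarrow> z \<epsilon> hull_stage n \<longleftrightarrow> z \<epsilon> A \<and> (z \<epsilon> Vr bb \<or> z = y0 \<or> (\<exists>c. c \<epsilon> n \<and> skolem_value (hull_stage c) z))"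
proof -
  assume n: "Ord n"
  have "ap (lam n (ordrec HX)) c = ordrec HX c" if "c \<epsilon> n" for c
    by (rule ap_lam[OF _ that]) (intro fn_ordrec[OF local_HX] dintro)
  then show ?thesis unfolding hull_stage_def ordrec_eq[OF local_HX n] HX_iff by metis
qed

lemma hull_stage_mono: "n \<epsilon> omega \<Longrightarrow> m \<epsilon> omega \<Longrightarrow> subs m n \<Longrightarrow> subs (hull_stage m) (hull_stage n)"
  unfolding Defs.subs_def using hull_stage_iff[OF Ord_nat] by blast

lemma hull_stage_A: "n \<epsilon> omega \<Longrightarrow> z \<epsilon> hull_stage n \<Longrightarrow> z \<epsilon> A"
  using hull_stage_iff[OF Ord_nat] by blast

lemma hull_stage_suc: "n \<epsilon> omega \<Longrightarrow> z \<epsilon> hull_stage (suc n) \<longleftrightarrow> z \<epsilon> hull_stage n \<or> skolem_value (hull_stage n) z"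
  using hull_stage_iff[OF Ord_nat] hull_stage_iff[OF Ord_nat[OF suc_omega]] new_A suc_iff by blast

lemma hull_stage_max: "n \<epsilon> omega \<Longrightarrow> m \<epsilon> omega \<Longrightarrow> \<exists>l. l \<epsilon> omega \<and> subs (hull_stage n) (hull_stage l) \<and> subs (hull_stage m) (hull_stage l)"
  using Ord_max[OF Ord_omega, of n m] hull_stage_mono by blast

definition skolem_hull :: "'a" where "skolem_hull = mkset (\<lambda>z. z \<epsilon> A \<and> (\<exists>n. n \<epsilon> omega \<and> z \<epsilon> hull_stage n))"

lemma skolem_hull_iff: "z \<epsilon> skolem_hull \<longleftrightarrow> (\<exists>n. n \<epsilon> omega \<and> z \<epsilon> hull_stage n)"
proof -
  have "z \<epsilon> skolem_hull \<longleftrightarrow> z \<epsilon> A \<and> (\<exists>n. n \<epsilon> omega \<and> z \<epsilon> hull_stage n)"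
    unfolding skolem_hull_def by (rule mkset_iff, rule sep_ex) (intro dintro)
  then show ?thesis using hull_stage_A by blast
qed

lemma skolem_hull_A: "z \<epsilon> skolem_hull \<Longrightarrow> z \<epsilon> A"
  using skolem_hull_iff hull_stage_A by blast

lemma base_hull_stage: "n \<epsilon> omega \<Longrightarrow> z \<epsilon> Vr bb \<or> z = y0 \<Longrightarrow> z \<epsilon> hull_stage n"
  using hull_stage_iff[OF Ord_nat] A subsD by blast

lemma witness:
  assumes "n \<epsilon> omega" "fo_formula p" "i \<epsilon> omega" "is_fun t omega (hull_stage n)" "\<exists>x. x \<epsilon> A \<and> fo_Sat A p (upd t i x)"
  shows "\<exists>x. x \<epsilon> hull_stage (suc n) \<and> fo_Sat A p (upd t i x)"
proof -
  have "skolem_value (hull_stage n) (skolem_fun p i t)" unfolding skolem_value_def using assms FoF_iff by blast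
  then show ?thesis using hull_stage_suc[OF assms(1)] skolem_fun_witnesses[OF assms(5)] by blast
qed

lemma hull_stage_fun_A: "n \<epsilon> omega \<Longrightarrow> is_fun t omega (hull_stage n) \<Longrightarrow> is_fun t omega A"
  by (rule fun_codomain) (use ap_in hull_stage_A in blast)+

text \<open>The hull contains a witness for the formula that x_0 is in x_1 but not in x_2. So the
  hull is extensional, which makes its collapse injective.\<close>

lemma skolem_hull_ext:
  assumes u: "u \<epsilon> skolem_hull" and v: "v \<epsilon> skolem_hull" and uv: "\<exists>z. z \<epsilon> u \<and> \<not> z \<epsilon> v"
  shows "\<exists>z. z \<epsilon> skolem_hull \<and> z \<epsilon> u \<and> \<not> z \<epsilon> v"
proof -
  obtain n where n: "n \<epsilon> omega" "u \<epsilon> hull_stage n" "v \<epsilon> hull_stage n"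
    using u v hull_stage_max unfolding skolem_hull_iff by (metis subsD)
  define t where "t = upd (upd (lam omega (\<lambda>_. u)) (tag 1) u) (tag 2) v"
  have t: "is_fun t omega (hull_stage n)" unfolding t_def by (intro upd_fun const_fun tag_omega n)
  have tA: "is_fun t omega A" by (rule hull_stage_fun_A[OF n(1) t])
  let ?p = "code (fm.And (fm.Mem 0 1) (fm.Neg (fm.Mem 0 2)))"
  have *: "fo_Sat A ?p (upd t (tag 0) x) \<longleftrightarrow> x \<epsilon> u \<and> \<not> x \<epsilon> v" if x: "x \<epsilon> A" for x
    unfolding code_sat[OF upd_fun[OF tA tag_omega x]] by (simp add: t_def ap_upd)
  have "\<exists>x. x \<epsilon> A \<and> fo_Sat A ?p (upd t (tag 0) x)"
    using uv * transD[OF A(1) skolem_hull_A[OF u]] by blast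
  from witness[OF n(1) code_fo tag_omega t this] obtain x where x: "x \<epsilon> hull_stage (suc n)" "fo_Sat A ?p (upd t (tag 0) x)" by blast
  then have "x \<epsilon> skolem_hull" "x \<epsilon> A" using skolem_hull_iff hull_stage_A suc_omega[OF n(1)] by blast+
  then show ?thesis using x(2) * by blast
qed

section \<open>The Mostowski collapse of the hull\<close>

definition layer :: "'a \<Rightarrow> 'a" where "layer b = mkset (\<lambda>x. x \<epsilon> skolem_hull \<and> rk x = b)"

lemma layer_iff: "x \<epsilon> layer b \<longleftrightarrow> x \<epsilon> skolem_hull \<and> rk x = b"
  unfolding layer_def by (rule mkset_iff, rule sep_ex[where P = "\<lambda>x. rk x = b"]) (intro dintro)

definition cut :: "'a \<Rightarrow> 'a" where "cut x = mkset (\<lambda>y. y \<epsilon> x \<and> y \<epsilon> skolem_hull)"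

lemma cut_iff: "y \<epsilon> cut x \<longleftrightarrow> y \<epsilon> x \<and> y \<epsilon> skolem_hull"
  unfolding cut_def by (rule mkset_iff, rule sep_ex[where P = "\<lambda>y. y \<epsilon> skolem_hull"]) (intro dintro)

text \<open>\<open>f\<close> sends a rank to the part of the collapse on the layer of that rank, so
  y is looked up in two steps, first by its rank.\<close>

definition val :: "'a \<Rightarrow> 'a \<Rightarrow> 'a" where
  "val f x = mkset (\<lambda>w. \<exists>y. y \<epsilon> cut x \<and> w = ap (ap f (rk y)) y)"

lemma val_iff: "w \<epsilon> val f x \<longleftrightarrow> (\<exists>y. y \<epsilon> cut x \<and> w = ap (ap f (rk y)) y)"
  unfolding val_def by (rule repl[where F = "\<lambda>y. ap (ap f (rk y)) y"]) (intro dintro)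

lemma fn_val [dintro]: "fn iU F \<Longrightarrow> fn iU G \<Longrightarrow> fn iU (\<lambda>B e. val (F B e) (G B e))"
proof (rule fn_comp2[where k = val])
  show "fn iU (\<lambda>B e. val (e 0) (e (Suc 0)))" unfolding val_def cut_def by (intro dintro)
qed

text \<open>The Mostowski collapse, by recursion on the rank: the value at the ordinal \<open>b\<close> is the
  collapse restricted to the elements of rank \<open>b\<close>.\<close>

definition HC :: "'a \<Rightarrow> 'a \<Rightarrow> 'a" where
  "HC f b = lam (layer b) (val f)"

lemma local_HC: "local_rec HC"
  unfolding local_rec_def
proof (intro conjI allI impI)
  show "fn iU (\<lambda>B e. HC (e 0) (e (Suc 0)))" unfolding HC_def layer_def by (intro dintro)
  fix f g b assume *: "\<forall>c. c \<epsilon> b \<longrightarrow> ap f c = ap g c"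
  have "val f x = val g x" if x: "x \<epsilon> layer b" for x
  proof (rule set_eqI)
    have "ap f (rk y) = ap g (rk y)" if y: "y \<epsilon> cut x" for y
    proof -
      have "y \<epsilon> x" using y cut_iff by simp
      then have "rk y \<epsilon> b" using rk_mem x layer_iff by metis
      then show ?thesis using * by simp
    qed
    then show "w \<epsilon> val f x \<longleftrightarrow> w \<epsilon> val g x" for w unfolding val_iff by metis
  qed
  note v = this
  have F: "fn iU (\<lambda>B e. val f (e 0))" for f by (intro dintro)
  show "HC f b = HC g b"
  proof (rule set_eqI)
    show "z \<epsilon> HC f b \<longleftrightarrow> z \<epsilon> HC g b" for z
      unfolding HC_def lam_iff[OF F] using v by metis
  qed
qed

definition mostowski :: "'a \<Rightarrow> 'a" where "mostowski x = ap (ordrec HC (rk x)) x"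

lemma fn_mostowski [dintro]: "fn iU F \<Longrightarrow> fn iU (\<lambda>B e. mostowski (F B e))"
proof (rule fn_comp1[where k = mostowski])
  show "fn iU (\<lambda>B e. mostowski (e 0))" unfolding mostowski_def by (intro dintro fn_ordrec[OF local_HC])
qed

lemma mostowski_iff:
  assumes x: "x \<epsilon> skolem_hull"
  shows "w \<epsilon> mostowski x \<longleftrightarrow> (\<exists>y. y \<epsilon> x \<and> y \<epsilon> skolem_hull \<and> w = mostowski y)"
proof -
  let ?f = "lam (rk x) (ordrec HC)"
  have v: "fn iU (\<lambda>B e. val ?f (e 0))" by (intro dintro)
  have "mostowski x = ap (HC ?f (rk x)) x" unfolding mostowski_def ordrec_eq[OF local_HC Ord_rk] ..
  also have "HC ?f (rk x) = lam (layer (rk x)) (val ?f)" by (rule HC_def)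
  also have "ap (lam (layer (rk x)) (val ?f)) x = val ?f x" by (rule ap_lam[OF v]) (simp add: x layer_iff)
  finally have c: "mostowski x = val ?f x" .
  have "ap ?f (rk y) = ordrec HC (rk y)" if "y \<epsilon> x" for y
    by (rule ap_lam[OF _ rk_mem[OF that]]) (intro fn_ordrec[OF local_HC] dintro)
  then have e: "ap (ap ?f (rk y)) y = mostowski y" if "y \<epsilon> x" for y
    using that unfolding mostowski_def by simp
  show ?thesis unfolding c val_iff cut_iff using e by auto
qed

lemma mostowski_inj: "x \<epsilon> skolem_hull \<Longrightarrow> y \<epsilon> skolem_hull \<Longrightarrow> mostowski x = mostowski y \<Longrightarrow> x = y"
proof -
  have D: "D iU (\<lambda>B e. e 0 \<epsilon> skolem_hull \<longrightarrow> (\<forall>y. y \<epsilon> skolem_hull \<longrightarrow> mostowski (e 0) = mostowski y \<longrightarrow> e 0 = y))" by (intro dintro)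
  have "x \<epsilon> skolem_hull \<longrightarrow> (\<forall>y. y \<epsilon> skolem_hull \<longrightarrow> mostowski x = mostowski y \<longrightarrow> x = y)"
  proof (rule eps_induct[where P = "\<lambda>x. x \<epsilon> skolem_hull \<longrightarrow> (\<forall>y. y \<epsilon> skolem_hull \<longrightarrow> mostowski x = mostowski y \<longrightarrow> x = y)", OF D], intro impI allI)
    fix x y assume IH: "\<And>z. z \<epsilon> x \<Longrightarrow> z \<epsilon> skolem_hull \<longrightarrow> (\<forall>y. y \<epsilon> skolem_hull \<longrightarrow> mostowski z = mostowski y \<longrightarrow> z = y)"
      and x: "x \<epsilon> skolem_hull" and y: "y \<epsilon> skolem_hull" and eq: "mostowski x = mostowski y"
    show "x = y"
    proof (rule ccontr)
      assume "x \<noteq> y"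
      then have "(\<exists>z. z \<epsilon> x \<and> \<not> z \<epsilon> y) \<or> (\<exists>z. z \<epsilon> y \<and> \<not> z \<epsilon> x)" using set_eqI by blast
      then show False
      proof
        assume "\<exists>z. z \<epsilon> x \<and> \<not> z \<epsilon> y"
        then obtain z where z: "z \<epsilon> skolem_hull" "z \<epsilon> x" "\<not> z \<epsilon> y" using skolem_hull_ext[OF x y] by blast
        then have "mostowski z \<epsilon> mostowski y" using mostowski_iff[OF x] eq by metis
        then obtain z' where z': "z' \<epsilon> y" "z' \<epsilon> skolem_hull" "mostowski z = mostowski z'" using mostowski_iff[OF y] by blast
        then show False using IH[OF z(2)] z by blast
      next
        assume "\<exists>z. z \<epsilon> y \<and> \<not> z \<epsilon> x"
        then obtain z where z: "z \<epsilon> skolem_hull" "z \<epsilon> y" "\<not> z \<epsilon> x" using skolem_hull_ext[OF y x] by blast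
        then have "mostowski z \<epsilon> mostowski x" using mostowski_iff[OF y] eq by metis
        then obtain z' where z': "z' \<epsilon> x" "z' \<epsilon> skolem_hull" "mostowski z = mostowski z'" using mostowski_iff[OF x] by blast
        then have "z' = z" using IH[OF z'(1)] z(1) by metis
        then show False using z z' by blast
      qed
    qed
  qed
  then show "x \<epsilon> skolem_hull \<Longrightarrow> y \<epsilon> skolem_hull \<Longrightarrow> mostowski x = mostowski y \<Longrightarrow> x = y" by blast
qed

lemma mostowski_mem: "x \<epsilon> skolem_hull \<Longrightarrow> y \<epsilon> skolem_hull \<Longrightarrow> mostowski x \<epsilon> mostowski y \<longleftrightarrow> x \<epsilon> y"
  using mostowski_iff[of y] mostowski_inj[of x] by metis

lemma Ord_bb: "Ord bb" by (rule Ord_mem[OF inac_Ord[OF k] bb])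

lemma Vr_skolem_hull: "z \<epsilon> Vr bb \<Longrightarrow> z \<epsilon> skolem_hull"
  using skolem_hull_iff base_hull_stage emp_omega by blast

text \<open>V_bb is a transitive subset of the hull, so the collapse does not move the
  parameters.\<close>

lemma mostowski_id: "x \<epsilon> Vr bb \<Longrightarrow> mostowski x = x"
proof -
  have D: "D iU (\<lambda>B e. e 0 \<epsilon> Vr bb \<longrightarrow> mostowski (e 0) = e 0)" by (intro dintro)
  have "x \<epsilon> Vr bb \<longrightarrow> mostowski x = x"
  proof (rule eps_induct[where P = "\<lambda>x. x \<epsilon> Vr bb \<longrightarrow> mostowski x = x", OF D], rule impI)
    fix x assume IH: "\<And>y. y \<epsilon> x \<Longrightarrow> y \<epsilon> Vr bb \<longrightarrow> mostowski y = y" and x: "x \<epsilon> Vr bb"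
    have y: "y \<epsilon> Vr bb" "y \<epsilon> skolem_hull" "mostowski y = y" if "y \<epsilon> x" for y
      using Vr_mem_subs[OF Ord_bb x that] Vr_skolem_hull IH[OF that] by blast+
    show "mostowski x = x"
    proof (rule set_eqI)
      show "w \<epsilon> mostowski x \<longleftrightarrow> w \<epsilon> x" for w unfolding mostowski_iff[OF Vr_skolem_hull[OF x]] using y by metis
    qed
  qed
  then show "x \<epsilon> Vr bb \<Longrightarrow> mostowski x = x" by blast
qed

definition collapsed :: 'a where "collapsed = mkset (\<lambda>w. \<exists>x. x \<epsilon> skolem_hull \<and> w = mostowski x)"

lemma collapsed_iff: "w \<epsilon> collapsed \<longleftrightarrow> (\<exists>x. x \<epsilon> skolem_hull \<and> w = mostowski x)"
  unfolding collapsed_def by (rule repl[where F = mostowski]) (intro dintro)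

lemma transitive_collapsed: "transitive collapsed"
  by (rule transI) (use collapsed_iff mostowski_iff in metis)

definition img :: "'a \<Rightarrow> 'a" where "img t = lam omega (\<lambda>i. mostowski (ap t i))"

lemma ap_img: "i \<epsilon> omega \<Longrightarrow> ap (img t) i = mostowski (ap t i)"
  unfolding img_def by (rule ap_lam) (intro dintro)

lemma img_fun: "n \<epsilon> omega \<Longrightarrow> is_fun t omega (hull_stage n) \<Longrightarrow> is_fun (img t) omega collapsed"
  unfolding img_def by (rule lam_fun) (intro dintro, use collapsed_iff skolem_hull_iff ap_in in blast)

text \<open>The assignments considered have all their values in one stage. An existential quantifier
  only leads to a common later stage, where the new value is found as well, so assignments spread
  over infinitely many stages do not arise.\<close>

lemma collapse_sat:
  assumes n: "n \<epsilon> omega" and p: "fo_formula p" and t: "is_fun t omega (hull_stage n)"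
  shows "fo_Sat A p t \<longleftrightarrow> fo_Sat collapsed p (img t)"
proof -
  let ?P = "\<lambda>p. \<forall>n. n \<epsilon> omega \<longrightarrow> (\<forall>t. is_fun t omega (hull_stage n) \<longrightarrow> (fo_Sat A p t \<longleftrightarrow> fo_Sat collapsed p (img t)))"
  have D: "D iU (\<lambda>B e. ?P (e 0))" unfolding img_def by (intro dintro)
  have "?P p"
  proof (rule fo_induct[where P = ?P, OF D p]; intro allI impI)
    fix i j n t assume ij: "i \<epsilon> omega" "j \<epsilon> omega" and n: "n \<epsilon> omega" and t: "is_fun t omega (hull_stage n)"
    note tA = hull_stage_fun_A[OF n t] and tN = img_fun[OF n t]
    have x: "ap t i \<epsilon> skolem_hull" "ap t j \<epsilon> skolem_hull" using ap_in[OF t] ij n skolem_hull_iff by blast+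
    show "fo_Sat A (cMem i j) t \<longleftrightarrow> fo_Sat collapsed (cMem i j) (img t)"
      using fo_Sat_simps(1)[OF tA ij] fo_Sat_simps(1)[OF tN ij] ap_img ij mostowski_mem[OF x] by simp
    show "fo_Sat A (cEq i j) t \<longleftrightarrow> fo_Sat collapsed (cEq i j) (img t)"
      using fo_Sat_simps(2)[OF tA ij] fo_Sat_simps(2)[OF tN ij] ap_img ij mostowski_inj[OF x] by auto
  next
    fix p n t assume p: "fo_formula p" and IH: "?P p" and n: "n \<epsilon> omega" and t: "is_fun t omega (hull_stage n)"
    show "fo_Sat A (cNeg p) t \<longleftrightarrow> fo_Sat collapsed (cNeg p) (img t)"
      using fo_Sat_simps(3)[OF hull_stage_fun_A[OF n t] p] fo_Sat_simps(3)[OF img_fun[OF n t] p] IH n t by blast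
  next
    fix p q n t assume p: "fo_formula p" "fo_formula q" and IH: "?P p" "?P q" and n: "n \<epsilon> omega" and t: "is_fun t omega (hull_stage n)"
    show "fo_Sat A (cAnd p q) t \<longleftrightarrow> fo_Sat collapsed (cAnd p q) (img t)"
      using fo_Sat_simps(4)[OF hull_stage_fun_A[OF n t] p] fo_Sat_simps(4)[OF img_fun[OF n t] p] IH n t by blast
  next
    fix i p n t assume i: "i \<epsilon> omega" and p: "fo_formula p" and IH: "?P p" and n: "n \<epsilon> omega" and t: "is_fun t omega (hull_stage n)"
    note eA = fo_Sat_simps(5)[OF hull_stage_fun_A[OF n t] i p] and eN = fo_Sat_simps(5)[OF img_fun[OF n t] i p]
    have step: "fo_Sat A p (upd t i x) \<longleftrightarrow> fo_Sat collapsed p (upd (img t) i (mostowski x))" if x: "x \<epsilon> skolem_hull" for x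
    proof -
      obtain m where m: "m \<epsilon> omega" "x \<epsilon> hull_stage m" using x skolem_hull_iff by blast
      obtain l where l: "l \<epsilon> omega" "subs (hull_stage n) (hull_stage l)" "subs (hull_stage m) (hull_stage l)" using hull_stage_max[OF n m(1)] by blast
      have tl: "is_fun t omega (hull_stage l)" by (rule fun_codomain[OF t]) (use ap_in[OF t] subsD[OF l(2)] in blast)
      have xl: "x \<epsilon> hull_stage l" using subsD[OF l(3) m(2)] .
      have ul: "is_fun (upd t i x) omega (hull_stage l)" by (rule upd_fun[OF tl i xl])
      have "img (upd t i x) = upd (img t) i (mostowski x)"
      proof (rule fun_ext[OF img_fun[OF l(1) ul]])
        show "is_fun (upd (img t) i (mostowski x)) omega collapsed" by (rule upd_fun[OF img_fun[OF n t] i]) (use collapsed_iff x in blast)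
        show "ap (img (upd t i x)) z = ap (upd (img t) i (mostowski x)) z" if "z \<epsilon> omega" for z
          using ap_img[OF that] by (simp add: ap_upd)
      qed
      then show ?thesis using IH l(1) ul by metis
    qed
    show "fo_Sat A (cEx i p) t \<longleftrightarrow> fo_Sat collapsed (cEx i p) (img t)"
    proof
      assume "fo_Sat A (cEx i p) t"
      then obtain x where x: "x \<epsilon> hull_stage (suc n)" "fo_Sat A p (upd t i x)" using witness[OF n p i t] eA by blast
      then have xs: "x \<epsilon> skolem_hull" using skolem_hull_iff suc_omega[OF n] by blast
      then show "fo_Sat collapsed (cEx i p) (img t)" using step[OF xs] x(2) eN collapsed_iff by blast
    next
      assume "fo_Sat collapsed (cEx i p) (img t)"
      then obtain w where w: "w \<epsilon> collapsed" "fo_Sat collapsed p (upd (img t) i w)" using eN by blast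
      from w(1) obtain x where "x \<epsilon> skolem_hull" "w = mostowski x" unfolding collapsed_iff by blast
      with w(2) have x: "x \<epsilon> skolem_hull" "fo_Sat collapsed p (upd (img t) i (mostowski x))" by simp_all
      then show "fo_Sat A (cEx i p) t" using step[OF x(1)] skolem_hull_A[OF x(1)] eA by blast
    qed
  qed
  then show ?thesis using n t by blast
qed

text \<open>A Skolem value over X is indexed by a formula, a variable and an assignment. Covering X
  by a set Z in V_k turns the assignments into functions from \<omega> to Z, and the set of all
  these indices is in V_k.\<close>

lemma small_new:
  assumes X: "small k X"
  obtains W where "small k W" "\<And>z. skolem_value X z \<Longrightarrow> z \<epsilon> W"
proof -
  obtain Z F where Z: "Z \<epsilon> Vr k" "\<And>y. y \<epsilon> X \<Longrightarrow> \<exists>z. z \<epsilon> Z \<and> ap F z = y" using X unfolding small_def by blast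
  note g = good_inac[OF k]
  define Z' where "Z' = prd FoF (prd omega (FunS omega Z))"
  have Z'V: "Z' \<epsilon> Vr k" unfolding Z'_def
    using good_prd[OF g good_FoF[OF g] good_prd[OF g good_omega[OF g] good_FunS[OF g good_omega[OF g] Z(1)]]] .
  \<comment> \<open>G computes the Skolem value from an index; the assignment into X is F composed
    with the assignment t into Z.\<close>
  define G where "G z = mkset (\<lambda>w. \<exists>p i t. z = opair p (opair i t) \<and> w \<epsilon> skolem_fun p i (lam omega (\<lambda>n. ap F (ap t n))))" for z
  have G: "G (opair p (opair i t)) = skolem_fun p i (lam omega (\<lambda>n. ap F (ap t n)))" for p i t
    unfolding G_def by (rule mkset_unique) simp
  have Gfn: "fn iU (\<lambda>B e. G (e 0))" unfolding G_def by (intro dintro)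
  define W where "W = mkset (\<lambda>w. \<exists>z. z \<epsilon> Z' \<and> w = G z)"
  have W: "w \<epsilon> W \<longleftrightarrow> (\<exists>z. z \<epsilon> Z' \<and> w = G z)" for w unfolding W_def by (rule repl[OF Gfn])
  have "small k W" unfolding small_def using Z'V W ap_lam[OF Gfn] by metis
  moreover have "z \<epsilon> W" if nw: "skolem_value X z" for z
  proof -
    obtain p i t where p: "p \<epsilon> FoF" "i \<epsilon> omega" and t: "is_fun t omega X" and z: "z = skolem_fun p i t" using nw unfolding skolem_value_def by blast
    \<comment> \<open>Choice lifts the assignment into X to one into Z.\<close>
    obtain c where c: "\<And>Y. Y \<epsilon> pow Z \<Longrightarrow> \<exists>y. y \<epsilon> Y \<Longrightarrow> ap c Y \<epsilon> Y" using choice_fun by blast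
    define P where "P n = mkset (\<lambda>u. u \<epsilon> Z \<and> ap F u = ap t n)" for n
    have P: "u \<epsilon> P n \<longleftrightarrow> u \<epsilon> Z \<and> ap F u = ap t n" for u n
      unfolding P_def by (rule mkset_iff, rule sep_ex[where P = "\<lambda>u. ap F u = ap t n"]) (intro dintro)
    have Pn: "ap c (P n) \<epsilon> Z \<and> ap F (ap c (P n)) = ap t n" if n: "n \<epsilon> omega" for n
    proof -
      have "\<exists>u. u \<epsilon> P n" using P Z(2)[OF ap_in[OF t n]] by blast
      moreover have "P n \<epsilon> pow Z" using P by (simp add: Defs.subs_def)
      ultimately show ?thesis using c P by blast
    qed
    define t' where "t' = lam omega (\<lambda>n. ap c (P n))"
    have f: "fn iU (\<lambda>B e. ap c (P (e 0)))" unfolding P_def by (intro dintro)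
    have t': "is_fun t' omega Z" unfolding t'_def by (rule lam_fun[OF f]) (use Pn in blast)
    have e: "ap F (ap t' n) = ap t n" if "n \<epsilon> omega" for n unfolding t'_def using ap_lam[OF f that] Pn[OF that] by simp
    have f2: "fn iU (\<lambda>B e. ap F (ap t' (e 0)))" by (intro dintro)
    have "lam omega (\<lambda>n. ap F (ap t' n)) = t"
    proof (rule fun_ext[OF _ t])
      show "is_fun (lam omega (\<lambda>n. ap F (ap t' n))) omega X" by (rule lam_fun[OF f2]) (use e ap_in[OF t] in simp)
      show "ap (lam omega (\<lambda>n. ap F (ap t' n))) x = ap t x" if "x \<epsilon> omega" for x using ap_lam[OF f2 that] e[OF that] by simp
    qed
    then have "z = G (opair p (opair i t'))" using G z by simp
    moreover have "opair p (opair i t') \<epsilon> Z'" unfolding Z'_def using p t' by simp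
    ultimately show ?thesis using W by blast
  qed
  ultimately show thesis using that by blast
qed

lemma small_hull_stage: "n \<epsilon> omega \<Longrightarrow> small k (hull_stage n)"
proof -
  have D: "D iU (\<lambda>B e. small k (hull_stage (e 0)))" unfolding small_def by (intro dintro)
  assume n: "n \<epsilon> omega"
  show ?thesis
  proof (rule omega_induct[where P = "\<lambda>n. small k (hull_stage n)", OF D n])
    show "small k (hull_stage emp)"
      by (rule small_Un[OF k small_elem[OF k Vr_mem[OF inac_Ord[OF k] bb]] small_single[OF k, of y0]])
        (use hull_stage_iff[OF Ord_emp] emp_iff upair_iff in blast)
  next
    fix n assume n: "n \<epsilon> omega" and s: "small k (hull_stage n)"
    obtain W where W: "small k W" "\<And>z. skolem_value (hull_stage n) z \<Longrightarrow> z \<epsilon> W" by (rule small_new[OF s]) blast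
    show "small k (hull_stage (suc n))"
      by (rule small_Un[OF k s W(1)]) (use hull_stage_suc[OF n] W(2) in blast)
  qed
qed

text \<open>The stages are small and k is regular, so those ranks of collapsed elements that are
  below k have a common bound c below k. An \<in>-minimal collapsed element outside V_k would then
  be a subset of V_c, hence in V_k.\<close>

lemma collapsed_Vr: "subs collapsed (Vr k)"
proof -
  note Ok = inac_Ord[OF k]
  \<comment> \<open>b bounds the ranks below k that occur at stage n. The least such b is a
    definable function of n, and regularity over \<omega> bounds these in turn.\<close>
  define P where "P n b \<longleftrightarrow> b \<epsilon> k \<and> (\<forall>x. x \<epsilon> hull_stage n \<longrightarrow> rk (mostowski x) \<epsilon> k \<longrightarrow> rk (mostowski x) \<epsilon> b)" for n b
  have PD: "D iU (\<lambda>B e. P (e i) (e l))" for i l unfolding P_def by (intro dintro)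
  have PD': "D iU (\<lambda>B e. P n (e l))" for n l unfolding P_def by (intro dintro)
  define bn where "bn n = least_ord (P n)" for n
  have bn: "P n (bn n)" if n: "n \<epsilon> omega" for n
  proof -
    have "fn iU (\<lambda>B e. rk (mostowski (e 0)))" by (intro dintro)
    then obtain b where b: "P n b" using small_bounded[OF k small_hull_stage[OF n], where G = "\<lambda>x. rk (mostowski x)"] unfolding P_def by blast
    then have "Ord b" using Ord_mem[OF Ok] unfolding P_def by blast
    then show ?thesis unfolding bn_def using least_ord_least(2)[where P = "P n", OF PD' _ b] by blast
  qed
  have "fn iU (\<lambda>B e. bn (e 0))" unfolding bn_def by (intro dintro PD)
  moreover have "bn n \<epsilon> k" if "n \<epsilon> omega" for n using bn[OF that] unfolding P_def by blast
  ultimately obtain c where c: "c \<epsilon> k" "\<And>n. n \<epsilon> omega \<Longrightarrow> bn n \<epsilon> c"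
    using inac_regularF[OF k, where F = bn, OF _ inac_omega[OF k]] by blast
  have Oc: "Ord c" using Ord_mem[OF Ok c(1)] .
  have bd: "rk w \<epsilon> c" if w: "w \<epsilon> collapsed" "rk w \<epsilon> k" for w
  proof -
    obtain x where x: "x \<epsilon> skolem_hull" "w = mostowski x" using w collapsed_iff by blast
    obtain n where n: "n \<epsilon> omega" "x \<epsilon> hull_stage n" using x skolem_hull_iff by blast
    have "rk w \<epsilon> bn n" using bn[OF n(1)] n(2) w(2) x(2) unfolding P_def by blast
    then show ?thesis using Ord_trans[OF Oc c(2)[OF n(1)]] by blast
  qed
  show ?thesis
  proof (rule subsI, rule ccontr)
    fix w assume w: "w \<epsilon> collapsed" "\<not> w \<epsilon> Vr k"
    have "D iU (\<lambda>B e. \<not> e 0 \<epsilon> Vr k)" by (intro dintro)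
    then obtain v where v: "v \<epsilon> collapsed" "\<not> v \<epsilon> Vr k" "\<And>z. z \<epsilon> collapsed \<Longrightarrow> \<not> z \<epsilon> Vr k \<Longrightarrow> \<not> z \<epsilon> v"
      by (rule minimal[where P = "\<lambda>w. \<not> w \<epsilon> Vr k", OF _ w]) blast
    have "z \<epsilon> Vr c" if z: "z \<epsilon> v" for z
    proof -
      have zN: "z \<epsilon> collapsed" using transD[OF transitive_collapsed v(1) z] .
      then have "z \<epsilon> Vr k" using v(3) z by blast
      then show ?thesis using bd[OF zN] mem_Vr_iff[OF Ok] mem_Vr_iff[OF Oc] by blast
    qed
    then have "subs v (Vr c)" by (rule subsI)
    then show False using v(2) Vr_iff[OF Ok] c(1) by blast
  qed
qed

text \<open>Delta_0 formulas are absolute between A, the collapse and the universe, and the collapse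
  fixes the parameters, so the image of y0 is the witness sought.\<close>

lemma hull_result:
  assumes q: "delta0_formula q" and s: "is_fun s omega (Vr bb)" and j: "j \<epsilon> omega" and V: "V_Sat_delta0 q (upd s j y0)"
  shows "\<exists>y. y \<epsilon> Vr k \<and> V_Sat_delta0 q (upd s j y)"
proof -
  have s0: "is_fun s omega (hull_stage emp)" by (rule fun_codomain[OF s]) (use ap_in[OF s] base_hull_stage[OF emp_omega] in blast)
  have u: "is_fun (upd s j y0) omega (hull_stage emp)" by (rule upd_fun[OF s0 j]) (use base_hull_stage[OF emp_omega] in blast)
  have "fo_Sat A q (upd s j y0)" using V_Sat_delta0_iff[OF A(1) hull_stage_fun_A[OF emp_omega u] q] V by blast
  then have 1: "fo_Sat collapsed q (img (upd s j y0))" using collapse_sat[OF emp_omega delta0_fo[OF q] u] by blast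
  have y0: "mostowski y0 \<epsilon> collapsed" using collapsed_iff skolem_hull_iff base_hull_stage[OF emp_omega] emp_omega by blast
  have sN: "is_fun s omega collapsed" by (rule fun_codomain[OF s]) (use ap_in[OF s] Vr_skolem_hull mostowski_id collapsed_iff in metis)
  have uN: "is_fun (upd s j (mostowski y0)) omega collapsed" by (rule upd_fun[OF sN j y0])
  have "img (upd s j y0) = upd s j (mostowski y0)"
  proof (rule fun_ext[OF img_fun[OF emp_omega u] uN])
    show "ap (img (upd s j y0)) z = ap (upd s j (mostowski y0)) z" if "z \<epsilon> omega" for z
      unfolding ap_img[OF that] by (simp add: ap_upd mostowski_id[OF ap_in[OF s that]])
  qed
  then have "V_Sat_delta0 q (upd s j (mostowski y0))" using 1 V_Sat_delta0_iff[OF transitive_collapsed uN q] by simp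
  then show ?thesis using subsD[OF collapsed_Vr y0] by blast
qed

end

context ZFC
begin

text \<open>Levy's theorem that an inaccessible \<open>V\<^sub>k\<close> is \<open>\<Sigma>\<^sub>1\<close>-elementary in the universe.\<close>

lemma levy:
  assumes k: "inaccessible k" and q: "delta0_formula q" and s: "is_fun s omega (Vr k)" and j: "j \<epsilon> omega"
    and V: "V_Sat_delta0 q (upd s j y)"
  shows "\<exists>y. y \<epsilon> Vr k \<and> V_Sat_delta0 q (upd s j y)"
proof -
  note Ok = inac_Ord[OF k]
  have "s \<epsilon> Vr k" using inac_fun_mem[OF k good_omega[OF good_inac[OF k]] s] .
  \<comment> \<open>An assignment into V_k is an element of V_k, so all parameters lie in one V_b
    with b < k.\<close>
  then obtain b where b: "b \<epsilon> k" "subs s (Vr b)" using Vr_iff[OF Ok] by blast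
  have Ob: "Ord b" using Ord_mem[OF Ok b(1)] .
  have "ap s i \<epsilon> Vr b" if i: "i \<epsilon> omega" for i
  proof -
    have "opair i (ap s i) \<epsilon> Vr b" using subsD[OF b(2)] fun_ap[OF s i] by blast
    moreover have "upair i (ap s i) \<epsilon> opair i (ap s i)" "ap s i \<epsilon> upair i (ap s i)" by (simp_all add: Defs.opair_def)
    ultimately show ?thesis using Vr_mem_subs[OF Ob] by blast
  qed
  then have sb: "is_fun s omega (Vr b)" by (rule fun_codomain[OF s])
  define A where "A = Vr (rk (adj (Vr b) y))"
  have sA: "subs (adj (Vr b) y) A" unfolding A_def by simp
  have A: "transitive A" unfolding A_def by (rule transitive_Vr) simp
  obtain h where h: "\<And>Y. Y \<epsilon> pow A \<Longrightarrow> \<exists>y. y \<epsilon> Y \<Longrightarrow> ap h Y \<epsilon> Y" using choice_fun by blast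
  interpret hull "(\<epsilon>)" k y b A h
  proof unfold_locales
    show "inaccessible k" by fact
    show "b \<epsilon> k" by fact
    show "transitive A" by fact
    show "subs (Vr b) A" using subsD[OF sA] by (auto intro: subsI)
    show "y \<epsilon> A" using subsD[OF sA] by simp
    show "\<And>Y. Y \<epsilon> pow A \<Longrightarrow> \<exists>y. y \<epsilon> Y \<Longrightarrow> ap h Y \<epsilon> Y" by fact
  qed
  show ?thesis by (rule hull_result[OF q sb j V])
qed

subsection \<open>Correct cardinals\<close>

lemma cAll_inject [simp]: "cAll i p = cAll j q \<longleftrightarrow> i = j \<and> p = q"
  unfolding Defs.cAll_def by auto

lemma cAll_fo: "i \<epsilon> omega \<Longrightarrow> fo_formula p \<Longrightarrow> fo_formula (cAll i p)"
  unfolding Defs.cAll_def by (intro fo_intros)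

lemma V_Sat_Sigma2_iff:
  "i \<epsilon> omega \<Longrightarrow> j \<epsilon> omega \<Longrightarrow> delta0_formula q \<Longrightarrow>
   V_Sat_Sigma2 (cEx i (cAll j q)) s \<longleftrightarrow> (\<exists>x. \<forall>y. V_Sat_delta0 q (upd (upd s i x) j y))"
  unfolding Defs.V_Sat_Sigma2_def by auto

lemma fo_Sat_Sigma2:
  assumes s: "is_fun s omega A" and ij: "i \<epsilon> omega" "j \<epsilon> omega" and q: "delta0_formula q"
  shows "fo_Sat A (cEx i (cAll j q)) s \<longleftrightarrow> (\<exists>x. x \<epsilon> A \<and> (\<forall>y. y \<epsilon> A \<longrightarrow> fo_Sat A q (upd (upd s i x) j y)))"
proof -
  have "fo_Sat A (cAll j q) (upd s i x) \<longleftrightarrow> (\<forall>y. y \<epsilon> A \<longrightarrow> fo_Sat A q (upd (upd s i x) j y))" if "x \<epsilon> A" for x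
    by (rule fo_Sat_All[OF upd_fun[OF s ij(1) that] ij(2) delta0_fo[OF q]])
  then show ?thesis unfolding fo_Sat_simps(5)[OF s ij(1) cAll_fo[OF ij(2) delta0_fo[OF q]]] by blast
qed

text \<open>By Levy's theorem for the negated matrix, a counterexample anywhere in the universe
  yields one in V_k. So the inner universal statement is absolute for V_k, and only the outer
  witness remains restricted to it.\<close>

lemma inac_Sigma2:
  assumes k: "inaccessible k" and s: "is_fun s omega (Vr k)" and ij: "i \<epsilon> omega" "j \<epsilon> omega" and q: "delta0_formula q"
  shows "fo_Sat (Vr k) (cEx i (cAll j q)) s \<longleftrightarrow> (\<exists>x. x \<epsilon> Vr k \<and> (\<forall>y. V_Sat_delta0 q (upd (upd s i x) j y)))"
proof -
  note tr = transitive_Vr[OF inac_Ord[OF k]]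
  have "(\<forall>y. y \<epsilon> Vr k \<longrightarrow> fo_Sat (Vr k) q (upd (upd s i x) j y)) \<longleftrightarrow> (\<forall>y. V_Sat_delta0 q (upd (upd s i x) j y))"
    if x: "x \<epsilon> Vr k" for x
  proof
    note sx = upd_fun[OF s ij(1) x]
    have e: "V_Sat_delta0 q (upd (upd s i x) j y) \<longleftrightarrow> fo_Sat (Vr k) q (upd (upd s i x) j y)" if y: "y \<epsilon> Vr k" for y
      by (rule V_Sat_delta0_iff[OF tr upd_fun[OF sx ij(2) y] q])
    assume all: "\<forall>y. y \<epsilon> Vr k \<longrightarrow> fo_Sat (Vr k) q (upd (upd s i x) j y)"
    show "\<forall>y. V_Sat_delta0 q (upd (upd s i x) j y)"
    proof (rule allI, rule ccontr)
      fix y assume n: "\<not> V_Sat_delta0 q (upd (upd s i x) j y)"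
      have "is_fun (upd (upd s i x) j y) omega (adj (Vr k) y)"
      proof (rule upd_fun[OF _ ij(2)])
        show "is_fun (upd s i x) omega (adj (Vr k) y)" by (rule fun_codomain[OF sx]) (use ap_in[OF sx] adj_iff in blast)
      qed simp
      from V_Sat_delta0_Neg[OF this q] n have "V_Sat_delta0 (cNeg q) (upd (upd s i x) j y)" by blast
      from levy[OF k delta0_intros(3)[OF q] sx ij(2) this] obtain y' where
        y': "y' \<epsilon> Vr k" "V_Sat_delta0 (cNeg q) (upd (upd s i x) j y')" by blast
      then show False using V_Sat_delta0_Neg[OF upd_fun[OF sx ij(2) y'(1)] q] e[OF y'(1)] all by blast
    qed
  next
    assume "\<forall>y. V_Sat_delta0 q (upd (upd s i x) j y)"
    then show "\<forall>y. y \<epsilon> Vr k \<longrightarrow> fo_Sat (Vr k) q (upd (upd s i x) j y)"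
      using V_Sat_delta0_iff[OF tr upd_fun[OF upd_fun[OF s ij(1) x] ij(2)] q] by blast
  qed
  then show ?thesis unfolding fo_Sat_Sigma2[OF s ij q] by blast
qed

lemma D_V_Sat_Sigma2 [dintro]:
  assumes F: "fn iU F" and G: "fn iU G" shows "D iU (\<lambda>B e. V_Sat_Sigma2 (F B e) (G B e))"
proof (rule D_comp2[where R = "\<lambda>B. V_Sat_Sigma2", OF _ F G])
  show "D iU (\<lambda>B e. V_Sat_Sigma2 (e 0) (e (Suc 0)))"
    unfolding Defs.V_Sat_Sigma2_def Defs.cAll_def by (intro dintro)
qed

lemma D_Sigma2_formula [dintro]:
  assumes F: "fn iU F" shows "D iU (\<lambda>B e. Sigma2_formula (F B e))"
proof (rule D_comp1[where R = "\<lambda>B. Sigma2_formula", OF _ F])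
  show "D iU (\<lambda>B e. Sigma2_formula (e 0))" unfolding Defs.Sigma2_formula_def Defs.cAll_def by (intro dintro)
qed

lemma Sigma2_fo: "Sigma2_formula p \<Longrightarrow> fo_formula p"
  unfolding Defs.Sigma2_formula_def using cAll_fo delta0_fo fo_intros(5) by blast

lemma inac_unbounded:
  assumes pc: "\<not> (\<exists>X. \<forall>k. inaccessible k \<longrightarrow> k \<epsilon> X)" and b: "Ord b"
  shows "\<exists>k. inaccessible k \<and> b \<epsilon> k"
proof -
  obtain k where k: "inaccessible k" "\<not> k \<epsilon> suc b" using pc by blast
  then show ?thesis using Ord_linear[OF inac_Ord[OF k(1)] b] by auto
qed

text \<open>The pairs of a formula and an assignment of reals form a set, so the least stages
  containing witnesses have a supremum, and every inaccessible above it is correct. Since the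
  parameters are reals, not arbitrary elements of V_k, one such supremum suffices and no closing-off
  iteration is made.\<close>

lemma real_correct_ex:
  assumes pc: "\<not> (\<exists>X. \<forall>k. inaccessible k \<longrightarrow> k \<epsilon> X)"
  shows "\<exists>k. inaccessible k \<and> Sigma2_real_correct k"
proof -
  \<comment> \<open>The Sigma_2 statement z, given by a formula and an assignment, has a witness in
    V_b; its inner universal quantifier ranges over the whole universe.\<close>
  define W where "W z b \<longleftrightarrow> Ord b \<and> (\<exists>s i j q. z = opair (cEx i (cAll j q)) s \<and> i \<epsilon> omega \<and> j \<epsilon> omega \<and> delta0_formula q \<and>
      (\<exists>x. x \<epsilon> Vr b \<and> (\<forall>y. V_Sat_delta0 q (upd (upd s i x) j y))))" for z b
  have WD: "D iU (\<lambda>B e. W (e i) (e j))" for i j unfolding W_def Defs.cAll_def by (intro dintro)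
  have WD': "D iU (\<lambda>B e. W z (e j))" for z j unfolding W_def Defs.cAll_def by (intro dintro)
  \<comment> \<open>Statements without any witness get the value 0, so that replacement has a total
    function.\<close>
  define F where "F z = (if \<exists>b. W z b then least_ord (W z) else emp)" for z
  have Ffn: "fn iU (\<lambda>B e. F (e 0))" unfolding F_def by (intro dintro WD)
  have FW: "W z (F z)" if "\<exists>b. W z b" for z
  proof -
    obtain b where b: "W z b" using \<open>\<exists>b. W z b\<close> by blast
    have "Ord b" using b unfolding W_def by blast
    then show ?thesis unfolding F_def using least_ord_least(2)[where P = "W z", OF WD' _ b] b by auto
  qed
  have OFz: "Ord (F z)" for z
  proof (cases "\<exists>b. W z b")
    case True then show ?thesis using FW W_def by blast
  qed (simp add: F_def)
  define S where "S = mkset (\<lambda>y. \<exists>z. z \<epsilon> prd HF (FunS omega (pow omega)) \<and> y = F z)"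
  have S: "y \<epsilon> S \<longleftrightarrow> (\<exists>z. z \<epsilon> prd HF (FunS omega (pow omega)) \<and> y = F z)" for y
    unfolding S_def by (rule repl[OF Ffn])
  have OS: "Ord (Uni S)" by (rule Ord_Uni) (use S OFz in auto)
  obtain k where k: "inaccessible k" "Uni S \<epsilon> k" using inac_unbounded[OF pc OS] by blast
  note Ok = inac_Ord[OF k(1)]
  have pw: "subs (pow omega) (Vr k)"
    using good_pow[OF good_inac[OF k(1)] good_omega[OF good_inac[OF k(1)]]] Vr_mem_subs[OF Ok] by (blast intro: subsI)
  have "fo_Sat (Vr k) p s \<longleftrightarrow> V_Sat_Sigma2 p s" if p: "Sigma2_formula p" and s: "is_fun s omega (pow omega)" for p s
  proof -
    obtain i j q where pq: "i \<epsilon> omega" "j \<epsilon> omega" "delta0_formula q" "p = cEx i (cAll j q)"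
      using p unfolding Defs.Sigma2_formula_def by blast
    have skolem_fun: "is_fun s omega (Vr k)" by (rule fun_codomain[OF s]) (use ap_in[OF s] subsD[OF pw] in blast)
    have "(\<exists>x. \<forall>y. V_Sat_delta0 q (upd (upd s i x) j y)) \<Longrightarrow> \<exists>x. x \<epsilon> Vr k \<and> (\<forall>y. V_Sat_delta0 q (upd (upd s i x) j y))"
    proof -
      assume "\<exists>x. \<forall>y. V_Sat_delta0 q (upd (upd s i x) j y)"
      then obtain x where x: "\<forall>y. V_Sat_delta0 q (upd (upd s i x) j y)" by blast
      let ?z = "opair p s"
      have "x \<epsilon> Vr (suc (rk x))" using mem_Vr_iff[OF Ord_suc[OF Ord_rk]] by simp
      then have "W ?z (suc (rk x))" unfolding W_def using x pq Ord_suc[OF Ord_rk] by blast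
      then have "W ?z (F ?z)" using FW by blast
      then obtain x' where x': "x' \<epsilon> Vr (F ?z)" "\<forall>y. V_Sat_delta0 q (upd (upd s i x') j y)"
        unfolding W_def pq(4) by auto
      have "p \<epsilon> HF" using formula_HF fo_so Sigma2_fo[OF p] by blast
      then have "?z \<epsilon> prd HF (FunS omega (pow omega))" using s by simp
      then have "F ?z \<epsilon> S" using S by blast
      then have "subs (F ?z) (Uni S)" by (intro subsI) (use Uni_iff in blast)
      then have "x' \<epsilon> Vr (Uni S)" using subsD[OF Vr_mono_le[OF OS OFz]] x'(1) by blast
      then have "x' \<epsilon> Vr k" using subsD[OF Vr_mono[OF Ok k(2)]] by blast
      then show ?thesis using x'(2) by blast
    qed
    then show ?thesis unfolding pq(4) V_Sat_Sigma2_iff[OF pq(1-3)] inac_Sigma2[OF k(1) skolem_fun pq(1-3)] by blast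
  qed
  then have "Sigma2_real_correct k" unfolding Defs.Sigma2_real_correct_def V_Vr[OF Ok] using Ok pw by blast
  then show ?thesis using k(1) by blast
qed

lemma V_Sat_delta0_cong:
  assumes q: "delta0_formula q" and s: "is_fun s omega B" "is_fun s' omega B'"
    and eq: "\<And>n. n \<epsilon> omega \<Longrightarrow> free_in (var1 n) q \<Longrightarrow> ap s n = ap s' n"
  shows "V_Sat_delta0 q s \<longleftrightarrow> V_Sat_delta0 q s'"
proof -
  define A where "A = Vr (rk (Uni (upair B B')))"
  have sb: "subs (Uni (upair B B')) A" unfolding A_def by simp
  have A: "transitive A" unfolding A_def by (rule transitive_Vr) simp
  have "is_fun s omega A" by (rule fun_codomain[OF s(1)]) (use ap_in[OF s(1)] subsD[OF sb] in auto)
  moreover have "is_fun s' omega A" by (rule fun_codomain[OF s(2)]) (use ap_in[OF s(2)] subsD[OF sb] in auto)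
  ultimately show ?thesis
    using V_Sat_delta0_iff[OF A _ q] fo_Sat_cong[OF delta0_fo[OF q] _ _ eq] by blast
qed

lemma V_Sat_Sigma2_cong:
  assumes p: "Sigma2_formula p" "fo_sentence p" and s: "is_fun s omega B" "is_fun s' omega B'"
  shows "V_Sat_Sigma2 p s \<longleftrightarrow> V_Sat_Sigma2 p s'"
proof -
  obtain i j q where pq: "i \<epsilon> omega" "j \<epsilon> omega" "delta0_formula q" "p = cEx i (cAll j q)"
    using p unfolding Defs.Sigma2_formula_def by blast
  have fr: "n = i \<or> n = j" if "free_in (var1 n) q" for n
  proof (rule ccontr)
    assume "\<not> (n = i \<or> n = j)"
    then have "free_in (var1 n) p" unfolding pq(4) Defs.cAll_def using that pq(1,2) by (intro free_intros) auto
    then show False using p(2) unfolding Defs.fo_sentence_def by blast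
  qed
  have "V_Sat_delta0 q (upd (upd s i x) j y) \<longleftrightarrow> V_Sat_delta0 q (upd (upd s' i x) j y)" for x y
  proof (rule V_Sat_delta0_cong[OF pq(3)])
    have *: "is_fun (upd (upd t i x) j y) omega (adj (adj C x) y)" if "is_fun t omega C" for t C
    proof (intro upd_fun pq)
      show "is_fun t omega (adj (adj C x) y)" by (rule fun_codomain[OF that]) (use ap_in[OF that] in simp)
    qed simp_all
    show "is_fun (upd (upd s i x) j y) omega (adj (adj B x) y)" by (rule *[OF s(1)])
    show "is_fun (upd (upd s' i x) j y) omega (adj (adj B' x) y)" by (rule *[OF s(2)])
  qed (use fr ap_upd in auto)
  then show ?thesis unfolding pq(4) V_Sat_Sigma2_iff[OF pq(1-3)] by blast
qed

text \<open>The truth value of a sentence is the same at all assignments, in particular at the one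
  that is constantly 0, whose values are reals.\<close>

lemma real_lightface:
  assumes k: "inaccessible k" and c: "Sigma2_real_correct k" shows "lightface_Sigma2_correct k"
proof -
  note Ok = inac_Ord[OF k]
  let ?s = "lam omega (\<lambda>_. emp)"
  have s: "is_fun ?s omega (pow omega)" by (rule const_fun) (simp add: Defs.subs_def)
  have skolem_fun: "is_fun ?s omega (Vr k)" by (rule const_fun[OF limit_emp[OF inac_limit[OF k]]])
  have "models (V k) p \<longleftrightarrow> V_models_Sigma2 p" if p: "Sigma2_formula p" "fo_sentence p" for p
  proof -
    have "V_models_Sigma2 p \<longleftrightarrow> V_Sat_Sigma2 p ?s"
      unfolding Defs.V_models_Sigma2_def using V_Sat_Sigma2_cong[OF p _ s] s by blast
    moreover have "models (Vr k) p \<longleftrightarrow> fo_Sat (Vr k) p ?s" by (rule models_fo_Sat[OF p(2) skolem_fun])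
    moreover have "fo_Sat (Vr k) p ?s \<longleftrightarrow> V_Sat_Sigma2 p ?s"
      using c p s unfolding Defs.Sigma2_real_correct_def V_Vr[OF Ok] by blast
    ultimately show ?thesis unfolding V_Vr[OF Ok] by blast
  qed
  then show ?thesis unfolding Defs.lightface_Sigma2_correct_def using Ok by blast
qed

lemma is_least_ex:
  assumes D: "D iU (\<lambda>B e. C (e 0))" and O: "\<And>x. C x \<Longrightarrow> Ord x" and k: "C k"
  obtains d where "is_least C d"
proof -
  obtain m where m: "Ord m" "C m" "m \<epsilon> k \<or> m = k" "\<And>b. b \<epsilon> m \<Longrightarrow> \<not> C b"
    by (rule Ord_least[OF D O[OF k] k]) blast
  have "ord_le m l" if "C l" for l
    unfolding Defs.ord_le_def using Ord_linear[OF m(1) O[OF that]] m(4) that by blast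
  then show thesis using that m(2) unfolding Defs.is_least_def by blast
qed

lemma D_lightface: "D iU (\<lambda>B e. lightface_Sigma2_correct (e i))"
proof -
  have *: "lightface_Sigma2_correct d \<longleftrightarrow> Ord d \<and> (\<forall>p. Sigma2_formula p \<longrightarrow> fo_sentence p \<longrightarrow> (models (Vr d) p \<longleftrightarrow>
      (\<forall>s A. is_fun s omega A \<longrightarrow> V_Sat_Sigma2 p s)))" for d
    unfolding Defs.lightface_Sigma2_correct_def Defs.V_models_Sigma2_def using V_Vr by metis
  show ?thesis unfolding * by (intro dintro)
qed

lemma D_real_correct: "D iU (\<lambda>B e. Sigma2_real_correct (e i))"
proof -
  have *: "Sigma2_real_correct d \<longleftrightarrow> Ord d \<and> subs (pow omega) (Vr d) \<and>
     (\<forall>p s. Sigma2_formula p \<longrightarrow> is_fun s omega (pow omega) \<longrightarrow> (fo_Sat (Vr d) p s \<longleftrightarrow> V_Sat_Sigma2 p s))" for d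
    unfolding Defs.Sigma2_real_correct_def using V_Vr by metis
  show ?thesis unfolding * by (intro dintro)
qed

lemma least_inac_lightface_fresh:
  assumes k: "is_least (\<lambda>k. inaccessible k \<and> lightface_Sigma2_correct k) k" shows "fo_fresh k"
proof -
  have ik: "inaccessible k" "lightface_Sigma2_correct k" using k unfolding Defs.is_least_def by blast+
  have "False" if d: "inaccessible d" "d \<epsilon> k" "\<forall>p. fo_sentence p \<longrightarrow> (models (V d) p \<longleftrightarrow> models (V k) p)" for d
  proof -
    have "lightface_Sigma2_correct d"
      using ik(2) d(3) inac_Ord[OF d(1)] unfolding Defs.lightface_Sigma2_correct_def by blast
    then have "ord_le k d" using k d(1) unfolding Defs.is_least_def by blast
    then show False using d(2) no_self no_cycle2 unfolding Defs.ord_le_def by blast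
  qed
  then show ?thesis unfolding Defs.fo_fresh_def Defs.fresh_def using ik(1) by blast
qed

section \<open>Iteration and a pairing function on the natural numbers\<close>

definition HI :: "('a \<Rightarrow> 'a) \<Rightarrow> 'a \<Rightarrow> 'a \<Rightarrow> 'a \<Rightarrow> 'a" where
  "HI g a f b = (if \<exists>c. c \<epsilon> b \<and> b = suc c then mkset (\<lambda>z. \<exists>c. c \<epsilon> b \<and> (b = suc c \<and> z \<epsilon> g (ap f c))) else a)"

text \<open>Iteration of \<open>g\<close> from \<open>a\<close> as an instance of ordinal recursion.
  In \<open>HI\<close> the predecessor occurs only under a quantifier, so the value at a successor
  is collected by \<open>mkset\<close>; at 0 the starting value is returned.\<close>

definition IT :: "('a \<Rightarrow> 'a) \<Rightarrow> 'a \<Rightarrow> 'a \<Rightarrow> 'a" where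
  "IT g a n = ordrec (HI g a) n"

lemma local_HI: "fn iU (\<lambda>B e. g (e 0)) \<Longrightarrow> local_rec (HI g a)"
  unfolding local_rec_def
proof (intro conjI allI impI)
  assume g: "fn iU (\<lambda>B e. g (e 0))"
  show "fn iU (\<lambda>B e. HI g a (e 0) (e (Suc 0)))" unfolding HI_def by (intro dintro fn_comp1[OF g])
  fix f f' b assume *: "\<forall>c. c \<epsilon> b \<longrightarrow> ap f c = ap f' c"
  then have "(\<lambda>z. \<exists>c. c \<epsilon> b \<and> (b = suc c \<and> z \<epsilon> g (ap f c))) = (\<lambda>z. \<exists>c. c \<epsilon> b \<and> (b = suc c \<and> z \<epsilon> g (ap f' c)))"
    by (intro ext) metis
  then show "HI g a f b = HI g a f' b" unfolding HI_def by (simp only:)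
qed

lemma fn_IT:
  assumes g: "fn iU (\<lambda>B e. g (e 0))" and F: "fn iU F" and G: "fn iU G"
  shows "fn iU (\<lambda>B e. IT g (F B e) (G B e))"
proof (rule fn_comp2[where k = "IT g", OF _ F G])
  show "fn iU (\<lambda>B e. IT g (e 0) (e (Suc 0)))"
    unfolding IT_def ordrec_def attempt_def HI_def by (intro dintro fn_comp1[OF g])
qed

lemma IT_simps:
  assumes g: "fn iU (\<lambda>B e. g (e 0))"
  shows "IT g a emp = a" "Ord n \<Longrightarrow> IT g a (suc n) = g (IT g a n)"
proof -
  note loc = local_HI[OF g, of a]
  show "IT g a emp = a" unfolding IT_def ordrec_eq[OF loc Ord_emp] HI_def by simp
  assume n: "Ord n"
  let ?f = "lam (suc n) (ordrec (HI g a))"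
  have "ap ?f n = ordrec (HI g a) n" by (rule ap_lam) (intro fn_ordrec[OF loc] dintro, simp)
  then have "z \<epsilon> g (ordrec (HI g a) n) \<longleftrightarrow> (\<exists>c. c \<epsilon> suc n \<and> (suc n = suc c \<and> z \<epsilon> g (ap ?f c)))" for z by auto
  then have "mkset (\<lambda>z. \<exists>c. c \<epsilon> suc n \<and> (suc n = suc c \<and> z \<epsilon> g (ap ?f c))) = g (ordrec (HI g a) n)" by (rule mkset_unique)
  moreover have "\<exists>c. c \<epsilon> suc n \<and> suc n = suc c" by auto
  ultimately have "HI g a ?f (suc n) = g (ordrec (HI g a) n)" unfolding HI_def by (simp only: if_True)
  then show "IT g a (suc n) = g (IT g a n)" unfolding IT_def ordrec_eq[OF loc Ord_suc[OF n]] .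
qed

definition dbl :: "'a \<Rightarrow> 'a" where "dbl n = IT (\<lambda>x. suc (suc x)) emp n"

text \<open>The pairing function \<open>(m, n) \<mapsto> 2\<^sup>m (2 n + 1)\<close>.\<close>

definition npair :: "'a \<Rightarrow> 'a \<Rightarrow> 'a" where "npair m n = IT dbl (suc (dbl n)) m"

lemma fn_ss: "fn iU (\<lambda>B e. suc (suc (e 0)))"
  by (intro dintro)

lemma fn_dbl [dintro]: "fn iU F \<Longrightarrow> fn iU (\<lambda>B e. dbl (F B e))"
  unfolding dbl_def by (rule fn_IT[OF fn_ss]) (intro dintro)

lemma fn_dbl0: "fn iU (\<lambda>B e. dbl (e 0))"
  by (intro dintro)

lemma fn_npair [dintro]: "fn iU F \<Longrightarrow> fn iU G \<Longrightarrow> fn iU (\<lambda>B e. npair (F B e) (G B e))"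
  unfolding npair_def by (rule fn_IT[OF fn_dbl0]) (intro dintro)

lemma dbl_simps [simp]: "dbl emp = emp" "n \<epsilon> omega \<Longrightarrow> dbl (suc n) = suc (suc (dbl n))"
  unfolding dbl_def using IT_simps[OF fn_ss] Ord_nat by simp_all

lemma npair_simps [simp]: "npair emp n = suc (dbl n)" "m \<epsilon> omega \<Longrightarrow> npair (suc m) n = dbl (npair m n)"
  unfolding npair_def using IT_simps[OF fn_dbl0] Ord_nat by simp_all

lemma dbl_omega: "n \<epsilon> omega \<Longrightarrow> dbl n \<epsilon> omega"
proof -
  assume n: "n \<epsilon> omega"
  have D: "D iU (\<lambda>B e. dbl (e 0) \<epsilon> omega)" by (intro dintro)
  show ?thesis by (rule omega_induct[where P = "\<lambda>n. dbl n \<epsilon> omega", OF D n]) (simp_all add: suc_omega)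
qed

lemma npair_omega: "m \<epsilon> omega \<Longrightarrow> n \<epsilon> omega \<Longrightarrow> npair m n \<epsilon> omega"
proof -
  assume m: "m \<epsilon> omega" and n: "n \<epsilon> omega"
  have D: "D iU (\<lambda>B e. npair (e 0) n \<epsilon> omega)" by (intro dintro)
  show ?thesis
    by (rule omega_induct[where P = "\<lambda>m. npair m n \<epsilon> omega", OF D m]) (simp_all add: suc_omega dbl_omega n)
qed

lemma dbl_inj: "m \<epsilon> omega \<Longrightarrow> n \<epsilon> omega \<Longrightarrow> dbl m = dbl n \<Longrightarrow> m = n"
proof -
  have D: "D iU (\<lambda>B e. \<forall>n. n \<epsilon> omega \<longrightarrow> dbl (e 0) = dbl n \<longrightarrow> e 0 = n)" by (intro dintro)
  have "\<forall>n. n \<epsilon> omega \<longrightarrow> dbl m = dbl n \<longrightarrow> m = n" if m: "m \<epsilon> omega" for m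
  proof (rule omega_induct[where P = "\<lambda>m. \<forall>n. n \<epsilon> omega \<longrightarrow> dbl m = dbl n \<longrightarrow> m = n", OF D m]; intro allI impI)
    fix n assume "n \<epsilon> omega" "dbl emp = dbl n"
    then show "emp = n" by (cases rule: omega_cases) auto
  next
    fix m n assume m: "m \<epsilon> omega" "\<forall>n. n \<epsilon> omega \<longrightarrow> dbl m = dbl n \<longrightarrow> m = n" and n: "n \<epsilon> omega" "dbl (suc m) = dbl n"
    show "suc m = n" using n(1)
    proof (cases rule: omega_cases)
      case 1 then show ?thesis using n(2) m(1) by simp
    next
      case (2 l) then show ?thesis using n(2) m by simp
    qed
  qed
  then show "m \<epsilon> omega \<Longrightarrow> n \<epsilon> omega \<Longrightarrow> dbl m = dbl n \<Longrightarrow> m = n" by blast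
qed

lemma odd_even: "n \<epsilon> omega \<Longrightarrow> m \<epsilon> omega \<Longrightarrow> suc (dbl m) \<noteq> dbl n"
proof -
  have D: "D iU (\<lambda>B e. \<forall>m. m \<epsilon> omega \<longrightarrow> suc (dbl m) \<noteq> dbl (e 0))" by (intro dintro)
  have "\<forall>m. m \<epsilon> omega \<longrightarrow> suc (dbl m) \<noteq> dbl n" if n: "n \<epsilon> omega" for n
  proof (rule omega_induct[where P = "\<lambda>n. \<forall>m. m \<epsilon> omega \<longrightarrow> suc (dbl m) \<noteq> dbl n", OF D n]; intro allI impI)
    fix m show "suc (dbl m) \<noteq> dbl emp" by simp
  next
    fix n m assume n: "n \<epsilon> omega" "\<forall>m. m \<epsilon> omega \<longrightarrow> suc (dbl m) \<noteq> dbl n" and m: "m \<epsilon> omega"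
    show "suc (dbl m) \<noteq> dbl (suc n)" using m
    proof (cases rule: omega_cases)
      case 1 then show ?thesis using n(1) by simp
    next
      case (2 l) then show ?thesis using n by simp
    qed
  qed
  then show "n \<epsilon> omega \<Longrightarrow> m \<epsilon> omega \<Longrightarrow> suc (dbl m) \<noteq> dbl n" by blast
qed

lemma npair_inj:
  assumes "m \<epsilon> omega" "n \<epsilon> omega" "m' \<epsilon> omega" "n' \<epsilon> omega"
  shows "npair m n = npair m' n' \<longleftrightarrow> m = m' \<and> n = n'"
proof -
  let ?P = "\<lambda>m. \<forall>m'. m' \<epsilon> omega \<longrightarrow> npair m n = npair m' n' \<longrightarrow> m = m' \<and> n = n'"
  have D: "D iU (\<lambda>B e. ?P (e 0))" by (intro dintro)
  have "?P m"
  proof (rule omega_induct[where P = ?P, OF D assms(1)]; intro allI impI)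
    fix m' assume m': "m' \<epsilon> omega" and eq: "npair emp n = npair m' n'"
    show "emp = m' \<and> n = n'" using m'
    proof (cases rule: omega_cases)
      case 1 then show ?thesis using eq dbl_inj assms by simp
    next
      case (2 l) then show ?thesis using eq odd_even[OF npair_omega[OF 2(1) assms(4)] assms(2)] by simp
    qed
  next
    fix m m' assume m: "m \<epsilon> omega" "?P m" and m': "m' \<epsilon> omega" and eq: "npair (suc m) n = npair m' n'"
    show "suc m = m' \<and> n = n'" using m'
    proof (cases rule: omega_cases)
      case 1 then show ?thesis using eq odd_even[OF npair_omega[OF m(1) assms(2)] assms(4)] m(1) by simp
    next
      case (2 l)
      then have "dbl (npair m n) = dbl (npair l n')" using eq m(1) by simp
      then have "npair m n = npair l n'" using dbl_inj npair_omega m(1) 2(1) assms by blast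
      then show ?thesis using m(2) 2 by blast
    qed
  qed
  then show ?thesis using assms by blast
qed

section \<open>Numbering the formulas by natural numbers\<close>

definition is_pairing :: "'a \<Rightarrow> 'a \<Rightarrow> bool" where
  "is_pairing d J \<longleftrightarrow> ap d emp = emp \<and> (\<forall>n. n \<epsilon> omega \<longrightarrow> ap d (suc n) = suc (suc (ap d n))) \<and>
    (\<forall>n. n \<epsilon> omega \<longrightarrow> ap J (opair emp n) = suc (ap d n)) \<and>
    (\<forall>m. m \<epsilon> omega \<longrightarrow> (\<forall>n. n \<epsilon> omega \<longrightarrow> ap J (opair (suc m) n) = ap d (ap J (opair m n))))"

definition is_coding :: "'a \<Rightarrow> 'a \<Rightarrow> bool" where
  "is_coding J c \<longleftrightarrow> (\<forall>i. i \<epsilon> omega \<longrightarrow> (\<forall>j. j \<epsilon> omega \<longrightarrow>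
        ap c (cMem i j) = ap J (opair (tag 0) (ap J (opair i j))) \<and> ap c (cEq i j) = ap J (opair (tag 1) (ap J (opair i j))) \<and>
        ap c (cMem2 i j) = ap J (opair (tag 2) (ap J (opair i j))))) \<and>
    (\<forall>p. p \<epsilon> SoF \<longrightarrow> ap c (cNeg p) = ap J (opair (tag 3) (ap c p)) \<and>
      (\<forall>q. q \<epsilon> SoF \<longrightarrow> ap c (cAnd p q) = ap J (opair (tag 4) (ap J (opair (ap c p) (ap c q))))) \<and>
      (\<forall>i. i \<epsilon> omega \<longrightarrow> ap c (cEx i p) = ap J (opair (tag 5) (ap J (opair i (ap c p)))) \<and>
        ap c (cEx2 i p) = ap J (opair (tag 6) (ap J (opair i (ap c p))))))"

text \<open>A Goedel numbering: formulas are hereditarily finite sets, and a theory must become a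
  set of natural numbers to serve as a real parameter. The pairing is described by recursion
  equations for sets d and J instead of \<open>npair\<close>, which comes from recursion over the
  universe; so the numbering can be recognized inside any good class.\<close>

definition isCode :: "'a \<Rightarrow> bool" where
  "isCode c \<longleftrightarrow> is_fun c SoF omega \<and> (\<exists>d. is_fun d omega omega \<and> (\<exists>J. is_fun J (prd omega omega) omega \<and> (is_pairing d J \<and> is_coding J c)))"

lemma D_isCode: "u \<noteq> iT \<Longrightarrow> D u (\<lambda>B e. isCode (e i))"
  unfolding isCode_def is_pairing_def is_coding_def by (intro dintro)

lemma is_pairing_npair:
  assumes d: "is_fun d omega omega" and J: "is_fun J (prd omega omega) omega" and dJ: "is_pairing d J"
    and m: "m \<epsilon> omega" "n \<epsilon> omega"
  shows "ap J (opair m n) = npair m n"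
proof -
  have D1: "D iU (\<lambda>B e. ap d (e 0) = dbl (e 0))" by (intro dintro)
  have dd: "ap d n = dbl n" if "n \<epsilon> omega" for n
    by (rule omega_induct[where P = "\<lambda>n. ap d n = dbl n", OF D1 that]) (use dJ in \<open>simp_all add: is_pairing_def\<close>)
  have D2: "D iU (\<lambda>B e. ap J (opair (e 0) n) = npair (e 0) n)" by (intro dintro)
  show ?thesis
    by (rule omega_induct[where P = "\<lambda>m. ap J (opair m n) = npair m n", OF D2 m(1)])
      (use dJ m(2) dd npair_omega in \<open>simp_all add: is_pairing_def\<close>)
qed

lemma isCode_eqs:
  assumes "isCode c"
  shows "i \<epsilon> omega \<Longrightarrow> j \<epsilon> omega \<Longrightarrow> ap c (cMem i j) = npair (tag 0) (npair i j)"
    "i \<epsilon> omega \<Longrightarrow> j \<epsilon> omega \<Longrightarrow> ap c (cEq i j) = npair (tag 1) (npair i j)"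
    "i \<epsilon> omega \<Longrightarrow> j \<epsilon> omega \<Longrightarrow> ap c (cMem2 i j) = npair (tag 2) (npair i j)"
    "so_formula p \<Longrightarrow> ap c (cNeg p) = npair (tag 3) (ap c p)"
    "so_formula p \<Longrightarrow> so_formula q \<Longrightarrow> ap c (cAnd p q) = npair (tag 4) (npair (ap c p) (ap c q))"
    "i \<epsilon> omega \<Longrightarrow> so_formula p \<Longrightarrow> ap c (cEx i p) = npair (tag 5) (npair i (ap c p))"
    "i \<epsilon> omega \<Longrightarrow> so_formula p \<Longrightarrow> ap c (cEx2 i p) = npair (tag 6) (npair i (ap c p))"
    "so_formula p \<Longrightarrow> ap c p \<epsilon> omega"
proof -
  obtain d J where c: "is_fun c SoF omega" and dJ: "is_fun d omega omega" "is_fun J (prd omega omega) omega" "is_pairing d J" "is_coding J c"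
    using assms unfolding isCode_def by blast
  have J: "ap J (opair m n) = npair m n" if "m \<epsilon> omega" "n \<epsilon> omega" for m n by (rule is_pairing_npair[OF dJ(1-3) that])
  have cw: "ap c p \<epsilon> omega" if "so_formula p" for p using ap_in[OF c] that SoF_iff by blast
  note e = dJ(4)[unfolded is_coding_def SoF_iff]
  show "i \<epsilon> omega \<Longrightarrow> j \<epsilon> omega \<Longrightarrow> ap c (cMem i j) = npair (tag 0) (npair i j)"
    "i \<epsilon> omega \<Longrightarrow> j \<epsilon> omega \<Longrightarrow> ap c (cEq i j) = npair (tag 1) (npair i j)"
    "i \<epsilon> omega \<Longrightarrow> j \<epsilon> omega \<Longrightarrow> ap c (cMem2 i j) = npair (tag 2) (npair i j)"
    using e J npair_omega tag_omega by metis+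
  show "so_formula p \<Longrightarrow> ap c (cNeg p) = npair (tag 3) (ap c p)" using e J cw tag_omega by metis
  show "so_formula p \<Longrightarrow> so_formula q \<Longrightarrow> ap c (cAnd p q) = npair (tag 4) (npair (ap c p) (ap c q))"
    using e J cw tag_omega npair_omega by metis
  show "i \<epsilon> omega \<Longrightarrow> so_formula p \<Longrightarrow> ap c (cEx i p) = npair (tag 5) (npair i (ap c p))"
    "i \<epsilon> omega \<Longrightarrow> so_formula p \<Longrightarrow> ap c (cEx2 i p) = npair (tag 6) (npair i (ap c p))"
    using e J cw tag_omega npair_omega by metis+
  show "so_formula p \<Longrightarrow> ap c p \<epsilon> omega" by (rule cw)
qed

lemma isCode_ex: "\<exists>c. isCode c"
proof -
  obtain c where c: "is_fun c SoF omega"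
    "\<And>i j. i \<epsilon> omega \<Longrightarrow> j \<epsilon> omega \<Longrightarrow> ap c (cMem i j) = npair (tag 0) (npair i j)"
    "\<And>i j. i \<epsilon> omega \<Longrightarrow> j \<epsilon> omega \<Longrightarrow> ap c (cEq i j) = npair (tag 1) (npair i j)"
    "\<And>i j. i \<epsilon> omega \<Longrightarrow> j \<epsilon> omega \<Longrightarrow> ap c (cMem2 i j) = npair (tag 2) (npair i j)"
    "\<And>p. so_formula p \<Longrightarrow> ap c (cNeg p) = npair (tag 3) (ap c p)"
    "\<And>p q. so_formula p \<Longrightarrow> so_formula q \<Longrightarrow> ap c (cAnd p q) = npair (tag 4) (npair (ap c p) (ap c q))"
    "\<And>i p. i \<epsilon> omega \<Longrightarrow> so_formula p \<Longrightarrow> ap c (cEx i p) = npair (tag 5) (npair i (ap c p))"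
    "\<And>i p. i \<epsilon> omega \<Longrightarrow> so_formula p \<Longrightarrow> ap c (cEx2 i p) = npair (tag 6) (npair i (ap c p))"
  proof (rule so_rec[of "\<lambda>i j. npair (tag 0) (npair i j)" "\<lambda>i j. npair (tag 1) (npair i j)" "\<lambda>i j. npair (tag 2) (npair i j)"
      "\<lambda>v. npair (tag 3) v" "\<lambda>v w. npair (tag 4) (npair v w)" "\<lambda>i v. npair (tag 5) (npair i v)" "\<lambda>i v. npair (tag 6) (npair i v)" omega])
    show "fn iU (\<lambda>B e. npair (tag 0) (npair (e 0) (e (Suc 0))))" by (intro dintro)
    show "fn iU (\<lambda>B e. npair (tag 1) (npair (e 0) (e (Suc 0))))" by (intro dintro)
    show "fn iU (\<lambda>B e. npair (tag 2) (npair (e 0) (e (Suc 0))))" by (intro dintro)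
    show "fn iU (\<lambda>B e. npair (tag 4) (npair (e 0) (e (Suc 0))))" by (intro dintro)
    show "fn iU (\<lambda>B e. npair (tag 5) (npair (e 0) (e (Suc 0))))" by (intro dintro)
    show "fn iU (\<lambda>B e. npair (tag 6) (npair (e 0) (e (Suc 0))))" by (intro dintro)
    show "fn iU (\<lambda>B e. npair (tag 3) (e 0))" by (intro dintro)
    show "npair (tag 0) (npair i j) \<epsilon> omega \<and> npair (tag 1) (npair i j) \<epsilon> omega \<and> npair (tag 2) (npair i j) \<epsilon> omega"
      if "i \<epsilon> omega" "j \<epsilon> omega" for i j using that npair_omega tag_omega by blast
    show "npair (tag 3) v \<epsilon> omega" if "v \<epsilon> omega" for v using that npair_omega tag_omega by blast
    show "npair (tag 4) (npair v w) \<epsilon> omega" if "v \<epsilon> omega" "w \<epsilon> omega" for v w using that npair_omega tag_omega by blast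
    show "npair (tag 5) (npair i v) \<epsilon> omega \<and> npair (tag 6) (npair i v) \<epsilon> omega"
      if "i \<epsilon> omega" "v \<epsilon> omega" for i v using that npair_omega tag_omega by blast
  qed (rule that)
  let ?d = "lam omega dbl"
  define G where "G z = mkset (\<lambda>w. \<exists>m n. z = opair m n \<and> w \<epsilon> npair m n)" for z
  have G: "G (opair m n) = npair m n" for m n unfolding G_def by (rule mkset_unique) simp
  have Gf: "fn iU (\<lambda>B e. G (e 0))" unfolding G_def by (intro dintro)
  let ?J = "lam (prd omega omega) G"
  have J: "ap ?J (opair m n) = npair m n" if "m \<epsilon> omega" "n \<epsilon> omega" for m n
    using ap_lam[OF Gf, of "opair m n" "prd omega omega"] that G by simp
  have d: "ap ?d n = dbl n" if "n \<epsilon> omega" for n by (rule ap_lam[OF fn_dbl0 that])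
  have 1: "is_fun ?d omega omega" by (rule lam_fun[OF fn_dbl0]) (rule dbl_omega)
  have 2: "is_fun ?J (prd omega omega) omega" by (rule lam_fun[OF Gf]) (use prd_iff G npair_omega in auto)
  have 3: "is_pairing ?d ?J" unfolding is_pairing_def by (simp add: d J suc_omega npair_omega)
  have cw: "ap c p \<epsilon> omega" if "so_formula p" for p using ap_in[OF c(1)] that SoF_iff by blast
  have 4: "is_coding ?J c" unfolding is_coding_def SoF_iff by (simp add: c J cw npair_omega del: tag_0)
  show ?thesis unfolding isCode_def using c(1) 1 2 3 4 by blast
qed

text \<open>The numbering found in a reflected set agrees with the one used to form the real, so the
  same theory is read from it.\<close>

lemma isCode_unique:
  assumes c: "isCode c" "isCode c'" and p: "so_formula p" shows "ap c p = ap c' p"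
proof -
  have D: "D iU (\<lambda>B e. ap c (e 0) = ap c' (e 0))" by (intro dintro)
  show ?thesis
    by (rule so_induct[where P = "\<lambda>p. ap c p = ap c' p", OF D p])
      (simp_all only: isCode_eqs[OF c(1)] isCode_eqs[OF c(2)])
qed

text \<open>The pairing function is injective and the tags tell the formation rules apart, so
  different sentences do not share a number and the real determines the theory.\<close>

lemma isCode_inj:
  assumes c: "isCode c" and p: "so_formula p" and q: "so_formula q" and eq: "ap c p = ap c q"
  shows "p = q"
proof -
  let ?P = "\<lambda>p. \<forall>q. so_formula q \<longrightarrow> ap c p = ap c q \<longrightarrow> p = q"
  note e = isCode_eqs[OF c]
  have D: "D iU (\<lambda>B e. ?P (e 0))" by (intro dintro)
  have cases: "(\<exists>i j. i \<epsilon> omega \<and> j \<epsilon> omega \<and> q = cMem i j) \<or> (\<exists>i j. i \<epsilon> omega \<and> j \<epsilon> omega \<and> q = cEq i j) \<or>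
     (\<exists>i j. i \<epsilon> omega \<and> j \<epsilon> omega \<and> q = cMem2 i j) \<or> (\<exists>p. so_formula p \<and> q = cNeg p) \<or>
     (\<exists>p r. so_formula p \<and> so_formula r \<and> q = cAnd p r) \<or> (\<exists>i p. i \<epsilon> omega \<and> so_formula p \<and> q = cEx i p) \<or>
     (\<exists>i p. i \<epsilon> omega \<and> so_formula p \<and> q = cEx2 i p)" (is "?C q") if "so_formula q" for q
  proof -
    have DC: "D iU (\<lambda>B e. ?C (e 0))" by (intro dintro)
    show "?C q" by (rule so_induct[where P = ?C, OF DC that]) blast+
  qed
  note J = npair_inj npair_omega tag_omega e
  have "?P p"
  proof (rule so_induct[where P = ?P, OF D p]; intro allI impI)
    fix i j q assume "i \<epsilon> omega" "j \<epsilon> omega" "so_formula q" "ap c (cMem i j) = ap c q"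
    then show "cMem i j = q" using cases[OF \<open>so_formula q\<close>] by (elim disjE exE conjE) (auto simp: J simp del: tag_0)
  next
    fix i j q assume "i \<epsilon> omega" "j \<epsilon> omega" "so_formula q" "ap c (cEq i j) = ap c q"
    then show "cEq i j = q" using cases[OF \<open>so_formula q\<close>] by (elim disjE exE conjE) (auto simp: J simp del: tag_0)
  next
    fix i j q assume "i \<epsilon> omega" "j \<epsilon> omega" "so_formula q" "ap c (cMem2 i j) = ap c q"
    then show "cMem2 i j = q" using cases[OF \<open>so_formula q\<close>] by (elim disjE exE conjE) (auto simp: J simp del: tag_0)
  next
    fix p q assume *: "so_formula p" "?P p" and q: "so_formula q" "ap c (cNeg p) = ap c q"
    have IH: "ap c p = ap c r \<longleftrightarrow> p = r" if "so_formula r" for r using * that by blast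
    show "cNeg p = q" using cases[OF q(1)] q(2) *(1) by (elim disjE exE conjE) (simp_all add: J IH del: tag_0)
  next
    fix p p' q assume *: "so_formula p" "?P p" "so_formula p'" "?P p'" and q: "so_formula q" "ap c (cAnd p p') = ap c q"
    have IH: "ap c p = ap c r \<longleftrightarrow> p = r" "ap c p' = ap c r \<longleftrightarrow> p' = r" if "so_formula r" for r using * that by blast+
    show "cAnd p p' = q" using cases[OF q(1)] q(2) *(1,3) by (elim disjE exE conjE) (simp_all add: J IH del: tag_0)
  next
    fix i p q assume *: "i \<epsilon> omega" "so_formula p" "?P p" and q: "so_formula q" "ap c (cEx i p) = ap c q"
    have IH: "ap c p = ap c r \<longleftrightarrow> p = r" if "so_formula r" for r using * that by blast
    show "cEx i p = q" using cases[OF q(1)] q(2) *(1,2) by (elim disjE exE conjE) (simp_all add: J IH del: tag_0)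
  next
    fix i p q assume *: "i \<epsilon> omega" "so_formula p" "?P p" and q: "so_formula q" "ap c (cEx2 i p) = ap c q"
    have IH: "ap c p = ap c r \<longleftrightarrow> p = r" if "so_formula r" for r using * that by blast
    show "cEx2 i p = q" using cases[OF q(1)] q(2) *(1,2) by (elim disjE exE conjE) (simp_all add: J IH del: tag_0)
  qed
  then show ?thesis using q eq by blast
qed

section \<open>Reflecting a fresh cardinal below a correct ordinal\<close>

definition codes_theory :: "('a \<Rightarrow> bool) \<Rightarrow> 'a \<Rightarrow> bool" where
  "codes_theory B r \<longleftrightarrow> (\<exists>k. B k \<and> (\<exists>W. B W \<and> (inaccessible k \<and> isV k W \<and> (\<exists>c. is_fun c SoF omega \<and> (isCode c \<and>
     (\<forall>p. p \<epsilon> FoF \<longrightarrow> fo_sentence p \<longrightarrow> (models W p \<longleftrightarrow> ap c p \<epsilon> r)))))))"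

lemma D_codes_theory: "D iG (\<lambda>B e. codes_theory B (e i))"
  unfolding codes_theory_def by (intro dintro D_isCode)

text \<open>With \<open>x, r, y\<close> the values of the variables 0, 1, 2: \<open>x\<close> is transitive, contains \<open>r\<close>, and contains
  \<open>y\<close> if \<open>y\<close> is a subset of an element of \<open>x\<close>.\<close>

definition swell_fm :: fm where
  "swell_fm = fm.And (fm.Neg (fm.Ex 3 (fm.And (fm.Mem 3 0) (fm.Ex 4 (fm.And (fm.Mem 4 3) (fm.Neg (fm.Mem 4 0)))))))
    (fm.And (fm.Neg (fm.Ex 3 (fm.And (fm.Mem 3 0) (fm.And (fm.Neg (fm.Ex 4 (fm.And (fm.Mem 4 2) (fm.Neg (fm.Mem 4 3)))))
      (fm.Neg (fm.Mem 2 0)))))) (fm.Mem 1 0))"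

lemma delta0_swell_fm: "delta0_formula (code swell_fm)"
  unfolding swell_fm_def by (simp add: delta0_intros del: tag_0)

lemma swell_fm_sat:
  assumes A: "transitive A" and s: "is_fun s omega A"
  shows "fo_Sat A (code swell_fm) s \<longleftrightarrow> transitive (ap s (tag 0)) \<and>
    (\<forall>z. z \<epsilon> ap s (tag 0) \<longrightarrow> subs (ap s (tag 2)) z \<longrightarrow> ap s (tag 2) \<epsilon> ap s (tag 0)) \<and> ap s (tag 1) \<epsilon> ap s (tag 0)"
proof -
  have m: "w \<epsilon> A" if "w \<epsilon> ap s (tag i)" for w i using transD[OF A ap_in[OF s tag_omega] that] .
  have m2: "w \<epsilon> A" if "w \<epsilon> z" "z \<epsilon> ap s (tag i)" for w z i using transD[OF A m[OF that(2)] that(1)] .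
  have e: "(\<forall>z. z \<epsilon> A \<longrightarrow> z \<epsilon> ap s (tag i) \<longrightarrow> P z) \<longleftrightarrow> (\<forall>z. z \<epsilon> ap s (tag i) \<longrightarrow> P z)" for i P using m by blast
  have e2: "(\<forall>w. w \<epsilon> A \<longrightarrow> w \<epsilon> z \<longrightarrow> P w) \<longleftrightarrow> (\<forall>w. w \<epsilon> z \<longrightarrow> P w)" if "z \<epsilon> ap s (tag i)" for z i P
    using m2[OF _ that] by blast
  have "fo_Sat A (code swell_fm) s \<longleftrightarrow> (\<forall>z. z \<epsilon> A \<longrightarrow> z \<epsilon> ap s (tag 0) \<longrightarrow> (\<forall>w. w \<epsilon> A \<longrightarrow> w \<epsilon> z \<longrightarrow> w \<epsilon> ap s (tag 0))) \<and>
    (\<forall>z. z \<epsilon> A \<longrightarrow> z \<epsilon> ap s (tag 0) \<longrightarrow> (\<forall>w. w \<epsilon> A \<longrightarrow> w \<epsilon> ap s (tag 2) \<longrightarrow> w \<epsilon> z) \<longrightarrow> ap s (tag 2) \<epsilon> ap s (tag 0)) \<and>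
    ap s (tag 1) \<epsilon> ap s (tag 0)"
    unfolding code_sat[OF s] swell_fm_def by (simp del: tag_0) blast
  also have "\<dots> \<longleftrightarrow> transitive (ap s (tag 0)) \<and>
    (\<forall>z. z \<epsilon> ap s (tag 0) \<longrightarrow> subs (ap s (tag 2)) z \<longrightarrow> ap s (tag 2) \<epsilon> ap s (tag 0)) \<and> ap s (tag 1) \<epsilon> ap s (tag 0)"
    unfolding Defs.transitive_def Defs.subs_def e by (simp add: e2 del: tag_0)
  finally show ?thesis .
qed

lemma fresh_below_real_correct:
  assumes fr: "fo_fresh k" and l: "inaccessible l" "k \<epsilon> l" and d: "Sigma2_real_correct d"
  shows "k \<epsilon> d"
proof -
  have k: "inaccessible k" using fr unfolding Defs.fo_fresh_def Defs.fresh_def by blast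
  note Ok = inac_Ord[OF k] and Ol = inac_Ord[OF l(1)]
  have Od: "Ord d" and pd: "subs (pow omega) (Vr d)"
    and cd: "\<And>p s. Sigma2_formula p \<Longrightarrow> is_fun s omega (pow omega) \<Longrightarrow> fo_Sat (Vr d) p s \<longleftrightarrow> V_Sat_Sigma2 p s"
    using d V_Vr unfolding Defs.Sigma2_real_correct_def by auto
  obtain c where c: "isCode c" using isCode_ex by blast
  define r where "r = mkset (\<lambda>n. n \<epsilon> omega \<and> (\<exists>p. p \<epsilon> FoF \<and> (fo_sentence p \<and> models (Vr k) p \<and> n = ap c p)))"
  have r: "n \<epsilon> r \<longleftrightarrow> n \<epsilon> omega \<and> (\<exists>p. p \<epsilon> FoF \<and> (fo_sentence p \<and> models (Vr k) p \<and> n = ap c p))" for n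
    unfolding r_def
    by (rule mkset_iff, rule sep_ex[where P = "\<lambda>n. \<exists>p. p \<epsilon> FoF \<and> (fo_sentence p \<and> models (Vr k) p \<and> n = ap c p)"]) (intro dintro)
  have rp: "ap c p \<epsilon> r \<longleftrightarrow> models (Vr k) p" if p: "fo_sentence p" for p
  proof -
    have fp: "fo_formula p" using p unfolding Defs.fo_sentence_def by blast
    have "p' = p" if "p' \<epsilon> FoF" "ap c p = ap c p'" for p'
      using isCode_inj[OF c fo_so[OF fp] _ that(2)] that(1) FoF_iff fo_so by blast
    then show ?thesis unfolding r using isCode_eqs(8)[OF c fo_so[OF fp]] p fp FoF_iff by blast
  qed
  have rw: "r \<epsilon> pow omega" using r by (simp add: Defs.subs_def)
  define Q where "Q B e \<longleftrightarrow> good B \<and> codes_theory B (e 0)" for B :: "'a \<Rightarrow> bool" and e :: "nat \<Rightarrow> 'a"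
  have DQ: "D iT Q" unfolding Q_def by (rule D_good_conj[OF D_codes_theory])
  have depQ: "depends 1 Q" unfolding depends_def Q_def by simp
  obtain q0 where q0: "delta0_formula q0"
    "\<And>A s. transitive A \<Longrightarrow> is_fun s omega A \<Longrightarrow> swelled (\<lambda>x. x \<epsilon> ap s (tag 0)) \<Longrightarrow>
      (\<And>i. i < 1 \<Longrightarrow> ap s (tag (Suc i)) \<epsilon> ap s (tag 0)) \<Longrightarrow>
      fo_Sat A q0 s \<longleftrightarrow> Q (\<lambda>x. x \<epsilon> ap s (tag 0)) (\<lambda>i. ap s (tag (Suc i)))"
  proof (rule delta0_code[OF DQ depQ])
    show "0 < (1::nat)" by simp
    fix q assume "delta0_formula q" and *: "\<And>A s. transitive A \<Longrightarrow> is_fun s omega A \<Longrightarrow> swelled (\<lambda>x. x \<epsilon> ap s (tag 0)) \<Longrightarrow>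
      (\<And>i. i < 1 \<Longrightarrow> ap s (tag (Suc i)) \<epsilon> ap s (tag 0)) \<Longrightarrow>
      fo_Sat A q s \<longleftrightarrow> Q (\<lambda>x. x \<epsilon> ap s (tag 0)) (\<lambda>i. ap s (tag (Suc i)))"
    show thesis
    proof (rule that[OF \<open>delta0_formula q\<close>])
    qed (rule *)
  qed
  define q where "q = cAnd (code swell_fm) q0"
  have q: "delta0_formula q" unfolding q_def using delta0_swell_fm q0(1) by (rule delta0_intros(4))
  \<comment> \<open>There is x such that for all y: x is transitive, contains r, contains y if y is
    a subset of an element of x, and satisfies the Delta_0 statement that x is good and contains an
    inaccessible with theory r. The unbounded universal quantifier is spent on closure under
    subsets, which ensures that the Delta_0 part is read correctly in x.\<close>
  let ?p = "cEx (tag 0) (cAll (tag 2) q)"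
  have p: "Sigma2_formula ?p" unfolding Defs.Sigma2_formula_def using q tag_omega by blast
  let ?s = "lam omega (\<lambda>_. r)"
  have s: "is_fun ?s omega (pow omega)" by (rule const_fun[OF rw])
  have s1: "ap ?s (tag n) = r" for n by (rule ap_lam) (intro dintro, simp)
  let ?t = "\<lambda>x y. upd (upd ?s (tag 0) x) (tag 2) y"
  have t: "ap (?t x y) (tag 0) = x" "ap (?t x y) (tag 1) = r" "ap (?t x y) (tag 2) = y" "ap (?t x y) (tag (Suc 0)) = r" for x y
    by (simp_all add: ap_upd s1 del: tag_0)
  have qsat: "fo_Sat A q (?t x y) \<longleftrightarrow> transitive x \<and> (\<forall>z. z \<epsilon> x \<longrightarrow> subs y z \<longrightarrow> y \<epsilon> x) \<and> r \<epsilon> x \<and> fo_Sat A q0 (?t x y)"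
    if A: "transitive A" "is_fun (?t x y) omega A" for A x y
    unfolding q_def fo_Sat_simps(4)[OF A(2) code_fo delta0_fo[OF q0(1)]] swell_fm_sat[OF A] t by blast
  have q0sat: "fo_Sat A q0 (?t x y) \<longleftrightarrow> good (\<lambda>z. z \<epsilon> x) \<and> codes_theory (\<lambda>z. z \<epsilon> x) r"
    if A: "transitive A" "is_fun (?t x y) omega A" and x: "swelled (\<lambda>z. z \<epsilon> x)" "r \<epsilon> x" for A x y
    using q0(2)[OF A] x unfolding Q_def t by (simp add: t del: tag_0)
  have "V_Sat_Sigma2 ?p ?s"
    unfolding V_Sat_Sigma2_iff[OF tag_omega tag_omega q]
  \<comment> \<open>V_l is a witness because l is an inaccessible above k.\<close>
  proof (intro exI[of _ "Vr l"] allI)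
    fix y
    let ?x = "Vr l"
    have "is_fun (?t ?x y) omega (adj (adj (pow omega) ?x) y)"
      by (intro upd_fun tag_omega const_fun) (use rw in simp_all)
    then obtain A where A: "transitive A" "is_fun (?t ?x y) omega A" using fun_trans_ex by blast
    have g: "good (\<lambda>z. z \<epsilon> ?x)" by (rule good_inac[OF l(1)])
    have rx: "r \<epsilon> ?x" using good_subs[OF g good_omega[OF g]] rw pow_iff by blast
    have "codes_theory (\<lambda>z. z \<epsilon> ?x) r" unfolding codes_theory_def
    proof (intro exI conjI)
      show "k \<epsilon> ?x" using Ord_Vr_iff[OF Ol Ok] l(2) by blast
      show "Vr k \<epsilon> ?x" by (rule Vr_mem[OF Ol l(2)])
      show "inaccessible k" by (rule k)
      show "isV k (Vr k)" unfolding isV_def using Ok by blast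
      show "is_fun c SoF omega" using c unfolding isCode_def by blast
      show "isCode c" by (rule c)
      show "\<forall>p. p \<epsilon> FoF \<longrightarrow> fo_sentence p \<longrightarrow> (models (Vr k) p \<longleftrightarrow> ap c p \<epsilon> r)" using rp by blast
    qed
    moreover have "\<forall>z. z \<epsilon> ?x \<longrightarrow> subs y z \<longrightarrow> y \<epsilon> ?x" using Vr_subs_mem[OF Ol] by blast
    ultimately have "fo_Sat A q (?t ?x y)"
      using qsat[OF A] q0sat[OF A good_swelled[OF g] rx] g rx transitive_Vr[OF Ol] by blast
    then show "V_Sat_delta0 q (?t ?x y)" using V_Sat_delta0_iff[OF A q] by blast
  qed
  then have "fo_Sat (Vr d) ?p ?s" using cd[OF p s] by blast
  moreover have sd: "is_fun ?s omega (Vr d)" by (rule const_fun) (use rw subsD[OF pd] in blast)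
  ultimately obtain x where x: "x \<epsilon> Vr d" and xy: "\<And>y. y \<epsilon> Vr d \<Longrightarrow> fo_Sat (Vr d) q (?t x y)"
    unfolding fo_Sat_Sigma2[OF sd tag_omega tag_omega q] by blast
  note trd = transitive_Vr[OF Od]
  have tf: "is_fun (?t x y) omega (Vr d)" if "y \<epsilon> Vr d" for y by (intro upd_fun sd tag_omega x that)
  have tx: "transitive x" and rx: "r \<epsilon> x" using xy[OF x] qsat[OF trd tf[OF x]] by blast+
  \<comment> \<open>Inside V_d only the y in V_d are tested, but every subset of an element of x is
    in V_d. So x is closed under subsets in the universe as well.\<close>
  have "y \<epsilon> x" if z: "z \<epsilon> x" "subs y z" for y z
  proof -
    have "y \<epsilon> Vr d" using Vr_subs_mem[OF Od Vr_mem_subs[OF Od x z(1)] z(2)] .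
    then show ?thesis using xy qsat[OF trd tf] z by blast
  qed
  then have tw: "swelled (\<lambda>z. z \<epsilon> x)" unfolding swelled_def using transD[OF tx] rx by blast
  have "codes_theory (\<lambda>z. z \<epsilon> x) r" using xy[OF x] qsat[OF trd tf[OF x]] q0sat[OF trd tf[OF x] tw rx] by blast
  then obtain k' W c' where k': "k' \<epsilon> x" "inaccessible k'" "isV k' W" "isCode c'"
    and th: "\<forall>p. p \<epsilon> FoF \<longrightarrow> fo_sentence p \<longrightarrow> (models W p \<longleftrightarrow> ap c' p \<epsilon> r)" unfolding codes_theory_def by blast
  have W: "W = Vr k'" using k'(3) unfolding isV_def by blast
  have same: "models (Vr k') p \<longleftrightarrow> models (Vr k) p" if p: "fo_sentence p" for p
  proof -
    have fp: "fo_formula p" using p unfolding Defs.fo_sentence_def by blast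
    then show ?thesis using th p rp[OF p] isCode_unique[OF k'(4) c fo_so[OF fp]] FoF_iff W by auto
  qed
  \<comment> \<open>As k is fresh, an inaccessible k' with the same theory is not smaller, so k
    \<le> k'. Also k' < d, since k' is in x and x is in V_d.\<close>
  have "\<not> k' \<epsilon> k"
    using fr same k'(2) V_Vr[OF Ok] V_Vr[OF inac_Ord[OF k'(2)]] unfolding Defs.fo_fresh_def Defs.fresh_def by metis
  then have kk: "k \<epsilon> k' \<or> k = k'" using Ord_linear[OF Ok inac_Ord[OF k'(2)]] by blast
  have "k' \<epsilon> d" using Vr_mem_subs[OF Od x k'(1)] Ord_Vr_iff[OF Od inac_Ord[OF k'(2)]] by blast
  then show ?thesis using kk Ord_trans[OF Od] by blast
qed

lemma D_cardinal: "D iU (\<lambda>B e. cardinal (e i))"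
  unfolding Defs.cardinal_def by (intro dintro)

lemma cardinal_inac: "inaccessible k \<Longrightarrow> cardinal k"
  unfolding Defs.inaccessible_def by blast

theorem common_supremum:
  assumes nl: "\<not> (\<exists>k. inaccessible k \<and> (\<forall>l. inaccessible l \<longrightarrow> ord_le l k))"
  shows "\<exists>s. is_sup fo_theory_categorical s \<and> is_sup so_theory_categorical s \<and>
    (\<forall>a. absolutely_definable a \<longrightarrow> is_sup (order_theory_categorical a) s) \<and>
    is_sup fo_fresh s \<and> is_sup so_fresh s \<and>
    (\<forall>a. absolutely_definable a \<longrightarrow> is_sup (order_fresh a) s) \<and>
    (\<not> (\<exists>X. \<forall>k. inaccessible k \<longrightarrow> k \<epsilon> X) \<longrightarrow>
       (\<exists>d. is_least (\<lambda>d. cardinal d \<and> lightface_Sigma2_correct d) d \<and> d \<epsilon> s) \<and>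
       (\<exists>d. is_least Sigma2_real_correct d \<and> ord_le s d))"
proof -
  obtain S where S: "\<And>k. k \<epsilon> S \<longleftrightarrow> fo_fresh k" using fo_fresh_set by blast
  have fO: "Ord k" if "fo_fresh k" for k using that fresh_Ord unfolding Defs.fo_fresh_def by blast
  define s where "s = Uni S"
  have s: "is_sup fo_fresh s" unfolding s_def by (rule is_sup_Uni[OF S fO])
  have Os: "Ord s" using s unfolding Defs.is_sup_def by blast
  have "(\<exists>d. is_least (\<lambda>d. cardinal d \<and> lightface_Sigma2_correct d) d \<and> d \<epsilon> s) \<and>
       (\<exists>d. is_least Sigma2_real_correct d \<and> ord_le s d)" if pc: "\<not> (\<exists>X. \<forall>k. inaccessible k \<longrightarrow> k \<epsilon> X)"
  proof
    obtain k0 where k0: "inaccessible k0" "Sigma2_real_correct k0" using real_correct_ex[OF pc] by blast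
    have l0: "lightface_Sigma2_correct k0" by (rule real_lightface[OF k0])
    have lO: "Ord x" if "lightface_Sigma2_correct x" for x using that unfolding Defs.lightface_Sigma2_correct_def by blast
    \<comment> \<open>Freshness concerns inaccessible cardinals, so the least correct cardinal d is
      compared with the least inaccessible correct cardinal k, for which d \<le> k.\<close>
    obtain k where k: "is_least (\<lambda>k. inaccessible k \<and> lightface_Sigma2_correct k) k"
    proof (rule is_least_ex[where C = "\<lambda>k. inaccessible k \<and> lightface_Sigma2_correct k"])
      show "D iU (\<lambda>B e. inaccessible (e 0) \<and> lightface_Sigma2_correct (e 0))" by (intro dintro D_lightface)
    qed (use k0 l0 lO in blast)+
    obtain d where d: "is_least (\<lambda>d. cardinal d \<and> lightface_Sigma2_correct d) d"
    proof (rule is_least_ex[where C = "\<lambda>d. cardinal d \<and> lightface_Sigma2_correct d"])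
      show "D iU (\<lambda>B e. cardinal (e 0) \<and> lightface_Sigma2_correct (e 0))" by (intro dintro D_lightface D_cardinal)
    qed (use k0 l0 lO cardinal_inac in blast)+
    have kf: "fo_fresh k" by (rule least_inac_lightface_fresh[OF k])
    have ik: "inaccessible k" "lightface_Sigma2_correct k" using k unfolding Defs.is_least_def by blast+
    have dk: "ord_le d k" using d ik cardinal_inac unfolding Defs.is_least_def by blast
    \<comment> \<open>A fresh cardinal above k puts k strictly below the supremum, and with d \<le>
      k this gives d < s.\<close>
    obtain l where l: "fo_fresh l" "k \<epsilon> l"
      using fresh_below_fo_fresh[OF nl language_fo absdef_emp] kf unfolding fo_order order_defs by blast
    have "k \<epsilon> s" using l(2) S l(1) unfolding s_def by auto
    then have "d \<epsilon> s" using dk Ord_trans[OF Os] unfolding Defs.ord_le_def by blast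
    then show "\<exists>d. is_least (\<lambda>d. cardinal d \<and> lightface_Sigma2_correct d) d \<and> d \<epsilon> s" using d by blast
    obtain e where e: "is_least Sigma2_real_correct e"
    proof (rule is_least_ex[where C = Sigma2_real_correct])
      show "D iU (\<lambda>B e. Sigma2_real_correct (e 0))" by (rule D_real_correct)
      show "Ord x" if "Sigma2_real_correct x" for x using that unfolding Defs.Sigma2_real_correct_def by blast
    qed (use k0 in blast)+
    have ce: "Sigma2_real_correct e" using e unfolding Defs.is_least_def by blast
    have "ord_le j e" if j: "fo_fresh j" for j
    proof -
      have "inaccessible j" using j unfolding Defs.fo_fresh_def Defs.fresh_def by blast
      \<comment> \<open>An inaccessible m above j provides the witness V_m for the reflection
        argument.\<close>
      then obtain m where "inaccessible m" "j \<epsilon> m" using inac_unbounded[OF pc inac_Ord] by blast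
      then show ?thesis using fresh_below_real_correct[OF j _ _ ce] unfolding Defs.ord_le_def by blast
    qed
    moreover have "Ord e" using ce unfolding Defs.Sigma2_real_correct_def by blast
    ultimately have "ord_le s e" using s unfolding Defs.is_sup_def by blast
    then show "\<exists>d. is_least Sigma2_real_correct d \<and> ord_le s d" using e by blast
  qed
  then show ?thesis using s common_sup[OF nl s] by blast
qed

end

theorem theorem15:
  fixes mem :: "'a \<Rightarrow> 'a \<Rightarrow> bool"
  assumes "ZFC mem"
    and no_largest: "\<not> (\<exists>k. inaccessible mem k \<and> (\<forall>l. inaccessible mem l \<longrightarrow> ord_le mem l k))"
  shows "\<exists>s.
    is_sup mem (fo_theory_categorical mem) s \<and>
    is_sup mem (so_theory_categorical mem) s \<and>
    (\<forall>a. absolutely_definable mem a \<longrightarrow> is_sup mem (order_theory_categorical mem a) s) \<and>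
    is_sup mem (fo_fresh mem) s \<and>
    is_sup mem (so_fresh mem) s \<and>
    (\<forall>a. absolutely_definable mem a \<longrightarrow> is_sup mem (order_fresh mem a) s) \<and>
    (\<not> (\<exists>X. \<forall>k. inaccessible mem k \<longrightarrow> mem k X) \<longrightarrow>
       (\<exists>d. is_least mem (\<lambda>d. cardinal mem d \<and> lightface_Sigma2_correct mem d) d \<and> mem d s) \<and>
       (\<exists>d. is_least mem (Sigma2_real_correct mem) d \<and> ord_le mem s d))"
  by (rule ZFC.common_supremum[OF assms])

end
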